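(* Let $E$ be the figure-eight knot, let $u$ be a real number with $0<u<\operatorname{arccosh}(3/2)$, let $p$ be a positive integer, and put $\xi:=u+2p\pi\sqrt{-1}$. Then, with $u$ and $p$ fixed, $$ J_N\left(E;e^{\xi/N}\right) = \frac{\sqrt{-\pi}}{2\sinh(u/2)}\,T_E(u)^{1/2}\, J_{p}\left(E;e^{4N\pi^2/\xi}\right) \left(\frac{N}{\xi}\right)^{1/2} e^{\frac{N}{\xi}S_E(u)} \bigl(1+O(N^{-1})\bigr) $$ as $N\to\infty$ through the positive integers, where $$ S_E(u):=\operatorname{Li}_2\left(e^{-u-\varphi(u)}\right)-\operatorname{Li}_2\left(e^{-u+\varphi(u)}\right)+u\bigl(\varphi(u)+2\pi\sqrt{-1}\bigr), $$ $$ T_E(u):=\frac{2}{\sqrt{(2\cosh u+1)(2\cosh u-3)}}, $$ $$ \varphi(u):=\log\left(\cosh u-\tfrac12-\tfrac12\sqrt{(2\cosh u+1)(2\cosh u-3)}\right). $$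
   Context: For a positive integer $N$, $J_N(E;q)$ is the $N$-dimensional colored Jones polynomial of the figure-eight knot $E$ (associated with the $N$-dimensional irreducible representation of $\mathfrak{sl}_2(\mathbb{C})$), normalized to be $1$ for the unknot. It is given explicitly by $$ J_N(E;q)=\sum_{k=0}^{N-1}q^{-kN}\prod_{l=1}^{k}\left(1-q^{N+l}\right)\left(1-q^{N-l}\right). $$ $\operatorname{Li}_2(z):=-\int_0^z\frac{\log(1-w)}{w}\,dw$ is the dilogarithm function. Conventions on square roots: since $0<u<\operatorname{arccosh}(3/2)$, the number $(2\cosh u+1)(2\cosh u-3)$ is negative, and $\sqrt{(2\cosh u+1)(2\cosh u-3)}$ denotes the square root that is a positive multiple of $\sqrt{-1}$. $\log$ is the principal branch ($-\pi<\operatorname{Im}\log\le\pi$), $\sqrt{-\pi}=\sqrt{\pi}\sqrt{-1}$, and the powers $T_E(u)^{1/2}$ and $(N/\xi)^{1/2}$ are principal (positive real part). *)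

theory Defs
  imports
    "HOL-Complex_Analysis.Contour_Integration"
    "HOL-Library.Landau_Symbols"
begin

(* The N-dimensional colored Jones polynomial of the figure-eight knot, through its explicit
   (Habiro-Le) formula, as a function of a complex value q (meaningful for q nonzero).
   Exponents are integers, so no natural-number subtraction is involved. *)
definition colored_Jones_fig8 :: "nat \<Rightarrow> complex \<Rightarrow> complex" where
  "colored_Jones_fig8 N q =
     (\<Sum>k<N. q powi (- (int k * int N)) *
        (\<Prod>l=1..k. (1 - q powi (int N + int l)) * (1 - q powi (int N - int l))))"

(* The path of integration is the straight segment from 0 to z, which gives the principal branch,
   holomorphic off the ray from 1 to infinity.  The singularity of the integrand at w = 0 is
   removable; the value that the division by 0 assigns there does not affect the integral. *)
definition dilog :: "complex \<Rightarrow> complex" where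
  "dilog z = - contour_integral (linepath 0 z) (\<lambda>w. Ln (1 - w) / w)"

(* For real u with 0 < u < arcosh (3/2) the radicand is a negative real, and csqrt of it is the
   root that is a positive multiple of the imaginary unit. *)
definition fig8_root :: "real \<Rightarrow> complex" where
  "fig8_root u = csqrt (of_real ((2 * cosh u + 1) * (2 * cosh u - 3)))"

definition fig8_phi :: "real \<Rightarrow> complex" where
  "fig8_phi u = Ln (of_real (cosh u) - 1/2 - 1/2 * fig8_root u)"

definition fig8_S :: "real \<Rightarrow> complex" where
  "fig8_S u = dilog (exp (- of_real u - fig8_phi u)) - dilog (exp (- of_real u + fig8_phi u))
     + of_real u * (fig8_phi u + 2 * of_real pi * \<i>)"

definition fig8_T :: "real \<Rightarrow> complex" where
  "fig8_T u = 2 / fig8_root u"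

end

theory Submission
  imports Defs "HOL-Complex_Analysis.Complex_Analysis" "HOL-Probability.Distributions"
begin

text \<open>
  Put \<open>h = \<xi> / N\<close> and \<open>G Z = 2 * cosh u - 2 * cosh Z\<close>. The \<open>k\<close>-th term of the sum defining the
  invariant is the product of the \<open>G (l * h)\<close> with \<open>l \<le> k\<close>, hence of size \<open>exp (F (k * h) / h)\<close> for a
  primitive \<open>F\<close> of \<open>g = Ln G\<close>. On the imaginary axis \<open>F\<close> is \<open>\<i>\<close> times a real function, whose maximum
  over \<open>[0, 2 \<pi> p]\<close> is attained only at \<open>y0 = 2 \<pi> p - \<theta>\<close> with \<open>cos \<theta> = cosh u - 1 / 2\<close>. Thus only the
  terms with \<open>Im (k * h)\<close> in the last period matter.

  There an integral of Abel-Plana type corrects \<open>F\<close> to a holomorphic \<open>\<Phi>\<close> with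
  \<open>\<Phi> (Z + h) - \<Phi> Z = h * g (Z + h)\<close> up to an exponentially small error, so \<open>exp (\<Phi> / h)\<close> interpolates the
  terms up to a constant factor. By residues, its sum over the lattice \<open>\<int> h\<close> is a contour integral around
  a rectangle whose left side lies on the imaginary axis and passes through the saddle point \<open>\<i> y0\<close>.
  The left side is evaluated by Laplace's method with a complex parameter; the other three sides are
  exponentially smaller.

  Finally \<open>F (\<i> y0) = S + 2 \<pi> \<i> (p - 1) u\<close>, and \<open>2 \<pi> \<i> (p - 1) u N / \<xi>\<close> differs by a multiple of \<open>2 \<pi> \<i>\<close>
  from \<open>p (p - 1) w\<close> with \<open>w = 4 \<pi>\<^sup>2 N / \<xi>\<close>, the leading exponent of the \<open>p\<close>-dimensional invariant at
  \<open>exp w\<close>.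
\<close>

section \<open>Lattice sums as contour integrals\<close>

text \<open>The obstacle is cancellation. The growth rate of the terms is a harmonic function whose
  restriction to the imaginary axis is maximal at the saddle point, so near this point it increases
  when the axis is left. The multiples of \<open>h\<close> lie on a slanted ray, and the terms there
  may be exponentially larger than their sum. A relative error of order 1/N that varies from term to
  term would therefore ruin the result: the terms have to be interpolated with exponentially small
  relative error, and only a factor common to all of them may be known up to 1 + O(1/N). This is why
  the Abel-Plana integral is cut off at a free length \<open>R\<close>. The error of the difference
  equation decays exponentially in N at a rate proportional to \<open>R\<close>, so a large fixed
  \<open>R\<close> beats any growth of the terms, while a finite \<open>R\<close> keeps all
  arguments of \<open>g\<close> in a bounded set. The axis suits Laplace's method because
  \<open>F\<close> is purely imaginary there: the exponent is N times a real function times the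
  constant \<open>\<i> / \<xi>\<close>, whose real part is positive. The oscillation enters through
  this constant alone, and no steepest descent path is needed.\<close>

lemma norm_one_plus_exp_ge:
  fixes \<tau> \<kappa> :: real
  assumes "0 \<le> \<kappa>" "\<kappa> \<le> 1/2"
  shows "max 1 (exp \<tau>) \<le> 2 * norm (1 + exp (of_real \<tau> * (1 + of_real \<kappa> * \<i>)))"
proof -
  \<comment> \<open>If \<sigma> * \<kappa> is at most pi / 2, the exponential has nonnegative real
    part and adding 1 does not shorten it. Otherwise \<kappa> \<le> 1/2 forces \<sigma> > pi, and
    the exponential is so large that the reverse triangle inequality suffices. Negative exponents
    reduce to this case by pulling the exponential out of the sum.\<close>
  have pos: "exp \<sigma> \<le> 2 * norm (1 + exp (of_real \<sigma> * (1 + of_real \<kappa> * \<i>)))" if "\<sigma> \<ge> 0" for \<sigma> :: real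
  proof -
    define z where "z = exp (of_real \<sigma> * (1 + of_real \<kappa> * \<i>))"
    have nz: "norm z = exp \<sigma>" by (simp add: z_def)
    have rz: "Re z = exp \<sigma> * cos (\<sigma> * \<kappa>)" by (simp add: z_def Re_exp)
    show ?thesis
    proof (cases "\<sigma> * \<kappa> \<le> pi / 2")
      case True
      have "cos (\<sigma> * \<kappa>) \<ge> 0" using that assms True mult_nonneg_nonneg[of \<sigma> \<kappa>] pi_gt_zero
        by (intro cos_ge_zero) linarith+
      hence "Re z \<ge> 0" by (simp add: rz)
      hence "(norm z)\<^sup>2 \<le> (norm (1 + z))\<^sup>2"
        unfolding cmod_power2 by (simp add: power2_eq_square algebra_simps)
      hence "norm z \<le> norm (1 + z)" using power2_le_imp_le norm_ge_zero by blast
      hence "norm z \<le> 2 * norm (1 + z)" using norm_ge_zero[of "1 + z"] by linarith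
      thus ?thesis using nz by (simp add: z_def)
    next
      case False
      have "\<sigma> * \<kappa> \<le> \<sigma> * (1/2)" using that assms by (intro mult_left_mono) auto
      hence "\<sigma> > pi" using False by simp
      hence "\<sigma> > 1" using pi_gt3 by linarith
      hence "exp \<sigma> \<ge> 2" using exp_ge_add_one_self[of \<sigma>] by linarith
      moreover have "norm z - 1 \<le> norm (1 + z)"
        using norm_triangle_ineq2[of z "-1"] by (simp add: add.commute)
      ultimately show ?thesis using nz by (simp add: z_def)
    qed
  qed
  show ?thesis
  proof (cases "\<tau> \<ge> 0")
    case True
    thus ?thesis using pos[OF True] by simp
  next
    case False
    define e where "e = exp (of_real \<tau> * (1 + of_real \<kappa> * \<i>))"
    have ne: "norm e = exp \<tau>" by (simp add: e_def)
    have e0: "e \<noteq> 0" by (simp add: e_def)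
    have inv: "exp (of_real (-\<tau>) * (1 + of_real \<kappa> * \<i>)) = inverse e"
      by (simp add: e_def flip: exp_minus)
    have "1 + e = e * (1 + inverse e)" using e0 by (simp add: field_simps)
    hence "norm (1 + e) = exp \<tau> * norm (1 + inverse e)" by (simp add: norm_mult ne)
    moreover have "exp (-\<tau>) \<le> 2 * norm (1 + inverse e)" using pos[of "-\<tau>"] False inv by simp
    ultimately have "2 * norm (1 + e) \<ge> exp \<tau> * exp (-\<tau>)"
      using mult_left_mono[of "exp (-\<tau>)" "2 * norm (1 + inverse e)" "exp \<tau>"] by simp
    hence "2 * norm (1 + e) \<ge> 1" by (simp flip: exp_add)
    thus ?thesis using False by (simp add: e_def)
  qed
qed

lemma exp_lattice_eq_1_iff:
  fixes h w :: complex
  assumes "h \<noteq> 0"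
  shows "exp (2 * of_real pi * \<i> * w / h) = 1 \<longleftrightarrow> (\<exists>k::int. w = of_int k * h)"
proof -
  have "exp (2 * of_real pi * \<i> * w / h) = 1 \<longleftrightarrow> (\<exists>k::int. 2 * of_real pi * \<i> * w / h = of_int (2 * k) * of_real pi * \<i>)"
    using exp_eq[of "2 * of_real pi * \<i> * w / h" 0] by (simp add: mult.assoc)
  also have "\<dots> \<longleftrightarrow> (\<exists>k::int. w = of_int k * h)"
    using assms by (intro ex_cong1) (auto simp: field_simps)
  finally show ?thesis .
qed

text \<open>The kernel has a simple pole with residue h / (2 pi i) at each lattice point. The open
  set \<open>S\<close> is a slight enlargement of the box without further lattice points, so that
  the residue theorem meets only the finitely many poles given by \<open>K\<close>.\<close>

lemma contour_integral_rectpath_lattice: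
  fixes f :: "complex \<Rightarrow> complex" and h A B :: complex and K :: "int set"
  assumes h: "h \<noteq> 0" and S: "open S" "convex S" and f: "f holomorphic_on S"
    and box: "cbox A B \<subseteq> S" and AB: "Re A < Re B" "Im A < Im B" and K: "finite K"
    and inside: "\<And>k. k \<in> K \<Longrightarrow> of_int k * h \<in> box A B"
    and all: "\<And>k. of_int k * h \<in> S \<Longrightarrow> k \<in> K"
  shows "contour_integral (rectpath A B) (\<lambda>w. f w / (exp (2 * of_real pi * \<i> * w / h) - 1))
           = h * (\<Sum>k\<in>K. f (of_int k * h))"
proof -
  let ?d = "\<lambda>w. exp (2 * of_real pi * \<i> * w / h) - 1"
  define P where "P = (\<lambda>k::int. of_int k * h) ` K"
  have inj: "inj_on (\<lambda>k::int. of_int k * h) K" using h by (auto simp: inj_on_def)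
  have dz: "?d w = 0 \<longleftrightarrow> (\<exists>k::int. w = of_int k * h)" for w
    using exp_lattice_eq_1_iff[OF h, of w] by simp
  have nz: "?d w \<noteq> 0" if "w \<in> S - P" for w
    unfolding dz using that all by (auto simp: P_def)
  have pim: "path_image (rectpath A B) \<subseteq> S - P"
  proof
    fix z assume z: "z \<in> path_image (rectpath A B)"
    have "z \<in> cbox A B - box A B" using z path_image_rectpath_cbox_minus_box[of A B] AB by auto
    thus "z \<in> S - P" using box inside by (auto simp: P_def)
  qed
  have "contour_integral (rectpath A B) (\<lambda>w. f w / ?d w)
     = 2 * pi * \<i> * (\<Sum>p\<in>P. winding_number (rectpath A B) p * residue (\<lambda>w. f w / ?d w) p)"
  proof (rule Residue_theorem)
    show "connected S" using S convex_connected by blast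
    show "(\<lambda>w. f w / ?d w) holomorphic_on S - P"
      by (intro holomorphic_intros holomorphic_on_subset[OF f] nz h) auto
    show "\<forall>z. z \<notin> S \<longrightarrow> winding_number (rectpath A B) z = 0"
      using winding_number_rectpath_outside[of A B] AB box by auto
  qed (use S K pim in \<open>auto simp: P_def\<close>)
  also have "(\<Sum>p\<in>P. winding_number (rectpath A B) p * residue (\<lambda>w. f w / ?d w) p)
     = (\<Sum>p\<in>P. f p * (h / (2 * pi * \<i>)))"
  proof (rule sum.cong[OF refl])
    fix p assume p: "p \<in> P"
    then obtain k where k: "k \<in> K" "p = of_int k * h" by (auto simp: P_def)
    have pS: "p \<in> S" "p \<in> box A B" using p inside box box_subset_cbox[of A B] by (auto simp: P_def)
    have 1: "winding_number (rectpath A B) p = 1"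
      using winding_number_rectpath pS by blast
    have e1: "exp (2 * of_real pi * \<i> * p / h) = 1" using dz[of p] k by auto
    have d: "(?d has_field_derivative (2 * pi * \<i> / h)) (at p)"
      using h by (auto intro!: derivative_eq_intros simp: e1)
    have "residue (\<lambda>w. f w / ?d w) p = f p / (2 * pi * \<i> / h)"
    proof (rule residue_simple')
      show "open (S - (P - {p}))"
        using S K by (intro open_Diff finite_imp_closed) (auto simp: P_def)
      show "p \<in> S - (P - {p})" using pS by auto
      show "(\<lambda>w. f w / ?d w) holomorphic_on S - (P - {p}) - {p}"
        by (intro holomorphic_intros holomorphic_on_subset[OF f] nz h) (use p in auto)
      have L1: "((\<lambda>w. (?d w - ?d p) / (w - p)) \<longlongrightarrow> 2 * pi * \<i> / h) (at p)"
        using d by (simp add: has_field_derivative_iff)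
      have L2: "(f \<longlongrightarrow> f p) (at p)"
        using f S pS by (metis at_within_open continuous_on holomorphic_on_imp_continuous_on)
      have "((\<lambda>w. f w / ((?d w - ?d p) / (w - p))) \<longlongrightarrow> f p / (2 * pi * \<i> / h)) (at p)"
        by (rule tendsto_divide[OF L2 L1]) (use h in simp)
      thus "((\<lambda>w. f w / ?d w * (w - p)) \<longlongrightarrow> f p / (2 * pi * \<i> / h)) (at p)"
        using e1 by simp
    qed
    with 1 show "winding_number (rectpath A B) p * residue (\<lambda>w. f w / ?d w) p = f p * (h / (2 * pi * \<i>))"
      by simp
  qed
  also have "2 * pi * \<i> * (\<Sum>p\<in>P. f p * (h / (2 * pi * \<i>))) = h * (\<Sum>p\<in>P. f p)"
    unfolding sum_distrib_right[symmetric] by simp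
  also have "(\<Sum>p\<in>P. f p) = (\<Sum>k\<in>K. f (of_int k * h))"
    unfolding P_def sum.reindex[OF inj] o_def ..
  finally show ?thesis .
qed

section \<open>Laplace's method with a complex parameter\<close>

lemma has_bochner_integral_lborel_has_integral:
  fixes f :: "real \<Rightarrow> real"
  assumes "has_bochner_integral lborel f x"
  shows "(f has_integral x) UNIV"
  using has_integral_integral_lborel[of f] assms unfolding has_bochner_integral_iff by auto

text \<open>Chebyshev's argument: beyond X the weight x^2 / X^2 is at least 1, so the second moment
  bounds the tail. This crude power is enough, because X will be of order sqrt N and only a relative
  error of order 1/N is wanted.\<close>

lemma gaussian_tail:
  fixes X :: real
  assumes "X > 0"
  shows "\<bar>integral {0..X} (\<lambda>x. exp (- x\<^sup>2)) - sqrt pi / 2\<bar> \<le> 1 / X\<^sup>2"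
proof -
  have g0: "((\<lambda>x::real. indicator {0..} x * exp (- x\<^sup>2)) has_integral (sqrt pi / 2)) UNIV"
    using has_bochner_integral_lborel_has_integral[OF gaussian_moment_0] by simp
  have "has_bochner_integral lborel (\<lambda>x::real. indicator {0..} x *\<^sub>R (exp (-x\<^sup>2)*x^(2 * 1)))
       ((sqrt pi / 2) * (fact (2 * 1) / (2 ^ (2 * 1) * fact 1)))"
    by (rule gaussian_moment_even_pos)
  from has_bochner_integral_lborel_has_integral[OF this]
  have g2: "((\<lambda>x::real. indicator {0..} x * (exp (- x\<^sup>2) * x\<^sup>2)) has_integral (sqrt pi / 4)) UNIV"
    by (simp add: fact_numeral numeral_eq_Suc)
  have gX: "((\<lambda>x::real. if x \<in> {0..X} then exp (- x\<^sup>2) else 0) has_integral integral {0..X} (\<lambda>x. exp (- x\<^sup>2))) UNIV"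
    unfolding has_integral_restrict_UNIV
    by (intro integrable_integral integrable_continuous_interval continuous_intros)
  have d: "((\<lambda>x::real. indicator {0..} x * exp (- x\<^sup>2) - (if x \<in> {0..X} then exp (- x\<^sup>2) else 0)) has_integral
     (sqrt pi / 2 - integral {0..X} (\<lambda>x. exp (- x\<^sup>2)))) UNIV"
    by (rule has_integral_diff[OF g0 gX])
  have "0 \<le> sqrt pi / 2 - integral {0..X} (\<lambda>x. exp (- x\<^sup>2))"
    by (rule has_integral_nonneg[OF d]) (auto simp: indicator_def)
  moreover have "sqrt pi / 2 - integral {0..X} (\<lambda>x. exp (- x\<^sup>2)) \<le> sqrt pi / 4 * (1 / X\<^sup>2)"
  proof (rule has_integral_le[OF d has_integral_mult_left[OF g2]])
    fix x :: real
    have "1 \<le> x\<^sup>2 * (1 / X\<^sup>2)" if "x > X"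
      using that assms by (simp add: field_simps power_mono)
    hence "exp (- x\<^sup>2) \<le> exp (- x\<^sup>2) * (x\<^sup>2 * (1 / X\<^sup>2))" if "x > X"
      using mult_left_mono[of 1 "x\<^sup>2 * (1 / X\<^sup>2)" "exp (- x\<^sup>2)"] that by simp
    thus "indicator {0..} x * exp (- x\<^sup>2) - (if x \<in> {0..X} then exp (- x\<^sup>2) else 0)
      \<le> indicator {0..} x * (exp (- x\<^sup>2) * x\<^sup>2) * (1 / X\<^sup>2)"
      using assms by (auto simp: indicator_def mult.assoc)
  qed
  moreover have "sqrt pi / 4 * (1 / X\<^sup>2) \<le> 1 * (1 / X\<^sup>2)"
    using real_sqrt_le_mono[of pi 4] pi_less_4 by (intro mult_right_mono) auto
  ultimately show ?thesis by linarith
qed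

lemma exp_minus_le_inverse_square:
  fixes x :: real assumes "x > 0" shows "exp (- x) \<le> 2 / x\<^sup>2"
proof -
  have "x\<^sup>2 / 2 \<le> exp x"
    using exp_lower_Taylor_quadratic[of x] assms by linarith
  thus ?thesis using assms by (simp add: exp_minus field_simps)
qed

lemma exp_minus_sq_primitive:
  obtains Er :: "complex \<Rightarrow> complex" where "\<And>z. (Er has_field_derivative exp (- z\<^sup>2)) (at z)"
proof -
  have "\<exists>g. \<forall>x\<in>UNIV. (g has_field_derivative (\<lambda>z. exp (- z\<^sup>2)) x) (at x :: complex filter)"
  proof (rule holomorphic_starlike_primitive)
    show "starlike (UNIV :: complex set)" by (intro convex_imp_starlike) auto
    show "(\<lambda>z::complex. exp (- z\<^sup>2)) field_differentiable at x" for x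
      by (intro holomorphic_on_imp_differentiable_at[of _ UNIV] holomorphic_intros) auto
  qed (auto intro!: continuous_intros)
  thus ?thesis using that by auto
qed

text \<open>A primitive \<open>Er\<close> of exp (-z^2) serves as error function. With r^2 = N \<nu>
  the integral is the increment of \<open>Er\<close> between -r \<epsilon> and r \<epsilon>, divided
  by r. Moving both end points to their real parts costs an exponentially small amount and leaves a
  real Gaussian integral.\<close>

lemma gaussian_integral_complex:
  fixes \<nu> :: complex and \<epsilon> :: real
  assumes "Re \<nu> > 0" "\<epsilon> > 0"
  shows "\<exists>C. \<forall>N\<ge>1. norm (integral {-\<epsilon>..\<epsilon>} (\<lambda>t. exp (- (of_real N * \<nu> * of_real (t\<^sup>2))))
            - csqrt (of_real pi / (of_real N * \<nu>))) \<le> C / (N * sqrt N)"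
proof -
  obtain Er :: "complex \<Rightarrow> complex" where Er: "\<And>z. (Er has_field_derivative exp (- z\<^sup>2)) (at z)"
    using exp_minus_sq_primitive by blast
  define \<rho> where "\<rho> = csqrt \<nu>"
  have \<rho>2: "\<rho>\<^sup>2 = \<nu>" by (simp add: \<rho>_def)
  have Re\<nu>: "Re \<nu> = (Re \<rho>)\<^sup>2 - (Im \<rho>)\<^sup>2" unfolding \<rho>2[symmetric] by (simp add: power2_eq_square)
  have "Re \<rho> \<ge> 0" unfolding \<rho>_def by (rule Re_csqrt)
  moreover have "Re \<rho> \<noteq> 0"
    using Re\<nu> assms(1) by (metis diff_ge_0_iff_ge diff_gt_0_iff_gt not_less power_zero_numeral zero_le_power2)
  ultimately have R: "Re \<rho> > 0" by linarith
  hence \<rho>0: "\<rho> \<noteq> 0" by auto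
  define k where "k = \<epsilon>\<^sup>2 * Re \<nu>"
  have k: "k > 0" using assms by (simp add: k_def)
  define C where "C = (4 * \<epsilon> * \<bar>Im \<rho>\<bar> * 2 / k\<^sup>2 + 2 / (\<epsilon> * Re \<rho>)\<^sup>2) / norm \<rho> "
  define C' where "C' = (4 * \<epsilon> * \<bar>Im \<rho>\<bar> / k\<^sup>2) / norm \<rho> + (2 / (\<epsilon> * Re \<rho>)\<^sup>2) / norm \<rho>"
  show ?thesis
  proof (intro exI allI impI)
    fix N :: real assume N: "N \<ge> 1"
    define r where "r = of_real (sqrt N) * \<rho>"
    have r0: "r \<noteq> 0" using \<rho>0 N by (simp add: r_def)
    have r2: "r\<^sup>2 = of_real N * \<nu>" using N by (simp add: r_def power_mult_distrib \<rho>2 flip: of_real_power)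
    define x where "x = \<epsilon> * Re r"
    have rx: "Re r = sqrt N * Re \<rho>" "Im r = sqrt N * Im \<rho>" by (simp_all add: r_def)
    have x: "x > 0" using assms R N by (simp add: x_def rx)
    have FTC: "((\<lambda>t. exp (- (of_real N * \<nu> * of_real (t\<^sup>2)))) has_integral (Er (r * \<epsilon>) / r - Er (r
        * (-\<epsilon>)) / r)) {-\<epsilon>..\<epsilon>}"
    proof -
      have "((\<lambda>t. exp (- (of_real N * \<nu> * of_real (t\<^sup>2)))) has_integral (Er (r * of_real \<epsilon>) / r - Er (r
          * of_real (-\<epsilon>)) / r)) {-\<epsilon>..\<epsilon>}"
      proof (rule fundamental_theorem_of_calculus)
        fix t assume "t \<in> {-\<epsilon>..\<epsilon>}"
        have "((\<lambda>z. Er (r * z) / r) has_field_derivative exp (- (r * of_real t)\<^sup>2)) (at (of_real t))"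
          by (rule derivative_eq_intros DERIV_chain2[OF Er] refl | use r0 in simp)+
        hence "((\<lambda>t. Er (r * of_real t) / r) has_vector_derivative exp (- (r * of_real t)\<^sup>2)) (at t within {-\<epsilon>..\<epsilon>})"
          by (rule has_vector_derivative_real_field)
        thus "((\<lambda>t. Er (r * of_real t) / r) has_vector_derivative exp (- (of_real N * \<nu>
            * of_real (t\<^sup>2)))) (at t within {-\<epsilon>..\<epsilon>})"
          by (simp add: power_mult_distrib r2)
      qed (use assms in auto)
      thus ?thesis by simp
    qed
    have FTC2: "((\<lambda>t. exp (- (t\<^sup>2))) has_integral (Er (of_real x) - Er (of_real (-x)))) {-x..x}"
    proof (rule fundamental_theorem_of_calculus)
      fix t assume "t \<in> {-x..x}"
      show "((\<lambda>t. Er (of_real t)) has_vector_derivative of_real (exp (- t\<^sup>2))) (at t within {-x..x})"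
        using has_vector_derivative_real_field[OF Er[of "of_real t"]] by (simp flip: exp_of_real)
    qed (use x in auto)
    have D: "((\<lambda>t. exp (- (t\<^sup>2))) has_integral (2 * integral {0..x} (\<lambda>x. exp (- x\<^sup>2)))) {-x..x}"
    proof -
      have i: "((\<lambda>t. exp (- (t\<^sup>2))) has_integral integral {0..x} (\<lambda>x. exp (- x\<^sup>2))) {0..x}"
        by (intro integrable_integral integrable_continuous_interval continuous_intros)
      have "((\<lambda>t. exp (- ((-t)\<^sup>2))) has_integral integral {0..x} (\<lambda>x. exp (- x\<^sup>2))) {-x..-0}"
        by (subst has_integral_reflect_real) (use i x in auto)
      hence "((\<lambda>t. exp (- (t\<^sup>2))) has_integral integral {0..x} (\<lambda>x. exp (- x\<^sup>2))) {-x..0}" by simp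
      from has_integral_combine[OF _ _ this i] x show ?thesis by simp
    qed
    have "((\<lambda>t. of_real (exp (- (t\<^sup>2))) :: complex) has_integral of_real (2
        * integral {0..x} (\<lambda>x. exp (- x\<^sup>2)))) {-x..x}"
      using has_integral_of_real[OF D] .
    with FTC2 have ErD: "Er (of_real x) - Er (of_real (-x)) = of_real (2 * integral {0..x} (\<lambda>x. exp (- x\<^sup>2)))"
      using has_integral_unique by blast
    \<comment> \<open>The segment from x = Re (r \<epsilon>) to r \<epsilon> is vertical, and Re
      (z^2) is smallest at its far end, where it equals \<epsilon>^2 N Re \<nu> = k N. The sign
      \<open>s\<close> treats both ends of the interval at once.\<close>
    have seg: "norm (Er (s * (r * \<epsilon>)) - Er (s * of_real x)) \<le> exp (- (k * N)) * (\<epsilon> * \<bar>Im r\<bar>)" if s: "s = 1 \<or> s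
        = -1" for s :: complex
    proof -
      have "norm (Er (s * (r * \<epsilon>)) - Er (s * of_real x)) \<le> exp (- (k * N)) * norm (s * (r * \<epsilon>) - s * of_real x)"
      proof (rule field_differentiable_bound[of "closed_segment (s * of_real x) (s * (r * \<epsilon>))"])
        fix z assume z: "z \<in> closed_segment (s * of_real x) (s * (r * \<epsilon>))"
        then obtain v where v: "0 \<le> v" "v \<le> 1" "z = (1 - v) *\<^sub>R (s * of_real x) + v *\<^sub>R (s * (r * \<epsilon>))"
          by (auto simp: in_segment)
        have z2: "z\<^sup>2 = ((1 - v) *\<^sub>R of_real x + v *\<^sub>R (r * \<epsilon>))\<^sup>2"
        proof -
          have "z = s * ((1 - v) *\<^sub>R of_real x + v *\<^sub>R (r * \<epsilon>))"
            unfolding v(3) by (simp add: scaleR_conv_of_real algebra_simps)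
          moreover have "s\<^sup>2 = 1" using s by auto
          ultimately show ?thesis by (simp add: power_mult_distrib)
        qed
        have "Re (z\<^sup>2) = x\<^sup>2 - (v * (\<epsilon> * Im r))\<^sup>2"
          unfolding z2 by (simp add: power2_eq_square x_def algebra_simps)
        also have "(v * (\<epsilon> * Im r))\<^sup>2 \<le> (\<epsilon> * Im r)\<^sup>2"
          using v by (simp add: power_mult_distrib mult_left_le_one_le power_le_one)
        hence "x\<^sup>2 - (v * (\<epsilon> * Im r))\<^sup>2 \<ge> x\<^sup>2 - (\<epsilon> * Im r)\<^sup>2" by simp
        also (xtrans) have "x\<^sup>2 - (\<epsilon> * Im r)\<^sup>2 = k * N"
          using N unfolding x_def k_def Re\<nu> rx by (simp add: power_mult_distrib algebra_simps)
        finally have "Re (z\<^sup>2) \<ge> k * N" .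
        thus "norm (exp (- z\<^sup>2)) \<le> exp (- (k * N))" by simp
      qed (use Er in \<open>auto intro: has_field_derivative_at_within\<close>)
      also have "norm (s * (r * \<epsilon>) - s * of_real x) = norm (r * \<epsilon> - of_real x)"
        using s by (metis (no_types, lifting) mult_1 norm_minus_commute minus_diff_minus mult_minus1 norm_minus_cancel)
      also have "r * \<epsilon> - of_real x = \<i> * of_real (\<epsilon> * Im r)"
        by (simp add: complex_eq_iff x_def)
      finally show ?thesis using assms by (simp add: norm_mult abs_mult)
    qed
    have "integral {-\<epsilon>..\<epsilon>} (\<lambda>t. exp (- (of_real N * \<nu> * of_real (t\<^sup>2)))) = (Er (r * \<epsilon>) - Er (- (r * \<epsilon>))) / r"
      using FTC by (simp add: integral_unique diff_divide_distrib)
    moreover have "csqrt (of_real pi / (of_real N * \<nu>)) = of_real (sqrt pi) / r"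
    proof (rule csqrt_unique)
      show "(of_real (sqrt pi) / r)\<^sup>2 = of_real pi / (of_real N * \<nu>)"
        by (simp add: power_divide r2 flip: of_real_power)
      have "Re (of_real (sqrt pi) / r) > 0"
        using R N \<rho>0 by (simp add: Re_divide rx r_def power2_eq_square sum_power2_gt_zero_iff  
            complex_eq_iff zero_less_divide_iff sum_squares_gt_zero_iff)
      thus "0 < Re (complex_of_real (sqrt pi) / r) \<or> Re (complex_of_real (sqrt pi) / r) = 0 \<and>
          0 \<le> Im (complex_of_real (sqrt pi) / r)" by simp
    qed
    ultimately have "integral {-\<epsilon>..\<epsilon>} (\<lambda>t. exp (- (of_real N * \<nu> * of_real (t\<^sup>2)))) - csqrt (of_real pi / (of_real N
        * \<nu>))
       = ((Er (r * \<epsilon>) - Er (of_real x)) - (Er (- (r * \<epsilon>)) - Er (- of_real x)) + (of_real (2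
           * integral {0..x} (\<lambda>x. exp (- x\<^sup>2))) - of_real (sqrt pi))) / r"
      unfolding ErD[symmetric] by (simp add: diff_divide_distrib add_divide_distrib)
    hence "norm (integral {-\<epsilon>..\<epsilon>} (\<lambda>t. exp (- (of_real N * \<nu> * of_real (t\<^sup>2)))) - csqrt (of_real pi / (of_real N * \<nu>)))
      = norm ((Er (r * \<epsilon>) - Er (of_real x)) - (Er (- (r * \<epsilon>)) - Er (- of_real x)) + (of_real (2
          * integral {0..x} (\<lambda>x. exp (- x\<^sup>2))) - of_real (sqrt pi))) / norm r"
      by (simp add: norm_divide)
    also have "\<dots> \<le> (exp (- (k * N)) * (\<epsilon> * \<bar>Im r\<bar>) + exp (- (k * N)) * (\<epsilon> * \<bar>Im r\<bar>) + 2 / x\<^sup>2) / norm r"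
    proof (rule divide_right_mono)
      have n1: "norm (Er (r * \<epsilon>) - Er (of_real x)) \<le> exp (- (k * N)) * (\<epsilon> * \<bar>Im r\<bar>)" using seg[of 1] by simp
      have n2: "norm (Er (- (r * \<epsilon>)) - Er (- of_real x)) \<le> exp (- (k * N)) * (\<epsilon> * \<bar>Im r\<bar>)" using seg[of "-1"] by simp
      have "norm (complex_of_real (2 * integral {0..x} (\<lambda>x. exp (- x\<^sup>2))) - of_real (sqrt pi))
         = \<bar>2 * (integral {0..x} (\<lambda>x. exp (- x\<^sup>2)) - sqrt pi / 2)\<bar>"
        by (simp flip: of_real_diff del: of_real_mult)
      also have "\<dots> \<le> 2 * (1 / x\<^sup>2)" unfolding abs_mult using gaussian_tail[OF x] by simp
      finally have n3: "norm (complex_of_real (2 * integral {0..x} (\<lambda>x. exp (- x\<^sup>2))) - of_real (sqrt pi)) \<le> 2 / x\<^sup>2"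
          by simp
      show "norm ((Er (r * \<epsilon>) - Er (of_real x)) - (Er (- (r * \<epsilon>)) - Er (- of_real x)) + (of_real (2
          * integral {0..x} (\<lambda>x. exp (- x\<^sup>2))) - of_real (sqrt pi)))
         \<le> exp (- (k * N)) * (\<epsilon> * \<bar>Im r\<bar>) + exp (- (k * N)) * (\<epsilon> * \<bar>Im r\<bar>) + 2 / x\<^sup>2"
        by (rule order_trans[OF norm_triangle_ineq] add_mono order_trans[OF norm_triangle_ineq4] n1 n2 n3)+
    qed auto
    also have "\<dots> = 2 * exp (- (k * N)) * \<epsilon> * \<bar>Im \<rho>\<bar> / norm \<rho> + (2 / (\<epsilon> * Re \<rho>)\<^sup>2) / norm \<rho> / (N * sqrt N)"
      using N \<rho>0 R assms by (simp add: x_def rx r_def norm_mult abs_mult power_mult_distrib field_simps)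
    also have "2 * exp (- (k * N)) * \<epsilon> * \<bar>Im \<rho>\<bar> / norm \<rho> \<le> 2 * (2 / k\<^sup>2 / (N * sqrt N)) * \<epsilon> * \<bar>Im \<rho>\<bar> / norm \<rho>"
    proof (intro divide_right_mono mult_right_mono mult_left_mono)
      have "exp (- (k * N)) \<le> 2 / (k * N)\<^sup>2" using k N by (intro exp_minus_le_inverse_square) auto
      also have "2 / (k * N)\<^sup>2 \<le> 2 / k\<^sup>2 / (N * sqrt N)"
      proof -
        have "sqrt N \<le> N" using N by (simp add: real_le_lsqrt power2_eq_square real_sqrt_le_iff sqrt_le_D)
        hence "N * sqrt N \<le> N * N" using N by simp
        thus ?thesis using k N by (simp add: power2_eq_square field_simps)
      qed
      finally show "exp (- (k * N)) \<le> 2 / k\<^sup>2 / (N * sqrt N)" .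
    qed (use assms in auto)
    also have "2 * (2 / k\<^sup>2 / (N * sqrt N)) * \<epsilon> * \<bar>Im \<rho>\<bar> / norm \<rho> + (2 / (\<epsilon> * Re \<rho>)\<^sup>2) / norm \<rho> / (N * sqrt N)
        = C' / (N * sqrt N)"
      unfolding C'_def by (simp add: add_divide_distrib)
    finally show "norm (integral {-\<epsilon>..\<epsilon>} (\<lambda>t. exp (- (of_real N * \<nu> * of_real (t\<^sup>2))))
        - csqrt (of_real pi / (of_real N * \<nu>))) \<le> C' / (N * sqrt N)" by simp
  qed
qed

text \<open>From 1 + k \<tau> / 4 \<le> exp (k \<tau> / 4). Of the four powers, two will absorb the
  factor (1 + \<tau>)^2 of the Taylor remainders in Laplace's method and two remain to make the
  error integrable.\<close>

lemma power4_le_exp: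
  fixes k :: real assumes "k > 0"
  obtains K where "K > 0" "\<And>\<tau>. \<tau> \<ge> 0 \<Longrightarrow> (1 + \<tau>) ^ 4 \<le> K * exp (k * \<tau>)"
proof -
  define m where "m = max 1 (4 / k)"
  have m1: "m \<ge> 1" "m \<ge> 4 / k" by (simp_all add: m_def)
  hence "4 / k * (k / 4) \<le> m * (k / 4)" using assms by (intro mult_right_mono) auto
  with m1 assms have m: "m \<ge> 1" "m * (k / 4) \<ge> 1" by simp_all
  have "(1 + \<tau>) ^ 4 \<le> m ^ 4 * exp (k * \<tau>)" if "\<tau> \<ge> 0" for \<tau>
  proof -
    have "1 * \<tau> \<le> m * (k / 4) * \<tau>" using m that by (intro mult_right_mono)
    hence "1 + \<tau> \<le> m * (1 + k * \<tau> / 4)" using m by (simp add: algebra_simps)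
    also have "\<dots> \<le> m * exp (k * \<tau> / 4)" using m by (intro mult_left_mono exp_ge_add_one_self) auto
    finally have "(1 + \<tau>) ^ 4 \<le> (m * exp (k * \<tau> / 4)) ^ 4" using that by (intro power_mono) auto
    also have "\<dots> = m ^ 4 * exp (k * \<tau>)" by (simp add: power_mult_distrib flip: exp_of_nat_mult)
    finally show ?thesis .
  qed
  thus ?thesis using that[of "m ^ 4"] m by simp
qed

text \<open>The terms with \<open>A1 * t\<close> and \<open>A0 * N * d * t ^ 3\<close> are kept
  because they are odd and integrate to zero against the Gaussian; all that is left is t^2 times a
  rapidly decreasing function of N t^2. The hypothesis \<open>small\<close> keeps the non-Gaussian
  part of the exponent below half of the Gaussian decay.\<close>

lemma laplace_pointwise:
  fixes E A :: "real \<Rightarrow> real" and \<mu> :: complex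
  assumes \<mu>: "Re \<mu> > 0" and c: "c > 0" and \<epsilon>: "\<epsilon> > 0" and B: "B \<ge> 0"
    and tE: "\<And>t. \<bar>t\<bar> \<le> \<epsilon> \<Longrightarrow> \<bar>E t + c / 2 * t\<^sup>2 - d * t ^ 3\<bar> \<le> B * t ^ 4"
    and tA: "\<And>t. \<bar>t\<bar> \<le> \<epsilon> \<Longrightarrow> \<bar>A t - A0 - A1 * t\<bar> \<le> B * t\<^sup>2"
    and small: "norm \<mu> * (\<bar>d\<bar> * \<epsilon> + B * \<epsilon>\<^sup>2) \<le> c * Re \<mu> / 4"
  shows "\<exists>K. \<forall>N\<ge>0. \<forall>t. \<bar>t\<bar> \<le> \<epsilon> \<longrightarrow>
     norm (of_real (A t) * exp (of_real N * \<mu> * of_real (E t))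
         - exp (- (of_real N * (\<mu> * of_real (c / 2)) * of_real (t\<^sup>2))) * (of_real A0 + of_real (A1 * t) + of_real (A0
             * N * d * t ^ 3) * \<mu>))
       \<le> K * (t\<^sup>2 / (1 + N * t\<^sup>2)\<^sup>2)"
proof -
  define m where "m = norm \<mu>"
  define k where "k = c * Re \<mu> / 4"
  have k: "k > 0" using \<mu> c by (simp add: k_def)
  have m: "m > 0" using \<mu> by (auto simp: m_def)
  obtain K2 where K2: "K2 > 0" "\<And>\<tau>. \<tau> \<ge> 0 \<Longrightarrow> (1 + \<tau>) ^ 4 \<le> K2 * exp (k * \<tau>)"
    using power4_le_exp[OF k] by blast
  define A2 where "A2 = \<bar>A0\<bar> + \<bar>A1\<bar> * \<epsilon>"
  have A2: "A2 \<ge> 0" using \<epsilon> by (simp add: A2_def)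
  define m1 where "m1 = m * (\<bar>d\<bar> + B * \<epsilon>)"
  have m1: "m1 \<ge> 0" using m B \<epsilon> by (simp add: m1_def)
  define K1 where "K1 = B + A2 * m1\<^sup>2 + A2 * m * B + \<bar>A1\<bar> * m * \<bar>d\<bar>"
  have K1: "K1 \<ge> 0" using m B A2 by (simp add: K1_def)
  show ?thesis
  proof (intro exI allI impI)
    fix N t :: real assume N: "N \<ge> 0" and t: "\<bar>t\<bar> \<le> \<epsilon>"
    define \<tau> where "\<tau> = N * t\<^sup>2"
    have \<tau>: "\<tau> \<ge> 0" using N by (simp add: \<tau>_def)
    define w where "w = of_real N * \<mu> * of_real (E t + c / 2 * t\<^sup>2)"
    define e where "e = E t + c / 2 * t\<^sup>2 - d * t ^ 3"
    have e: "\<bar>e\<bar> \<le> B * t ^ 4" using tE[OF t] by (simp add: e_def)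
    have t4: "t ^ 4 = \<bar>t\<bar> * \<bar>t\<bar> ^ 3"
    proof -
      have "t ^ 4 = \<bar>t\<bar> ^ 4" by simp
      also have "\<dots> = \<bar>t\<bar> * \<bar>t\<bar> ^ 3" by (simp only: power4_eq_xxxx power3_eq_cube mult.assoc)
      finally show ?thesis .
    qed
    have "t ^ 4 \<le> \<epsilon> * \<bar>t\<bar> ^ 3" unfolding t4 using t by (intro mult_right_mono) auto
    hence "B * t ^ 4 \<le> B * \<epsilon> * \<bar>t\<bar> ^ 3" using B by (simp add: mult.assoc mult_left_mono)
    hence "\<bar>d * t ^ 3 + e\<bar> \<le> \<bar>d\<bar> * \<bar>t\<bar> ^ 3 + B * \<epsilon> * \<bar>t\<bar> ^ 3"
      using e abs_triangle_ineq[of "d * t ^ 3" e] by (simp add: abs_mult power_abs)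
    hence "\<bar>E t + c / 2 * t\<^sup>2\<bar> \<le> (\<bar>d\<bar> + B * \<epsilon>) * \<bar>t\<bar> ^ 3"
      by (simp add: e_def algebra_simps)
    hence "N * m * \<bar>E t + c / 2 * t\<^sup>2\<bar> \<le> N * m * ((\<bar>d\<bar> + B * \<epsilon>) * \<bar>t\<bar> ^ 3)"
      using N m by (intro mult_left_mono) auto
    moreover have "norm w = N * m * \<bar>E t + c / 2 * t\<^sup>2\<bar>"
      unfolding w_def norm_mult norm_of_real m_def using N by simp
    ultimately have w1: "norm w \<le> m1 * N * \<bar>t\<bar> ^ 3"
      by (simp add: m1_def mult_ac)
    also have "m1 * N * \<bar>t\<bar> ^ 3 = m1 * \<bar>t\<bar> * \<tau>"
      by (simp add: \<tau>_def power3_eq_cube power2_eq_square)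
    also have "\<dots> \<le> k * \<tau>"
    proof (rule mult_right_mono[OF _ \<tau>])
      have "m1 * \<bar>t\<bar> \<le> m1 * \<epsilon>" using m1 t by (intro mult_left_mono)
      also have "\<dots> = m * (\<bar>d\<bar> * \<epsilon> + B * \<epsilon>\<^sup>2)" by (simp add: m1_def power2_eq_square algebra_simps)
      also have "\<dots> \<le> k" using small by (simp add: m_def k_def)
      finally show "m1 * \<bar>t\<bar> \<le> k" .
    qed
    finally have w2: "norm w \<le> k * \<tau>" .
    have "(norm w)\<^sup>2 \<le> (m1 * N * \<bar>t\<bar> ^ 3)\<^sup>2" using w1 by (intro power_mono) auto
    also have "\<dots> = m1\<^sup>2 * \<tau>\<^sup>2 * t\<^sup>2" unfolding \<tau>_def by (simp add: power_mult_distrib power2_eq_square power3_eq_cube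
        mult_ac)
    finally have w3: "(norm w)\<^sup>2 \<le> m1\<^sup>2 * \<tau>\<^sup>2 * t\<^sup>2" .
    have ew: "norm (exp w) \<le> exp (k * \<tau>)" using w2 abs_Re_le_cmod[of w] by simp
    have "norm (exp w - (\<Sum>i\<le>1. w ^ i / fact i)) \<le> exp \<bar>Re w\<bar> * norm w ^ Suc 1 / fact 1"
      by (rule Taylor_exp)
    hence "norm (exp w - 1 - w) \<le> exp \<bar>Re w\<bar> * (norm w)\<^sup>2"
      by (simp add: power2_eq_square algebra_simps)
    also have "\<dots> \<le> exp (k * \<tau>) * (m1\<^sup>2 * \<tau>\<^sup>2 * t\<^sup>2)"
      using w2 w3 abs_Re_le_cmod[of w] by (intro mult_mono) auto
    finally have ew2: "norm (exp w - 1 - w) \<le> exp (k * \<tau>) * (m1\<^sup>2 * \<tau>\<^sup>2 * t\<^sup>2)" .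
    have wd: "w - of_real (N * d * t ^ 3) * \<mu> = of_real (N * e) * \<mu>"
      by (simp add: w_def e_def algebra_simps)
    have "norm (w - of_real (N * d * t ^ 3) * \<mu>) = N * \<bar>e\<bar> * m" unfolding wd using N
        by (simp add: norm_mult m_def abs_mult)
    also have "\<dots> \<le> N * (B * t ^ 4) * m" using e N m by (intro mult_right_mono mult_left_mono) auto
    finally have w4: "norm (w - of_real (N * d * t ^ 3) * \<mu>) \<le> m * B * \<tau> * t\<^sup>2"
      by (simp add: \<tau>_def mult_ac power4_eq_xxxx power2_eq_square)
    have At: "norm (of_real A0 + of_real (A1 * t) :: complex) \<le> A2"
      using norm_triangle_ineq[of "of_real A0 :: complex" "of_real (A1 * t)"] mult_left_mono[OF t, of "\<bar>A1\<bar>"]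
      by (simp add: A2_def norm_mult)
    define X where "X = of_real (A t) * exp w - (of_real A0 + of_real (A1 * t) + of_real (A0 * N * d * t ^ 3) * \<mu>)"
    \<comment> \<open>The four summands are the remainder of \<open>A\<close>, the second-order
      remainder of the exponential, the quartic remainder of \<open>E\<close>, and the product of
      the two odd terms, which is even and has to be estimated.\<close>
    have Xeq: "X = of_real (A t - A0 - A1 * t) * exp w + (of_real A0 + of_real (A1 * t)) * (exp w - 1 - w)
        + (of_real A0 + of_real (A1 * t)) * (w - of_real (N * d * t ^ 3) * \<mu>) + of_real (A1 * N * d * t ^ 4) * \<mu>"
      unfolding X_def by (simp add: algebra_simps power4_eq_xxxx power3_eq_cube power2_eq_square)
    have p1: "norm (of_real (A t - A0 - A1 * t) * exp w) \<le> (B * t\<^sup>2) * exp (k * \<tau>)"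
      unfolding norm_mult using tA[OF t] ew by (intro mult_mono) (auto simp del: of_real_diff of_real_mult)
    have p2: "norm ((of_real A0 + of_real (A1 * t)) * (exp w - 1 - w)) \<le> A2 * (exp (k * \<tau>) * (m1\<^sup>2 * \<tau>\<^sup>2 * t\<^sup>2))"
      unfolding norm_mult using At ew2 A2 by (intro mult_mono) auto
    have p3: "norm ((of_real A0 + of_real (A1 * t)) * (w - of_real (N * d * t ^ 3) * \<mu>)) \<le> A2 * (m * B * \<tau> * t\<^sup>2)"
      unfolding norm_mult[of "of_real A0 + of_real (A1 * t)"] using At w4 A2 by (intro mult_mono) auto
    have p4: "norm (of_real (A1 * N * d * t ^ 4) * \<mu>) \<le> \<bar>A1\<bar> * m * \<bar>d\<bar> * \<tau> * t\<^sup>2"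
      using N by (simp add: norm_mult abs_mult m_def \<tau>_def power4_eq_xxxx power2_eq_square mult_ac)
    have "norm X \<le> (B * t\<^sup>2) * exp (k * \<tau>) + A2 * (exp (k * \<tau>) * (m1\<^sup>2 * \<tau>\<^sup>2 * t\<^sup>2)) + A2 * (m * B * \<tau> * t\<^sup>2)
        + \<bar>A1\<bar> * m * \<bar>d\<bar> * \<tau> * t\<^sup>2"
      unfolding Xeq by (rule order_trans[OF norm_triangle_ineq] add_mono p1 p2 p3 p4)+
    also have "\<dots> \<le> exp (k * \<tau>) * t\<^sup>2 * (K1 * (1 + \<tau>)\<^sup>2)"
    proof -
      have e1: "1 \<le> exp (k * \<tau>)" using k \<tau> by simp
      have \<tau>s: "1 \<le> (1 + \<tau>)\<^sup>2" "\<tau> \<le> (1 + \<tau>)\<^sup>2" "\<tau>\<^sup>2 \<le> (1 + \<tau>)\<^sup>2"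
        using \<tau> by (auto simp: power2_eq_square algebra_simps)
      have r3: "A2 * (m * B * \<tau> * t\<^sup>2) \<le> exp (k * \<tau>) * t\<^sup>2 * (A2 * m * B * (1 + \<tau>)\<^sup>2)"
      proof -
        have "1 * (A2 * m * B * \<tau> * t\<^sup>2) \<le> exp (k * \<tau>) * (A2 * m * B * (1 + \<tau>)\<^sup>2 * t\<^sup>2)"
          using e1 \<tau>s A2 m B \<tau> by (intro mult_mono mult_left_mono mult_right_mono) auto
        thus ?thesis by (simp add: mult_ac)
      qed
      have r4: "\<bar>A1\<bar> * m * \<bar>d\<bar> * \<tau> * t\<^sup>2 \<le> exp (k * \<tau>) * t\<^sup>2 * (\<bar>A1\<bar> * m * \<bar>d\<bar> * (1 + \<tau>)\<^sup>2)"
      proof -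
        have "1 * (\<bar>A1\<bar> * m * \<bar>d\<bar> * \<tau> * t\<^sup>2) \<le> exp (k * \<tau>) * (\<bar>A1\<bar> * m * \<bar>d\<bar> * (1 + \<tau>)\<^sup>2 * t\<^sup>2)"
          using e1 \<tau>s m \<tau> by (intro mult_mono mult_left_mono mult_right_mono) auto
        thus ?thesis by (simp add: mult_ac)
      qed
      have r1: "(B * t\<^sup>2) * exp (k * \<tau>) \<le> exp (k * \<tau>) * t\<^sup>2 * (B * (1 + \<tau>)\<^sup>2)"
      proof -
        have "exp (k * \<tau>) * t\<^sup>2 * (B * 1) \<le> exp (k * \<tau>) * t\<^sup>2 * (B * (1 + \<tau>)\<^sup>2)"
          using \<tau>s B by (intro mult_left_mono) auto
        thus ?thesis by (simp add: mult_ac)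
      qed
      have r2: "A2 * (exp (k * \<tau>) * (m1\<^sup>2 * \<tau>\<^sup>2 * t\<^sup>2)) \<le> exp (k * \<tau>) * t\<^sup>2 * (A2 * m1\<^sup>2 * (1 + \<tau>)\<^sup>2)"
      proof -
        have "exp (k * \<tau>) * t\<^sup>2 * (A2 * m1\<^sup>2 * \<tau>\<^sup>2) \<le> exp (k * \<tau>) * t\<^sup>2 * (A2 * m1\<^sup>2 * (1 + \<tau>)\<^sup>2)"
          using \<tau>s A2 by (intro mult_left_mono) auto
        thus ?thesis by (simp add: mult_ac)
      qed
      have "exp (k * \<tau>) * t\<^sup>2 * (K1 * (1 + \<tau>)\<^sup>2) = exp (k * \<tau>) * t\<^sup>2 * (B * (1 + \<tau>)\<^sup>2) + exp (k * \<tau>) * t\<^sup>2 * (A2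
          * m1\<^sup>2 * (1 + \<tau>)\<^sup>2)
         + exp (k * \<tau>) * t\<^sup>2 * (A2 * m * B * (1 + \<tau>)\<^sup>2) + exp (k * \<tau>) * t\<^sup>2 * (\<bar>A1\<bar> * m * \<bar>d\<bar> * (1 + \<tau>)\<^sup>2)"
        unfolding K1_def by (simp add: distrib_left distrib_right)
      with r1 r2 r3 r4 show ?thesis by linarith
    qed
    finally have X: "norm X \<le> exp (k * \<tau>) * t\<^sup>2 * (K1 * (1 + \<tau>)\<^sup>2)" .
    have split: "of_real N * \<mu> * of_real (E t) = - (of_real N * (\<mu> * of_real (c / 2)) * of_real (t\<^sup>2)) + w"
      by (simp add: w_def algebra_simps)
    have ng: "norm (exp (- (of_real N * (\<mu> * of_real (c / 2)) * of_real (t\<^sup>2)))) = exp (- (2 * k * \<tau>))"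
      by (simp add: k_def \<tau>_def flip: of_real_power of_real_mult)
    have "of_real (A t) * exp (of_real N * \<mu> * of_real (E t))
         - exp (- (of_real N * (\<mu> * of_real (c / 2)) * of_real (t\<^sup>2))) * (of_real A0 + of_real (A1 * t) + of_real (A0
             * N * d * t ^ 3) * \<mu>)
       = exp (- (of_real N * (\<mu> * of_real (c / 2)) * of_real (t\<^sup>2))) * X"
      unfolding split exp_add X_def by (simp only: right_diff_distrib mult_ac)
    hence "norm (of_real (A t) * exp (of_real N * \<mu> * of_real (E t))
         - exp (- (of_real N * (\<mu> * of_real (c / 2)) * of_real (t\<^sup>2))) * (of_real A0 + of_real (A1 * t) + of_real (A0
             * N * d * t ^ 3) * \<mu>))
       = exp (- (2 * k * \<tau>)) * norm X" by (simp only: norm_mult ng)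
    also have "\<dots> \<le> exp (- (2 * k * \<tau>)) * (exp (k * \<tau>) * t\<^sup>2 * (K1 * (1 + \<tau>)\<^sup>2))" using X by (intro mult_left_mono) auto
    also have "\<dots> = t\<^sup>2 * K1 * ((1 + \<tau>)\<^sup>2 * exp (- (k * \<tau>)))"
      using exp_add[of "- (2 * k * \<tau>)" "k * \<tau>"] by (simp add: mult_ac)
    also have "\<dots> \<le> t\<^sup>2 * K1 * (K2 / (1 + \<tau>)\<^sup>2)"
    proof (intro mult_left_mono)
      have "(1 + \<tau>)\<^sup>2 * exp (- (k * \<tau>)) * (1 + \<tau>)\<^sup>2 = (1 + \<tau>) ^ 4 * exp (- (k * \<tau>))"
        by (simp add: power4_eq_xxxx power2_eq_square mult_ac)
      also have "\<dots> \<le> K2 * exp (k * \<tau>) * exp (- (k * \<tau>))" using K2(2)[OF \<tau>] by (intro mult_right_mono) auto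
      also have "\<dots> = K2" by (simp flip: exp_add)
      finally show "(1 + \<tau>)\<^sup>2 * exp (- (k * \<tau>)) \<le> K2 / (1 + \<tau>)\<^sup>2" using \<tau> by (simp add: pos_le_divide_eq)
    qed (use K1 in auto)
    also have "\<dots> = K1 * K2 * (t\<^sup>2 / (1 + N * t\<^sup>2)\<^sup>2)" by (simp add: \<tau>_def)
    finally show "norm (of_real (A t) * exp (of_real N * \<mu> * of_real (E t))
         - exp (- (of_real N * (\<mu> * of_real (c / 2)) * of_real (t\<^sup>2))) * (of_real A0 + of_real (A1 * t) + of_real (A0
             * N * d * t ^ 3) * \<mu>))
       \<le> K1 * K2 * (t\<^sup>2 / (1 + N * t\<^sup>2)\<^sup>2)" .
  qed
qed

text \<open>The substitution s = sqrt N * t produces the order N^(-3/2), and s^2 / (1 + s^2)^2 has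
  the primitive (arctan s - s / (1 + s^2)) / 2.\<close>

lemma integral_lorentz_square_le:
  fixes N \<epsilon> :: real
  assumes N: "N \<ge> 1" and \<epsilon>: "\<epsilon> > 0"
  shows "(\<lambda>t. t\<^sup>2 / (1 + N * t\<^sup>2)\<^sup>2) integrable_on {-\<epsilon>..\<epsilon>}"
    and "integral {-\<epsilon>..\<epsilon>} (\<lambda>t. t\<^sup>2 / (1 + N * t\<^sup>2)\<^sup>2) \<le> 4 / (N * sqrt N)"
proof -
  define q where "q = sqrt N"
  have q: "q > 0" "N = q\<^sup>2" using N by (auto simp: q_def)
  define Q where "Q = (\<lambda>t. (arctan (q * t) - q * t / (1 + (q * t)\<^sup>2)) / (2 * q ^ 3))"
  have nz: "1 + (q * t)\<^sup>2 > 0" for t by (simp add: add_pos_nonneg)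
  have I: "((\<lambda>t. t\<^sup>2 / (1 + N * t\<^sup>2)\<^sup>2) has_integral (Q \<epsilon> - Q (-\<epsilon>))) {-\<epsilon>..\<epsilon>}"
  proof (rule fundamental_theorem_of_calculus)
    fix t
    have "(Q has_real_derivative (inverse (1 + (q * t)\<^sup>2) * q - (q * (1 + (q * t)\<^sup>2) - q * t * (2 * (q * t) * q)) / (1
        + (q * t)\<^sup>2)\<^sup>2) / (2 * q ^ 3)) (at t)"
      unfolding Q_def using nz[of t] q
      by (intro DERIV_cdivide) (auto intro!: derivative_eq_intros simp: power2_eq_square)
    also have "(inverse (1 + (q * t)\<^sup>2) * q - (q * (1 + (q * t)\<^sup>2) - q * t * (2 * (q * t) * q)) / (1 + (q * t)\<^sup>2)\<^sup>2)
        = 2 * q ^ 3 * t\<^sup>2 / (1 + (q * t)\<^sup>2)\<^sup>2"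
    proof -
      define D where "D = 1 + (q * t)\<^sup>2"
      have D: "D > 0" using nz by (simp add: D_def)
      have "inverse D * q = q * D / D\<^sup>2" using D by (simp add: power2_eq_square field_simps)
      hence "inverse D * q - (q * D - q * t * (2 * (q * t) * q)) / D\<^sup>2 = 2 * q ^ 3 * t\<^sup>2 / D\<^sup>2"
        by (simp add: diff_divide_distrib power2_eq_square power3_eq_cube mult_ac)
      thus ?thesis by (simp add: D_def)
    qed
    also have "2 * q ^ 3 * t\<^sup>2 / (1 + (q * t)\<^sup>2)\<^sup>2 / (2 * q ^ 3) = t\<^sup>2 / (1 + N * t\<^sup>2)\<^sup>2"
      using q by (simp add: power_mult_distrib)
    finally show "(Q has_vector_derivative t\<^sup>2 / (1 + N * t\<^sup>2)\<^sup>2) (at t within {-\<epsilon>..\<epsilon>})"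
      by (simp add: has_real_derivative_iff_has_vector_derivative has_vector_derivative_at_within)
  qed (use \<epsilon> in auto)
  thus "(\<lambda>t. t\<^sup>2 / (1 + N * t\<^sup>2)\<^sup>2) integrable_on {-\<epsilon>..\<epsilon>}" by blast
  have "integral {-\<epsilon>..\<epsilon>} (\<lambda>t. t\<^sup>2 / (1 + N * t\<^sup>2)\<^sup>2) = Q \<epsilon> - Q (-\<epsilon>)" using I by blast
  also have "\<dots> = (arctan (q * \<epsilon>) - q * \<epsilon> / (1 + (q * \<epsilon>)\<^sup>2)) / q ^ 3"
    unfolding Q_def by (simp add: arctan_minus diff_divide_distrib mult_ac)
  also have "\<dots> \<le> 4 / q ^ 3"
  proof (intro divide_right_mono)
    have "q * \<epsilon> / (1 + (q * \<epsilon>)\<^sup>2) \<ge> 0" using q \<epsilon> by simp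
    thus "arctan (q * \<epsilon>) - q * \<epsilon> / (1 + (q * \<epsilon>)\<^sup>2) \<le> 4"
      using arctan_ubound[of "q * \<epsilon>"] pi_less_4 by linarith
  qed (use q in auto)
  also have "q ^ 3 = N * sqrt N" using q by (simp add: power3_eq_cube power2_eq_square flip: q_def)
  finally show "integral {-\<epsilon>..\<epsilon>} (\<lambda>t. t\<^sup>2 / (1 + N * t\<^sup>2)\<^sup>2) \<le> 4 / (N * sqrt N)" .
qed

lemma inverse_square_le_inverse_N_sqrt_N:
  fixes N :: real assumes "N \<ge> 1" shows "1 / N\<^sup>2 \<le> 1 / (N * sqrt N)"
proof -
  have "sqrt N \<le> sqrt (N\<^sup>2)" using assms self_le_power[of N 2] by (intro real_sqrt_le_mono) auto
  hence "N * sqrt N \<le> N\<^sup>2" using assms by (simp add: power2_eq_square)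
  thus ?thesis using assms by (intro divide_left_mono) auto
qed

text \<open>The constant is uniform in the end points because they will be half-integral multiples
  of c / N and thus move with N. Phase and amplitude are real, so the complex \<mu> enters only
  through the Gaussian integral. The main term has order N^(-1/2), hence the error N^(-3/2) is a
  relative error of order 1/N.\<close>

proposition laplace_asymptotic:
  fixes E A :: "real \<Rightarrow> real" and \<mu> :: complex and a0 a1 b0 b1 c d \<epsilon> B A0 A1 :: real
  assumes \<mu>: "Re \<mu> > 0" and c: "c > 0" and \<epsilon>: "\<epsilon> > 0" and B: "B \<ge> 0"
    and ab: "a0 \<le> a1" "a1 < 0" "0 < b1" "b1 \<le> b0"
    and cont: "continuous_on {a0..b0} E" "continuous_on {a0..b0} A"
    and tE: "\<And>t. \<bar>t\<bar> \<le> \<epsilon> \<Longrightarrow> \<bar>E t + c / 2 * t\<^sup>2 - d * t ^ 3\<bar> \<le> B * t ^ 4"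
    and tA: "\<And>t. \<bar>t\<bar> \<le> \<epsilon> \<Longrightarrow> \<bar>A t - A0 - A1 * t\<bar> \<le> B * t\<^sup>2"
    and far: "\<And>\<delta>. \<delta> > 0 \<Longrightarrow> \<exists>\<kappa>>0. \<forall>t\<in>{a0..b0}. \<bar>t\<bar> \<ge> \<delta> \<longrightarrow> E t \<le> -\<kappa>"
  shows "\<exists>C. \<forall>N\<ge>1. \<forall>a\<in>{a0..a1}. \<forall>b\<in>{b1..b0}.
     norm (integral {a..b} (\<lambda>t. of_real (A t) * exp (of_real N * \<mu> * of_real (E t)))
         - of_real A0 * csqrt (of_real pi / (of_real N * (\<mu> * of_real (c / 2))))) \<le> C / (N * sqrt N)"
proof -
  \<comment> \<open>The radius of the central part: at most -a1 and b1, so that it fits into every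
    admissible interval, at most 1 to have \<epsilon>1^2 \<le> \<epsilon>1, and small enough for the
    smallness condition of \<open>laplace_pointwise\<close>. The added 1 keeps the denominator
    positive.\<close>
  define \<epsilon>1 where "\<epsilon>1 = min (min \<epsilon> 1) (min (min (- a1) b1) (c * Re \<mu> / (4 * (norm \<mu> * (\<bar>d\<bar> + B) + 1))))"
  have p1: "norm \<mu> * (\<bar>d\<bar> + B) + 1 > 0" using B by (simp add: add_nonneg_pos)
  have \<epsilon>1: "\<epsilon>1 > 0" "\<epsilon>1 \<le> \<epsilon>" "\<epsilon>1 \<le> 1" "\<epsilon>1 \<le> - a1" "\<epsilon>1 \<le> b1" "\<epsilon>1 \<le> c * Re \<mu> / (4 * (norm \<mu> * (\<bar>d\<bar> + B) + 1))"
    unfolding \<epsilon>1_def using \<epsilon> ab \<mu> c p1 by (simp_all add: min.coboundedI1 min.coboundedI2)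
  have small: "norm \<mu> * (\<bar>d\<bar> * \<epsilon>1 + B * \<epsilon>1\<^sup>2) \<le> c * Re \<mu> / 4"
  proof -
    have "\<epsilon>1\<^sup>2 \<le> \<epsilon>1" using \<epsilon>1 by (simp add: power2_eq_square mult_le_cancel_right1)
    hence "norm \<mu> * (\<bar>d\<bar> * \<epsilon>1 + B * \<epsilon>1\<^sup>2) \<le> norm \<mu> * (\<bar>d\<bar> * \<epsilon>1 + B * \<epsilon>1)"
      using B by (intro mult_left_mono add_left_mono) auto
    also have "\<dots> \<le> (norm \<mu> * (\<bar>d\<bar> + B) + 1) * \<epsilon>1" using \<epsilon>1 by (simp add: algebra_simps)
    also have "\<dots> \<le> (norm \<mu> * (\<bar>d\<bar> + B) + 1) * (c * Re \<mu> / (4 * (norm \<mu> * (\<bar>d\<bar> + B) + 1)))"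
      using \<epsilon>1 p1 by (intro mult_left_mono) auto
    also have "\<dots> = c * Re \<mu> / 4"
    proof -
      have "P * (x / (4 * P)) = x / 4" if "P > 0" for P x :: real using that by simp
      thus ?thesis using p1 by blast
    qed
    finally show ?thesis .
  qed
  let ?\<phi> = "\<lambda>N t. of_real (A t) * exp (of_real N * \<mu> * of_real (E t))"
  let ?g = "\<lambda>N t. exp (- (of_real N * (\<mu> * of_real (c / 2)) * of_real (t\<^sup>2)))"
  let ?\<psi> = "\<lambda>N t. ?g N t * (of_real A0 + of_real (A1 * t) + of_real (A0 * N * d * t ^ 3) * \<mu>)"
  have "\<exists>K. \<forall>N\<ge>0. \<forall>t. \<bar>t\<bar> \<le> \<epsilon>1 \<longrightarrow> norm (?\<phi> N t - ?\<psi> N t) \<le> K * (t\<^sup>2 / (1 + N * t\<^sup>2)\<^sup>2)"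
    by (rule laplace_pointwise[OF \<mu> c \<epsilon>1(1) B]) (use tE tA small \<epsilon>1 in auto)
  then obtain K where K: "\<And>N t. N \<ge> 0 \<Longrightarrow> \<bar>t\<bar> \<le> \<epsilon>1 \<Longrightarrow> norm (?\<phi> N t - ?\<psi> N t) \<le> K * (t\<^sup>2 / (1 + N * t\<^sup>2)\<^sup>2)"
    by blast
  \<comment> \<open>The pointwise bound admits N = 0; evaluated there it shows that the constant is
    nonnegative.\<close>
  have K0: "K \<ge> 0"
  proof -
    have "0 \<le> K * (\<epsilon>1\<^sup>2 / (1 + 0 * \<epsilon>1\<^sup>2)\<^sup>2)" by (rule order_trans[OF norm_ge_zero K]) (use \<epsilon>1 in auto)
    thus ?thesis using \<epsilon>1 by (simp add: zero_le_mult_iff)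
  qed
  have "Re (\<mu> * of_real (c / 2)) > 0" using \<mu> c by simp
  from gaussian_integral_complex[OF this \<epsilon>1(1)] obtain Cg where Cg: "\<And>N. N \<ge> 1 \<Longrightarrow>
     norm (integral {-\<epsilon>1..\<epsilon>1} (?g N) - csqrt (of_real pi / (of_real N * (\<mu> * of_real (c / 2))))) \<le> Cg / (N * sqrt N)"
    by blast
  obtain \<kappa> where \<kappa>: "\<kappa> > 0" "\<And>t. t \<in> {a0..b0} \<Longrightarrow> \<bar>t\<bar> \<ge> \<epsilon>1 \<Longrightarrow> E t \<le> -\<kappa>" using far[OF \<epsilon>1(1)] by blast
  obtain MA where MA: "MA > 0" "\<And>t. t \<in> {a0..b0} \<Longrightarrow> \<bar>A t\<bar> \<le> MA"
  proof -
    have "bounded (A ` {a0..b0})" by (intro compact_imp_bounded compact_continuous_image cont) auto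
    thus ?thesis using that unfolding bounded_pos by (auto simp: real_norm_def)
  qed
  define Cf where "Cf = MA * (2 / (Re \<mu> * \<kappa>)\<^sup>2) * (b0 - a0)"
  show ?thesis
  proof (intro exI allI impI ballI)
    fix N a b :: real assume N: "N \<ge> 1" and a: "a \<in> {a0..a1}" and b: "b \<in> {b1..b0}"
    have cont\<phi>: "continuous_on {a0..b0} (?\<phi> N)" by (intro continuous_intros cont)
    have int\<phi>: "?\<phi> N integrable_on {x..y}" if "a0 \<le> x" "y \<le> b0" for x y
      by (intro integrable_continuous_interval continuous_on_subset[OF cont\<phi>]) (use that in auto)
    have far_bound: "norm (integral {x..y} (?\<phi> N)) \<le> Cf / (N * sqrt N)"
      if xy: "x \<le> y" "a0 \<le> x" "y \<le> b0" "\<And>t. t \<in> {x..y} \<Longrightarrow> \<bar>t\<bar> \<ge> \<epsilon>1" for x y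
    proof -
      have "norm (integral {x..y} (?\<phi> N)) \<le> (MA * exp (- (N * (Re \<mu> * \<kappa>)))) * (y - x)"
      proof (rule integral_bound[OF xy(1)])
        show "continuous_on {x..y} (?\<phi> N)" by (rule continuous_on_subset[OF cont\<phi>]) (use xy in auto)
        fix t assume t: "t \<in> {x..y}"
        hence t': "t \<in> {a0..b0}" using xy by auto
        have "N * Re \<mu> * E t \<le> N * Re \<mu> * (- \<kappa>)" using \<kappa>(2)[OF t' xy(4)[OF t]] N \<mu> by (intro mult_left_mono) auto
        hence "exp (N * Re \<mu> * E t) \<le> exp (- (N * (Re \<mu> * \<kappa>)))" by (simp add: mult.assoc)
        thus "norm (?\<phi> N t) \<le> MA * exp (- (N * (Re \<mu> * \<kappa>)))"
          using MA t' by (simp add: norm_mult mult_mono)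
      qed
      also have "\<dots> \<le> (MA * (2 / (Re \<mu> * \<kappa>)\<^sup>2 * (1 / (N * sqrt N)))) * (b0 - a0)"
      proof (intro mult_mono mult_left_mono)
        have "exp (- (N * (Re \<mu> * \<kappa>))) \<le> 2 / (N * (Re \<mu> * \<kappa>))\<^sup>2"
          using N \<mu> \<kappa> by (intro exp_minus_le_inverse_square) auto
        also have "\<dots> = 2 / (Re \<mu> * \<kappa>)\<^sup>2 * (1 / N\<^sup>2)" by (simp add: power_mult_distrib)
        also have "\<dots> \<le> 2 / (Re \<mu> * \<kappa>)\<^sup>2 * (1 / (N * sqrt N))"
          using inverse_square_le_inverse_N_sqrt_N[OF N] by (intro mult_left_mono) auto
        finally show "exp (- (N * (Re \<mu> * \<kappa>))) \<le> 2 / (Re \<mu> * \<kappa>)\<^sup>2 * (1 / (N * sqrt N))" .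
      qed (use MA N xy in auto)
      also have "\<dots> = Cf / (N * sqrt N)" by (simp add: Cf_def)
      finally show ?thesis .
    qed
    have split: "integral {a..b} (?\<phi> N) = integral {a..-\<epsilon>1} (?\<phi> N) + integral {-\<epsilon>1..\<epsilon>1} (?\<phi> N)
        + integral {\<epsilon>1..b} (?\<phi> N)"
    proof -
      have "integral {a..b} (?\<phi> N) = integral {a..-\<epsilon>1} (?\<phi> N) + integral {-\<epsilon>1..b} (?\<phi> N)"
        by (rule Henstock_Kurzweil_Integration.integral_combine[symmetric]) (use a b \<epsilon>1 ab int\<phi> in auto)
      also have "integral {-\<epsilon>1..b} (?\<phi> N) = integral {-\<epsilon>1..\<epsilon>1} (?\<phi> N) + integral {\<epsilon>1..b} (?\<phi> N)"
        by (rule Henstock_Kurzweil_Integration.integral_combine[symmetric]) (use a b \<epsilon>1 ab int\<phi> in auto)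
      finally show ?thesis by (simp add: add.assoc)
    qed
    have I\<psi>: "integral {-\<epsilon>1..\<epsilon>1} (?\<psi> N) = of_real A0 * integral {-\<epsilon>1..\<epsilon>1} (?g N)"
    proof -
      let ?o = "\<lambda>t. ?g N t * (of_real (A1 * t) + of_real (A0 * N * d * t ^ 3) * \<mu>)"
      have io: "?o integrable_on {-\<epsilon>1..\<epsilon>1}" by (intro integrable_continuous_interval continuous_intros)
      have ig: "(\<lambda>t. of_real A0 * ?g N t) integrable_on {-\<epsilon>1..\<epsilon>1}"
          by (intro integrable_continuous_interval continuous_intros)
      have "integral {-\<epsilon>1..\<epsilon>1} ?o = integral {-\<epsilon>1..\<epsilon>1} (\<lambda>t. ?o (- t))"
        using Henstock_Kurzweil_Integration.integral_reflect_real[of \<epsilon>1 "-\<epsilon>1" ?o] by simp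
      also have "\<dots> = integral {-\<epsilon>1..\<epsilon>1} (\<lambda>t. - ?o t)"
        by (rule integral_cong) (simp add: algebra_simps)
      also have "\<dots> = - integral {-\<epsilon>1..\<epsilon>1} ?o" by (rule integral_neg)
      finally have o0: "integral {-\<epsilon>1..\<epsilon>1} ?o = 0" by (simp add: eq_neg_iff_add_eq_0)
      have "integral {-\<epsilon>1..\<epsilon>1} (?\<psi> N) = integral {-\<epsilon>1..\<epsilon>1} (\<lambda>t. of_real A0 * ?g N t + ?o t)"
        by (rule integral_cong) (simp add: algebra_simps)
      also have "\<dots> = integral {-\<epsilon>1..\<epsilon>1} (\<lambda>t. of_real A0 * ?g N t) + integral {-\<epsilon>1..\<epsilon>1} ?o"
        by (rule integral_add[OF ig io])
      finally show ?thesis unfolding o0 by simp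
    qed
    have central: "norm (integral {-\<epsilon>1..\<epsilon>1} (?\<phi> N) - integral {-\<epsilon>1..\<epsilon>1} (?\<psi> N)) \<le> K * (4 / (N * sqrt N))"
    proof -
      have i1: "?\<phi> N integrable_on {-\<epsilon>1..\<epsilon>1}" by (rule int\<phi>) (use \<epsilon>1 ab in auto)
      have i2: "?\<psi> N integrable_on {-\<epsilon>1..\<epsilon>1}" by (intro integrable_continuous_interval continuous_intros)
      have "norm (integral {-\<epsilon>1..\<epsilon>1} (\<lambda>t. ?\<phi> N t - ?\<psi> N t)) \<le> integral {-\<epsilon>1..\<epsilon>1} (\<lambda>t. K * (t\<^sup>2 / (1 + N * t\<^sup>2)\<^sup>2))"
      proof (rule integral_norm_bound_integral)
        show "(\<lambda>t. ?\<phi> N t - ?\<psi> N t) integrable_on {-\<epsilon>1..\<epsilon>1}" by (rule integrable_diff[OF i1 i2])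
        show "(\<lambda>t. K * (t\<^sup>2 / (1 + N * t\<^sup>2)\<^sup>2)) integrable_on {-\<epsilon>1..\<epsilon>1}"
          using integral_lorentz_square_le(1)[OF N \<epsilon>1(1)] by (rule integrable_on_mult_right)
        show "norm (?\<phi> N t - ?\<psi> N t) \<le> K * (t\<^sup>2 / (1 + N * t\<^sup>2)\<^sup>2)" if "t \<in> {-\<epsilon>1..\<epsilon>1}" for t
          by (rule K) (use that N in auto)
      qed
      also have "\<dots> = K * integral {-\<epsilon>1..\<epsilon>1} (\<lambda>t. t\<^sup>2 / (1 + N * t\<^sup>2)\<^sup>2)" by (rule integral_mult_right)
      also have "\<dots> \<le> K * (4 / (N * sqrt N))"
        using integral_lorentz_square_le(2)[OF N \<epsilon>1(1)] K0 by (intro mult_left_mono)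
      finally show ?thesis unfolding integral_diff[OF i1 i2] .
    qed
    let ?G = "csqrt (of_real pi / (of_real N * (\<mu> * of_real (c / 2))))"
    have "integral {a..b} (?\<phi> N) - of_real A0 * ?G = integral {a..-\<epsilon>1} (?\<phi> N) + (integral {-\<epsilon>1..\<epsilon>1} (?\<phi> N)
        - integral {-\<epsilon>1..\<epsilon>1} (?\<psi> N))
        + of_real A0 * (integral {-\<epsilon>1..\<epsilon>1} (?g N) - ?G) + integral {\<epsilon>1..b} (?\<phi> N)"
      unfolding split I\<psi> by (simp add: algebra_simps)
    also have "norm \<dots> \<le> Cf / (N * sqrt N) + K * (4 / (N * sqrt N)) + \<bar>A0\<bar> * (Cg / (N * sqrt N)) + Cf / (N * sqrt N)"
    proof -
      have f1: "norm (integral {a..-\<epsilon>1} (?\<phi> N)) \<le> Cf / (N * sqrt N)"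
        by (rule far_bound) (use a b \<epsilon>1 ab in auto)
      have f2: "norm (integral {\<epsilon>1..b} (?\<phi> N)) \<le> Cf / (N * sqrt N)"
        by (rule far_bound) (use a b \<epsilon>1 ab in auto)
      have f3: "norm (of_real A0 * (integral {-\<epsilon>1..\<epsilon>1} (?g N) - ?G)) \<le> \<bar>A0\<bar> * (Cg / (N * sqrt N))"
        unfolding norm_mult norm_of_real using Cg[OF N] by (intro mult_left_mono) auto
      show ?thesis by (rule order_trans[OF norm_triangle_ineq] add_mono f1 f2 f3 central)+
    qed
    also have "\<dots> = (2 * Cf + 4 * K + \<bar>A0\<bar> * Cg) / (N * sqrt N)" by (simp add: add_divide_distrib)
    finally show "norm (integral {a..b} (?\<phi> N) - of_real A0 * ?G) \<le> (2 * Cf + 4 * K + \<bar>A0\<bar> * Cg) / (N * sqrt N)" .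
  qed
qed

text \<open>The case of a real parameter and amplitude 1. It bounds the integral of the modulus,
  which converts a relative error O(1/N) of an integrand into an absolute error of order
  N^(-3/2).\<close>

corollary laplace_upper_bound:
  fixes E :: "real \<Rightarrow> real" and a0 a1 b0 b1 c d \<epsilon> B m :: real
  assumes m: "m > 0" and c: "c > 0" and \<epsilon>: "\<epsilon> > 0" and B: "B \<ge> 0"
    and ab: "a0 \<le> a1" "a1 < 0" "0 < b1" "b1 \<le> b0"
    and cont: "continuous_on {a0..b0} E"
    and tE: "\<And>t. \<bar>t\<bar> \<le> \<epsilon> \<Longrightarrow> \<bar>E t + c / 2 * t\<^sup>2 - d * t ^ 3\<bar> \<le> B * t ^ 4"
    and far: "\<And>\<delta>. \<delta> > 0 \<Longrightarrow> \<exists>\<kappa>>0. \<forall>t\<in>{a0..b0}. \<bar>t\<bar> \<ge> \<delta> \<longrightarrow> E t \<le> -\<kappa>"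
  shows "\<exists>C. \<forall>N\<ge>1. \<forall>a\<in>{a0..a1}. \<forall>b\<in>{b1..b0}. integral {a..b} (\<lambda>t. exp (N * m * E t)) \<le> C / sqrt N"
proof -
  have "\<exists>C. \<forall>N\<ge>1. \<forall>a\<in>{a0..a1}. \<forall>b\<in>{b1..b0}.
     norm (integral {a..b} (\<lambda>t. of_real 1 * exp (of_real N * of_real m * of_real (E t)))
         - of_real 1 * csqrt (of_real pi / (of_real N * (of_real m * of_real (c / 2))))) \<le> C / (N * sqrt N)"
    by (rule laplace_asymptotic[where A = "\<lambda>_. 1" and ?A1.0 = 0, OF _ c \<epsilon> B ab cont _ tE _ far]) (use m B in auto)
  then obtain C where C: "\<And>N a b. N \<ge> 1 \<Longrightarrow> a \<in> {a0..a1} \<Longrightarrow> b \<in> {b1..b0} \<Longrightarrow>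
     norm (integral {a..b} (\<lambda>t. of_real 1 * exp (of_real N * of_real m * of_real (E t)))
         - of_real 1 * csqrt (of_real pi / (of_real N * (of_real m * of_real (c / 2))))) \<le> C / (N * sqrt N)" by blast
  show ?thesis
  proof (intro exI allI impI ballI)
    fix N a b :: real assume N: "N \<ge> 1" and a: "a \<in> {a0..a1}" and b: "b \<in> {b1..b0}"
    have int: "(\<lambda>t. exp (N * m * E t)) integrable_on {a..b}"
      by (intro integrable_continuous_interval continuous_intros continuous_on_subset[OF cont]) (use a b in auto)
    have "integral {a..b} (\<lambda>t. of_real 1 * exp (of_real N * of_real m * of_real (E t)))
       = integral {a..b} (\<lambda>t. complex_of_real (exp (N * m * E t)))"
      by (rule integral_cong) (simp flip: exp_of_real)
    also have "\<dots> = of_real (integral {a..b} (\<lambda>t. exp (N * m * E t)))"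
      using has_integral_of_real[OF integrable_integral[OF int]] by (rule integral_unique)
    finally have eq: "integral {a..b} (\<lambda>t. of_real 1 * exp (of_real N * of_real m * of_real (E t)))
        = complex_of_real (integral {a..b} (\<lambda>t. exp (N * m * E t)))" .
    have cs: "csqrt (of_real pi / (of_real N * (of_real m * of_real (c / 2))))
        = of_real (sqrt (pi / (m * (c / 2))) / sqrt N)"
    proof -
      have "csqrt (of_real (pi / (N * (m * (c / 2))))) = of_real (sqrt (pi / (N * (m * (c / 2)))))"
        using N m c csqrt_of_real_nonneg[of "of_real (pi / (N * (m * (c / 2))))"] by simp
      also have "sqrt (pi / (N * (m * (c / 2)))) = sqrt (pi / (m * (c / 2))) / sqrt N"
        by (simp add: real_sqrt_divide real_sqrt_mult)
      finally show ?thesis by simp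
    qed
    have "norm (complex_of_real (integral {a..b} (\<lambda>t. exp (N * m * E t)) - sqrt (pi / (m * (c / 2))) / sqrt N))
        \<le> C / (N * sqrt N)"
      using C[OF N a b] unfolding eq cs by simp
    hence 1: "\<bar>integral {a..b} (\<lambda>t. exp (N * m * E t)) - sqrt (pi / (m * (c / 2))) / sqrt N\<bar> \<le> C / (N * sqrt N)"
      unfolding norm_of_real .
    have "C / (N * sqrt N) \<le> \<bar>C\<bar> / sqrt N"
      using N by (intro frac_le) (auto simp: mult_le_cancel_right1)
    with 1 show "integral {a..b} (\<lambda>t. exp (N * m * E t)) \<le> (sqrt (pi / (m * (c / 2))) + \<bar>C\<bar>) / sqrt N"
      by (simp add: add_divide_distrib)
  qed
qed

section \<open>An approximate solution of a difference equation\<close>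

text \<open>
  When \<open>Z\<close> moves by \<open>h\<close>, the path of integration below is in effect shifted by \<open>h\<close> and crosses the pole
  \<open>w = h\<close> of the kernel, whose residue contributes \<open>h * g (Z + h)\<close>. The kernel tends to \<open>0\<close> on the right
  and to \<open>- 1\<close> on the left, where the first summand compensates it.
\<close>

definition lattice_kernel :: "complex \<Rightarrow> complex \<Rightarrow> complex" where
  "lattice_kernel h w = 1 / (exp (2 * of_real pi * \<i> * w / h) - 1)"

definition sum_primitive :: "(complex \<Rightarrow> complex) \<Rightarrow> (complex \<Rightarrow> complex) \<Rightarrow> complex \<Rightarrow> real \<Rightarrow> complex \<Rightarrow> complex" where
  "sum_primitive F g h R Z = F (Z + h / 2 - of_real R)
     - contour_integral (linepath (h / 2 - of_real R) (h / 2 + of_real R)) (\<lambda>w. g (Z + w) * lattice_kernel h w)"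

lemma lattice_kernel_periodic: "h \<noteq> 0 \<Longrightarrow> lattice_kernel h (w + h) = lattice_kernel h w"
  by (simp add: lattice_kernel_def add_divide_distrib distrib_left exp_add)

text \<open>Since 2 pi i / h = a (1 + i \<kappa>), the modulus of the exponential depends only on Re
  w - \<kappa> Im w, a multiple of the signed distance to the line through the lattice. The kernel
  is thus close to 0 to the right of this line and close to -1 to its left.\<close>

lemma lattice_exponent:
  fixes h w :: complex
  assumes "Im h > 0"
  defines "a \<equiv> 2 * pi * Im h / (norm h)\<^sup>2" and "\<kappa> \<equiv> Re h / Im h"
  shows "2 * of_real pi * \<i> * w / h = of_real a * (1 + of_real \<kappa> * \<i>) * w"
    and "norm (exp (2 * of_real pi * \<i> * w / h)) = exp (a * (Re w - \<kappa> * Im w))"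
proof -
  have h0: "h \<noteq> 0" using assms by auto
  have n: "h * cnj h = of_real ((norm h)\<^sup>2)" by (rule complex_norm_square[symmetric])
  have "of_real a * (1 + of_real \<kappa> * \<i>) = 2 * of_real pi * (of_real (Im h) + of_real (Re h) * \<i>) / of_real ((norm h)\<^sup>2)"
  proof -
    have "of_real (Im h) * (1 + of_real \<kappa> * \<i>) = of_real (Im h) + of_real (Re h) * \<i>"
      using assms(1) by (simp add: \<kappa>_def complex_eq_iff)
    moreover have "complex_of_real a * (1 + of_real \<kappa> * \<i>)
        = 2 * of_real pi * (of_real (Im h) * (1 + of_real \<kappa> * \<i>)) / of_real ((norm h)\<^sup>2)"
      by (simp add: a_def)
    ultimately show ?thesis by simp
  qed
  also have "of_real (Im h) + of_real (Re h) * \<i> = \<i> * cnj h" by (simp add: complex_eq_iff)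
  also have "2 * of_real pi * (\<i> * cnj h) / of_real ((norm h)\<^sup>2) = 2 * of_real pi * \<i> / h"
    using h0 unfolding n[symmetric] by (simp add: field_simps)
  finally show 1: "2 * of_real pi * \<i> * w / h = of_real a * (1 + of_real \<kappa> * \<i>) * w" by simp
  show "norm (exp (2 * of_real pi * \<i> * w / h)) = exp (a * (Re w - \<kappa> * Im w))"
    unfolding 1 norm_exp_eq_Re by (simp add: algebra_simps)
qed

text \<open>Half a lattice step contributes the factor exp (pi i) = -1, so on the horizontal line
  through h / 2 the kernel is the negative of a Fermi function with complex slope. Its denominator
  is bounded below by \<open>norm_one_plus_exp_ge\<close>.\<close>

lemma lattice_kernel_centre:
  fixes h :: complex and x :: real
  assumes "Im h > 0"
  defines "a \<equiv> 2 * pi * Im h / (norm h)\<^sup>2" and "\<kappa> \<equiv> Re h / Im h"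
  shows "lattice_kernel h (h / 2 + of_real x) = - 1 / (1 + exp (of_real (a * x) * (1 + of_real \<kappa> * \<i>)))"
proof -
  have h0: "h \<noteq> 0" using assms by auto
  have "2 * of_real pi * \<i> * (h / 2 + of_real x) / h = of_real pi * \<i> + 2 * of_real pi * \<i> * of_real x / h"
    using h0 by (simp add: add_divide_distrib distrib_left)
  hence "exp (2 * of_real pi * \<i> * (h / 2 + of_real x) / h)
      = exp (of_real pi * \<i>) * exp (2 * of_real pi * \<i> * of_real x / h)"
    by (simp only: exp_add)
  also have "\<dots> = - exp (of_real (a * x) * (1 + of_real \<kappa> * \<i>))"
    unfolding lattice_exponent(1)[OF assms(1)] by (simp add: a_def \<kappa>_def mult_ac)
  finally have e: "exp (2 * of_real pi * \<i> * (h / 2 + of_real x) / h) = - exp (of_real (a * x) * (1 + of_real \<kappa> * \<i>))" .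
  show ?thesis unfolding lattice_kernel_def e
    by (metis (no_types, opaque_lifting) add.commute add_uminus_conv_diff minus_add_distrib minus_divide_right
        minus_divide_left)
qed

lemma lattice_denominator_nonzero:
  fixes h w :: complex
  assumes "Im h > 0" "\<And>k::int. Im w \<noteq> of_int k * Im h"
  shows "exp (2 * of_real pi * \<i> * w / h) - 1 \<noteq> 0"
proof
  assume "exp (2 * of_real pi * \<i> * w / h) - 1 = 0"
  moreover have "h \<noteq> 0" using assms(1) by auto
  ultimately obtain k :: int where "w = of_int k * h" using exp_lattice_eq_1_iff[of h w] by auto
  thus False using assms(2)[of k] by simp
qed

lemma half_integer_not_multiple:
  fixes y :: real assumes "y > 0" shows "y / 2 \<noteq> of_int k * y" "3 * y / 2 \<noteq> of_int k * y"
proof -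
  have "2 * k \<noteq> 1" "2 * k \<noteq> 3" by presburger+
  hence "real_of_int (2 * k) \<noteq> real_of_int 1" "real_of_int (2 * k) \<noteq> real_of_int 3" by (metis of_int_eq_iff)+
  thus "y / 2 \<noteq> of_int k * y" "3 * y / 2 \<noteq> of_int k * y" using assms by (auto simp: field_simps)
qed

text \<open>X \<ge> 1 gives exp X \<ge> 2, so the summand -1 in the denominator costs at most a
  factor 2.\<close>

lemma norm_lattice_kernel_far:
  fixes h w :: complex and X :: real
  assumes h: "Im h > 0" and X: "X \<ge> 1"
  defines "a \<equiv> 2 * pi * Im h / (norm h)\<^sup>2" and "\<kappa> \<equiv> Re h / Im h"
  shows "a * (Re w - \<kappa> * Im w) \<ge> X \<Longrightarrow> norm (lattice_kernel h w) \<le> 2 * exp (- X)"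
    and "a * (Re w - \<kappa> * Im w) \<le> - X \<Longrightarrow> norm (lattice_kernel h w + 1) \<le> 2 * exp (- X)"
    and "\<bar>a * (Re w - \<kappa> * Im w)\<bar> \<ge> X \<Longrightarrow> exp (2 * of_real pi * \<i> * w / h) - 1 \<noteq> 0"
proof -
  define e where "e = exp (2 * of_real pi * \<i> * w / h)"
  have ne: "norm e = exp (a * (Re w - \<kappa> * Im w))"
    unfolding e_def a_def \<kappa>_def by (rule lattice_exponent(2)[OF h])
  have eX: "exp X \<ge> 2" using exp_ge_add_one_self[of X] X by linarith
  have emX: "exp (- X) \<le> 1 / 2" using eX by (simp add: exp_minus field_simps)
  { assume "a * (Re w - \<kappa> * Im w) \<ge> X"
    hence "norm e \<ge> exp X" by (simp add: ne)
    moreover have "norm e \<le> norm (e - 1) + 1" using norm_triangle_ineq[of "e - 1" 1] by simp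
    ultimately have 1: "norm (e - 1) \<ge> exp X / 2" using eX by linarith
    hence "1 / norm (e - 1) \<le> 1 / (exp X / 2)" by (intro divide_left_mono) (auto intro!: mult_pos_pos less_le_trans[OF
        _ 1])
    thus "norm (lattice_kernel h w) \<le> 2 * exp (- X)"
      unfolding lattice_kernel_def e_def[symmetric] by (simp add: norm_divide exp_minus divide_simps) 
  } note a1 = this
  { assume "a * (Re w - \<kappa> * Im w) \<le> - X"
    hence n2: "norm e \<le> exp (- X)" by (simp add: ne)
    moreover have "1 \<le> norm (e - 1) + norm e" using norm_triangle_ineq4[of e "e - 1"] by simp
    ultimately have 1: "norm (e - 1) \<ge> 1 / 2" using emX by linarith
    hence e1: "e - 1 \<noteq> 0" by auto
    have "lattice_kernel h w + 1 = e / (e - 1)"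
      using e1 unfolding lattice_kernel_def e_def[symmetric] by (simp add: field_simps)
    hence "norm (lattice_kernel h w + 1) = norm e / norm (e - 1)" by (simp add: norm_divide)
    also have "\<dots> \<le> exp (- X) / (1 / 2)" using 1 n2 by (intro frac_le) auto
    finally show "norm (lattice_kernel h w + 1) \<le> 2 * exp (- X)" by simp
  }
  assume ab: "\<bar>a * (Re w - \<kappa> * Im w)\<bar> \<ge> X"
  have "norm e \<noteq> 1" unfolding ne using ab X by auto
  hence "e \<noteq> 1" by auto
  thus "exp (2 * of_real pi * \<i> * w / h) - 1 \<noteq> 0" by (simp add: e_def)
qed

lemma has_field_derivative_shift_left:
  fixes f :: "complex \<Rightarrow> complex"
  assumes "(f has_field_derivative D) (at (Z + w))"
  shows "((\<lambda>w. f (Z + w)) has_field_derivative D) (at w)"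
proof -
  have "((\<lambda>w. Z + w) has_field_derivative 1) (at w)" by (auto intro!: derivative_eq_intros)
  from DERIV_chain2[OF assms this] show ?thesis by simp
qed

lemma has_integral_mult_exp_minus:
  fixes b :: real
  assumes b: "b > 0"
  shows "((\<lambda>s. s * exp (- (b * s))) has_integral ((1 - (1 + b) * exp (- b)) / b\<^sup>2)) {0..1}"
proof -
  define Q where "Q = (\<lambda>s. (- ((1 + b * s) * exp (- (b * s)))) / b\<^sup>2)"
  have "((\<lambda>s. s * exp (- (b * s))) has_integral (Q 1 - Q 0)) {0..1}"
  proof (rule fundamental_theorem_of_calculus)
    fix s :: real
    have "(Q has_real_derivative (- (b * exp (- (b * s)) + (1 + b * s) * (exp (- (b * s)) * (- b)))) / b\<^sup>2) (at s)"
      unfolding Q_def by (intro DERIV_cdivide) (auto intro!: derivative_eq_intros)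
    also have "(- (b * exp (- (b * s)) + (1 + b * s) * (exp (- (b * s)) * (- b)))) / b\<^sup>2 = s * exp (- (b * s))"
      using b by (simp add: power2_eq_square field_simps)
    finally show "(Q has_vector_derivative s * exp (- (b * s))) (at s within {0..1})"
      by (simp add: has_real_derivative_iff_has_vector_derivative has_vector_derivative_at_within)
  qed auto
  moreover have "Q 1 - Q 0 = (1 - (1 + b) * exp (- b)) / b\<^sup>2"
    by (simp add: Q_def diff_divide_distrib)
  ultimately show ?thesis by simp
qed

text \<open>The condition \<open>2 * Re h \<le> Im h\<close> says \<kappa> \<le> 1/2, as the lower
  bound for 1 + exp requires. For h = \<xi> / N it holds because u < 1 and c \<ge> 2 pi.\<close>

locale sum_primitive_strip =
  fixes F g :: "complex \<Rightarrow> complex" and \<alpha> \<beta> :: real and h :: complex and R :: real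
  assumes F: "\<And>Z. \<alpha> < Im Z \<Longrightarrow> Im Z < \<beta> \<Longrightarrow> (F has_field_derivative g Z) (at Z)"
    and h: "Im h > 0" "Re h \<ge> 0" "2 * Re h \<le> Im h" "2 * Re h < R"
begin

definition "a = 2 * pi * Im h / (norm h)\<^sup>2"
definition "\<kappa> = Re h / Im h"

lemma h0: "h \<noteq> 0" using h by auto
lemma \<kappa>: "0 \<le> \<kappa>" "\<kappa> \<le> 1 / 2" using h by (auto simp: \<kappa>_def field_simps)
lemma a_pos: "a > 0" using h h0 by (simp add: a_def)
lemma R_pos: "R > 0" using h by linarith

lemma open_strip: "open {Z. \<alpha> < Im Z \<and> Im Z < \<beta>}"
  by (intro open_Collect_conj open_halfspace_Im_gt open_halfspace_Im_lt)

lemma g_holo: "g holomorphic_on {Z. \<alpha> < Im Z \<and> Im Z < \<beta>}"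
proof -
  have "deriv F holomorphic_on {Z. \<alpha> < Im Z \<and> Im Z < \<beta>}"
    by (intro holomorphic_deriv open_strip) (use F in \<open>auto simp: holomorphic_on_open[OF open_strip]\<close>)
  thus ?thesis by (rule holomorphic_transform) (use F DERIV_imp_deriv in auto)
qed

lemma g_cont: "T \<subseteq> {Z. \<alpha> < Im Z \<and> Im Z < \<beta>} \<Longrightarrow> continuous_on T g"
  using g_holo holomorphic_on_imp_continuous_on continuous_on_subset by blast

lemma g_shift_cont:
  assumes "\<And>w. w \<in> T \<Longrightarrow> \<alpha> < Im Z + Im w \<and> Im Z + Im w < \<beta>"
  shows "continuous_on T (\<lambda>w. g (Z + w))"
proof -
  have "continuous_on T (g \<circ> (\<lambda>w. Z + w))"
    by (intro continuous_on_compose continuous_intros g_cont) (use assms in auto)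
  thus ?thesis by (simp add: o_def)
qed

lemma kernel_cont:
  assumes "\<And>w. w \<in> T \<Longrightarrow> exp (2 * of_real pi * \<i> * w / h) - 1 \<noteq> 0"
  shows "continuous_on T (lattice_kernel h)"
  unfolding lattice_kernel_def by (intro continuous_intros) (use assms h0 in auto)

text \<open>By periodicity of the kernel, replacing Z by Z + h moves the path from p1, p2 to q1, q2
  without changing the integrand. The rectangle p1, p2, r2, r1 encloses the single pole w = h, and
  r1, r2 lie on the line through q1, q2. What remains are four segments at the two ends, each of
  length at most |h|, on which the kernel, or on the left the kernel plus 1, is at most 2 exp (-X).
  This is the origin of the factor 8.\<close>

lemma sum_primitive_step:
  fixes Z :: complex and M :: real
  defines "X \<equiv> a * (R - 3 / 2 * Re h)"
  assumes Z: "\<alpha> < Im Z + Im h / 2" "Im Z + 3 / 2 * Im h < \<beta>" and X1: "X \<ge> 1"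
    and M: "\<And>W. Im Z + Im h / 2 \<le> Im W \<Longrightarrow> Im W \<le> Im Z + 3 / 2 * Im h \<Longrightarrow> \<bar>Re W - Re Z\<bar> \<le> R + 2 * Re h \<Longrightarrow> norm (g W) \<le> M"
  shows "norm (sum_primitive F g h R (Z + h) - sum_primitive F g h R Z - h * g (Z + h)) \<le> 8 * M * norm h * exp (- X)"
proof -
  define p1 p2 r1 r2 q1 q2 where "p1 = h / 2 - of_real R" and "p2 = h / 2 + of_real R"
    and "r1 = p1 + of_real (Im h) * \<i>" and "r2 = p2 + of_real (Im h) * \<i>" and "q1 = p1 + h" and "q2 = p2 + h"
  note defs = p1_def p2_def r1_def r2_def q1_def q2_def
  define ff where "ff = (\<lambda>w. g (Z + w) * lattice_kernel h w)"
  define I where "I = (\<lambda>x y. contour_integral (linepath x y) ff)"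
  define T where "T = {w. Im h / 2 \<le> Im w \<and> Im w \<le> 3 / 2 * Im h}"
  \<comment> \<open>The part of the strip on which the denominator of the kernel is known not to
    vanish: the two half-integral heights and everything far from the lattice line.\<close>
  define T' where "T' = {w \<in> T. Im w = Im h / 2 \<or> Im w = 3 / 2 * Im h \<or> \<bar>a * (Re w - \<kappa> * Im w)\<bar> \<ge> X}"
  have M0: "M \<ge> 0" using M[of "Z + h"] h R_pos norm_ge_zero order_trans[OF norm_ge_zero] by force
  have nz: "exp (2 * of_real pi * \<i> * w / h) - 1 \<noteq> 0" if "w \<in> T'" for w
  proof (cases "\<bar>a * (Re w - \<kappa> * Im w)\<bar> \<ge> X")
    case True
    thus ?thesis using norm_lattice_kernel_far(3)[OF h(1) X1, of w] by (simp add: a_def \<kappa>_def)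
  next
    case False
    thus ?thesis using that half_integer_not_multiple[OF h(1)]
      by (intro lattice_denominator_nonzero h) (auto simp: T'_def)
  qed
  have gc: "continuous_on U (\<lambda>w. g (Z + w))" if "U \<subseteq> T" for U
    by (rule g_shift_cont) (use that Z in \<open>force simp: T_def\<close>)
  have ffc: "continuous_on U ff" if "U \<subseteq> T'" for U
    unfolding ff_def by (intro continuous_on_mult gc kernel_cont nz) (use that in \<open>auto simp: T'_def\<close>)
  have "T = {w. Im h / 2 \<le> Im w} \<inter> {w. Im w \<le> 3 / 2 * Im h}" by (auto simp: T_def)
  hence convT: "convex T" by (metis convex_Int convex_halfspace_Im_ge convex_halfspace_Im_le)
  have pT: "p1 \<in> T" "p2 \<in> T" "r1 \<in> T" "r2 \<in> T" "q1 \<in> T" "q2 \<in> T"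
    using h by (auto simp: T_def defs)
  have aX: "a * x \<ge> X" if "x \<ge> R - 3 / 2 * Re h" for x unfolding X_def using that a_pos by (intro mult_left_mono) auto
  have \<kappa>h: "\<kappa> * Im h = Re h" using h by (simp add: \<kappa>_def)
  \<comment> \<open>In \<open>T\<close> the lattice line has real part between 0 and 3/2 Re h. With
    these margins every point of \<open>rt\<close> and \<open>lt\<close> is at horizontal distance
    at least R - 3/2 Re h from it, which explains X; the margin on the left is as wide as needed to
    contain q1.\<close>
  define rt where "rt = {w \<in> T. Re w \<ge> R}"
  define lt where "lt = {w \<in> T. Re w \<le> - R + 3 / 2 * Re h}"
  have \<kappa>T: "0 \<le> \<kappa> * Im w" "\<kappa> * Im w \<le> 3 / 2 * Re h" if "w \<in> T" for w
  proof -
    show "0 \<le> \<kappa> * Im w" using that h \<kappa> by (auto simp: T_def)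
    have "\<kappa> * Im w \<le> \<kappa> * (3 / 2 * Im h)" using that \<kappa> by (intro mult_left_mono) (auto simp: T_def)
    thus "\<kappa> * Im w \<le> 3 / 2 * Re h" using \<kappa>h by simp
  qed
  have rtX: "a * (Re w - \<kappa> * Im w) \<ge> X" if "w \<in> rt" for w
    using that \<kappa>T[of w] by (intro aX) (auto simp: rt_def)
  have ltX: "a * (Re w - \<kappa> * Im w) \<le> - X" if "w \<in> lt" for w
  proof -
    have "a * (- (Re w - \<kappa> * Im w)) \<ge> X" using that \<kappa>T[of w] by (intro aX) (auto simp: lt_def)
    thus ?thesis by (simp only: mult_minus_right)
  qed
  have rtT': "rt \<subseteq> T'" using rtX by (force simp: T'_def rt_def)
  have ltT': "lt \<subseteq> T'" using ltX by (force simp: T'_def lt_def)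
  have "convex {w. Re w \<ge> R}" "convex {w. Re w \<le> - R + 3 / 2 * Re h}"
    by (rule convex_halfspace_Re_ge, rule convex_halfspace_Re_le)
  moreover have "rt = T \<inter> {w. Re w \<ge> R}" "lt = T \<inter> {w. Re w \<le> - R + 3 / 2 * Re h}"
    by (auto simp: rt_def lt_def)
  ultimately have crt: "convex rt" and clt: "convex lt" using convT by (simp_all only: convex_Int)
  have mrt: "p2 \<in> rt" "r2 \<in> rt" "q2 \<in> rt" using pT h by (auto simp: rt_def defs)
  have mlt: "p1 \<in> lt" "r1 \<in> lt" "q1 \<in> lt" using pT h by (auto simp: lt_def defs)
  have seg_rt: "closed_segment x y \<subseteq> rt" if "x \<in> rt" "y \<in> rt" for x y using closed_segment_subset[OF that crt] .
  have seg_lt: "closed_segment x y \<subseteq> lt" if "x \<in> lt" "y \<in> lt" for x y using closed_segment_subset[OF that clt] .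
  have seg_hor: "closed_segment x y \<subseteq> T'" if "x \<in> T" "y \<in> T" "Im x = Im y" "Im x = Im h / 2 \<or> Im x = 3 / 2 * Im h"
      for x y
  proof
    fix w assume w: "w \<in> closed_segment x y"
    hence "w \<in> T" using closed_segment_subset[OF that(1,2) convT] by blast
    moreover from w obtain v where "w = (1 - v) *\<^sub>R x + v *\<^sub>R y" by (auto simp: in_segment)
    hence "Im w = (1 - v) * Im x + v * Im y" by simp
    hence "Im w = Im x" using that(3) by (simp add: algebra_simps)
    ultimately show "w \<in> T'" using that(4) by (auto simp: T'_def)
  qed
  have hq: "Im q1 = 3 / 2 * Im h" "Im q2 = 3 / 2 * Im h" "Im r1 = 3 / 2 * Im h" "Im r2 = 3 / 2 * Im h"
    "Im p1 = Im h / 2" "Im p2 = Im h / 2" by (simp_all add: defs)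
  have hor_seg: "w \<in> closed_segment x y" if "Im x = Im w" "Im y = Im w" "Re x \<le> Re w" "Re w \<le> Re y" for x y w :: complex
    using that by (simp add: closed_segment_same_Im closed_segment_eq_real_ivl)
  have shift: "sum_primitive F g h R (Z + h) = F (Z + q1) - I q1 q2"
  proof -
    have "I q1 q2 = contour_integral (linepath p1 p2) (\<lambda>w. g (Z + h + w) * lattice_kernel h w)"
    proof -
      have "linepath q1 q2 x = linepath p1 p2 x + h" for x
        by (simp add: linepath_def defs field_simps scaleR_conv_of_real)
      moreover have "q2 - q1 = p2 - p1" by (simp add: defs)
      moreover have "Z + (linepath p1 p2 x + h) = Z + h + linepath p1 p2 x" for x by simp
      ultimately show ?thesis
        unfolding I_def contour_integral_integral ff_def
        by (simp only: vector_derivative_linepath_at lattice_kernel_periodic[OF h0])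
    qed
    thus ?thesis by (simp add: sum_primitive_def defs algebra_simps)
  qed
  have noshift: "sum_primitive F g h R Z = F (Z + p1) - I p1 p2"
    by (simp add: sum_primitive_def I_def ff_def p1_def p2_def algebra_simps)
  have rect: "h * g (Z + h) = I p1 p2 + I p2 r2 + I r2 r1 + I r1 p1"
  proof -
    \<comment> \<open>Heights between 0 and 2 Im h, so that h is the only lattice point in
      \<open>U\<close>.\<close>
    define U where "U = {w. 0 < Im w \<and> Im w < 2 * Im h \<and> \<alpha> < Im Z + Im w \<and> Im Z + Im w < \<beta>}"
    have U_eq: "U = {w. max 0 (\<alpha> - Im Z) < Im w} \<inter> {w. Im w < min (2 * Im h) (\<beta> - Im Z)}"
      by (auto simp: U_def)
    have "contour_integral (rectpath p1 r2) (\<lambda>w. g (Z + w) / (exp (2 * of_real pi * \<i> * w / h) - 1))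
        = h * (\<Sum>k\<in>{1::int}. g (Z + of_int k * h))"
    proof (rule contour_integral_rectpath_lattice[OF h0])
      show "open U" unfolding U_eq by (intro open_Int open_halfspace_Im_gt open_halfspace_Im_lt)
      show "convex U" unfolding U_eq by (intro convex_Int convex_halfspace_Im_gt convex_halfspace_Im_lt)
      have "g \<circ> (\<lambda>w. Z + w) holomorphic_on U"
        by (intro holomorphic_on_compose_gen[OF _ g_holo] holomorphic_intros) (auto simp: U_def)
      thus "(\<lambda>w. g (Z + w)) holomorphic_on U" by (simp add: o_def)
      show "cbox p1 r2 \<subseteq> U" using Z h by (auto simp: in_cbox_complex_iff U_def hq)
      show "Re p1 < Re r2" "Im p1 < Im r2" using h R_pos by (auto simp: defs)
      show "of_int k * h \<in> box p1 r2" if "k \<in> {1}" for k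
        using that h by (auto simp: in_box_complex_iff defs)
      show "k \<in> {1}" if "of_int k * h \<in> U" for k
      proof -
        have "0 * Im h < of_int k * Im h" "of_int k * Im h < 2 * Im h" using that by (auto simp: U_def)
        hence "(0::real) < of_int k" "of_int k < (2::real)" using h(1) by (auto simp only: mult_less_cancel_right)
        thus ?thesis by auto
      qed
    qed auto
    also have "rectpath p1 r2 = linepath p1 p2 +++ linepath p2 r2 +++ linepath r2 r1 +++ linepath r1 p1"
    proof -
      have "Complex (Re r2) (Im p1) = p2" "Complex (Re p1) (Im r2) = r1"
        by (simp_all add: defs complex_eq_iff)
      thus ?thesis by (simp only: rectpath_def Let_def)
    qed
    also have "(\<lambda>w. g (Z + w) / (exp (2 * of_real pi * \<i> * w / h) - 1)) = ff"
      by (simp add: ff_def lattice_kernel_def)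
    finally have e: "contour_integral (linepath p1 p2 +++ linepath p2 r2 +++ linepath r2 r1 +++ linepath r1 p1) ff
        = h * g (Z + h)" by simp
    have ci: "ff contour_integrable_on linepath p1 p2" "ff contour_integrable_on linepath p2 r2"
      "ff contour_integrable_on linepath r2 r1" "ff contour_integrable_on linepath r1 p1"
    proof -
      show "ff contour_integrable_on linepath p1 p2" "ff contour_integrable_on linepath r2 r1"
        by (intro contour_integrable_continuous_linepath ffc seg_hor; use pT hq in simp)+
      show "ff contour_integrable_on linepath p2 r2"
        by (intro contour_integrable_continuous_linepath ffc order_trans[OF seg_rt[OF mrt(1,2)] rtT'])
      show "ff contour_integrable_on linepath r1 p1"
        by (intro contour_integrable_continuous_linepath ffc order_trans[OF seg_lt[OF mlt(2,1)] ltT'])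
    qed
    have "contour_integral (linepath p1 p2 +++ linepath p2 r2 +++ linepath r2 r1 +++ linepath r1 p1) ff
        = I p1 p2 + (I p2 r2 + (I r2 r1 + I r1 p1))"
      unfolding I_def by (subst contour_integral_join; (use ci in \<open>auto intro!: contour_integrable_joinI
          valid_path_join\<close>)?)+
    thus ?thesis using e by simp
  qed
  have s1: "I r2 r1 = I r2 q1 + I q1 r1"
    unfolding I_def
  proof (rule contour_integral_split_linepath)
    show "continuous_on (closed_segment r2 r1) ff" by (intro ffc seg_hor) (use pT hq in auto)
    show "q1 \<in> closed_segment r2 r1" unfolding closed_segment_commute[of r2 r1]
      by (rule hor_seg) (use hq h in \<open>auto simp: defs\<close>)
  qed
  have s2: "I q2 q1 = I q2 r2 + I r2 q1"
    unfolding I_def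
  proof (rule contour_integral_split_linepath)
    show "continuous_on (closed_segment q2 q1) ff" by (intro ffc seg_hor) (use pT hq in auto)
    show "r2 \<in> closed_segment q2 q1" unfolding closed_segment_commute[of q2 q1]
      by (rule hor_seg) (use hq h in \<open>auto simp: defs\<close>)
  qed
  have s3: "I q2 q1 = - I q1 q2"
    unfolding I_def by (rule contour_integral_reverse_linepath) (intro ffc seg_hor; use pT hq in auto)
  have prim: "I x y + (F (Z + y) - F (Z + x)) = contour_integral (linepath x y) (\<lambda>w. g (Z + w) * (lattice_kernel h w
      + 1))"
    if xy: "x \<in> lt" "y \<in> lt" for x y
  proof -
    have 1: "((\<lambda>w. g (Z + w)) has_contour_integral (F (Z + y) - F (Z + x))) (linepath x y)"
    proof -
      have "((\<lambda>w. g (Z + w)) has_contour_integral ((\<lambda>w. F (Z + w)) (pathfinish (linepath x y)) - (\<lambda>w. F (Z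
          + w)) (pathstart (linepath x y)))) (linepath x y)"
      proof (rule contour_integral_primitive)
        fix w assume "w \<in> closed_segment x y"
        hence "w \<in> T" using seg_lt[OF xy] by (auto simp: lt_def)
        hence "(F has_field_derivative g (Z + w)) (at (Z + w))" using Z by (intro F) (auto simp: T_def)
        hence "((\<lambda>w. F (Z + w)) has_field_derivative g (Z + w)) (at w)" by (rule has_field_derivative_shift_left)
        thus "((\<lambda>w. F (Z + w)) has_field_derivative g (Z + w)) (at w within closed_segment x y)"
          by (rule has_field_derivative_at_within)
      qed auto
      thus ?thesis by simp
    qed
    have 2: "(ff has_contour_integral I x y) (linepath x y)"
      unfolding I_def by (intro has_contour_integral_integral contour_integrable_continuous_linepath ffc)
        (use seg_lt[OF xy] ltT' in blast)
    have "((\<lambda>w. ff w + g (Z + w)) has_contour_integral (I x y + (F (Z + y) - F (Z + x)))) (linepath x y)"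
      by (rule has_contour_integral_add[OF 2 1])
    hence "((\<lambda>w. g (Z + w) * (lattice_kernel h w + 1)) has_contour_integral (I x y + (F (Z + y) - F (Z
        + x)))) (linepath x y)"
      by (simp add: ff_def distrib_left)
    thus ?thesis by (rule contour_integral_unique[symmetric])
  qed
  have gM: "norm (g (Z + w)) \<le> M" if "w \<in> T" "\<bar>Re w\<bar> \<le> R + 2 * Re h" for w
    by (rule M) (use that in \<open>auto simp: T_def\<close>)
  have bR: "norm (I x y) \<le> M * (2 * exp (- X)) * norm (y - x)"
    if xy: "x \<in> rt" "y \<in> rt" "Re x \<le> R + 2 * Re h" "Re y \<le> R + 2 * Re h" for x y
  proof (rule has_contour_integral_bound_linepath)
    show "(ff has_contour_integral I x y) (linepath x y)"
      unfolding I_def by (intro has_contour_integral_integral contour_integrable_continuous_linepath ffc)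
        (use seg_rt[OF xy(1,2)] rtT' in blast)
    fix w assume w: "w \<in> closed_segment x y"
    hence wr: "w \<in> rt" using seg_rt[OF xy(1,2)] by blast
    have "closed_segment x y \<subseteq> {w. Re w \<le> R + 2 * Re h}"
      by (rule closed_segment_subset) (use xy convex_halfspace_Re_le in auto)
    hence "norm (g (Z + w)) \<le> M" using w wr R_pos by (intro gM) (auto simp: rt_def)
    moreover have "norm (lattice_kernel h w) \<le> 2 * exp (- X)"
      using norm_lattice_kernel_far(1)[OF h(1) X1, of w] rtX[OF wr] by (simp add: a_def \<kappa>_def)
    ultimately show "norm (ff w) \<le> M * (2 * exp (- X))"
      unfolding ff_def norm_mult using M0 by (intro mult_mono) auto
  qed (use M0 in auto)
  have bL: "norm (I x y + (F (Z + y) - F (Z + x))) \<le> M * (2 * exp (- X)) * norm (y - x)"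
    if xy: "x \<in> lt" "y \<in> lt" "- R \<le> Re x" "- R \<le> Re y" for x y
    unfolding prim[OF xy(1,2)]
  proof (rule has_contour_integral_bound_linepath)
    show "((\<lambda>w. g (Z + w) * (lattice_kernel h w + 1)) has_contour_integral contour_integral (linepath x y) (\<lambda>w. g (Z
        + w) * (lattice_kernel h w + 1))) (linepath x y)"
      by (intro has_contour_integral_integral contour_integrable_continuous_linepath continuous_on_mult
          continuous_on_add gc kernel_cont nz continuous_intros)
        (use seg_lt[OF xy(1,2)] ltT' T'_def in blast)+
    fix w assume w: "w \<in> closed_segment x y"
    hence wr: "w \<in> lt" using seg_lt[OF xy(1,2)] by blast
    have "closed_segment x y \<subseteq> {w. Re w \<ge> - R}"
      by (rule closed_segment_subset) (use xy convex_halfspace_Re_ge in auto)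
    hence "norm (g (Z + w)) \<le> M" using w wr h by (intro gM) (auto simp: lt_def)
    moreover have "norm (lattice_kernel h w + 1) \<le> 2 * exp (- X)"
      using norm_lattice_kernel_far(2)[OF h(1) X1, of w] ltX[OF wr] by (simp add: a_def \<kappa>_def)
    ultimately show "norm (g (Z + w) * (lattice_kernel h w + 1)) \<le> M * (2 * exp (- X))"
      unfolding norm_mult using M0 by (intro mult_mono) auto
  qed (use M0 in auto)
  have n1: "norm (r2 - p2) \<le> norm h" "norm (r2 - q2) \<le> norm h" "norm (r1 - q1) \<le> norm h" "norm (p1 - r1) \<le> norm h"
    using abs_Im_le_cmod[of h] abs_Re_le_cmod[of h] h
    by (auto simp: defs norm_mult complex_eq_iff cmod_def)
  have "sum_primitive F g h R (Z + h) - sum_primitive F g h R Z - h * g (Z + h)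
     = I q2 r2 - I p2 r2 - (I q1 r1 + (F (Z + r1) - F (Z + q1))) - (I r1 p1 + (F (Z + p1) - F (Z + r1)))"
    unfolding shift noshift rect s1 using s2 s3 by (simp add: algebra_simps)
  also have "norm \<dots> \<le> M * (2 * exp (- X)) * norm h + M * (2 * exp (- X)) * norm h + M * (2 * exp (- X)) * norm h + M
      * (2 * exp (- X)) * norm h"
  proof -
    have c: "norm x \<le> M * (2 * exp (- X)) * norm h" if "norm x \<le> M * (2 * exp (- X)) * norm y" "norm y
        \<le> norm h" for x y :: complex
      by (rule order_trans[OF that(1) mult_left_mono[OF that(2)]]) (use M0 in simp)
    have 1: "norm (I q2 r2) \<le> M * (2 * exp (- X)) * norm h"
      by (rule c[OF bR n1(2)]) (use mrt h in \<open>auto simp: defs\<close>)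
    have 2: "norm (I p2 r2) \<le> M * (2 * exp (- X)) * norm h"
      by (rule c[OF bR n1(1)]) (use mrt h in \<open>auto simp: defs\<close>)
    have 3: "norm (I q1 r1 + (F (Z + r1) - F (Z + q1))) \<le> M * (2 * exp (- X)) * norm h"
      by (rule c[OF bL n1(3)]) (use mlt h in \<open>auto simp: defs\<close>)
    have 4: "norm (I r1 p1 + (F (Z + p1) - F (Z + r1))) \<le> M * (2 * exp (- X)) * norm h"
      by (rule c[OF bL n1(4)]) (use mlt h in \<open>auto simp: defs\<close>)
    show ?thesis by (rule order_trans[OF norm_triangle_ineq4] add_mono 1 2 3 4)+
  qed
  also have "\<dots> = 8 * M * norm h * exp (- X)" by simp
  finally show ?thesis .
qed

text \<open>Around V = Z + h / 2 the kernel has the symmetry n (-x) = 1 - n x. Folding the two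
  halves of the path leaves the odd difference g (V + x) - g (V - x) integrated against n, which
  decays on the scale 1 / a of order |h|; a Lipschitz bound then gives |h|^2. The term h / 2 * g Z
  comes from expanding F V at Z.\<close>

lemma sum_primitive_asymptotic:
  fixes Z :: complex and M :: real
  assumes Z: "\<alpha> < Im Z" "Im Z + Im h / 2 < \<beta>"
    and M: "\<And>W. Im Z \<le> Im W \<Longrightarrow> Im W \<le> Im Z + Im h / 2 \<Longrightarrow> \<bar>Re W - Re Z\<bar> \<le> R + Re h \<Longrightarrow> norm (deriv g W) \<le> M"
  shows "norm (sum_primitive F g h R Z - F Z - h / 2 * g Z) \<le> M * (norm h)\<^sup>2"
proof -
  define V where "V = Z + h / 2"
  define n where "n = (\<lambda>x. 1 / (1 + exp (of_real (a * x) * (1 + of_real \<kappa> * \<i>))))"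
  have M0: "M \<ge> 0" using M[of Z] h R_pos order_trans[OF norm_ge_zero] by force
  have gd: "(g has_field_derivative deriv g W) (at W)" if "\<alpha> < Im W" "Im W < \<beta>" for W
    using g_holo open_strip that holomorphic_derivI by blast
  have one: "1 + exp (of_real x * (1 + of_real \<kappa> * \<i>)) \<noteq> 0" for x :: real
    using norm_one_plus_exp_ge[OF \<kappa>, of x] by (metis max.cobounded1 mult_zero_right norm_zero not_one_le_zero
        order_trans)
  have nneg: "n (- x) = 1 - n x" for x
  proof -
    define e where "e = exp (of_real (a * x) * (1 + of_real \<kappa> * \<i>))"
    have e: "e \<noteq> 0" "1 + e \<noteq> 0" using one[of "a * x"] by (auto simp: e_def)
    have "exp (of_real (a * - x) * (1 + of_real \<kappa> * \<i>)) = inverse e"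
      unfolding e_def exp_minus[symmetric] by simp
    hence "n (- x) = 1 / (1 + inverse e)" by (simp add: n_def)
    also have "\<dots> = 1 - 1 / (1 + e)" using e by (simp add: field_simps)
    finally show ?thesis by (simp add: n_def e_def)
  qed
  have nb: "norm (n x) \<le> 2 * exp (- (a * x))" for x
  proof -
    have "exp (a * x) \<le> 2 * norm (1 + exp (of_real (a * x) * (1 + of_real \<kappa> * \<i>)))"
      using norm_one_plus_exp_ge[OF \<kappa>, of "a * x"] by simp
    hence "1 / norm (1 + exp (of_real (a * x) * (1 + of_real \<kappa> * \<i>))) \<le> 1 / (exp (a * x) / 2)"
      using one[of "a * x"] by (intro divide_left_mono) auto
    thus ?thesis by (simp add: n_def norm_divide exp_minus divide_simps)
  qed
  have ker: "lattice_kernel h (h / 2 + of_real x) = - n x" for x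
    unfolding n_def a_def \<kappa>_def using lattice_kernel_centre[OF h(1), of x] by simp
  define ff where "ff = (\<lambda>w. g (Z + w) * lattice_kernel h w)"
  define L where "L = {w. Im w = Im h / 2}"
  have nz: "exp (2 * of_real pi * \<i> * w / h) - 1 \<noteq> 0" if "w \<in> L" for w
    using that half_integer_not_multiple[OF h(1)] by (intro lattice_denominator_nonzero h) (auto simp: L_def)
  have gc: "continuous_on U (\<lambda>w. g (Z + w))" if "U \<subseteq> L" for U
    by (rule g_shift_cont) (use that Z h in \<open>force simp: L_def\<close>)
  have ffc: "continuous_on U ff" if "U \<subseteq> L" for U
    unfolding ff_def by (intro continuous_on_mult gc kernel_cont nz) (use that in auto)
  have segL: "closed_segment x y \<subseteq> L" if "x \<in> L" "y \<in> L" for x y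
  proof
    fix w assume "w \<in> closed_segment x y"
    then obtain v where "w = (1 - v) *\<^sub>R x + v *\<^sub>R y" by (auto simp: in_segment)
    hence "Im w = (1 - v) * Im x + v * Im y" by simp
    moreover have e: "Im x = Im h / 2" "Im y = Im h / 2" using that by (auto simp: L_def)
    ultimately have "Im w = (1 - v) * (Im h / 2) + v * (Im h / 2)" by simp
    thus "w \<in> L" by (simp add: L_def field_simps)
  qed
  define p1 p2 where "p1 = h / 2 - of_real R" and "p2 = h / 2 + of_real R"
  have pL: "p1 \<in> L" "p2 \<in> L" "h / 2 \<in> L" by (auto simp: L_def p1_def p2_def)
  have split: "contour_integral (linepath p1 p2) ff = contour_integral (linepath p1 (h / 2)) ff
      + contour_integral (linepath (h / 2) p2) ff"
  proof (rule contour_integral_split_linepath)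
    show "continuous_on (closed_segment p1 p2) ff" by (intro ffc segL pL)
    show "h / 2 \<in> closed_segment p1 p2"
      using R_pos by (simp add: p1_def p2_def closed_segment_same_Im closed_segment_eq_real_ivl)
  qed
  define J where "J = (\<lambda>s. of_real R * (n (s * R) * (g (V + of_real (s * R)) - g (V - of_real (s * R)))))"
  have I2: "((\<lambda>s. - (of_real R * (n (s * R) * g (V + of_real (s
      * R))))) has_integral contour_integral (linepath (h / 2) p2) ff) {0..1}"
  proof -
    have "(ff has_contour_integral contour_integral (linepath (h / 2) p2) ff) (linepath (h / 2) p2)"
      by (intro has_contour_integral_integral contour_integrable_continuous_linepath ffc segL pL)
    hence "((\<lambda>s. ff (linepath (h / 2) p2 s) * (p2 - h / 2)) has_integral contour_integral (linepath (h / 2) p2) ff)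
        {0..1}"
      by (simp only: has_contour_integral_linepath)
    moreover have lp: "linepath (h / 2) p2 s = h / 2 + of_real (s * R)" for s
      by (simp add: linepath_def p2_def scaleR_conv_of_real field_simps)
    have "ff (linepath (h / 2) p2 s) * (p2 - h / 2) = - (of_real R * (n (s * R) * g (V + of_real (s * R))))" for s
      unfolding lp ff_def ker by (simp add: p2_def V_def algebra_simps)
    ultimately show ?thesis by simp
  qed
  \<comment> \<open>The left half is reversed so that both halves start at h / 2. The increment of
    \<open>F\<close> adds 1 to the kernel, and 1 - n (-x) = n x gives the same weight as on the
    right.\<close>
  have I1: "((\<lambda>s. of_real R * (n (s * R) * g (V - of_real (s
      * R)))) has_integral (contour_integral (linepath p1 (h / 2)) ff + (F V - F (Z + p1)))) {0..1}"
  proof -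
    have 1: "(ff has_contour_integral contour_integral (linepath p1 (h / 2)) ff) (linepath p1 (h / 2))"
      by (intro has_contour_integral_integral contour_integrable_continuous_linepath ffc segL pL)
    have 2: "((\<lambda>w. g (Z + w)) has_contour_integral ((\<lambda>w. F (Z + w)) (pathfinish (linepath p1 (h / 2))) - (\<lambda>w. F (Z
        + w)) (pathstart (linepath p1 (h / 2))))) (linepath p1 (h / 2))"
    proof (rule contour_integral_primitive)
      fix w assume "w \<in> closed_segment p1 (h / 2)"
      hence "w \<in> L" using segL pL by blast
      hence "(F has_field_derivative g (Z + w)) (at (Z + w))" using Z h by (intro F) (auto simp: L_def)
      hence "((\<lambda>w. F (Z + w)) has_field_derivative g (Z + w)) (at w)" by (rule has_field_derivative_shift_left)
      thus "((\<lambda>w. F (Z + w)) has_field_derivative g (Z + w)) (at w within closed_segment p1 (h / 2))"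
        by (rule has_field_derivative_at_within)
    qed auto
    have "((\<lambda>w. ff w + g (Z + w)) has_contour_integral (contour_integral (linepath p1 (h / 2)) ff + (F V - F (Z
        + p1)))) (linepath p1 (h / 2))"
      using has_contour_integral_add[OF 1 2] by (simp add: V_def)
    from has_contour_integral_reversepath[OF valid_path_linepath this]
    have "((\<lambda>w. ff w + g (Z + w)) has_contour_integral - (contour_integral (linepath p1 (h / 2)) ff + (F V - F (Z
        + p1)))) (linepath (h / 2) p1)"
      by simp
    hence "((\<lambda>s. (ff (linepath (h / 2) p1 s) + g (Z + linepath (h / 2) p1 s)) * (p1 - h / 2)) has_integral
        - (contour_integral (linepath p1 (h / 2)) ff + (F V - F (Z + p1)))) {0..1}"
      by (simp only: has_contour_integral_linepath)
    from has_integral_neg[OF this]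
    have "((\<lambda>s. - ((ff (linepath (h / 2) p1 s) + g (Z + linepath (h / 2) p1 s)) * (p1
        - h / 2))) has_integral (contour_integral (linepath p1 (h / 2)) ff + (F V - F (Z + p1)))) {0..1}"
      by (simp only: minus_minus)
    moreover have lp: "linepath (h / 2) p1 s = h / 2 + of_real (- (s * R))" for s
      by (simp add: linepath_def p1_def scaleR_conv_of_real field_simps)
    have "- ((ff (linepath (h / 2) p1 s) + g (Z + linepath (h / 2) p1 s)) * (p1 - h / 2))
        = of_real R * (n (s * R) * g (V - of_real (s * R)))" for s
      unfolding lp ff_def ker nneg by (simp add: p1_def V_def algebra_simps)
    ultimately show ?thesis by simp
  qed
  have "(J has_integral - (contour_integral (linepath p1 (h / 2)) ff + (F V - F (Z + p1))
      + contour_integral (linepath (h / 2) p2) ff)) {0..1}"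
    using has_integral_neg[OF has_integral_add[OF I1 I2]] by (simp add: J_def algebra_simps)
  moreover have "sum_primitive F g h R Z = F (Z + p1) - contour_integral (linepath p1 p2) ff"
    by (simp add: sum_primitive_def ff_def p1_def p2_def algebra_simps)
  hence "- (contour_integral (linepath p1 (h / 2)) ff + (F V - F (Z + p1))
      + contour_integral (linepath (h / 2) p2) ff) = sum_primitive F g h R Z - F V"
    unfolding split by (simp add: algebra_simps)
  ultimately have JI: "(J has_integral (sum_primitive F g h R Z - F V)) {0..1}"
    by (simp only:)
  define b where "b = a * R"
  have b: "b > 0" using a_pos R_pos by (simp add: b_def)
  have Jb: "norm (J s) \<le> 4 * M * R\<^sup>2 * (s * exp (- (b * s)))" if s: "s \<in> {0..1}" for s
  proof -
    have sR: "0 \<le> s * R" "s * R \<le> R" using s R_pos by (auto simp: mult_left_le_one_le)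
    have "norm (g (V + of_real (s * R)) - g (V - of_real (s * R)))
        \<le> M * norm ((V + of_real (s * R)) - (V - of_real (s * R)))"
    proof (rule field_differentiable_bound[of "closed_segment (V - of_real (s * R)) (V + of_real (s * R))"])
      fix W assume W: "W \<in> closed_segment (V - of_real (s * R)) (V + of_real (s * R))"
      from W obtain v where "W = (1 - v) *\<^sub>R (V - of_real (s * R)) + v *\<^sub>R (V + of_real (s * R))"
          by (auto simp: in_segment)
      hence "Im W = (1 - v) * Im V + v * Im V" by simp
      hence ImW: "Im W = Im Z + Im h / 2" by (simp add: V_def field_simps)
      have "closed_segment (V - of_real (s * R)) (V + of_real (s * R)) \<subseteq> {W. Re V - R \<le> Re W} \<inter> {W. Re W \<le> Re V + R}"
        by (rule closed_segment_subset) (use sR in \<open>auto intro!: convex_Int convex_halfspace_Re_ge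
            convex_halfspace_Re_le\<close>)
      hence ReW: "\<bar>Re W - Re Z\<bar> \<le> R + Re h" using W h by (force simp: V_def)
      show "norm (deriv g W) \<le> M" by (rule M) (use ImW ReW h in auto)
      show "(g has_field_derivative deriv g W) (at W within closed_segment (V - of_real (s * R)) (V + of_real (s * R)))"
      proof (rule has_field_derivative_at_within[OF gd])
        show "\<alpha> < Im W" using ImW Z(1) h(1) by linarith
        show "Im W < \<beta>" using ImW Z(2) by linarith
      qed
    qed auto
    also have "norm ((V + of_real (s * R)) - (V - of_real (s * R))) = 2 * (s * R)"
    proof -
      have "(V + of_real (s * R)) - (V - of_real (s * R)) = of_real (2 * (s * R))" by simp
      thus ?thesis using sR by (simp only: norm_of_real)
    qed
    finally have g1: "norm (g (V + of_real (s * R)) - g (V - of_real (s * R))) \<le> M * (2 * (s * R))" .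
    have "norm (J s) \<le> R * ((2 * exp (- (a * (s * R)))) * (M * (2 * (s * R))))"
      unfolding J_def norm_mult using g1 nb[of "s * R"] R_pos by (intro mult_mono) (auto intro!: mult_mono)
    thus ?thesis by (simp add: b_def power2_eq_square mult_ac)
  qed
  have PI: "((\<lambda>s. 4 * M * R\<^sup>2 * (s * exp (- (b * s)))) has_integral (4 * M * R\<^sup>2 * ((1 - (1 + b)
      * exp (- b)) / b\<^sup>2))) {0..1}"
    by (rule has_integral_mult_right[OF has_integral_mult_exp_minus[OF b]])
  have "norm (integral {0..1} J) \<le> integral {0..1} (\<lambda>s. 4 * M * R\<^sup>2 * (s * exp (- (b * s))))"
    by (rule integral_norm_bound_integral[OF has_integral_integrable[OF JI] has_integral_integrable[OF PI] Jb])
  hence "norm (sum_primitive F g h R Z - F V) \<le> 4 * M * R\<^sup>2 * ((1 - (1 + b) * exp (- b)) / b\<^sup>2)"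
    unfolding integral_unique[OF JI] integral_unique[OF PI] .
  also have "\<dots> \<le> 4 * M * R\<^sup>2 * (1 / b\<^sup>2)"
    using M0 b by (intro mult_left_mono divide_right_mono) auto
  also have "\<dots> = M * (4 / a\<^sup>2)" using R_pos by (simp add: b_def power_mult_distrib)
  also have "\<dots> \<le> M * ((norm h)\<^sup>2 / 2)"
  proof (intro mult_left_mono M0)
    \<comment> \<open>The claim amounts to (a |h|)^2 \<ge> 8. From Re h \<le> Im h / 2 one has |h|
      \<le> 3/2 Im h, hence a |h| \<ge> 4 pi / 3 > 3.\<close>
    have "norm h \<le> \<bar>Re h\<bar> + \<bar>Im h\<bar>" by (rule cmod_le)
    hence "norm h \<le> 3 / 2 * Im h" using h by simp
    hence "3 * (norm h * norm h) \<le> 3 * (norm h * (3 / 2 * Im h))" by (intro mult_left_mono) auto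
    hence "a * norm h \<ge> 2 * pi * (2 / 3)"
      using h h0 by (simp add: a_def power2_eq_square field_simps)
    hence "a * norm h \<ge> 3" using pi_gt3 by linarith
    hence "(a * norm h)\<^sup>2 \<ge> 3\<^sup>2" by (intro power_mono) auto
    hence "8 \<le> (a * norm h)\<^sup>2" by simp
    hence "8 \<le> a\<^sup>2 * (norm h)\<^sup>2" by (simp add: power_mult_distrib)
    thus "4 / a\<^sup>2 \<le> (norm h)\<^sup>2 / 2" using a_pos by (simp add: field_simps)
  qed
  finally have A: "norm (sum_primitive F g h R Z - F V) \<le> M * ((norm h)\<^sup>2 / 2)" .
  have B: "norm (F V - (\<Sum>i\<le>1. (if i = 0 then F else if i = 1 then g else deriv g) Z * (V - Z) ^ i / fact i))
      \<le> M * norm (V - Z) ^ Suc 1 / fact 1"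
  proof (rule complex_Taylor[of "closed_segment Z V" 1 "\<lambda>i. if i = 0 then F else if i
      = 1 then g else deriv g", simplified if_True refl])
    fix i :: nat and x assume x: "x \<in> closed_segment Z V"
    have "closed_segment Z V \<subseteq> {W. Im Z \<le> Im W} \<inter> {W. Im W \<le> Im Z + Im h / 2} \<inter> {W. Re Z \<le> Re W} \<inter> {W. Re W
        \<le> Re Z + Re h}"
      by (rule closed_segment_subset)
        (use h in \<open>auto simp: V_def intro!: convex_Int convex_halfspace_Re_ge convex_halfspace_Re_le
            convex_halfspace_Im_ge convex_halfspace_Im_le\<close>)
    hence xb: "Im Z \<le> Im x" "Im x \<le> Im Z + Im h / 2" "\<bar>Re x - Re Z\<bar> \<le> R + Re h" using x R_pos by force+
    show "norm ((if Suc 1 = 0 then F else if Suc 1 = 1 then g else deriv g) x) \<le> M"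
      using M[of x] xb by simp
    assume "i \<le> 1"
    hence i: "i = 0 \<or> i = 1" by linarith
    have "\<alpha> < Im x" "Im x < \<beta>" using xb Z by auto
    note d = F[OF this, THEN has_field_derivative_at_within] gd[OF this, THEN has_field_derivative_at_within]
    from i show "((if i = 0 then F else if i = 1 then g else deriv g) has_field_derivative (if Suc i
        = 0 then F else if Suc i = 1 then g else deriv g) x) (at x within closed_segment Z V)"
      by (elim disjE) (use d in simp_all)
  qed auto
  hence "norm (F V - F Z - h / 2 * g Z) \<le> M * (norm (h / 2))\<^sup>2"
    by (simp add: V_def power2_eq_square algebra_simps)
  hence B': "norm (F V - F Z - h / 2 * g Z) \<le> M * ((norm h)\<^sup>2 / 4)"
    by (simp add: norm_divide power_divide)
  have "sum_primitive F g h R Z - F Z - h / 2 * g Z = (sum_primitive F g h R Z - F V) + (F V - F Z - h / 2 * g Z)"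
      by simp
  also have "norm \<dots> \<le> M * ((norm h)\<^sup>2 / 2) + M * ((norm h)\<^sup>2 / 4)"
    by (rule norm_triangle_mono[OF A B'])
  also have "\<dots> \<le> M * (norm h)\<^sup>2" using M0 by (simp add: algebra_simps)
  finally show ?thesis .
qed

text \<open>Differentiation under the integral sign. The domain is shifted down by Im h / 2 because
  the path of integration runs at that height above Z.\<close>

lemma sum_primitive_holomorphic:
  "sum_primitive F g h R holomorphic_on {Z. \<alpha> - Im h / 2 < Im Z \<and> Im Z < \<beta> - Im h / 2}"
proof -
  define U where "U = {Z. \<alpha> - Im h / 2 < Im Z \<and> Im Z < \<beta> - Im h / 2}"
  define p1 p2 where "p1 = h / 2 - of_real R" and "p2 = h / 2 + of_real R"
  have U_eq: "U = {w. \<alpha> - Im h / 2 < Im w} \<inter> {w. Im w < \<beta> - Im h / 2}" by (auto simp: U_def)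
  have cU: "convex U" unfolding U_eq by (intro convex_Int convex_halfspace_Im_gt convex_halfspace_Im_lt)
  have ImL: "Im (linepath p1 p2 t) = Im h / 2" for t
    by (simp add: linepath_def p1_def p2_def algebra_simps)
  have nz: "exp (2 * of_real pi * \<i> * linepath p1 p2 t / h) - 1 \<noteq> 0" for t
    using ImL[of t] half_integer_not_multiple[OF h(1)] by (intro lattice_denominator_nonzero h) auto
  have kc: "continuous_on S (\<lambda>t. lattice_kernel h (linepath p1 p2 t))" for S
    unfolding lattice_kernel_def using nz h0 by (intro continuous_intros) auto
  have dh: "deriv g holomorphic_on {Z. \<alpha> < Im Z \<and> Im Z < \<beta>}" by (intro holomorphic_deriv g_holo open_strip)
  have "(\<lambda>Z. integral (cbox 0 1) (\<lambda>t. g (Z + linepath p1 p2 t) * lattice_kernel h (linepath p1 p2 t) * (p2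
      - p1))) holomorphic_on U"
  proof (rule leibniz_rule_holomorphic[where fx = "\<lambda>Z t. deriv g (Z + linepath p1 p2 t)
      * lattice_kernel h (linepath p1 p2 t) * (p2 - p1)"])
    fix Z and t :: real assume Z: "Z \<in> U" and t: "t \<in> cbox 0 1"
    have "(g has_field_derivative deriv g (Z + linepath p1 p2 t)) (at (Z + linepath p1 p2 t))"
      by (rule holomorphic_derivI[OF g_holo open_strip]) (use Z in \<open>auto simp: U_def ImL\<close>)
    hence "((\<lambda>Z. g (Z + linepath p1 p2 t)) has_field_derivative deriv g (Z + linepath p1 p2 t)) (at Z within U)"
      by (simp add: DERIV_shift has_field_derivative_at_within)
    thus "((\<lambda>Z. g (Z + linepath p1 p2 t) * lattice_kernel h (linepath p1 p2 t) * (p2 - p1)) has_field_derivative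
         deriv g (Z + linepath p1 p2 t) * lattice_kernel h (linepath p1 p2 t) * (p2 - p1)) (at Z within U)"
      by (intro DERIV_cmult_right)
  next
    fix Z assume Z: "Z \<in> U"
    have "continuous_on {0..1} (g \<circ> (\<lambda>t. Z + linepath p1 p2 t))"
      by (intro continuous_on_compose continuous_intros g_cont) (use Z in \<open>auto simp: U_def ImL\<close>)
    thus "(\<lambda>t. g (Z + linepath p1 p2 t) * lattice_kernel h (linepath p1 p2 t) * (p2 - p1)) integrable_on cbox 0 1"
      by (intro integrable_continuous continuous_intros kc) (simp add: o_def)
  next
    have cl: "continuous_on (U \<times> cbox 0 1) (\<lambda>x. fst x + linepath p1 p2 (snd x))"
      unfolding linepath_def by (intro continuous_intros)
    have "(\<lambda>x. fst x + linepath p1 p2 (snd x)) ` (U \<times> cbox 0 1) \<subseteq> {Z. \<alpha> < Im Z \<and> Im Z < \<beta>}"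
      by (auto simp: U_def ImL)
    hence "continuous_on (U \<times> cbox 0 1) (deriv g \<circ> (\<lambda>x. fst x + linepath p1 p2 (snd x)))"
      by (intro continuous_on_compose cl continuous_on_subset[OF holomorphic_on_imp_continuous_on[OF dh]])
    moreover have "continuous_on (U \<times> cbox 0 1) ((\<lambda>t. lattice_kernel h (linepath p1 p2 t)) \<circ> snd)"
      by (intro continuous_on_compose continuous_intros kc)
    ultimately show "continuous_on (U \<times> cbox 0 1) (\<lambda>(Z, t). deriv g (Z + linepath p1 p2 t)
        * lattice_kernel h (linepath p1 p2 t) * (p2 - p1))"
      by (auto simp: case_prod_unfold o_def intro!: continuous_intros)
  qed (rule cU)
  hence "(\<lambda>Z. contour_integral (linepath p1 p2) (\<lambda>w. g (Z + w) * lattice_kernel h w)) holomorphic_on U"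
    by (simp add: contour_integral_integral)
  moreover have "(\<lambda>Z. F (Z + p1)) holomorphic_on U"
  proof -
    have "F holomorphic_on {Z. \<alpha> < Im Z \<and> Im Z < \<beta>}" using F by (auto simp: holomorphic_on_open[OF open_strip])
    hence "F \<circ> (\<lambda>Z. Z + p1) holomorphic_on U"
      by (intro holomorphic_on_compose_gen[OF _ \<open>F holomorphic_on _\<close>] holomorphic_intros) (auto simp: U_def p1_def)
    thus ?thesis by (simp add: o_def)
  qed
  ultimately have "(\<lambda>Z. F (Z + p1) - contour_integral (linepath p1 p2) (\<lambda>w. g (Z + w)
      * lattice_kernel h w)) holomorphic_on U"
    by (intro holomorphic_on_diff)
  thus ?thesis by (simp add: U_def sum_primitive_def[abs_def] p1_def p2_def add_diff_eq)
qed

end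

section \<open>The phase function of the figure-eight knot\<close>

text \<open>The integrand has a removable singularity at 0. Once it is removed there is a primitive
  on the unit disc, and changing the integrand at the single point 0 does not affect the integral
  along the segment.\<close>

lemma dilog_has_field_derivative:
  assumes "norm z < 1" "z \<noteq> 0"
  shows "(dilog has_field_derivative (- Ln (1 - z) / z)) (at z)"
proof -
  define f where "f = (\<lambda>w::complex. Ln (1 - w))"
  define q where "q = (\<lambda>w. if w = 0 then deriv f 0 else (f w - f 0) / (w - 0))"
  have nr: "1 - w \<notin> \<real>\<^sub>\<le>\<^sub>0" if "w \<in> ball 0 1" for w :: complex
  proof -
    have "Re w < 1" using that complex_Re_le_cmod[of w] by simp
    thus ?thesis by (auto simp: complex_nonpos_Reals_iff)
  qed
  have "f holomorphic_on ball 0 1" unfolding f_def by (intro holomorphic_intros nr)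
  hence "q holomorphic_on ball 0 1" unfolding q_def by (rule pole_lemma) simp
  from holomorphic_convex_primitive'[OF convex_ball open_ball this]
  obtain Q where Q: "\<And>w. w \<in> ball 0 1 \<Longrightarrow> (Q has_field_derivative q w) (at w within ball 0 1)"
    by blast
  have eq: "dilog w = - (Q w - Q 0)" if w: "w \<in> ball 0 1" for w
  proof (cases "w = 0")
    case True
    thus ?thesis by (simp add: dilog_def)
  next
    case False
    have seg: "closed_segment 0 w \<subseteq> ball 0 1" using w by (intro closed_segment_subset) auto
    have "(q has_contour_integral (Q (pathfinish (linepath 0 w)) - Q (pathstart (linepath 0 w)))) (linepath 0 w)"
      by (rule contour_integral_primitive[OF Q]) (use seg in auto)
    hence "contour_integral (linepath 0 w) q = Q w - Q 0" by (auto dest: contour_integral_unique)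
    moreover have "contour_integral (linepath 0 w) (\<lambda>w. Ln (1 - w) / w) = contour_integral (linepath 0 w) q"
      by (rule contour_integral_spike_finite_simple_path[of "{0}"])
        (use False in \<open>auto simp: q_def f_def simple_path_linepath\<close>)
    ultimately show ?thesis by (simp add: dilog_def)
  qed
  have zb: "z \<in> ball 0 1" using assms by simp
  have "(Q has_field_derivative q z) (at z)" using Q[OF zb] zb by (simp add: at_within_open[OF zb])
  hence "((\<lambda>w. - (Q w - Q 0)) has_field_derivative (- (q z - 0))) (at z)"
    by (intro derivative_intros)
  hence "(dilog has_field_derivative (- (q z - 0))) (at z)"
    by (rule has_field_derivative_transform_within_open[of _ _ _ "ball 0 1"]) (use zb eq in auto)
  thus ?thesis using assms by (simp add: q_def f_def)
qed

text \<open>Expand \<open>F\<close> to second and \<open>g\<close> to first order at z: the terms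
  with g1 z * h^2 / 2 cancel in the trapezoidal combination, and each remainder contributes at most
  M |h|^3 / 2.\<close>

lemma trapezoid_step:
  fixes F g g1 g2 :: "complex \<Rightarrow> complex" and z h :: complex
  assumes T: "closed_segment z (z + h) \<subseteq> T"
    and F: "\<And>x. x \<in> T \<Longrightarrow> (F has_field_derivative g x) (at x)"
    and g: "\<And>x. x \<in> T \<Longrightarrow> (g has_field_derivative g1 x) (at x)"
    and g1: "\<And>x. x \<in> T \<Longrightarrow> (g1 has_field_derivative g2 x) (at x)"
    and M: "\<And>x. x \<in> T \<Longrightarrow> norm (g2 x) \<le> M"
  shows "norm (F (z + h) - F z - h * (g z + g (z + h)) / 2) \<le> M * norm h ^ 3"
proof -
  let ?S = "closed_segment z (z + h)"
  define D where "D = (\<lambda>i::nat. if i = 0 then F else if i = 1 then g else if i = 2 then g1 else g2)"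
  have D: "(D i has_field_derivative D (Suc i) x) (at x within ?S)" if "x \<in> ?S" "i \<le> 2" for i x
  proof -
    have i: "i = 0 \<or> i = 1 \<or> i = 2" using that by linarith
    have "x \<in> T" using that T by blast
    note d = F[OF this, THEN has_field_derivative_at_within] g[OF this, THEN has_field_derivative_at_within]
      g1[OF this, THEN has_field_derivative_at_within]
    from i show ?thesis
    proof (elim disjE)
      assume "i = 2"
      hence "D i = g1" "D (Suc i) = g2" by (auto simp: D_def fun_eq_iff)
      thus ?thesis using d(3) by simp
    qed (use d in \<open>simp_all add: D_def\<close>)
  qed
  have M2: "norm (D 3 x) \<le> M" if "x \<in> ?S" for x using M[of x] that T by (auto simp: D_def)
  have "norm (D 0 (z + h) - (\<Sum>i\<le>2. D i z * ((z + h) - z) ^ i / fact i)) \<le> M * norm ((z + h) - z) ^ Suc 2 / fact 2"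
  proof (rule complex_Taylor[of ?S])
    show "norm (D (Suc 2) x) \<le> M" if "x \<in> ?S" for x using M2[OF that] by (simp add: numeral_eq_Suc)
  qed (use D in auto)
  moreover have "norm ((\<lambda>i. D (Suc i)) 0 (z + h) - (\<Sum>i\<le>1. (\<lambda>i. D (Suc i)) i z * ((z + h) - z) ^ i / fact i))
      \<le> M * norm ((z + h) - z) ^ Suc 1 / fact 1"
  proof (rule complex_Taylor[of ?S])
    show "norm (D (Suc (Suc 1)) x) \<le> M" if "x \<in> ?S" for x using M2[OF that] by (simp add: numeral_eq_Suc)
  qed (use D in auto)
  ultimately have 1: "norm (F (z + h) - (F z + g z * h + g1 z * h\<^sup>2 / 2)) \<le> M * norm h ^ 3 / 2"
    and 2: "norm (g (z + h) - (g z + g1 z * h)) \<le> M * (norm h)\<^sup>2"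
    by (simp_all add: D_def numeral_eq_Suc)
  have "F (z + h) - F z - h * (g z + g (z + h)) / 2
     = (F (z + h) - (F z + g z * h + g1 z * h\<^sup>2 / 2)) - h / 2 * (g (z + h) - (g z + g1 z * h))"
    by (simp add: field_simps power2_eq_square)
  also have "norm \<dots> \<le> M * norm h ^ 3 / 2 + norm h / 2 * (M * (norm h)\<^sup>2)"
  proof (rule order_trans[OF norm_triangle_ineq4 add_mono[OF 1]])
    show "norm (h / 2 * (g (z + h) - (g z + g1 z * h))) \<le> norm h / 2 * (M * (norm h)\<^sup>2)"
      using mult_left_mono[OF 2, of "norm h / 2"] by (simp add: norm_mult norm_divide)
  qed
  also have "\<dots> = M * norm h ^ 3" by (simp add: power2_eq_square power3_eq_cube)
  finally show ?thesis .
qed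

text \<open>Euler-Maclaurin summation up to the boundary term. Division by h leaves an error |h|^2
  per step, so for |h| of order 1/N and at most N steps the total is O(1/N).\<close>

lemma trapezoid_sum:
  fixes F g g1 g2 :: "complex \<Rightarrow> complex" and h :: complex and k :: nat
  assumes T: "convex T" "\<And>l. l \<le> k \<Longrightarrow> of_nat l * h \<in> T" and h: "h \<noteq> 0"
    and F: "\<And>x. x \<in> T \<Longrightarrow> (F has_field_derivative g x) (at x)"
    and g: "\<And>x. x \<in> T \<Longrightarrow> (g has_field_derivative g1 x) (at x)"
    and g1: "\<And>x. x \<in> T \<Longrightarrow> (g1 has_field_derivative g2 x) (at x)"
    and M: "\<And>x. x \<in> T \<Longrightarrow> norm (g2 x) \<le> M"
  shows "norm ((\<Sum>l=1..k. g (of_nat l * h)) - (F (of_nat k * h) - F 0) / h - (g (of_nat k * h) - g 0) / 2)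
      \<le> real k * (M * (norm h)\<^sup>2)"
  using T(2)
proof (induction k)
  case 0
  thus ?case by simp
next
  case (Suc k)
  let ?z = "of_nat k * h"
  have IH: "norm ((\<Sum>l=1..k. g (of_nat l * h)) - (F ?z - F 0) / h - (g ?z - g 0) / 2) \<le> real k * (M * (norm h)\<^sup>2)"
    using Suc by simp
  have z: "?z \<in> T" "?z + h \<in> T" using Suc.prems[of k] Suc.prems[of "Suc k"] by (auto simp: algebra_simps)
  have "norm (F (?z + h) - F ?z - h * (g ?z + g (?z + h)) / 2) \<le> M * norm h ^ 3"
    by (rule trapezoid_step[OF closed_segment_subset[OF z T(1)] F g g1 M])
  hence "norm (F (?z + h) - F ?z - h * (g ?z + g (?z + h)) / 2) / norm h \<le> M * norm h ^ 3 / norm h"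
    by (rule divide_right_mono) auto
  hence step: "norm ((F (?z + h) - F ?z - h * (g ?z + g (?z + h)) / 2) / h) \<le> M * (norm h)\<^sup>2"
    using h by (simp add: norm_divide power3_eq_cube power2_eq_square)
  have e: "of_nat (Suc k) * h = ?z + h" by (simp add: distrib_right)
  have "(\<Sum>l=1..Suc k. g (of_nat l * h)) - (F (?z + h) - F 0) / h - (g (?z + h) - g 0) / 2
     = ((\<Sum>l=1..k. g (of_nat l * h)) - (F ?z - F 0) / h - (g ?z - g 0) / 2)
       - (F (?z + h) - F ?z - h * (g ?z + g (?z + h)) / 2) / h"
    using h by (simp add: e field_simps)
  also have "norm \<dots> \<le> real k * (M * (norm h)\<^sup>2) + M * (norm h)\<^sup>2"
    by (rule order_trans[OF norm_triangle_ineq4 add_mono[OF IH step]])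
  also have "\<dots> = real (Suc k) * (M * (norm h)\<^sup>2)" by (simp add: distrib_right)
  finally show ?case unfolding e .
qed

section \<open>The parameters, the domain of the logarithm and its primitive\<close>

locale fig8 =
  fixes u :: real and p :: nat
  assumes u_pos: "0 < u" and u_less: "u < arcosh (3 / 2)" and p_pos: "p > 0"
begin

lemma cosh_u: "1 < cosh u" "cosh u < 3 / 2"
proof -
  have a: "arcosh (3 / 2 :: real) \<ge> 0" using u_pos u_less by linarith
  have "cosh 0 < cosh u" using u_pos by (subst cosh_real_nonneg_less_iff) auto
  thus "1 < cosh u" by simp
  have "cosh u < cosh (arcosh (3 / 2))" using u_pos u_less a by (subst cosh_real_nonneg_less_iff) auto
  thus "cosh u < 3 / 2" by (simp add: cosh_arcosh_real)
qed

text \<open>For u \<ge> 1 the inequality sinh x \<ge> x at x = u / 2 would give cosh u = 1 + 2 (sinh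
  (u / 2))^2 \<ge> 3/2. This numerical bound feeds most of the later comparisons of
  constants.\<close>

lemma u_less_1: "u < 1"
proof (rule ccontr)
  assume "\<not> u < 1"
  hence "(1 / 2 :: real) \<le> u / 2" by simp
  also have "u / 2 \<le> (exp (u / 2) - inverse (exp (u / 2))) / 2" using u_pos by (intro real_le_x_sinh) auto
  also have "\<dots> = sinh (u / 2)" by (simp add: sinh_def exp_minus)
  finally have "(1 / 2)\<^sup>2 \<le> (sinh (u / 2))\<^sup>2" by (intro power_mono) auto
  moreover have "cosh u = 2 * (sinh (u / 2))\<^sup>2 + 1"
    using cosh_double[of "u / 2"] cosh_square_eq[of "u / 2"] by simp
  ultimately have "cosh u \<ge> 3 / 2" by (simp add: power2_eq_square)
  thus False using cosh_u by simp
qed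

definition "\<theta> = arccos (cosh u - 1 / 2)"
definition "c = 2 * pi * real p"
definition "\<xi> = Complex u c"
definition "y0 = c - \<theta>"

lemma \<theta>: "cos \<theta> = cosh u - 1 / 2" "0 < \<theta>" "\<theta> < pi / 2" "sin \<theta> > 0"
proof -
  show 1: "cos \<theta> = cosh u - 1 / 2" unfolding \<theta>_def using cosh_u by (intro cos_arccos) auto
  have "0 \<le> \<theta>" "\<theta> \<le> pi" unfolding \<theta>_def using cosh_u by (auto intro!: arccos_lbound arccos_ubound)
  moreover have "\<theta> \<noteq> 0" using 1 cosh_u by auto
  ultimately show 2: "0 < \<theta>" by simp
  show 3: "\<theta> < pi / 2"
  proof (rule ccontr)
    assume "\<not> \<theta> < pi / 2"
    hence "cos \<theta> \<le> cos (pi / 2)" using \<open>\<theta> \<le> pi\<close> by (intro cos_monotone_0_pi_le) auto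
    thus False using 1 cosh_u by simp
  qed
  show "sin \<theta> > 0" using 2 3 by (intro sin_gt_zero) auto
qed

lemma p_ge_1: "real p \<ge> 1" using p_pos by linarith
lemma c_pos: "c > 0" using p_pos by (simp add: c_def)
lemma c_ge: "c \<ge> 2 * pi" using p_ge_1 by (simp add: c_def)
lemma y0_bounds: "c - pi / 2 < y0" "y0 < c" using \<theta> by (auto simp: y0_def)
lemma \<xi>_simps [simp]: "Re \<xi> = u" "Im \<xi> = c" by (auto simp: \<xi>_def)
lemma \<xi>_nonzero: "\<xi> \<noteq> 0" using u_pos by (auto simp: complex_eq_iff)

definition "G Z = of_real (2 * cosh u) - exp Z - exp (- Z)" for Z :: complex
definition "g Z = Ln (G Z)" for Z :: complex
text \<open>\<open>G\<close> is real and nonpositive exactly on horizontal half-lines: Im Z a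
  multiple of 2 pi and |Re Z| \<ge> u. The strip passes between them for all heights; the window is
  the gap between the two topmost relevant heights and leaves Re Z free, as the path of length 2 R
  in \<open>sum_primitive\<close> requires.\<close>

definition "window = {Z :: complex. c - 2 * pi < Im Z \<and> Im Z < c}"
definition "strip = {Z :: complex. - u < Re Z \<and> Re Z < u}"
definition "dmn = strip \<union> window"

text \<open>The factorization behind the dilogarithms: the logarithm of each factor is, up to sign,
  the derivative of a dilogarithm of an exponential.\<close>

lemma G_prod: "G Z = of_real (exp u) * ((1 - exp (- of_real u - Z)) * (1 - exp (- of_real u + Z)))"
proof -
  have "of_real (2 * cosh u) = exp (of_real u) + exp (- of_real u :: complex)"
    by (simp add: cosh_def flip: exp_of_real)
  moreover have "exp (of_real u) * ((1 - exp (- of_real u - Z)) * (1 - exp (- of_real u + Z)))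
     = exp (of_real u) - exp (of_real u) * exp (- of_real u - Z) - exp (of_real u) * exp (- of_real u + Z)
       + exp (of_real u) * exp (- of_real u - Z) * exp (- of_real u + Z)"
    by (simp add: algebra_simps)
  ultimately show ?thesis
    by (simp add: G_def flip: exp_add exp_of_real)
qed

lemma Re_G: "Re (G Z) = 2 * cosh u - (exp (Re Z) + exp (- Re Z)) * cos (Im Z)"
  by (simp add: G_def Re_exp algebra_simps)
lemma Im_G: "Im (G Z) = - (exp (Re Z) - exp (- Re Z)) * sin (Im Z)"
  by (simp add: G_def Im_exp algebra_simps)

lemma exp_sum_less: "\<bar>s\<bar> < u \<Longrightarrow> exp s + exp (- s) < 2 * cosh u"
proof -
  assume s: "\<bar>s\<bar> < u"
  have "cosh \<bar>s\<bar> < cosh u" using s by (subst cosh_real_nonneg_less_iff) auto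
  thus ?thesis by (simp add: cosh_def abs_if split: if_splits)
qed

lemma Re_G_pos_strip: "Z \<in> strip \<Longrightarrow> Re (G Z) > 0"
proof -
  assume Z: "Z \<in> strip"
  hence "exp (Re Z) + exp (- Re Z) < 2 * cosh u" by (intro exp_sum_less) (auto simp: strip_def)
  moreover have "(exp (Re Z) + exp (- Re Z)) * cos (Im Z) \<le> exp (Re Z) + exp (- Re Z)"
    by (intro mult_left_le) (auto intro: add_nonneg_nonneg)
  ultimately have "(exp (Re Z) + exp (- Re Z)) * cos (Im Z) < 2 * cosh u" by (rule le_less_trans[rotated])
  thus ?thesis unfolding Re_G by simp
qed

lemma window_cos:
  assumes "c - 2 * pi < y" "y < c" shows "cos y < 1" "sin y = 0 \<Longrightarrow> cos y = - 1"
proof -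
  define x where "x = y - 2 * pi * real (p - 1)"
  have cx: "c = 2 * pi * real (p - 1) + 2 * pi" using p_pos by (simp add: c_def of_nat_diff algebra_simps)
  have x: "0 < x" "x < 2 * pi" using assms cx by (auto simp: x_def)
  have y: "y = x + real (p - 1) * (2 * pi)" by (simp add: x_def)
  have sc: "sin y = sin x" "cos y = cos x"
    unfolding y using sin_cos_eq_iff[of "x + real (p - 1) * (2 * pi)" x] by (metis mult.commute of_int_of_nat_eq)+
  have "cos x < 1"
  proof (cases "x \<le> pi")
    case True
    thus ?thesis using cos_monotone_0_pi[of 0 x] x by simp
  next
    case False
    hence "cos (2 * pi - x) < cos 0" using x by (intro cos_monotone_0_pi) auto
    thus ?thesis by simp
  qed
  hence "cos x \<noteq> 1" by simp
  show "cos y < 1" using \<open>cos x \<noteq> 1\<close> cos_le_one[of x] sc by linarith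
  assume "sin y = 0"
  hence "(cos x)\<^sup>2 = 1" using sin_cos_squared_add[of x] sc by simp
  thus "cos y = - 1" using \<open>cos x \<noteq> 1\<close> sc by (simp add: power2_eq_1_iff)
qed

lemma G_not_nonpos: assumes "Z \<in> dmn" shows "G Z \<notin> \<real>\<^sub>\<le>\<^sub>0"
proof (cases "Z \<in> strip")
  case True
  thus ?thesis using Re_G_pos_strip by (force simp: complex_nonpos_Reals_iff)
next
  case False
  hence w: "Z \<in> window" using assms by (auto simp: dmn_def)
  show ?thesis
  proof
    assume "G Z \<in> \<real>\<^sub>\<le>\<^sub>0"
    hence G: "Re (G Z) \<le> 0" "Im (G Z) = 0" by (auto simp: complex_nonpos_Reals_iff)
    have "Re Z \<noteq> 0" using False u_pos by (auto simp: strip_def)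
    hence "sin (Im Z) = 0" using G(2) by (auto simp: Im_G)
    hence "cos (Im Z) = - 1" using w by (intro window_cos) (auto simp: window_def)
    hence "Re (G Z) = 2 * cosh u + (exp (Re Z) + exp (- Re Z))" by (simp add: Re_G)
    moreover have "exp (Re Z) + exp (- Re Z) > 0" by (intro add_pos_pos) auto
    ultimately have "Re (G Z) > 0" using cosh_u by linarith
    thus False using G by simp
  qed
qed

lemma G_nonzero: "Z \<in> dmn \<Longrightarrow> G Z \<noteq> 0" using G_not_nonpos by (metis complex_nonpos_Reals_iff order_refl zero_complex.sel)

lemma exp_g: "Z \<in> dmn \<Longrightarrow> exp (g Z) = G Z" by (simp add: g_def G_nonzero)

lemma strip_eq: "strip = {Z. - u < Re Z} \<inter> {Z. Re Z < u}" by (auto simp: strip_def)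
lemma window_eq: "window = {Z. c - 2 * pi < Im Z} \<inter> {Z. Im Z < c}" by (auto simp: window_def)
lemma open_strip: "open strip" unfolding strip_eq by (intro open_Int open_halfspace_Re_gt open_halfspace_Re_lt)
lemma open_window: "open window" unfolding window_eq by (intro open_Int open_halfspace_Im_gt open_halfspace_Im_lt)
lemma convex_strip: "convex strip" unfolding strip_eq by (intro convex_Int convex_halfspace_Re_gt
    convex_halfspace_Re_lt)
lemma convex_window: "convex window" unfolding window_eq
    by (intro convex_Int convex_halfspace_Im_gt convex_halfspace_Im_lt)
lemma open_dmn: "open dmn" unfolding dmn_def by (rule open_Un[OF open_strip open_window])

text \<open>Strip and window are convex and both contain the saddle point, so their union, though
  not convex, is starlike about it. This gives the primitive of \<open>g\<close> as an integral
  along segments from \<open>z0\<close>.\<close>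

definition "z0 = Complex 0 y0"

lemma z0_mem: "z0 \<in> strip" "z0 \<in> window" "z0 \<in> dmn"
  using u_pos y0_bounds pi_gt_zero by (auto simp: z0_def strip_def window_def dmn_def)

lemma segment_dmn: "Z \<in> dmn \<Longrightarrow> closed_segment z0 Z \<subseteq> dmn"
  using closed_segment_subset[OF z0_mem(1) _ convex_strip] closed_segment_subset[OF z0_mem(2) _ convex_window]
  by (auto simp: dmn_def)

lemma starlike_dmn: "starlike dmn" unfolding starlike_def using segment_dmn z0_mem by blast

lemma g_holo: "g holomorphic_on dmn"
  unfolding g_def G_def by (intro holomorphic_intros) (use G_not_nonpos in \<open>auto simp: G_def\<close>)

text \<open>
  \<open>F0\<close> carries the dilogarithms but is a primitive of \<open>g\<close> on the strip only; \<open>F\<close> continues it to the window.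
\<close>

definition "F0 Z = of_real u * Z + dilog (exp (- of_real u - Z)) - dilog (exp (- of_real u + Z))" for Z :: complex
definition "F Z = F0 z0 + contour_integral (linepath z0 Z) g" for Z :: complex

text \<open>In the strip both exponentials have modulus below 1, so both factors have positive real
  part. Their arguments are less than pi / 2 in modulus, and the logarithms add up without a
  multiple of 2 pi i.\<close>

lemma g_strip: assumes "Z \<in> strip" shows "g Z = of_real u + Ln (1 - exp (- of_real u - Z)) + Ln (1 - exp (- of_real u
    + Z))"
proof -
  define A B where "A = 1 - exp (- of_real u - Z)" and "B = 1 - exp (- of_real u + Z)"
  have n: "norm (exp (- of_real u - Z)) < 1" "norm (exp (- of_real u + Z)) < 1" using assms by (auto simp: strip_def)
  have AB: "Re A > 0" "Re B > 0"
    using le_less_trans[OF complex_Re_le_cmod n(1)] le_less_trans[OF complex_Re_le_cmod n(2)]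
        by (simp_all only: A_def B_def minus_complex.simps one_complex.simps diff_gt_0_iff_gt)
  hence AB0: "A \<noteq> 0" "B \<noteq> 0" by auto
  have i: "\<bar>Im (Ln A)\<bar> < pi / 2" "\<bar>Im (Ln B)\<bar> < pi / 2"
    using AB AB0 Re_Ln_pos_lt by blast+
  have "exp (of_real u + Ln A + Ln B) = of_real (exp u) * (A * B)"
    using AB0 by (simp add: exp_add exp_of_real mult.assoc)
  moreover have "G Z = of_real (exp u) * (A * B)" by (simp only: G_prod A_def B_def)
  ultimately have "Ln (G Z) = Ln (exp (of_real u + Ln A + Ln B))" by simp
  also have "\<dots> = of_real u + Ln A + Ln B" by (rule Ln_exp) (use i in auto)
  finally show ?thesis by (simp add: g_def A_def B_def)
qed

lemma F0_deriv: assumes Z: "Z \<in> strip" shows "(F0 has_field_derivative g Z) (at Z)"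
proof -
  have n: "norm (exp (- of_real u - Z)) < 1" "norm (exp (- of_real u + Z)) < 1" using assms by (auto simp: strip_def)
  have d1: "((\<lambda>Z. dilog (exp (- of_real u - Z))) has_field_derivative (- Ln (1 - exp (- of_real u
      - Z)) / exp (- of_real u - Z)) * (- exp (- of_real u - Z))) (at Z)"
    by (rule DERIV_chain2[OF dilog_has_field_derivative]) (use n in \<open>auto intro!: derivative_eq_intros\<close>)
  have d2: "((\<lambda>Z. dilog (exp (- of_real u + Z))) has_field_derivative (- Ln (1 - exp (- of_real u
      + Z)) / exp (- of_real u + Z)) * exp (- of_real u + Z)) (at Z)"
    by (rule DERIV_chain2[OF dilog_has_field_derivative]) (use n in \<open>auto intro!: derivative_eq_intros\<close>)
  have "(F0 has_field_derivative of_real u + (- Ln (1 - exp (- of_real u - Z)) / exp (- of_real u - Z))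
      * (- exp (- of_real u - Z))
      - (- Ln (1 - exp (- of_real u + Z)) / exp (- of_real u + Z)) * exp (- of_real u + Z)) (at Z)"
    unfolding F0_def[abs_def] by (rule derivative_eq_intros d1 d2 refl)+ simp
  thus ?thesis unfolding g_strip[OF Z] by simp
qed

lemma F_deriv: assumes Z: "Z \<in> dmn" shows "(F has_field_derivative g Z) (at Z)"
proof -
  have "\<exists>P. \<forall>x\<in>dmn. (P has_field_derivative g x) (at x)"
  proof (rule holomorphic_starlike_primitive[OF _ starlike_dmn open_dmn finite.emptyI])
    show "continuous_on dmn g" using g_holo by (rule holomorphic_on_imp_continuous_on)
    show "\<And>x. x \<in> dmn - {} \<Longrightarrow> g field_differentiable at x"
      using g_holo open_dmn holomorphic_on_imp_differentiable_at by auto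
  qed
  then obtain P where P: "\<And>x. x \<in> dmn \<Longrightarrow> (P has_field_derivative g x) (at x)" by blast
  have eq: "F0 z0 + (P x - P z0) = F x" if x: "x \<in> dmn" for x
  proof -
    have "(g has_contour_integral (P (pathfinish (linepath z0 x)) - P (pathstart (linepath z0 x)))) (linepath z0 x)"
      by (rule contour_integral_primitive[of "closed_segment z0 x"])
        (use P[THEN has_field_derivative_at_within] segment_dmn[OF x] in auto)
    thus ?thesis by (simp add: F_def contour_integral_unique)
  qed
  have "((\<lambda>x. F0 z0 + (P x - P z0)) has_field_derivative g Z) (at Z)"
    using P[OF Z] by (auto intro!: derivative_eq_intros)
  thus ?thesis by (rule has_field_derivative_transform_within_open[OF _ open_dmn Z]) (use eq in auto)
qed

lemma F_strip: assumes Z: "Z \<in> strip" shows "F Z = F0 Z"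
proof -
  have "\<exists>k. \<forall>Z\<in>strip. F Z - F0 Z = k"
  proof (rule has_field_derivative_zero_constant[OF convex_strip])
    fix x assume x: "x \<in> strip"
    have "((\<lambda>Z. F Z - F0 Z) has_field_derivative (g x - g x)) (at x)"
      using x by (intro derivative_intros F_deriv F0_deriv) (auto simp: dmn_def)
    thus "((\<lambda>Z. F Z - F0 Z) has_field_derivative 0) (at x within strip)" by (simp add: has_field_derivative_at_within)
  qed
  then obtain k where k: "\<And>Z. Z \<in> strip \<Longrightarrow> F Z - F0 Z = k" by blast
  have "F z0 = F0 z0" by (simp add: F_def)
  hence "k = 0" using k[OF z0_mem(1)] by simp
  thus ?thesis using k[OF Z] by simp
qed

lemma axis_strip: "\<i> * of_real y \<in> strip" using u_pos by (simp add: strip_def)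

lemma F_zero: "F 0 = 0" using F_strip[of 0] u_pos by (simp add: strip_def F0_def)

text \<open>The dilogarithms are periodic and only the linear term changes. On the axis the phase
  thus gains 2 pi u in every period, and this is why the last period dominates.\<close>

lemma F_period: assumes "Z \<in> strip" shows "F (Z + 2 * of_real pi * \<i>) = F Z + 2 * of_real pi * \<i> * of_real u"
proof -
  have "Z + 2 * of_real pi * \<i> \<in> strip" using assms by (simp add: strip_def)
  moreover have "exp (- of_real u - (Z + 2 * of_real pi * \<i>)) = exp (- of_real u - Z)"
    by (simp add: exp_diff exp_add diff_add_eq_diff_diff_swap)
  moreover have "exp (- of_real u + (Z + 2 * of_real pi * \<i>)) = exp (- of_real u + Z)"
    by (simp add: exp_add flip: add.assoc)
  ultimately show ?thesis by (simp add: F_strip assms F0_def algebra_simps)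
qed

section \<open>The phase on the imaginary axis\<close>

definition "Fr y = Im (F (\<i> * of_real y))" for y :: real

lemma G_axis: "G (\<i> * of_real y) = of_real (2 * cosh u - 2 * cos y)"
  by (simp add: complex_eq_iff Re_G Im_G)

lemma G_axis_pos: "2 * cosh u - 2 * cos y > 0" using cosh_u cos_le_one[of y] by linarith

lemma g_axis: "g (\<i> * of_real y) = of_real (ln (2 * cosh u - 2 * cos y))"
  unfolding g_def G_axis using G_axis_pos[of y] by (rule Ln_of_real)

lemma F_axis_vector_derivative:
  "((\<lambda>y. F (\<i> * of_real y)) has_vector_derivative \<i> * of_real (ln (2 * cosh u - 2 * cos y))) (at y)"
proof -
  have "((\<lambda>z. F (\<i> * z)) has_field_derivative g (\<i> * of_real y) * \<i>) (at (of_real y))"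
    by (rule DERIV_chain2[OF F_deriv]) (use axis_strip in \<open>auto intro!: derivative_eq_intros simp: dmn_def\<close>)
  from has_vector_derivative_real_field[OF this]
  show ?thesis by (simp add: g_axis mult.commute)
qed

lemma Fr_deriv: "(Fr has_real_derivative ln (2 * cosh u - 2 * cos y)) (at y)"
  using bounded_linear.has_vector_derivative[OF bounded_linear_Im F_axis_vector_derivative[of y]]
  unfolding Fr_def[abs_def] by (simp add: has_real_derivative_iff_has_vector_derivative)

lemma F_axis: "F (\<i> * of_real y) = \<i> * of_real (Fr y)"
proof -
  have d: "((\<lambda>y. Re (F (\<i> * of_real y))) has_real_derivative 0) (at y)" for y
    using bounded_linear.has_vector_derivative[OF bounded_linear_Re F_axis_vector_derivative[of y]]
    by (simp add: has_real_derivative_iff_has_vector_derivative)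
  have "Re (F (\<i> * of_real y)) = Re (F (\<i> * of_real 0))"
    using DERIV_isconst_all[of "\<lambda>y. Re (F (\<i> * of_real y))" y 0] d by blast
  thus ?thesis by (simp add: complex_eq_iff Fr_def F_zero)
qed

lemma Fr_zero: "Fr 0 = 0" by (simp add: Fr_def F_zero)

lemma Fr_period: "Fr (y + 2 * pi) = Fr y + 2 * pi * u"
  using F_period[OF axis_strip[of y]] by (simp add: Fr_def algebra_simps)

lemma Fr_period_nat: "Fr (y + 2 * pi * real n) = Fr y + 2 * pi * real n * u"
proof (induction n)
  case (Suc n)
  have "y + 2 * pi * real (Suc n) = (y + 2 * pi * real n) + 2 * pi" by (simp add: algebra_simps)
  thus ?case using Fr_period[of "y + 2 * pi * real n"] Suc by (simp add: algebra_simps)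
qed simp

text \<open>The function under the logarithm equals 1 exactly where cos y = cos \<theta>. So the
  phase falls within distance \<theta> of the multiples of 2 pi and rises elsewhere.\<close>

lemma ln_sign: "cos y < cos \<theta> \<Longrightarrow> ln (2 * cosh u - 2 * cos y) > 0" "cos y > cos \<theta> \<Longrightarrow> ln (2 * cosh u - 2 * cos y) < 0"
  using G_axis_pos[of y] \<theta>(1) by (auto simp: ln_gt_zero_iff ln_less_zero_iff)

lemma cos_gt: "\<bar>y\<bar> < \<theta> \<Longrightarrow> cos y > cos \<theta>"
proof -
  assume y: "\<bar>y\<bar> < \<theta>"
  have "cos \<theta> < cos \<bar>y\<bar>" using y \<theta> by (intro cos_monotone_0_pi) auto
  thus ?thesis by simp
qed

lemma cos_lt: "\<theta> < y \<Longrightarrow> y < 2 * pi - \<theta> \<Longrightarrow> cos y < cos \<theta>"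
proof -
  assume y: "\<theta> < y" "y < 2 * pi - \<theta>"
  show ?thesis
  proof (cases "y \<le> pi")
    case True
    thus ?thesis using y \<theta> by (intro cos_monotone_0_pi) auto
  next
    case False
    have "cos (2 * pi - y) < cos \<theta>" using False y \<theta> by (intro cos_monotone_0_pi) auto
    thus ?thesis by simp
  qed
qed

lemma Fr_cont: "continuous_on S Fr"
  using Fr_deriv DERIV_isCont continuous_at_imp_continuous_on by blast

lemma Fr_dec0: assumes "-\<theta> \<le> x" "x < y" "y \<le> \<theta>" shows "Fr y < Fr x"
  by (rule DERIV_neg_imp_decreasing_open[OF assms(2) _ Fr_cont])
    (use assms Fr_deriv ln_sign(2) cos_gt in \<open>force simp: abs_less_iff\<close>)

lemma Fr_inc0: assumes "\<theta> \<le> x" "x < y" "y \<le> 2 * pi - \<theta>" shows "Fr x < Fr y"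
  by (rule DERIV_pos_imp_increasing_open[OF assms(2) _ Fr_cont])
    (use assms Fr_deriv ln_sign(1) cos_lt in force)

lemma Fr_dec: assumes "2 * pi * real n - \<theta> \<le> x" "x < y" "y \<le> 2 * pi * real n + \<theta>" shows "Fr y < Fr x"
  using Fr_dec0[of "x - 2 * pi * real n" "y - 2 * pi * real n"] assms
    Fr_period_nat[of "x - 2 * pi * real n" n] Fr_period_nat[of "y - 2 * pi * real n" n] by simp

lemma Fr_inc: assumes "2 * pi * real n + \<theta> \<le> x" "x < y" "y \<le> 2 * pi * real n + 2 * pi - \<theta>" shows "Fr x < Fr y"
  using Fr_inc0[of "x - 2 * pi * real n" "y - 2 * pi * real n"] assms
    Fr_period_nat[of "x - 2 * pi * real n" n] Fr_period_nat[of "y - 2 * pi * real n" n] by simp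

text \<open>Periods are counted from \<theta>, a local minimum of the phase, so that each of them
  consists of one rise up to 2 pi (n + 1) - \<theta> and one fall.\<close>

lemma Fr_period_max:
  assumes "2 * pi * real n + \<theta> \<le> y" "y \<le> 2 * pi * real n + 2 * pi + \<theta>"
  shows "Fr y \<le> Fr (2 * pi * real n + 2 * pi - \<theta>)"
proof (cases "y < 2 * pi * real n + 2 * pi - \<theta>")
  case True
  thus ?thesis using Fr_inc[of n y "2 * pi * real n + 2 * pi - \<theta>"] assms by simp
next
  case False
  have "2 * pi * real (Suc n) = 2 * pi * real n + 2 * pi" by (simp add: algebra_simps)
  thus ?thesis using Fr_dec[of "Suc n" "2 * pi * real n + 2 * pi - \<theta>" y] assms False by fastforce
qed

lemma Fr_y0: "Fr y0 = Fr (2 * pi - \<theta>) + 2 * pi * (real p - 1) * u"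
proof -
  have "y0 = (2 * pi - \<theta>) + 2 * pi * real (p - 1)"
    using p_pos by (simp add: y0_def c_def of_nat_diff algebra_simps)
  thus ?thesis using Fr_period_nat[of "2 * pi - \<theta>" "p - 1"] p_pos by (simp add: of_nat_diff)
qed

text \<open>Before the first minimum the phase is at most 0, while at 2 pi - \<theta> it already
  exceeds Fr (2 pi) = 2 pi u. Afterwards y lies in a period with index n \<le> p - 2, whose maximum
  is lower than Fr y0 by at least 2 pi u. This gap pays for leaving the axis in
  \<open>H_low\<close>.\<close>

lemma Fr_low: assumes y: "0 \<le> y" "y < c - 2 * pi + \<theta>" shows "Fr y \<le> Fr y0 - 2 * pi * u"
proof (cases "y < \<theta>")
  case True
  have "Fr y \<le> 0" using Fr_dec0[of 0 y] y True \<theta> Fr_zero by (cases "y = 0") auto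
  moreover have "Fr (2 * pi) < Fr (2 * pi - \<theta>)" using Fr_dec[of 1 "2 * pi - \<theta>" "2 * pi"] \<theta> by simp
  moreover have "Fr (2 * pi) = 2 * pi * u" using Fr_period[of 0] Fr_zero by simp
  moreover have "2 * pi * (real p - 1) * u \<ge> 0" using p_ge_1 u_pos by simp
  ultimately show ?thesis unfolding Fr_y0 by linarith
next
  case False
  define n where "n = nat \<lfloor>(y - \<theta>) / (2 * pi)\<rfloor>"
  have "real n \<le> (y - \<theta>) / (2 * pi)" "(y - \<theta>) / (2 * pi) < real n + 1"
    unfolding n_def using False by (auto simp: of_nat_nat) 
  hence n: "2 * pi * real n + \<theta> \<le> y" "y \<le> 2 * pi * real n + 2 * pi + \<theta>"
    by (auto simp: field_simps)
  have "2 * pi * real n < 2 * pi * (real p - 1)" using n y by (simp add: c_def algebra_simps)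
  hence "real (n + 1) < real p" by simp
  hence "n + 2 \<le> p" by (simp only: of_nat_less_iff)
  hence "real (n + 2) \<le> real p" by (simp only: of_nat_le_iff)
  hence np: "real n \<le> real p - 2" by simp
  have "Fr y \<le> Fr (2 * pi * real n + 2 * pi - \<theta>)" by (rule Fr_period_max[OF n])
  also have "\<dots> = Fr (2 * pi - \<theta>) + 2 * pi * real n * u"
    using Fr_period_nat[of "2 * pi - \<theta>" n] by (simp add: algebra_simps)
  also have "\<dots> \<le> Fr (2 * pi - \<theta>) + 2 * pi * (real p - 2) * u"
    using np u_pos by (intro add_left_mono mult_right_mono mult_left_mono) auto
  also have "\<dots> = Fr y0 - 2 * pi * u" unfolding Fr_y0 by (simp add: algebra_simps)
  finally show ?thesis .
qed

lemma Fr_y0_max: assumes "0 \<le> y" "y \<le> c" shows "Fr y \<le> Fr y0"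
proof (cases "y < c - 2 * pi + \<theta>")
  case True
  have "2 * pi * u \<ge> 0" using u_pos by simp
  thus ?thesis using Fr_low[OF assms(1) True] by linarith
next
  case False
  have "2 * pi * real (p - 1) = c - 2 * pi" using p_pos by (simp add: c_def of_nat_diff algebra_simps)
  thus ?thesis using Fr_period_max[of "p - 1" y] False assms \<theta> by (simp add: y0_def)
qed

text \<open>In the last period the phase is monotone on either side of y0, so its values at the ends
  of a neighbourhood bound it outside. Lower heights are covered by the gap of a full
  period.\<close>

lemma Fr_y0_strict: assumes "\<delta> > 0"
  shows "\<exists>\<kappa>>0. \<forall>y\<in>{0..c}. \<bar>y - y0\<bar> \<ge> \<delta> \<longrightarrow> Fr y \<le> Fr y0 - \<kappa>"
proof -
  have e: "2 * pi * real (p - 1) = c - 2 * pi" using p_pos by (simp add: c_def of_nat_diff algebra_simps)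
  define b where "b = c - 2 * pi + \<theta>"
  have by0: "b < y0" unfolding b_def y0_def using \<theta> pi_gt_zero by linarith
  define yl where "yl = max b (y0 - \<delta>)"
  define yr where "yr = min c (y0 + \<delta>)"
  have yl: "b \<le> yl" "yl < y0" using by0 assms by (auto simp: yl_def)
  have yr: "y0 < yr" "yr \<le> c" using y0_bounds assms by (auto simp: yr_def)
  have inc: "Fr x < Fr y" if "b \<le> x" "x < y" "y \<le> y0" for x y
    using Fr_inc[of "p - 1" x y] that e by (simp add: b_def y0_def)
  have dec: "Fr y < Fr x" if "y0 \<le> x" "x < y" "y \<le> c" for x y
    using Fr_dec[of p x y] that \<theta> by (simp add: c_def y0_def)
  define \<kappa> where "\<kappa> = min (2 * pi * u) (min (Fr y0 - Fr yl) (Fr y0 - Fr yr))"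
  have "\<kappa> > 0" unfolding \<kappa>_def using u_pos inc[OF yl(1,2)] dec[OF _ yr(1,2)] by simp
  moreover have "Fr y \<le> Fr y0 - \<kappa>" if y: "y \<in> {0..c}" "\<bar>y - y0\<bar> \<ge> \<delta>" for y
  proof -
    consider "y < b" | "b \<le> y" "y \<le> yl" | "yr \<le> y" using y yl yr unfolding yl_def yr_def by fastforce
    thus ?thesis
    proof cases
      case 1
      thus ?thesis using Fr_low[of y] y unfolding b_def \<kappa>_def by auto
    next
      case 2
      hence "Fr y \<le> Fr yl" using inc[of y yl] yl by (cases "y = yl") auto
      thus ?thesis unfolding \<kappa>_def by linarith
    next
      case 3
      hence "Fr y \<le> Fr yr" using dec[of yr y] yr y by (cases "y = yr") auto
      thus ?thesis unfolding \<kappa>_def by linarith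
    qed
  qed
  ultimately show ?thesis by blast
qed

end

section \<open>The terms of the Jones sum\<close>

text \<open>One factor q^(-N) goes into each factor of the product: q^(-N) (1 - q^(N+l)) (1 -
  q^(N-l)) = q^N + q^(-N) - q^l - q^(-l). For q = exp (\<xi> / N) the first two terms become 2 cosh
  u, since exp \<xi> = exp u.\<close>

lemma colored_Jones_fig8_exp:
  "colored_Jones_fig8 N (exp w) = (\<Sum>k<N. \<Prod>l=1..k. exp (of_nat N * w) + exp (- (of_nat N * w)) - exp (of_nat l * w)
      - exp (- (of_nat l * w)))"
  unfolding colored_Jones_fig8_def
proof (rule sum.cong[OF refl])
  fix k assume "k \<in> {..<N}"
  have pw: "exp w powi m = exp (of_int m * w)" for m
    by (cases m rule: int_cases2) (simp_all add: power_int_minus exp_minus flip: exp_of_nat_mult)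
  have "exp w powi (- (int k * int N)) = (\<Prod>l=1..k. exp (- (of_nat N * w)))"
    by (simp add: pw flip: exp_of_nat_mult) (simp add: mult_ac)
  hence "exp w powi (- (int k * int N)) * (\<Prod>l=1..k. (1 - exp w powi (int N + int l)) * (1 - exp w powi (int N - int l)))
     = (\<Prod>l=1..k. exp (- (of_nat N * w)) * ((1 - exp w powi (int N + int l)) * (1 - exp w powi (int N - int l))))"
    by (simp add: prod.distrib)
  also have "\<dots> = (\<Prod>l=1..k. exp (of_nat N * w) + exp (- (of_nat N * w)) - exp (of_nat l * w) - exp (- (of_nat l * w)))"
  proof (rule prod.cong[OF refl])
    fix l
    define X Y where "X = exp (of_nat N * w)" and "Y = exp (of_nat l * w)"
    have nz: "X \<noteq> 0" "Y \<noteq> 0" by (auto simp: X_def Y_def)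
    have "exp w powi (int N + int l) = X * Y" "exp w powi (int N - int l) = X / Y"
      by (simp_all add: pw X_def Y_def distrib_right left_diff_distrib exp_add exp_diff)
    moreover have "inverse X * ((1 - X * Y) * (1 - X / Y)) = X + inverse X - Y - inverse Y"
      using nz by (simp add: field_simps)
    ultimately show "exp (- (of_nat N * w)) * ((1 - exp w powi (int N + int l)) * (1 - exp w powi (int N - int l)))
       = exp (of_nat N * w) + exp (- (of_nat N * w)) - exp (of_nat l * w) - exp (- (of_nat l * w))"
      by (simp add: exp_minus X_def Y_def)
  qed
  finally show "exp w powi (- (int k * int N)) * (\<Prod>l=1..k. (1 - exp w powi (int N + int l)) * (1 - exp w powi (int N
      - int l)))
     = (\<Prod>l=1..k. exp (of_nat N * w) + exp (- (of_nat N * w)) - exp (of_nat l * w) - exp (- (of_nat l * w)))" .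
qed

text \<open>Normalized by its leading exponential, the invariant is a polynomial in \<open>exp (- w)\<close> with constant term 1.\<close>

lemma colored_Jones_fig8_leading:
  assumes p: "p > 0"
  shows "\<exists>C. \<forall>w. 0 \<le> Re w \<longrightarrow> norm (colored_Jones_fig8 p (exp w) * exp (- (of_nat (p * (p - 1)) * w)) - 1)
      \<le> C * exp (- Re w)"
proof -
  define Q where "Q = (\<lambda>x::complex. \<Sum>k<p. x ^ (p * (p - 1 - k)) * (\<Prod>l=1..k. 1 + x ^ (2 * p) - x ^ (p - l) - x ^ (p
      + l)))"
  have Q0: "Q 0 = 1"
  proof -
    have "Q 0 = (\<Sum>k<p. if k = p - 1 then 1 else 0)"
      unfolding Q_def using p by (intro sum.cong refl) (auto simp: power_0_left intro!: prod.neutral)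
    thus ?thesis using p by simp
  qed
  have Qexp: "colored_Jones_fig8 p (exp w) * exp (- (of_nat (p * (p - 1)) * w)) = Q (exp (- w))" for w
  proof -
    define x where "x = exp (- w)"
    have x0: "x \<noteq> 0" by (simp add: x_def)
    have e: "exp (- (of_nat n * w)) = x ^ n" for n by (simp add: x_def flip: exp_of_nat_mult)
    have e': "exp (of_nat n * w) = inverse (x ^ n)" for n
      unfolding e[symmetric] by (simp add: exp_minus)
    have "colored_Jones_fig8 p (exp w) * x ^ (p * (p - 1)) = Q x"
      unfolding colored_Jones_fig8_exp Q_def sum_distrib_right
    proof (rule sum.cong[OF refl])
      fix k assume k: "k \<in> {..<p}"
      have t: "exp (of_nat p * w) + exp (- (of_nat p * w)) - exp (of_nat l * w) - exp (- (of_nat l * w))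
         = inverse (x ^ p) * (1 + x ^ (2 * p) - x ^ (p - l) - x ^ (p + l))" if l: "l \<in> {1..k}" for l
      proof -
        have "x ^ p = x ^ l * x ^ (p - l)" using l k by (simp flip: power_add)
        hence "inverse (x ^ p) * x ^ (p - l) = inverse (x ^ l)" using x0 by (simp add: field_simps)
        moreover have "inverse (x ^ p) * x ^ (2 * p) = x ^ p" "inverse (x ^ p) * x ^ (p + l) = x ^ l"
          using x0 by (simp_all add: power_add power_mult power2_eq_square mult.commute[of 2] power_mult_distrib)
        ultimately show ?thesis unfolding e e' by (simp add: distrib_left right_diff_distrib)
      qed
      have "(\<Prod>l=1..k. exp (of_nat p * w) + exp (- (of_nat p * w)) - exp (of_nat l * w) - exp (- (of_nat l * w)))
        = (\<Prod>l=1..k. inverse (x ^ p) * (1 + x ^ (2 * p) - x ^ (p - l) - x ^ (p + l)))"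
        by (rule prod.cong[OF refl t])
      also have "\<dots> = inverse (x ^ p) ^ k * (\<Prod>l=1..k. 1 + x ^ (2 * p) - x ^ (p - l) - x ^ (p + l))"
        by (simp add: prod.distrib)
      also have "inverse (x ^ p) ^ k = inverse (x ^ (p * k))" by (simp add: power_inverse power_mult)
      finally have "(\<Prod>l=1..k. exp (of_nat p * w) + exp (- (of_nat p * w)) - exp (of_nat l * w) - exp (- (of_nat l
          * w))) * x ^ (p * (p - 1))
        = (inverse (x ^ (p * k)) * x ^ (p * (p - 1))) * (\<Prod>l=1..k. 1 + x ^ (2 * p) - x ^ (p - l) - x ^ (p + l))"
        by simp
      also have "inverse (x ^ (p * k)) * x ^ (p * (p - 1)) = x ^ (p * (p - 1 - k))"
      proof -
        have "p * (p - 1) = p * k + p * (p - 1 - k)" using k by (simp flip: distrib_left)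
        thus ?thesis using x0 by (simp add: power_add)
      qed
      finally show "(\<Prod>l=1..k. exp (of_nat p * w) + exp (- (of_nat p * w)) - exp (of_nat l * w) - exp (- (of_nat l
          * w))) * x ^ (p * (p - 1))
        = x ^ (p * (p - 1 - k)) * (\<Prod>l=1..k. 1 + x ^ (2 * p) - x ^ (p - l) - x ^ (p + l))" .
    qed
    thus ?thesis unfolding e x_def[symmetric] .
  qed
  have hol: "Q holomorphic_on UNIV" unfolding Q_def by (intro holomorphic_intros)
  have "continuous_on (cball 0 1) (deriv Q)"
    by (intro holomorphic_on_imp_continuous_on holomorphic_on_subset[OF holomorphic_deriv[OF hol]]) auto
  hence "bounded (deriv Q ` cball 0 1)" by (intro compact_imp_bounded compact_continuous_image) auto
  then obtain C where C: "\<And>x. x \<in> cball 0 1 \<Longrightarrow> norm (deriv Q x) \<le> C" by (metis bounded_iff imageI)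
  have bound: "norm (Q x - Q 0) \<le> C * norm (x - 0)" if "norm x \<le> 1" for x
  proof (rule field_differentiable_bound[of "cball 0 1"])
    show "(Q has_field_derivative deriv Q z) (at z within cball 0 1)" for z
      by (rule has_field_derivative_at_within[OF holomorphic_derivI[OF hol]]) auto
  qed (use C that in auto)
  have "norm (Q (exp (- w)) - 1) \<le> C * exp (- Re w)" if "0 \<le> Re w" for w
    using bound[of "exp (- w)"] that by (simp add: Q0)
  thus ?thesis unfolding Qexp by blast
qed

section \<open>Growth of the terms\<close>

context fig8 begin

definition "hN N = \<xi> / of_nat N" for N :: nat
definition "f N k = (\<Prod>l=1..k. G (of_nat l * hN N))" for N k :: nat
definition "\<rho> = (norm \<xi>)\<^sup>2"
text \<open>\<open>H\<close> is |\<xi>|^2 times the real part of F / \<xi>, so |exp (F / h)| = exp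
  (N H / \<rho>). \<open>M\<close> is its value at the saddle point. \<open>B\<close> bounds its
  derivative in the horizontal direction for |Re Z| \<le> 3 u, where Re g \<le> 4 and Im g \<le>
  pi.\<close>

definition "H Z = u * Re (F Z) + c * Im (F Z)" for Z
definition "M = c * Fr y0"
definition "B = 4 * u + pi * c"

lemma \<rho>: "\<rho> = u\<^sup>2 + c\<^sup>2" "\<rho> > 0"
proof -
  show "\<rho> = u\<^sup>2 + c\<^sup>2" by (simp add: \<rho>_def cmod_power2)
  show "\<rho> > 0" using \<xi>_nonzero by (simp add: \<rho>_def)
qed

lemma hN_simps: assumes "N > 0"
  shows "Re (hN N) = u / N" "Im (hN N) = c / N" "norm (hN N) = norm \<xi> / N" "hN N \<noteq> 0" "of_nat N * hN N = \<xi>"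
  using assms \<xi>_nonzero by (simp_all add: hN_def norm_divide)

lemma Complex_split: "Complex s y = of_real s + \<i> * of_real y" by (simp add: complex_eq_iff)

lemma Re_div_h: "N > 0 \<Longrightarrow> Re (F Z / hN N) = real N * H Z / \<rho>"
  by (simp add: hN_def H_def \<rho> Re_divide power2_eq_square algebra_simps)

lemma exp_\<xi>: "exp \<xi> = of_real (exp u)"
proof -
  have "sin c = 0" "cos c = 1"
    unfolding c_def using sin_npi2[of "2 * p"] cos_npi2[of "2 * p"] by (simp_all add: mult_ac)
  thus ?thesis by (simp add: complex_eq_iff Re_exp Im_exp)
qed

lemma sin_cos_c: "sin c = 0" "cos c = 1"
  unfolding c_def using sin_npi2[of "2 * p"] cos_npi2[of "2 * p"] by (simp_all add: mult_ac)

lemma colored_Jones_eq: "N > 0 \<Longrightarrow> colored_Jones_fig8 N (exp (\<xi> / of_nat N)) = (\<Sum>k<N. f N k)"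
proof -
  assume N: "N > 0"
  have "exp \<xi> + exp (- \<xi>) = of_real (2 * cosh u)"
    by (simp add: exp_minus exp_\<xi> cosh_def)
  thus ?thesis using N unfolding colored_Jones_fig8_exp f_def G_def by (simp add: hN_def)
qed

lemma c_bounds: "pi * c > 18" "4 * u < pi * c" "12 * u < pi * c"
proof -
  have "3 * 6 < pi * c" using pi_gt3 c_ge by (intro mult_strict_mono) auto
  thus "pi * c > 18" by simp
  thus "4 * u < pi * c" "12 * u < pi * c" using u_less_1 by linarith+
qed

lemma norm_G_le: assumes "\<bar>Re Z\<bar> \<le> 3 * u" shows "norm (G Z) \<le> exp 4"
proof -
  have s: "\<bar>Re Z\<bar> \<le> 3" using assms u_less_1 by linarith
  have "norm (G Z) \<le> norm (of_real (2 * cosh u) - exp Z :: complex) + norm (exp (- Z))"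
    unfolding G_def by (rule norm_triangle_ineq4)
  also have "\<dots> \<le> norm (of_real (2 * cosh u) :: complex) + norm (exp Z) + norm (exp (- Z))"
    by (intro add_right_mono norm_triangle_ineq4)
  also have "\<dots> = 2 * cosh u + (exp (Re Z) + exp (- Re Z))" using cosh_u by simp
  also have "exp (Re Z) + exp (- Re Z) = exp \<bar>Re Z\<bar> + exp (- \<bar>Re Z\<bar>)" by (simp add: abs_if)
  also have "\<dots> \<le> exp 3 + 1" using s by (intro add_mono) auto
  also have "2 * cosh u + (exp 3 + 1) \<le> 4 + exp 3" using cosh_u by linarith
  also have "\<dots> \<le> exp 3 * 2" using exp_ge_add_one_self[of "3 :: real"] by simp
  also have "\<dots> \<le> exp 3 * exp 1" using exp_ge_add_one_self[of "1 :: real"] by (intro mult_left_mono) auto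
  also have "\<dots> = exp (4 :: real)" by (simp flip: exp_add)
  finally show ?thesis by simp
qed

lemma H_deriv: assumes "Complex s y \<in> dmn"
  shows "((\<lambda>s. H (Complex s y)) has_real_derivative (u * Re (g (Complex s y)) + c * Im (g (Complex s y)))) (at s)"
proof -
  have "((\<lambda>z. F (z + \<i> * of_real y)) has_field_derivative g (of_real s + \<i> * of_real y) * 1) (at (of_real s))"
    by (rule DERIV_chain2[OF F_deriv]) (use assms in \<open>auto intro!: derivative_eq_intros simp: Complex_split\<close>)
  from has_vector_derivative_real_field[OF this]
  have v: "((\<lambda>s. F (Complex s y)) has_vector_derivative g (Complex s y)) (at s)"
    by (simp add: Complex_split)
  have "((\<lambda>s. Re (F (Complex s y))) has_real_derivative Re (g (Complex s y))) (at s)"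
    "((\<lambda>s. Im (F (Complex s y))) has_real_derivative Im (g (Complex s y))) (at s)"
    using bounded_linear.has_vector_derivative[OF bounded_linear_Re v] bounded_linear.has_vector_derivative[OF
        bounded_linear_Im v]
    by (simp_all add: has_real_derivative_iff_has_vector_derivative)
  thus ?thesis unfolding H_def by (intro DERIV_add DERIV_cmult)
qed

lemma g_bound: assumes "Z \<in> dmn" "\<bar>Re Z\<bar> \<le> 3 * u" shows "u * Re (g Z) + c * Im (g Z) \<le> B"
proof -
  have G0: "norm (G Z) > 0" using G_nonzero[OF assms(1)] by simp
  have "Re (g Z) = ln (norm (G Z))" unfolding g_def using G_nonzero[OF assms(1)] by simp
  also have "\<dots> \<le> 4" using norm_G_le[OF assms(2)] G0 by (metis ln_exp ln_le_cancel_iff exp_gt_zero)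
  finally have "u * Re (g Z) \<le> u * 4" using u_pos by (intro mult_left_mono) auto
  moreover have "c * Im (g Z) \<le> c * pi"
    unfolding g_def using Im_Ln_le_pi[OF G_nonzero[OF assms(1)]] c_pos by (intro mult_left_mono) auto
  ultimately show ?thesis by (simp add: B_def mult_ac)
qed

lemma H_horizontal:
  assumes s: "s1 \<le> s2" "- (3 * u) \<le> s1" "s2 \<le> 3 * u" and d: "\<And>s. s1 \<le> s \<Longrightarrow> s \<le> s2 \<Longrightarrow> Complex s y \<in> dmn"
  shows "H (Complex s2 y) \<le> H (Complex s1 y) + B * (s2 - s1)"
proof -
  have "H (Complex s2 y) - B * s2 \<le> H (Complex s1 y) - B * s1"
  proof (rule DERIV_nonpos_imp_nonincreasing[OF s(1)])
    fix x assume x: "s1 \<le> x" "x \<le> s2"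
    have "((\<lambda>s. H (Complex s y) - B * s) has_real_derivative (u * Re (g (Complex x y)) + c * Im (g (Complex x y))
        - B)) (at x)"
      by (auto intro!: derivative_eq_intros H_deriv d x)
    moreover have "u * Re (g (Complex x y)) + c * Im (g (Complex x y)) - B \<le> 0"
      using g_bound[OF d[OF x]] x s by auto
    ultimately show "\<exists>D. ((\<lambda>s. H (Complex s y) - B * s) has_real_derivative D) (at x) \<and> D \<le> 0" by blast
  qed
  thus ?thesis by (simp add: algebra_simps)
qed

lemma H_axis: "H (Complex 0 y) = c * Fr y"
  using F_axis[of y] by (simp add: H_def Complex_split)

lemma Complex_strip: "\<bar>s\<bar> < u \<Longrightarrow> Complex s y \<in> strip" by (auto simp: strip_def)
lemma Complex_window: "c - 2 * pi < y \<Longrightarrow> y < c \<Longrightarrow> Complex s y \<in> window" by (simp add: window_def)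
lemma strip_dmn: "Z \<in> strip \<Longrightarrow> Z \<in> dmn" by (simp add: dmn_def)
lemma window_dmn: "Z \<in> window \<Longrightarrow> Z \<in> dmn" by (simp add: dmn_def)

text \<open>Lying below the last period costs 2 pi u in the phase, hence 2 pi u c in
  \<open>H\<close>; a horizontal displacement of at most u wins back no more than B u.\<close>

definition "\<epsilon>0 = u * (2 * pi * c - B)"

lemma \<epsilon>0_pos: "\<epsilon>0 > 0" unfolding \<epsilon>0_def B_def using u_pos c_bounds by simp

lemma H_low: assumes "0 \<le> s" "s < u" "0 \<le> y" "y < c - 2 * pi + \<theta>" shows "H (Complex s y) \<le> M - \<epsilon>0"
proof -
  have "H (Complex s y) \<le> H (Complex 0 y) + B * (s - 0)"
    by (rule H_horizontal) (use assms u_pos in \<open>auto intro!: strip_dmn Complex_strip\<close>)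
  also have "H (Complex 0 y) = c * Fr y" by (rule H_axis)
  also have "c * Fr y \<le> c * (Fr y0 - 2 * pi * u)" using Fr_low[OF assms(3,4)] c_pos by (intro mult_left_mono) auto
  also have "B * (s - 0) \<le> B * u" using assms u_pos c_pos by (intro mult_left_mono) (auto simp: B_def)
  finally show ?thesis by (simp add: M_def \<epsilon>0_def algebra_simps)
qed

text \<open>At height c the value of \<open>G\<close> is real and, for |x| < u, strictly between 0
  and 1. So Im g = 0 and Re g < 0, and \<open>H\<close> decreases to the right.\<close>

lemma H_top_line: assumes "0 \<le> s" "s < u" shows "H (Complex s c) \<le> H (Complex 0 c)"
proof (rule DERIV_nonpos_imp_nonincreasing[OF assms(1)])
  fix x assume x: "0 \<le> x" "x \<le> s"
  define q where "q = 2 * cosh u - (exp x + exp (- x))"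
  have Gx: "G (Complex x c) = of_real q"
    by (simp add: complex_eq_iff Re_G Im_G sin_cos_c q_def)
  have q0: "q > 0" using exp_sum_less[of x] x assms by (simp add: q_def)
  have "exp x + exp (- x) \<ge> 2" using cosh_real_ge_1[of x] by (simp add: cosh_def)
  hence q1: "q < 1" using cosh_u by (simp add: q_def)
  have "g (Complex x c) = of_real (ln q)" unfolding g_def Gx using q0 by (rule Ln_of_real)
  hence "u * Re (g (Complex x c)) + c * Im (g (Complex x c)) \<le> 0"
    using q0 q1 u_pos by (simp add: mult_nonneg_nonpos)
  thus "\<exists>D. ((\<lambda>s. H (Complex s c)) has_real_derivative D) (at x) \<and> D \<le> 0"
    by (intro exI[of _ "u * Re (g (Complex x c)) + c * Im (g (Complex x c))"] conjI H_deriv strip_dmn Complex_strip)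
      (use x assms in auto)
qed

lemma F_cont: "continuous_on dmn F"
  using F_deriv by (meson DERIV_isCont continuous_at_imp_continuous_on)

lemma H_cont: "S \<subseteq> dmn \<Longrightarrow> continuous_on S H"
  unfolding H_def by (intro continuous_intros continuous_on_subset[OF F_cont])

text \<open>The corner with real part u and height c is \<xi>, a zero of \<open>G\<close>, and lies
  outside the domain of \<open>F\<close>. Compactness is therefore used for s \<le> u - e only, and
  on the remaining piece \<open>H\<close> grows by at most B e \<le> \<kappa>. Of the gap M - H
  (Complex 0 c) = 3 \<kappa>, one third goes to uniform continuity, one third to that piece, and one
  third survives.\<close>

lemma H_top: "\<exists>\<delta>>0. \<exists>\<epsilon>>0. \<delta> \<le> \<theta> / 2 \<and> (\<forall>y s. c - \<delta> \<le> y \<longrightarrow> y \<le> c \<longrightarrow> 0 \<le> s \<longrightarrow> s < u \<longrightarrow> H (Complex s y) \<le> M - \<epsilon>)"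
proof -
  define \<kappa> where "\<kappa> = (M - H (Complex 0 c)) / 3"
  have "Fr c < Fr y0" using Fr_dec[of p y0 c] \<theta> by (simp add: y0_def c_def)
  hence \<kappa>: "\<kappa> > 0" using c_pos by (simp add: \<kappa>_def M_def H_axis)
  have B0: "B > 0" using u_pos c_pos by (simp add: B_def add_pos_pos)
  define e where "e = min (u / 2) (\<kappa> / B)"
  have e: "0 < e" "e < u" "B * e \<le> \<kappa>" using u_pos \<kappa> B0 by (auto simp: e_def min_def field_simps)
  define K where "K = cbox (Complex 0 (c - 1)) (Complex (u - e) c)"
  have Ks: "K \<subseteq> dmn" using e by (auto simp: K_def in_cbox_complex_iff dmn_def strip_def)
  have "uniformly_continuous_on K H"
    by (intro compact_uniformly_continuous H_cont Ks) (simp add: K_def)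
  then obtain d where d: "d > 0" "\<And>x x'. x \<in> K \<Longrightarrow> x' \<in> K \<Longrightarrow> dist x' x < d \<Longrightarrow> dist (H x') (H x) < \<kappa>"
    using \<kappa> unfolding uniformly_continuous_on_def by blast
  define \<delta> where "\<delta> = min (min (d / 2) 1) (\<theta> / 2)"
  have \<delta>: "\<delta> > 0" "\<delta> < d" "\<delta> \<le> 1" "\<delta> \<le> \<theta> / 2" using d \<theta> by (auto simp: \<delta>_def)
  have A: "H (Complex s y) \<le> M - 2 * \<kappa>" if "c - \<delta> \<le> y" "y \<le> c" "0 \<le> s" "s \<le> u - e" for s y
  proof -
    have "Complex s y - Complex s c = \<i> * of_real (y - c)" by (simp add: complex_eq_iff)
    hence "dist (Complex s y) (Complex s c) = \<bar>y - c\<bar>" by (simp add: dist_norm norm_mult del: of_real_diff)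
    hence "dist (H (Complex s y)) (H (Complex s c)) < \<kappa>"
      using that \<delta> e by (intro d(2)) (auto simp: K_def in_cbox_complex_iff)
    hence "H (Complex s y) \<le> H (Complex s c) + \<kappa>" by (simp add: dist_real_def)
    also have "H (Complex s c) \<le> H (Complex 0 c)" using that e by (intro H_top_line) auto
    also have "H (Complex 0 c) = M - 3 * \<kappa>" by (simp add: \<kappa>_def field_simps)
    finally show ?thesis by simp
  qed
  have "H (Complex s y) \<le> M - \<kappa>" if y: "c - \<delta> \<le> y" "y \<le> c" and s: "0 \<le> s" "s < u" for s y
  proof (cases "s \<le> u - e")
    case True
    thus ?thesis using A[OF y s(1) True] \<kappa> by linarith
  next
    case False
    have "H (Complex s y) \<le> H (Complex (u - e) y) + B * (s - (u - e))"
      by (rule H_horizontal) (use False s e in \<open>auto intro!: strip_dmn Complex_strip\<close>)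
    also have "B * (s - (u - e)) \<le> B * e" using B0 s by (intro mult_left_mono) auto
    also have "H (Complex (u - e) y) \<le> M - 2 * \<kappa>" using e by (intro A y) auto
    finally show ?thesis using e by linarith
  qed
  thus ?thesis using \<delta> \<kappa> by blast
qed

text \<open>\<open>G\<close> vanishes at \<xi>, so the last factors of the product have modulus at
  most 1 and the terms stop growing. This controls the end of the sum, where \<open>g\<close>
  becomes singular and no expansion of the terms is available.\<close>

lemma G_tail: "\<exists>\<eta>>0. \<forall>x. \<bar>x - 1\<bar> < \<eta> \<longrightarrow> norm (G (of_real x * \<xi>)) \<le> 1"
proof -
  have "isCont (\<lambda>x. G (of_real x * \<xi>)) 1" unfolding G_def by (intro continuous_intros)
  then obtain d where d: "d > 0" "\<And>x. x \<noteq> 1 \<Longrightarrow> \<bar>x - 1\<bar> < d \<Longrightarrow> norm (G (of_real x * \<xi>) - G (of_real 1 * \<xi>)) < 1"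
    unfolding isCont_def LIM_def dist_norm real_norm_def by (metis zero_less_one)
  have G1: "G (of_real 1 * \<xi>) = 0" by (simp add: G_def exp_minus exp_\<xi> cosh_def add_divide_distrib)
  have "norm (G (of_real x * \<xi>)) \<le> 1" if "\<bar>x - 1\<bar> < d" for x
  proof (cases "x = 1")
    case False
    thus ?thesis using d(2)[OF False that] unfolding G1 by simp
  qed (use G1 in simp)
  thus ?thesis using d(1) by blast
qed

text \<open>The restriction to k \<le> \<beta> N with \<beta> < 1 keeps the points k h in a compact
  segment of the strip, away from the zero \<xi> of \<open>G\<close>, so that the second derivative
  of \<open>g\<close> is bounded there.\<close>

lemma trapezoid:
  assumes \<beta>: "0 < \<beta>" "\<beta> < 1"
  shows "\<exists>C\<ge>0. \<forall>N>0. \<forall>k. real k \<le> \<beta> * real N \<longrightarrow>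
     (\<exists>e. norm e \<le> C / real N \<and> f N k = exp (F (of_nat k * hN N) / hN N + (g (of_nat k * hN N) - g 0) / 2 + e))"
proof -
  define T where "T = closed_segment 0 (of_real \<beta> * \<xi>)"
  have "0 \<in> strip" "of_real \<beta> * \<xi> \<in> strip"
    using u_pos \<beta> mult_strict_right_mono[OF \<beta>(2) u_pos] mult_pos_pos[OF \<beta>(1) u_pos] by (auto simp: strip_def)
  hence Ts: "T \<subseteq> strip" unfolding T_def using convex_strip by (intro closed_segment_subset)
  have gs: "g holomorphic_on strip" by (rule holomorphic_on_subset[OF g_holo]) (auto simp: dmn_def)
  have g1s: "deriv g holomorphic_on strip" and g2s: "deriv (deriv g) holomorphic_on strip"
    using holomorphic_deriv[OF _ open_strip] gs by blast+
  have "bounded (deriv (deriv g) ` T)"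
    by (intro compact_imp_bounded compact_continuous_image continuous_on_subset[OF holomorphic_on_imp_continuous_on[OF
        g2s] Ts])
      (auto simp: T_def)
  then obtain D where D: "\<And>x. x \<in> T \<Longrightarrow> norm (deriv (deriv g) x) \<le> D" by (metis bounded_iff imageI)
  have "0 \<in> T" by (simp add: T_def)
  hence D0: "D \<ge> 0" using order_trans[OF norm_ge_zero D] by blast
  show ?thesis
  proof (intro exI[of _ "D * \<rho>"] conjI allI impI)
    show "D * \<rho> \<ge> 0" using D0 \<rho> by simp
    fix N k :: nat assume N: "N > 0" and k: "real k \<le> \<beta> * real N"
    note h = hN_simps[OF N]
    have mem: "of_nat l * hN N \<in> T" if "l \<le> k" for l
    proof -
      have "real l / (\<beta> * real N) \<le> 1" using that k \<beta> N by (simp add: field_simps)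
      moreover have "of_nat l * hN N = (real l / (\<beta> * real N)) *\<^sub>R (of_real \<beta> * \<xi>)"
        using \<beta> N by (simp add: hN_def scaleR_conv_of_real)
      ultimately show ?thesis unfolding T_def in_segment
        using \<beta> by (intro exI[of _ "real l / (\<beta> * real N)"]) auto
    qed
    define e where "e = (\<Sum>l=1..k. g (of_nat l * hN N)) - (F (of_nat k * hN N) - F 0) / hN N - (g (of_nat k * hN N)
        - g 0) / 2"
    have "norm e \<le> real k * (D * (norm (hN N))\<^sup>2)"
      unfolding e_def
    proof (rule trapezoid_sum[of T])
      show "convex T" by (simp add: T_def)
      fix x assume "x \<in> T"
      hence x: "x \<in> strip" using Ts by blast
      show "(F has_field_derivative g x) (at x)" using x by (intro F_deriv strip_dmn)
      show "(g has_field_derivative deriv g x) (at x)" by (rule holomorphic_derivI[OF gs open_strip x])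
      show "(deriv g has_field_derivative deriv (deriv g) x) (at x)" by (rule holomorphic_derivI[OF g1s open_strip x])
    qed (use mem h D in auto)
    also have "\<dots> \<le> real N * (D * (norm (hN N))\<^sup>2)"
    proof (intro mult_right_mono)
      have "\<beta> * real N \<le> 1 * real N" using \<beta> by (intro mult_right_mono) auto
      thus "real k \<le> real N" using k by simp
    qed (use D0 in auto)
    also have "\<dots> = D * \<rho> / real N" using N by (simp add: h \<rho>_def power_divide power2_eq_square field_simps)
    finally have e: "norm e \<le> D * \<rho> / real N" .
    have "f N k = (\<Prod>l=1..k. exp (g (of_nat l * hN N)))"
      unfolding f_def using mem Ts by (intro prod.cong refl exp_g[symmetric] strip_dmn) auto
    also have "\<dots> = exp (\<Sum>l=1..k. g (of_nat l * hN N))" by (simp add: exp_sum)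
    also have "(\<Sum>l=1..k. g (of_nat l * hN N)) = F (of_nat k * hN N) / hN N + (g (of_nat k * hN N) - g 0) / 2 + e"
      by (simp add: e_def F_zero)
    finally show "\<exists>e. norm e \<le> D * \<rho> / real N \<and> f N k = exp (F (of_nat k * hN N) / hN N + (g (of_nat k * hN N)
        - g 0) / 2 + e)"
      using e by blast
  qed
qed

lemma norm_exp_half_g: assumes "Z \<in> dmn" "\<bar>Re Z\<bar> \<le> 3 * u" shows "norm (exp (g Z / 2)) \<le> exp 2"
proof -
  have "Re (g Z) = ln (norm (G Z))" unfolding g_def using G_nonzero[OF assms(1)] by simp
  also have "\<dots> \<le> 4" using norm_G_le[OF assms(2)] G_nonzero[OF assms(1)]
      by (metis ln_exp ln_le_cancel_iff exp_gt_zero zero_less_norm_iff)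
  finally show ?thesis by simp
qed

text \<open>The origin of the prefactor 1 / (2 sinh (u / 2)): it is the boundary term of the
  trapezoidal rule at 0, where G 0 = 2 cosh u - 2 = (2 sinh (u / 2))^2.\<close>

lemma exp_half_g0: "exp (- (g 0 / 2)) = of_real (1 / (2 * sinh (u / 2)))"
proof -
  have s: "sinh (u / 2) > 0" using u_pos by simp
  have "2 * cosh u - 2 * cos 0 = (2 * sinh (u / 2))\<^sup>2"
    using cosh_double[of "u / 2"] cosh_square_eq[of "u / 2"] by (simp add: power_mult_distrib)
  hence "ln (2 * cosh u - 2 * cos 0) = ln ((2 * sinh (u / 2))\<^sup>2)" by (simp only:)
  also have "\<dots> = 2 * ln (2 * sinh (u / 2))" by (subst ln_realpow) (use s in auto)
  finally have "ln (2 * cosh u - 2 * cos 0) = 2 * ln (2 * sinh (u / 2))" .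
  hence "g 0 = of_real (2 * ln (2 * sinh (u / 2)))" using g_axis[of 0] by simp
  hence "exp (- (g 0 / 2)) = of_real (exp (- ln (2 * sinh (u / 2))))"
    by (simp flip: exp_of_real)
  also have "exp (- ln (2 * sinh (u / 2))) = 1 / (2 * sinh (u / 2))"
  proof -
    have "exp (ln (2 * sinh (u / 2))) = 2 * sinh (u / 2)" using s by (intro exp_ln) simp
    thus ?thesis by (simp only: exp_minus inverse_eq_divide)
  qed
  finally show ?thesis .
qed

lemma f_bound:
  assumes \<beta>: "0 < \<beta>" "\<beta> < 1"
  shows "\<exists>C>0. \<forall>N>0. \<forall>k. real k \<le> \<beta> * real N \<longrightarrow> norm (f N k) \<le> C * exp (real N * H (of_nat k * hN N) / \<rho>)"
proof -
  obtain C where C: "C \<ge> 0" "\<And>N k. N > 0 \<Longrightarrow> real k \<le> \<beta> * real N \<Longrightarrow>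
     \<exists>e. norm e \<le> C / real N \<and> f N k = exp (F (of_nat k * hN N) / hN N + (g (of_nat k * hN N) - g 0) / 2 + e)"
    using trapezoid[OF \<beta>] by blast
  show ?thesis
  proof (intro exI[of _ "exp 2 * norm (exp (- (g 0 / 2))) * exp C"] conjI allI impI)
    fix N k :: nat assume N: "N > 0" and k: "real k \<le> \<beta> * real N"
    obtain e where e: "norm e \<le> C / real N" "f N k = exp (F (of_nat k * hN N) / hN N + (g (of_nat k * hN N) - g 0) / 2
        + e)"
      using C(2)[OF N k] by blast
    have "real k * u \<le> \<beta> * real N * u" using k u_pos by (intro mult_right_mono) auto
    also have "\<dots> < 1 * real N * u" using \<beta> N u_pos by (intro mult_strict_right_mono) auto
    finally have "real k * u / real N < u" using N by (simp add: field_simps)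
    hence st: "of_nat k * hN N \<in> strip" "\<bar>Re (of_nat k * hN N)\<bar> \<le> 3 * u"
      using u_pos hN_simps[OF N] by (auto simp: strip_def intro: less_le_trans[of _ 0])
    have "f N k = exp (F (of_nat k * hN N) / hN N) * exp (g (of_nat k * hN N) / 2) * exp (- (g 0 / 2)) * exp e"
    proof -
      have "F (of_nat k * hN N) / hN N + (g (of_nat k * hN N) - g 0) / 2 + e
         = F (of_nat k * hN N) / hN N + g (of_nat k * hN N) / 2 + - (g 0 / 2) + e" by (simp add: diff_divide_distrib)
      thus ?thesis unfolding e(2) by (simp only: exp_add)
    qed
    hence "norm (f N k) = exp (real N * H (of_nat k * hN N) / \<rho>) * norm (exp (g (of_nat k * hN N) / 2))
        * norm (exp (- (g 0 / 2))) * norm (exp e)"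
      by (simp only: norm_mult norm_exp_eq_Re[of "F (of_nat k * hN N) / hN N"] Re_div_h[OF N])
    also have "\<dots> \<le> exp (real N * H (of_nat k * hN N) / \<rho>) * exp 2 * norm (exp (- (g 0 / 2))) * exp C"
    proof (intro mult_mono mult_nonneg_nonneg)
      show "norm (exp (g (of_nat k * hN N) / 2)) \<le> exp 2" using st by (intro norm_exp_half_g strip_dmn)
      have "C / real N \<le> C / 1" using C(1) N by (intro divide_left_mono) auto
      hence "norm e \<le> C" using e(1) by simp
      thus "norm (exp e) \<le> exp C" using abs_Re_le_cmod[of e] by simp
    qed auto
    finally show "norm (f N k) \<le> exp 2 * norm (exp (- (g 0 / 2))) * exp C * exp (real N * H (of_nat k * hN N) / \<rho>)"
      by (simp add: mult_ac)
  qed auto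
qed

end

section \<open>Holomorphic interpolation of the terms in the last period\<close>

lemma norm_exp_minus_one_le: "norm (exp z - 1) \<le> norm z * exp (norm z)" for z :: complex
proof -
  have "norm (exp z - 1) \<le> exp \<bar>Re z\<bar> * norm z" using Taylor_exp[of z 0] by simp
  also have "\<dots> \<le> exp (norm z) * norm z" using abs_Re_le_cmod[of z] by (intro mult_right_mono) auto
  finally show ?thesis by (simp add: mult.commute)
qed

context fig8 begin

definition "E R N Z = exp (sum_primitive F g (hN N) R Z / hN N)" for R :: real and N :: nat and Z :: complex
text \<open>Halfway between the lower edge of the window and the height below which
  \<open>H_low\<close> applies, so that the lower side of the rectangle fits above \<open>yl\<close>
  and is still negligible. It is positive also for p = 1.\<close>

definition "yl = c - 2 * pi + \<theta> / 2"

lemma yl: "c - 2 * pi < yl" "0 < yl" "yl < c - 2 * pi + \<theta>" using \<theta> c_ge by (auto simp: yl_def)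

lemma sum_primitive_strip: assumes "N > 0" "R > 2"
  shows "sum_primitive_strip F g (c - 2 * pi) c (hN N) R"
proof
  have N: "real N \<ge> 1" using assms by linarith
  show "(F has_field_derivative g Z) (at Z)" if "c - 2 * pi < Im Z" "Im Z < c" for Z
    using that by (intro F_deriv window_dmn) (simp add: window_def)
  show "Im (hN N) > 0" "Re (hN N) \<ge> 0" using assms u_pos c_pos by (auto simp: hN_simps)
  have "2 * u \<le> c" using u_less_1 c_ge pi_gt3 by linarith
  thus "2 * Re (hN N) \<le> Im (hN N)" using assms by (simp add: hN_simps divide_right_mono)
  have "u / real N \<le> u" using N u_pos by (simp add: field_simps)
  thus "2 * Re (hN N) < R" using assms u_less_1 by (simp add: hN_simps)
qed

lemma box_bound:
  assumes "\<delta> > 0"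
  shows "\<exists>D>0. \<forall>W. yl \<le> Im W \<longrightarrow> Im W \<le> c - \<delta> \<longrightarrow> \<bar>Re W\<bar> \<le> r \<longrightarrow> norm (g W) \<le> D \<and> norm (deriv g W) \<le> D"
proof -
  define K where "K = cbox (Complex (- r) yl) (Complex r (c - \<delta>))"
  have K: "K \<subseteq> dmn" using assms yl by (auto simp: K_def in_cbox_complex_iff dmn_def window_def)
  have c1: "continuous_on K g" by (rule continuous_on_subset[OF holomorphic_on_imp_continuous_on[OF g_holo] K])
  have c2: "continuous_on K (deriv g)"
    by (rule continuous_on_subset[OF holomorphic_on_imp_continuous_on[OF holomorphic_deriv[OF g_holo open_dmn]] K])
  have "bounded (g ` K)" "bounded (deriv g ` K)"
    using c1 c2 by (auto intro!: compact_imp_bounded compact_continuous_image simp: K_def)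
  then obtain D1 D2 where D: "\<And>W. W \<in> K \<Longrightarrow> norm (g W) \<le> D1" "\<And>W. W \<in> K \<Longrightarrow> norm (deriv g W) \<le> D2"
    unfolding bounded_iff by (metis imageI)
  have "norm (g W) \<le> max 1 (max D1 D2) \<and> norm (deriv g W) \<le> max 1 (max D1 D2)"
    if "yl \<le> Im W" "Im W \<le> c - \<delta>" "\<bar>Re W\<bar> \<le> r" for W
  proof -
    have "W \<in> K" using that by (auto simp: K_def in_cbox_complex_iff)
    from D[OF this] show ?thesis by (simp add: le_max_iff_disj)
  qed
  thus ?thesis by (intro exI[of _ "max 1 (max D1 D2)"]) auto
qed

lemma eventually_N_ge: "\<forall>\<^sub>F N in sequentially. N > 0 \<and> real N \<ge> x"
  using eventually_gt_at_top[of "0::nat"] filterlim_real_sequentially[THEN filterlim_at_top[THEN iffD1], rule_format,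
      of x]
  by (rule eventually_conj)

text \<open>After division by h the correction h / 2 * g Z becomes the factor exp (g Z / 2), which
  also appears in \<open>trapezoid\<close>. To leading order interpolant and terms thus differ by
  the constant exp (- g 0 / 2).\<close>

lemma E_asymptotic:
  assumes \<delta>: "\<delta> > 0" and R: "R > 2"
  shows "\<exists>C>0. \<forall>\<^sub>F N in sequentially. \<forall>Z. 0 \<le> Re Z \<longrightarrow> Re Z \<le> 3 * u \<longrightarrow> yl \<le> Im Z \<longrightarrow> Im Z \<le> c - \<delta> \<longrightarrow>
     (\<exists>e. norm e \<le> C / real N \<and> E R N Z = exp (F Z / hN N + g Z / 2 + e))"
proof -
  obtain D where D: "D > 0" "\<And>W. yl \<le> Im W \<Longrightarrow> Im W \<le> c - \<delta> / 2 \<Longrightarrow> \<bar>Re W\<bar> \<le> R + 4 \<Longrightarrow> norm (deriv g W) \<le> D"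
    using box_bound[of "\<delta> / 2" "R + 4"] \<delta> by auto
  have "\<forall>\<^sub>F N in sequentially. \<forall>Z. 0 \<le> Re Z \<longrightarrow> Re Z \<le> 3 * u \<longrightarrow> yl \<le> Im Z \<longrightarrow> Im Z \<le> c - \<delta> \<longrightarrow>
     (\<exists>e. norm e \<le> D * norm \<xi> / real N \<and> E R N Z = exp (F Z / hN N + g Z / 2 + e))"
    using eventually_N_ge[of "c / \<delta>"]
  proof eventually_elim
    case (elim N)
    hence N: "N > 0" and Nc: "c / real N \<le> \<delta>" using \<delta> by (auto simp: field_simps)
    note hs = hN_simps[OF N]
    interpret sum_primitive_strip F g "c - 2 * pi" c "hN N" R by (rule sum_primitive_strip[OF N R])
    have "real N \<ge> 1" using N by linarith
    hence uN: "u / real N \<le> 1" using u_less_1 by (simp add: divide_le_eq)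
    show ?case
    proof (intro allI impI)
      fix Z assume Z: "0 \<le> Re Z" "Re Z \<le> 3 * u" "yl \<le> Im Z" "Im Z \<le> c - \<delta>"
      define r where "r = sum_primitive F g (hN N) R Z - F Z - hN N / 2 * g Z"
      have "norm r \<le> D * (norm (hN N))\<^sup>2"
        unfolding r_def
      proof (rule sum_primitive_asymptotic)
        show "c - 2 * pi < Im Z" using Z yl by linarith
        have "Im (hN N) / 2 < \<delta>" using Nc \<delta> by (simp add: hs)
        thus "Im Z + Im (hN N) / 2 < c" using Z by linarith
        fix W assume W: "Im Z \<le> Im W" "Im W \<le> Im Z + Im (hN N) / 2" "\<bar>Re W - Re Z\<bar> \<le> R + Re (hN N)"
        have "Im (hN N) / 2 \<le> \<delta> / 2" using Nc by (simp add: hs)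
        thus "norm (deriv g W) \<le> D"
          using W Z uN u_less_1 by (intro D) (auto simp: hs)
      qed
      hence "norm r / norm (hN N) \<le> D * (norm (hN N))\<^sup>2 / norm (hN N)" by (rule divide_right_mono) simp
      also have "D * (norm (hN N))\<^sup>2 / norm (hN N) = D * norm (hN N)"
        using hs(4) by (simp add: power2_eq_square)
      finally have 1: "norm (r / hN N) \<le> D * norm \<xi> / real N"
        unfolding hs(3) norm_divide by simp
      have "sum_primitive F g (hN N) R Z / hN N = F Z / hN N + g Z / 2 + r / hN N"
        using hs(4) by (simp add: r_def field_simps)
      thus "\<exists>e. norm e \<le> D * norm \<xi> / real N \<and> E R N Z = exp (F Z / hN N + g Z / 2 + e)"
        using 1 by (auto simp: E_def)
    qed
  qed
  moreover have "D * norm \<xi> > 0" using D \<xi>_nonzero by simp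
  ultimately show ?thesis by blast
qed

lemma E_bound:
  assumes \<delta>: "\<delta> > 0" and R: "R > 2"
  shows "\<exists>C>0. \<forall>\<^sub>F N in sequentially. \<forall>Z. 0 \<le> Re Z \<longrightarrow> Re Z \<le> 3 * u \<longrightarrow> yl \<le> Im Z \<longrightarrow> Im Z \<le> c - \<delta> \<longrightarrow>
     norm (E R N Z) \<le> C * exp (real N * H Z / \<rho>)"
proof -
  from E_asymptotic[OF assms] obtain C where C: "C > 0" and ev: "\<forall>\<^sub>F N in sequentially. \<forall>Z. 0 \<le> Re Z \<longrightarrow> Re Z \<le> 3 * u \<longrightarrow>
      yl \<le> Im Z \<longrightarrow> Im Z \<le> c - \<delta> \<longrightarrow>
     (\<exists>e. norm e \<le> C / real N \<and> E R N Z = exp (F Z / hN N + g Z / 2 + e))" by blast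
  have "\<forall>\<^sub>F N in sequentially. \<forall>Z. 0 \<le> Re Z \<longrightarrow> Re Z \<le> 3 * u \<longrightarrow> yl \<le> Im Z \<longrightarrow> Im Z \<le> c - \<delta> \<longrightarrow>
     norm (E R N Z) \<le> (exp 2 * exp C) * exp (real N * H Z / \<rho>)"
    using ev eventually_N_ge[of 1]
  proof eventually_elim
    case (elim N)
    hence N: "N > 0" "real N \<ge> 1" by auto
    show ?case
    proof (intro allI impI)
      fix Z assume Z: "0 \<le> Re Z" "Re Z \<le> 3 * u" "yl \<le> Im Z" "Im Z \<le> c - \<delta>"
      then obtain e where e: "norm e \<le> C / real N" "E R N Z = exp (F Z / hN N + g Z / 2 + e)" using elim by blast
      have dm: "Z \<in> dmn" using Z yl \<delta> by (intro window_dmn) (auto simp: window_def)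
      have "norm (E R N Z) = exp (real N * H Z / \<rho>) * norm (exp (g Z / 2)) * norm (exp e)"
        unfolding e(2) exp_add norm_mult norm_exp_eq_Re[of "F Z / hN N"] Re_div_h[OF N(1)] ..
      also have "\<dots> \<le> exp (real N * H Z / \<rho>) * exp 2 * exp C"
      proof (intro mult_mono mult_nonneg_nonneg)
        show "norm (exp (g Z / 2)) \<le> exp 2" using Z dm by (intro norm_exp_half_g) auto
        have "C / real N \<le> C / 1" using C N by (intro divide_left_mono) auto
        hence "norm e \<le> C" using e by simp
        thus "norm (exp e) \<le> exp C" using abs_Re_le_cmod[of e] by simp
      qed auto
      finally show "norm (E R N Z) \<le> (exp 2 * exp C) * exp (real N * H Z / \<rho>)" by (simp add: mult_ac)
    qed
  qed
  thus ?thesis by (intro exI[of _ "exp 2 * exp C"]) simp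
qed

lemma E_holomorphic: assumes "N > 0" "R > 2"
  shows "E R N holomorphic_on {Z. c - 2 * pi < Im Z \<and> Im Z < c - Im (hN N) / 2}"
proof -
  interpret sum_primitive_strip F g "c - 2 * pi" c "hN N" R by (rule sum_primitive_strip[OF assms])
  have "sum_primitive F g (hN N) R holomorphic_on {Z. c - 2 * pi < Im Z \<and> Im Z < c - Im (hN N) / 2}"
    by (rule holomorphic_on_subset[OF sum_primitive_holomorphic]) (use h in auto)
  thus ?thesis unfolding E_def[abs_def] using h0 by (intro holomorphic_intros)
qed

definition "rate N = 2 * pi * c * real N / \<rho>" for N :: nat

lemma rate: assumes "N > 0" "R > 2"
  shows "2 * pi * Im (hN N) / (norm (hN N))\<^sup>2 = rate N" "Re (hN N) / Im (hN N) = u / c"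
  using assms c_pos \<xi>_nonzero by (auto simp: hN_simps rate_def \<rho>_def power_divide power2_eq_square field_simps)

lemma E_step:
  assumes \<delta>: "\<delta> > 0" and R: "R > 3"
  shows "\<exists>C>0. \<forall>\<^sub>F N in sequentially. \<forall>Z. 0 \<le> Re Z \<longrightarrow> Re Z \<le> u \<longrightarrow> yl \<le> Im Z \<longrightarrow> Im (Z + hN N) \<le> c - \<delta> \<longrightarrow>
     (\<exists>e. norm e \<le> C * exp (- (rate N * (R / 2))) \<and> E R N (Z + hN N) = E R N Z * G (Z + hN N) * exp e)"
proof -
  obtain D where D: "D > 0" "\<And>W. yl \<le> Im W \<Longrightarrow> Im W \<le> c - \<delta> / 2 \<Longrightarrow> \<bar>Re W\<bar> \<le> R + 4 \<Longrightarrow> norm (g W) \<le> D"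
    using box_bound[of "\<delta> / 2" "R + 4"] \<delta> by auto
  have "\<forall>\<^sub>F N in sequentially. \<forall>Z. 0 \<le> Re Z \<longrightarrow> Re Z \<le> u \<longrightarrow> yl \<le> Im Z \<longrightarrow> Im (Z + hN N) \<le> c - \<delta> \<longrightarrow>
     (\<exists>e. norm e \<le> 8 * D * exp (- (rate N * (R / 2))) \<and> E R N (Z + hN N) = E R N Z * G (Z + hN N) * exp e)"
    using eventually_N_ge[of "max (c / \<delta>) (\<rho> / c)"]
  proof eventually_elim
    case (elim N)
    hence N: "N > 0" "real N \<ge> 1" and Nc: "c / real N \<le> \<delta>" and Nr: "real N \<ge> \<rho> / c" using \<delta> by (auto simp: field_simps)
    have R2: "R > 2" using R by simp
    note h' = hN_simps[OF N(1)]
    interpret sum_primitive_strip F g "c - 2 * pi" c "hN N" R by (rule sum_primitive_strip[OF N(1) R2])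
    have ar: "a = rate N" unfolding a_def using rate[OF N(1) R2] by simp
    have uN: "u / real N \<le> 1" using N u_less_1 u_pos by (simp add: field_simps)
    have rate1: "rate N \<ge> 1"
    proof -
      have "1 \<le> c * real N / \<rho>" using Nr c_pos \<rho> by (simp add: field_simps)
      also have "\<dots> = 1 * (c * real N / \<rho>)" by simp
      also have "\<dots> \<le> 2 * pi * (c * real N / \<rho>)"
        using pi_gt3 c_pos \<rho>(2) by (intro mult_right_mono) auto
      finally show ?thesis by (simp add: rate_def mult_ac)
    qed
    \<comment> \<open>With Re h \<le> 1 and R > 3 the loss 3/2 Re h is at most R / 2.\<close>
    have Rm: "R / 2 \<le> R - 3 / 2 * Re (hN N)" using R uN by (simp add: h')
    have "1 * 1 \<le> rate N * (R / 2)" using rate1 R by (intro mult_mono) auto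
    also have "\<dots> \<le> rate N * (R - 3 / 2 * Re (hN N))" using Rm rate1 by (intro mult_left_mono) auto
    finally have X1: "a * (R - 3 / 2 * Re (hN N)) \<ge> 1" by (simp add: ar)
    have Xr: "exp (- (a * (R - 3 / 2 * Re (hN N)))) \<le> exp (- (rate N * (R / 2)))"
      using mult_left_mono[OF Rm, of "rate N"] rate1 by (simp add: ar)
    show ?case
    proof (intro allI impI)
      fix Z assume Z: "0 \<le> Re Z" "Re Z \<le> u" "yl \<le> Im Z" "Im (Z + hN N) \<le> c - \<delta>"
      define r where "r = sum_primitive F g (hN N) R (Z + hN N) - sum_primitive F g (hN N) R Z - hN N * g (Z + hN N)"
      have hd: "Im (hN N) \<le> \<delta>" using Nc by (simp add: h')
      have "norm r \<le> 8 * D * norm (hN N) * exp (- (a * (R - 3 / 2 * Re (hN N))))"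
        unfolding r_def
      proof (rule sum_primitive_step[OF _ _ X1])
        show "c - 2 * pi < Im Z + Im (hN N) / 2" using Z yl h by simp
        show "Im Z + 3 / 2 * Im (hN N) < c" using Z hd \<delta> by simp
        fix W assume W: "Im Z + Im (hN N) / 2 \<le> Im W" "Im W \<le> Im Z + 3 / 2 * Im (hN N)" "\<bar>Re W - Re Z\<bar>
            \<le> R + 2 * Re (hN N)"
        have "Re (hN N) \<le> 1" using uN by (simp add: h')
        thus "norm (g W) \<le> D" using W Z hd h u_less_1 by (intro D) auto
      qed
      also have "\<dots> \<le> 8 * D * norm (hN N) * exp (- (rate N * (R / 2)))" using Xr D by (intro mult_left_mono) auto
      finally have "norm r / norm (hN N) \<le> 8 * D * norm (hN N) * exp (- (rate N * (R / 2))) / norm (hN N)"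
        by (rule divide_right_mono) simp
      hence 1: "norm (r / hN N) \<le> 8 * D * exp (- (rate N * (R / 2)))" using h0 by (simp add: norm_divide)
      have "sum_primitive F g (hN N) R (Z + hN N) / hN N
          = sum_primitive F g (hN N) R Z / hN N + g (Z + hN N) + r / hN N"
        using h0 by (simp add: r_def field_simps)
      moreover have "Z + hN N \<in> dmn" using Z yl h \<delta> by (intro window_dmn) (auto simp: window_def)
      ultimately have "E R N (Z + hN N) = E R N Z * G (Z + hN N) * exp (r / hN N)"
        by (simp add: E_def exp_add exp_g)
      with 1 show "\<exists>e. norm e \<le> 8 * D * exp (- (rate N * (R / 2))) \<and>
          E R N (Z + hN N) = E R N Z * G (Z + hN N) * exp e" by blast
    qed
  qed
  moreover have "8 * D > 0" using D by simp
  ultimately show ?thesis by blast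
qed

lemma f_Suc: "f N (Suc k) = f N k * G (of_nat (Suc k) * hN N)"
  by (simp add: f_def)

text \<open>The trapezoidal rule is compared with the interpolant at the single index
  \<open>a\<close>; this costs the factor exp e' with e' = O(1/N), the same for all k. From there on
  both sides satisfy the same recursion up to exponentially small factors, of which at most N
  accumulate. Comparing at every k would leave errors O(1/N) in terms that cancel.\<close>

lemma interpolation:
  assumes \<delta>: "\<delta> > 0" "\<delta> < c" and R: "R > 3"
  shows "\<exists>C>0. \<forall>\<^sub>F N in sequentially. \<forall>a. yl \<le> real a * c / real N \<longrightarrow> real a * c / real N \<le> c - \<delta> \<longrightarrow>
     (\<exists>e'. norm e' \<le> C / real N \<and> (\<forall>k\<ge>a. real k * c / real N \<le> c - \<delta> \<longrightarrow>
        (\<exists>e. norm e \<le> C * real N * exp (- (rate N * (R / 2))) \<and>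
            f N k = exp (- (g 0 / 2)) * exp e' * E R N (of_nat k * hN N) * exp e)))"
proof -
  have R2: "R > 2" using R by simp
  obtain C1 where C1: "C1 > 0" and ev1: "\<forall>\<^sub>F N in sequentially. \<forall>Z. 0 \<le> Re Z \<longrightarrow> Re Z \<le> u \<longrightarrow> yl \<le> Im Z \<longrightarrow>
      Im (Z + hN N) \<le> c - \<delta> \<longrightarrow>
     (\<exists>e. norm e \<le> C1 * exp (- (rate N * (R / 2))) \<and> E R N (Z + hN N) = E R N Z * G (Z + hN N) * exp e)"
    using E_step[OF \<delta>(1) R] by blast
  obtain C2 where C2: "C2 > 0" and ev2: "\<forall>\<^sub>F N in sequentially. \<forall>Z. 0 \<le> Re Z \<longrightarrow> Re Z \<le> 3 * u \<longrightarrow> yl \<le> Im Z \<longrightarrow> Im Z \<le> c - \<delta> \<longrightarrow>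
     (\<exists>e. norm e \<le> C2 / real N \<and> E R N Z = exp (F Z / hN N + g Z / 2 + e))"
    using E_asymptotic[OF \<delta>(1) R2] by blast
  define \<beta> where "\<beta> = 1 - \<delta> / c"
  have \<beta>: "0 < \<beta>" "\<beta> < 1" using \<delta> c_pos by (auto simp: \<beta>_def)
  obtain C3 where C3: "C3 \<ge> 0" "\<And>N k. N > 0 \<Longrightarrow> real k \<le> \<beta> * real N \<Longrightarrow>
     \<exists>e. norm e \<le> C3 / real N \<and> f N k = exp (F (of_nat k * hN N) / hN N + (g (of_nat k * hN N) - g 0) / 2 + e)"
    using trapezoid[OF \<beta>] by blast
  define C where "C = C1 + C2 + C3"
  have C: "C > 0" "C \<ge> C1" "C \<ge> C2 + C3" using C1 C2 C3 by (auto simp: C_def)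
  have "\<forall>\<^sub>F N in sequentially. \<forall>a. yl \<le> real a * c / real N \<longrightarrow> real a * c / real N \<le> c - \<delta> \<longrightarrow>
     (\<exists>e'. norm e' \<le> C / real N \<and> (\<forall>k\<ge>a. real k * c / real N \<le> c - \<delta> \<longrightarrow>
        (\<exists>e. norm e \<le> C * real N * exp (- (rate N * (R / 2))) \<and>
            f N k = exp (- (g 0 / 2)) * exp e' * E R N (of_nat k * hN N) * exp e)))"
    using ev1 ev2 eventually_N_ge[of 1]
  proof eventually_elim
    case (elim N)
    hence N: "N > 0" by auto
    note h = hN_simps[OF N]
    define \<tau> where "\<tau> = exp (- (rate N * (R / 2)))"
    have kN: "real k \<le> \<beta> * real N" "real k \<le> real N" if "real k * c / real N \<le> c - \<delta>" for k
    proof -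
      have "real k * c \<le> (c - \<delta>) * real N" using that N by (simp add: pos_divide_le_eq)
      also have "\<dots> = \<beta> * real N * c" using c_pos by (simp add: \<beta>_def field_simps)
      finally show "real k \<le> \<beta> * real N" using c_pos by simp
      also have "\<dots> \<le> 1 * real N" using \<beta> by (intro mult_right_mono) auto
      finally show "real k \<le> real N" by simp
    qed
    have Rek: "0 \<le> Re (of_nat k * hN N)" "Re (of_nat k * hN N) \<le> u" if "real k \<le> real N" for k
    proof -
      show "0 \<le> Re (of_nat k * hN N)" using u_pos by (simp add: h)
      have "real k * u \<le> real N * u" using that u_pos by (intro mult_right_mono) auto
      thus "Re (of_nat k * hN N) \<le> u" using N by (simp add: h field_simps)
    qed
    show ?case
    proof (intro allI impI)
      fix a assume a: "yl \<le> real a * c / real N" "real a * c / real N \<le> c - \<delta>"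
      obtain e3 where e3: "norm e3 \<le> C3 / real N" "f N a
          = exp (F (of_nat a * hN N) / hN N + (g (of_nat a * hN N) - g 0) / 2 + e3)"
        using C3(2)[OF N kN(1)[OF a(2)]] by blast
      have "\<exists>e. norm e \<le> C2 / real N \<and> E R N (of_nat a * hN N)
          = exp (F (of_nat a * hN N) / hN N + g (of_nat a * hN N) / 2 + e)"
        using elim(2)[rule_format, of "of_nat a * hN N"] Rek[OF kN(2)[OF a(2)]] a u_pos by (simp add: h)
      then obtain e2 where e2: "norm e2 \<le> C2 / real N" "E R N (of_nat a * hN N)
          = exp (F (of_nat a * hN N) / hN N + g (of_nat a * hN N) / 2 + e2)"
        by blast
      define e' where "e' = e3 - e2"
      have "norm e' \<le> C3 / real N + C2 / real N" unfolding e'_def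
          by (rule order_trans[OF norm_triangle_ineq4 add_mono[OF e3(1) e2(1)]])
      also have "\<dots> \<le> C / real N" using C(3) N by (simp flip: add_divide_distrib add: divide_right_mono add.commute)
      finally have ne': "norm e' \<le> C / real N" .
      have fa: "f N a = exp (- (g 0 / 2)) * exp e' * E R N (of_nat a * hN N)"
        unfolding e3(2) e2(2) e'_def exp_add[symmetric] by (rule arg_cong[of _ _ exp]) (simp add: diff_divide_distrib)
      have ind: "\<exists>e. norm e \<le> real (k - a) * (C1 * \<tau>) \<and>
          f N k = exp (- (g 0 / 2)) * exp e' * E R N (of_nat k * hN N) * exp e"
        if "a \<le> k" "real k * c / real N \<le> c - \<delta>" for k
        using that
      proof (induction k rule: dec_induct)
        case base
        show ?case by (intro exI[of _ 0]) (simp add: fa)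
      next
        case (step k)
        have "real k * c / real N \<le> real (Suc k) * c / real N" using N c_pos
            by (intro divide_right_mono mult_right_mono) auto
        hence kc: "real k * c / real N \<le> c - \<delta>" using step.prems by linarith
        then obtain e where e: "norm e \<le> real (k - a) * (C1 * \<tau>)" "f N k
            = exp (- (g 0 / 2)) * exp e' * E R N (of_nat k * hN N) * exp e"
          using step.IH by blast
        have S: "of_nat (Suc k) * hN N = of_nat k * hN N + hN N" by (simp add: algebra_simps)
        have "real a * c / real N \<le> real k * c / real N" using N c_pos step.hyps
            by (intro divide_right_mono mult_right_mono) auto
        hence "\<exists>e. norm e \<le> C1 * exp (- (rate N * (R / 2))) \<and>
            E R N (of_nat k * hN N + hN N) = E R N (of_nat k * hN N) * G (of_nat k * hN N + hN N) * exp e"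
          using elim(1)[rule_format, of "of_nat k * hN N"] Rek[OF kN(2)[OF kc]] a step.prems N
              by (simp add: h field_simps)
        then obtain e1 where e1: "norm e1 \<le> C1 * \<tau>" "E R N (of_nat k * hN N + hN N)
            = E R N (of_nat k * hN N) * G (of_nat k * hN N + hN N) * exp e1"
          unfolding \<tau>_def by blast
        have "f N (Suc k) = exp (- (g 0 / 2)) * exp e' * E R N (of_nat (Suc k) * hN N) * exp (e - e1)"
          unfolding f_Suc S e(2) e1(2) by (simp add: exp_diff)
        moreover have "norm (e - e1) \<le> real (Suc k - a) * (C1 * \<tau>)"
        proof -
          have "norm (e - e1) \<le> real (k - a) * (C1 * \<tau>) + C1 * \<tau>"
              by (rule order_trans[OF norm_triangle_ineq4 add_mono[OF e(1) e1(1)]])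
          also have "\<dots> = real (Suc k - a) * (C1 * \<tau>)" using step.hyps by (simp add: Suc_diff_le algebra_simps)
          finally show ?thesis .
        qed
        ultimately show ?case by blast
      qed
      have "\<exists>e. norm e \<le> C * real N * \<tau> \<and> f N k = exp (- (g 0 / 2)) * exp e' * E R N (of_nat k * hN N) * exp e"
        if k: "a \<le> k" "real k * c / real N \<le> c - \<delta>" for k
      proof -
        obtain e where e: "norm e \<le> real (k - a) * (C1 * \<tau>)" "f N k
            = exp (- (g 0 / 2)) * exp e' * E R N (of_nat k * hN N) * exp e"
          using ind[OF k] by blast
        have "real (k - a) \<le> real N" using kN(2)[OF k(2)] by simp
        hence "real (k - a) * (C1 * \<tau>) \<le> real N * (C * \<tau>)"
          using C C1 by (intro mult_mono mult_right_mono) (auto simp: \<tau>_def)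
        hence "norm e \<le> C * real N * \<tau>" using e(1) by (simp add: mult_ac)
        thus ?thesis using e(2) by blast
      qed
      thus "\<exists>e'. norm e' \<le> C / real N \<and> (\<forall>k\<ge>a. real k * c / real N \<le> c - \<delta> \<longrightarrow>
        (\<exists>e. norm e \<le> C * real N * exp (- (rate N * (R / 2))) \<and>
            f N k = exp (- (g 0 / 2)) * exp e' * E R N (of_nat k * hN N) * exp e))"
        using ne' unfolding \<tau>_def by blast
    qed
  qed
  thus ?thesis using C(1) by blast
qed

end

section \<open>Summation around a rectangle\<close>

lemma lattice_kernel_periodic_nat: "h \<noteq> 0 \<Longrightarrow> lattice_kernel h (w + of_nat n * h) = lattice_kernel h w"
proof (induction n)
  case (Suc n)
  have e: "w + of_nat (Suc n) * h = (w + of_nat n * h) + h" by (simp add: algebra_simps)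
  show ?case unfolding e lattice_kernel_periodic[OF Suc.prems] by (rule Suc.IH[OF Suc.prems])
qed simp

context fig8 begin

text \<open>A horizontal line midway between lattice points meets the lattice ray at a real part
  \<open>sr\<close> below u. To the left of it the kernel is bounded and the hypothesis on
  \<open>H\<close> applies. To the right \<open>H\<close> grows at a rate of at most B < 2 pi c,
  which the decay of the kernel outweighs. So a bound on \<open>H\<close> for s < u controls the
  side up to 3 u.\<close>

lemma horizontal_bound:
  assumes \<delta>: "\<delta> > 0" and R: "R > 2"
  shows "\<exists>C>0. \<forall>\<^sub>F N in sequentially. \<forall>m y \<epsilon> s. 1 \<le> m \<longrightarrow> y = (real m - 1 / 2) * c / real N \<longrightarrow> yl \<le> y \<longrightarrow> y \<le> c - \<delta> \<longrightarrow>
     (\<forall>s. 0 \<le> s \<longrightarrow> s < u \<longrightarrow> H (Complex s y) \<le> M - \<epsilon>) \<longrightarrow> 0 \<le> s \<longrightarrow> s \<le> 3 * u \<longrightarrow>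
     norm (E R N (Complex s y) * lattice_kernel (hN N) (Complex s y)) \<le> C * exp (real N * (M - \<epsilon>) / \<rho>)"
proof -
  obtain C where C: "C > 0" and ev: "\<forall>\<^sub>F N in sequentially. \<forall>Z. 0 \<le> Re Z \<longrightarrow> Re Z \<le> 3 * u \<longrightarrow> yl \<le> Im Z \<longrightarrow> Im Z \<le> c - \<delta> \<longrightarrow>
     norm (E R N Z) \<le> C * exp (real N * H Z / \<rho>)" using E_bound[OF \<delta> R] by blast
  have "\<forall>\<^sub>F N in sequentially. \<forall>m y \<epsilon> s. 1 \<le> m \<longrightarrow> y = (real m - 1 / 2) * c / real N \<longrightarrow> yl \<le> y \<longrightarrow> y \<le> c - \<delta> \<longrightarrow>
     (\<forall>s. 0 \<le> s \<longrightarrow> s < u \<longrightarrow> H (Complex s y) \<le> M - \<epsilon>) \<longrightarrow> 0 \<le> s \<longrightarrow> s \<le> 3 * u \<longrightarrow>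
     norm (E R N (Complex s y) * lattice_kernel (hN N) (Complex s y)) \<le> (2 * C) * exp (real N * (M - \<epsilon>) / \<rho>)"
    using ev eventually_N_ge[of 1]
  proof eventually_elim
    case (elim N)
    hence N: "N > 0" by auto
    note h = hN_simps[OF N]
    show ?case
    proof (intro allI impI)
      fix m :: nat and y \<epsilon> s :: real
      assume m: "1 \<le> m" and y: "y = (real m - 1 / 2) * c / real N" "yl \<le> y" "y \<le> c - \<delta>"
        and Hs: "\<forall>s. 0 \<le> s \<longrightarrow> s < u \<longrightarrow> H (Complex s y) \<le> M - \<epsilon>" and s: "0 \<le> s" "s \<le> 3 * u"
      define sr where "sr = (real m - 1 / 2) * u / real N"
      have sry: "sr = y * u / c" using c_pos by (simp add: sr_def y(1))
      have yc: "y < c" "y > 0" using y \<delta> yl by auto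
      have sr: "0 \<le> sr" "sr < u" using yc u_pos c_pos by (auto simp: sry field_simps)
      define x where "x = s - sr"
      \<comment> \<open>Going back m - 1 periods leads to the line through h / 2, where the kernel
        is explicit.\<close>
      have "Complex s y = (hN N / 2 + of_real x) + of_nat (m - 1) * hN N"
        using m N by (simp add: complex_eq_iff h x_def sr_def y(1) of_nat_diff field_simps)
      hence "lattice_kernel (hN N) (Complex s y) = lattice_kernel (hN N) (hN N / 2 + of_real x)"
        by (simp only: lattice_kernel_periodic_nat[OF h(4)])
      also have "\<dots> = - 1 / (1 + exp (of_real (rate N * x) * (1 + of_real (u / c) * \<i>)))"
        by (rule lattice_kernel_centre[of "hN N" x, unfolded rate[OF N R]]) (use c_pos N in \<open>simp add: h(2)\<close>)
      finally have "lattice_kernel (hN N) (Complex s y)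
          = - 1 / (1 + exp (of_real (rate N * x) * (1 + of_real (u / c) * \<i>)))" .
      hence nk: "norm (lattice_kernel (hN N) (Complex s y))
          = 1 / norm (1 + exp (of_real (rate N * x) * (1 + of_real (u / c) * \<i>)))"
        by (simp add: norm_divide)
      have uc: "0 \<le> u / c" "u / c \<le> 1 / 2" using u_pos c_pos u_less_1 c_ge pi_gt3 by (auto simp: field_simps)
      define q where "q = norm (1 + exp (of_real (rate N * x) * (1 + of_real (u / c) * \<i>)))"
      have q: "1 \<le> 2 * q" "exp (rate N * x) \<le> 2 * q" using norm_one_plus_exp_ge[OF uc, of "rate N * x"]
          by (auto simp: q_def)
      have k1: "norm (lattice_kernel (hN N) (Complex s y)) \<le> 2" unfolding nk q_def[symmetric] using q(1)
          by (simp add: field_simps)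
      have k2: "norm (lattice_kernel (hN N) (Complex s y)) \<le> 2 * exp (- (rate N * x))"
      proof -
        have "1 / q \<le> 1 / (exp (rate N * x) / 2)" using q by (intro divide_left_mono) auto
        thus ?thesis unfolding nk q_def[symmetric] by (simp add: exp_minus field_simps)
      qed
      have nE: "norm (E R N (Complex s y)) \<le> C * exp (real N * H (Complex s y) / \<rho>)"
        using elim y s by simp
      show "norm (E R N (Complex s y) * lattice_kernel (hN N) (Complex s y)) \<le> (2 * C) * exp (real N * (M - \<epsilon>) / \<rho>)"
      proof (cases "s \<le> sr")
        case True
        have "H (Complex s y) \<le> M - \<epsilon>" using Hs s True sr by auto
        hence "exp (real N * H (Complex s y) / \<rho>) \<le> exp (real N * (M - \<epsilon>) / \<rho>)"
          using \<rho> by (simp add: divide_right_mono mult_left_mono)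
        hence "norm (E R N (Complex s y)) \<le> C * exp (real N * (M - \<epsilon>) / \<rho>)" using nE C
            by (meson mult_left_mono less_imp_le order_trans)
        hence "norm (E R N (Complex s y)) * norm (lattice_kernel (hN N) (Complex s y))
            \<le> (C * exp (real N * (M - \<epsilon>) / \<rho>)) * 2"
          using k1 C by (intro mult_mono) auto
        thus ?thesis by (simp add: norm_mult mult_ac)
      next
        case False
        have x: "x > 0" using False by (simp add: x_def)
        have "H (Complex s y) \<le> H (Complex sr y) + B * (s - sr)"
          by (rule H_horizontal) (use False sr s y \<delta> yl in \<open>auto intro!: window_dmn Complex_window\<close>)
        also have "H (Complex sr y) \<le> M - \<epsilon>" using Hs sr by auto
        also have "B * (s - sr) \<le> 2 * pi * c * x"
          unfolding x_def using False c_bounds by (intro mult_right_mono) (auto simp: B_def)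
        finally have "H (Complex s y) \<le> M - \<epsilon> + 2 * pi * c * x" by simp
        hence "real N * H (Complex s y) / \<rho> \<le> real N * (M - \<epsilon> + 2 * pi * c * x) / \<rho>"
          using \<rho> by (intro divide_right_mono mult_left_mono) auto
        also have "\<dots> = real N * (M - \<epsilon>) / \<rho> + rate N * x"
            by (simp add: rate_def distrib_left add_divide_distrib mult_ac)
        finally have ex: "exp (real N * H (Complex s y) / \<rho>) \<le> exp (real N * (M - \<epsilon>) / \<rho>) * exp (rate N * x)"
          by (simp flip: exp_add)
        have "norm (E R N (Complex s y)) * norm (lattice_kernel (hN N) (Complex s y))
           \<le> (C * (exp (real N * (M - \<epsilon>) / \<rho>) * exp (rate N * x))) * (2 * exp (- (rate N * x)))"
          using k2 C nE ex by (intro mult_mono) (auto intro: order_trans[OF nE])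
        also have "\<dots> = (2 * C) * exp (real N * (M - \<epsilon>) / \<rho>)" by (simp add: exp_minus)
        finally show ?thesis by (simp add: norm_mult)
      qed
    qed
  qed
  thus ?thesis using C by (intro exI[of _ "2 * C"]) auto
qed

text \<open>
  At \<open>Re Z = 3 * u\<close> the kernel decays at the rate \<open>4 * pi * c * u\<close>, which beats the growth \<open>3 * u * B\<close> of \<open>H\<close>
  between the two vertical sides.
\<close>

lemma right_bound:
  assumes \<delta>: "\<delta> > 0" and R: "R > 2"
  shows "\<exists>C>0. \<exists>\<epsilon>>0. \<forall>\<^sub>F N in sequentially. \<forall>y. yl \<le> y \<longrightarrow> y \<le> c - \<delta> \<longrightarrow>
     norm (E R N (Complex (3 * u) y) * lattice_kernel (hN N) (Complex (3 * u) y)) \<le> C * exp (real N * (M - \<epsilon>) / \<rho>)"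
proof -
  obtain C where C: "C > 0" and ev: "\<forall>\<^sub>F N in sequentially. \<forall>Z. 0 \<le> Re Z \<longrightarrow> Re Z \<le> 3 * u \<longrightarrow> yl \<le> Im Z \<longrightarrow> Im Z \<le> c - \<delta> \<longrightarrow>
     norm (E R N Z) \<le> C * exp (real N * H Z / \<rho>)" using E_bound[OF \<delta> R] by blast
  define \<epsilon> where "\<epsilon> = u * (4 * pi * c - 3 * B)"
  have \<epsilon>: "\<epsilon> > 0" unfolding \<epsilon>_def B_def using u_pos c_bounds by simp
  have "\<forall>\<^sub>F N in sequentially. \<forall>y. yl \<le> y \<longrightarrow> y \<le> c - \<delta> \<longrightarrow>
     norm (E R N (Complex (3 * u) y) * lattice_kernel (hN N) (Complex (3 * u) y))
         \<le> (2 * C) * exp (real N * (M - \<epsilon>) / \<rho>)"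
    using ev eventually_N_ge[of "\<rho> / (4 * pi * c * u)"]
  proof eventually_elim
    case (elim N)
    hence N: "N > 0" and N2: "real N \<ge> \<rho> / (4 * pi * c * u)" by auto
    note h = hN_simps[OF N]
    define X where "X = rate N * (2 * u)"
    have X1: "X \<ge> 1" using N2 c_pos u_pos \<rho> by (simp add: X_def rate_def field_simps)
    have r0: "rate N \<ge> 0" using c_pos \<rho> by (simp add: rate_def)
    show ?case
    proof (intro allI impI)
      fix y assume y: "yl \<le> y" "y \<le> c - \<delta>"
      have "u / c * y \<le> u / c * c" using y \<delta> u_pos c_pos by (intro mult_left_mono) auto
      hence "u / c * y \<le> u" using c_pos by simp
      hence "X \<le> rate N * (Re (Complex (3 * u) y) - u / c * Im (Complex (3 * u) y))"
        unfolding X_def using r0 by (intro mult_left_mono) auto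
      hence k: "norm (lattice_kernel (hN N) (Complex (3 * u) y)) \<le> 2 * exp (- X)"
        by (rule norm_lattice_kernel_far(1)[OF _ X1, of "hN N", unfolded rate[OF N R], rotated]) (use c_pos N in \<open>simp
            add: h(2)\<close>)
      have "H (Complex (3 * u) y) \<le> H (Complex 0 y) + B * (3 * u - 0)"
        by (rule H_horizontal) (use u_pos y \<delta> yl in \<open>auto intro!: window_dmn Complex_window\<close>)
      also have "H (Complex 0 y) \<le> M" unfolding H_axis M_def using Fr_y0_max[of y] y yl \<delta> c_pos
          by (intro mult_left_mono) auto
      finally have "real N * H (Complex (3 * u) y) / \<rho> \<le> real N * (M + B * (3 * u)) / \<rho>"
        using \<rho> by (intro divide_right_mono mult_left_mono) auto
      also have "\<dots> = real N * (M - \<epsilon>) / \<rho> + X" by (simp add: X_def rate_def \<epsilon>_def algebra_simps flip: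
          add_divide_distrib)
      finally have ex: "exp (real N * H (Complex (3 * u) y) / \<rho>) \<le> exp (real N * (M - \<epsilon>) / \<rho>) * exp X"
          by (simp flip: exp_add)
      have "norm (E R N (Complex (3 * u) y)) \<le> C * exp (real N * H (Complex (3 * u) y) / \<rho>)" using elim y u_pos by simp
      also have "\<dots> \<le> C * (exp (real N * (M - \<epsilon>) / \<rho>) * exp X)" using ex C by (intro mult_left_mono) auto
      finally have "norm (E R N (Complex (3 * u) y)) * norm (lattice_kernel (hN N) (Complex (3 * u) y))
         \<le> (C * (exp (real N * (M - \<epsilon>) / \<rho>) * exp X)) * (2 * exp (- X))"
        using k C by (intro mult_mono) auto
      also have "\<dots> = (2 * C) * exp (real N * (M - \<epsilon>) / \<rho>)" by (simp add: exp_minus)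
      finally show "norm (E R N (Complex (3 * u) y) * lattice_kernel (hN N) (Complex (3 * u) y))
          \<le> (2 * C) * exp (real N * (M - \<epsilon>) / \<rho>)"
        by (simp add: norm_mult)
    qed
  qed
  thus ?thesis using C \<epsilon> by (intro exI[of _ "2 * C"] exI[of _ \<epsilon>] conjI) auto
qed

text \<open>The axis lies to the left of the lattice ray at horizontal distance u y / c, which is at
  least u yl / c > 0. There the kernel is exponentially close to -1, so that the left side
  contributes the integral of the interpolant itself; the exponent gained is
  \<open>rate N * (u * yl / c)\<close>.\<close>

lemma left_bound:
  assumes \<delta>: "\<delta> > 0" and R: "R > 2"
  shows "\<exists>C>0. \<exists>\<epsilon>>0. \<forall>\<^sub>F N in sequentially. \<forall>y. yl \<le> y \<longrightarrow> y \<le> c - \<delta> \<longrightarrow>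
     norm (E R N (Complex 0 y) * (lattice_kernel (hN N) (Complex 0 y) + 1)) \<le> C * exp (real N * (M - \<epsilon>) / \<rho>)"
proof -
  obtain C where C: "C > 0" and ev: "\<forall>\<^sub>F N in sequentially. \<forall>Z. 0 \<le> Re Z \<longrightarrow> Re Z \<le> 3 * u \<longrightarrow> yl \<le> Im Z \<longrightarrow> Im Z \<le> c - \<delta> \<longrightarrow>
     norm (E R N Z) \<le> C * exp (real N * H Z / \<rho>)" using E_bound[OF \<delta> R] by blast
  define \<epsilon> where "\<epsilon> = 2 * pi * u * yl"
  have \<epsilon>: "\<epsilon> > 0" unfolding \<epsilon>_def using u_pos yl by simp
  have "\<forall>\<^sub>F N in sequentially. \<forall>y. yl \<le> y \<longrightarrow> y \<le> c - \<delta> \<longrightarrow>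
     norm (E R N (Complex 0 y) * (lattice_kernel (hN N) (Complex 0 y) + 1)) \<le> (2 * C) * exp (real N * (M - \<epsilon>) / \<rho>)"
    using ev eventually_N_ge[of "\<rho> / \<epsilon>"]
  proof eventually_elim
    case (elim N)
    hence N: "N > 0" and N2: "real N \<ge> \<rho> / \<epsilon>" by auto
    note h = hN_simps[OF N]
    define X where "X = real N * \<epsilon> / \<rho>"
    have X1: "X \<ge> 1" using N2 \<epsilon> \<rho> by (simp add: X_def field_simps)
    have r0: "rate N \<ge> 0" using c_pos \<rho> by (simp add: rate_def)
    show ?case
    proof (intro allI impI)
      fix y assume y: "yl \<le> y" "y \<le> c - \<delta>"
      have "u / c * yl \<le> u / c * y" using y u_pos c_pos by (intro mult_left_mono) auto
      hence "rate N * (0 - u / c * y) \<le> rate N * (0 - u / c * yl)" using r0 by (intro mult_left_mono) auto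
      also have "\<dots> = - X" using c_pos by (simp add: X_def rate_def \<epsilon>_def field_simps)
      finally have k: "norm (lattice_kernel (hN N) (Complex 0 y) + 1) \<le> 2 * exp (- X)"
        by (intro norm_lattice_kernel_far(2)[OF _ X1, of "hN N", unfolded rate[OF N R]]) (use c_pos N in \<open>simp_all
            add: h(2)\<close>)
      have "H (Complex 0 y) \<le> M" unfolding H_axis M_def using Fr_y0_max[of y] y yl \<delta> c_pos
          by (intro mult_left_mono) auto
      hence "real N * H (Complex 0 y) / \<rho> \<le> real N * M / \<rho>"
        using \<rho> by (intro divide_right_mono mult_left_mono) auto
      also have "\<dots> = real N * (M - \<epsilon>) / \<rho> + X" by (simp add: X_def algebra_simps flip: add_divide_distrib)
      finally have ex: "exp (real N * H (Complex 0 y) / \<rho>) \<le> exp (real N * (M - \<epsilon>) / \<rho>) * exp X" by (simp flip: exp_add)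
      have "norm (E R N (Complex 0 y)) \<le> C * exp (real N * H (Complex 0 y) / \<rho>)" using elim y u_pos by simp
      also have "\<dots> \<le> C * (exp (real N * (M - \<epsilon>) / \<rho>) * exp X)" using ex C by (intro mult_left_mono) auto
      finally have "norm (E R N (Complex 0 y)) * norm (lattice_kernel (hN N) (Complex 0 y) + 1)
         \<le> (C * (exp (real N * (M - \<epsilon>) / \<rho>) * exp X)) * (2 * exp (- X))"
        using k C by (intro mult_mono) auto
      also have "\<dots> = (2 * C) * exp (real N * (M - \<epsilon>) / \<rho>)" by (simp add: exp_minus)
      finally show "norm (E R N (Complex 0 y) * (lattice_kernel (hN N) (Complex 0 y) + 1))
          \<le> (2 * C) * exp (real N * (M - \<epsilon>) / \<rho>)"
        by (simp add: norm_mult)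
    qed
  qed
  thus ?thesis using C \<epsilon> by (intro exI[of _ "2 * C"] exI[of _ \<epsilon>] conjI) auto
qed

lemma exp_rate_mono: "\<epsilon> \<le> \<epsilon>' \<Longrightarrow> exp (real N * (M - \<epsilon>') / \<rho>) \<le> exp (real N * (M - \<epsilon>) / \<rho>)"
  using \<rho> by (simp add: divide_right_mono mult_left_mono)

text \<open>The shift by 1/2 puts the horizontal sides midway between lattice points. The left side
  is run through downwards with a kernel close to -1, hence the plus sign of i times the integral
  upwards. \<open>H_low\<close> controls the lower side and the hypothesis \<open>top\<close> the
  upper one.\<close>

lemma sum_E:
  assumes \<delta>: "\<delta> > 0" and R: "R > 2" and \<epsilon>1: "\<epsilon>1 > 0"
    and top: "\<And>y s. c - \<delta>' \<le> y \<Longrightarrow> y \<le> c \<Longrightarrow> 0 \<le> s \<Longrightarrow> s < u \<Longrightarrow> H (Complex s y) \<le> M - \<epsilon>1"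
  shows "\<exists>C>0. \<exists>\<epsilon>>0. \<forall>\<^sub>F N in sequentially. \<forall>a b. 1 \<le> a \<longrightarrow> a < b \<longrightarrow>
     yl \<le> (real a - 1 / 2) * c / real N \<longrightarrow> (real a - 1 / 2) * c / real N < c - 2 * pi + \<theta> \<longrightarrow>
     c - \<delta>' \<le> (real b - 1 / 2) * c / real N \<longrightarrow> (real b - 1 / 2) * c / real N \<le> c - \<delta> \<longrightarrow>
     norm (hN N * (\<Sum>k\<in>{a..<b}. E R N (of_nat k * hN N))
        - \<i> * integral {(real a - 1 / 2) * c / real N..(real b - 1 / 2) * c / real N} (\<lambda>y. E R N (Complex 0 y)))
       \<le> C * exp (real N * (M - \<epsilon>) / \<rho>)"
proof -
  obtain C1 where C1: "C1 > 0" and ev1: "\<forall>\<^sub>F N in sequentially. \<forall>m y \<epsilon> s. 1 \<le> m \<longrightarrow> y = (real m - 1 / 2) * c / real N \<longrightarrow>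
      yl \<le> y \<longrightarrow> y \<le> c - \<delta> \<longrightarrow>
     (\<forall>s. 0 \<le> s \<longrightarrow> s < u \<longrightarrow> H (Complex s y) \<le> M - \<epsilon>) \<longrightarrow> 0 \<le> s \<longrightarrow> s \<le> 3 * u \<longrightarrow>
     norm (E R N (Complex s y) * lattice_kernel (hN N) (Complex s y)) \<le> C1 * exp (real N * (M - \<epsilon>) / \<rho>)"
    using horizontal_bound[OF \<delta> R] by blast
  obtain C2 \<epsilon>2 where C2: "C2 > 0" "\<epsilon>2 > 0" and ev2: "\<forall>\<^sub>F N in sequentially. \<forall>y. yl \<le> y \<longrightarrow> y \<le> c - \<delta> \<longrightarrow>
     norm (E R N (Complex (3 * u) y) * lattice_kernel (hN N) (Complex (3 * u) y)) \<le> C2 * exp (real N * (M - \<epsilon>2) / \<rho>)"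
    using right_bound[OF \<delta> R] by blast
  obtain C3 \<epsilon>3 where C3: "C3 > 0" "\<epsilon>3 > 0" and ev3: "\<forall>\<^sub>F N in sequentially. \<forall>y. yl \<le> y \<longrightarrow> y \<le> c - \<delta> \<longrightarrow>
     norm (E R N (Complex 0 y) * (lattice_kernel (hN N) (Complex 0 y) + 1)) \<le> C3 * exp (real N * (M - \<epsilon>3) / \<rho>)"
    using left_bound[OF \<delta> R] by blast
  define \<epsilon> where "\<epsilon> = min (min \<epsilon>0 \<epsilon>1) (min \<epsilon>2 \<epsilon>3)"
  have \<epsilon>: "\<epsilon> > 0" "\<epsilon> \<le> \<epsilon>0" "\<epsilon> \<le> \<epsilon>1" "\<epsilon> \<le> \<epsilon>2" "\<epsilon> \<le> \<epsilon>3" using \<epsilon>1 C2 C3 \<epsilon>0_pos by (auto simp: \<epsilon>_def)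
  define C where "C = C1 * (3 * u) + C2 * c + C1 * (3 * u) + C3 * c"
  have C: "C > 0" using C1 C2 C3 u_pos c_pos by (simp add: C_def add_pos_pos)
  have "\<forall>\<^sub>F N in sequentially. \<forall>a b. 1 \<le> a \<longrightarrow> a < b \<longrightarrow>
     yl \<le> (real a - 1 / 2) * c / real N \<longrightarrow> (real a - 1 / 2) * c / real N < c - 2 * pi + \<theta> \<longrightarrow>
     c - \<delta>' \<le> (real b - 1 / 2) * c / real N \<longrightarrow> (real b - 1 / 2) * c / real N \<le> c - \<delta> \<longrightarrow>
     norm (hN N * (\<Sum>k\<in>{a..<b}. E R N (of_nat k * hN N))
        - \<i> * integral {(real a - 1 / 2) * c / real N..(real b - 1 / 2) * c / real N} (\<lambda>y. E R N (Complex 0 y)))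
       \<le> C * exp (real N * (M - \<epsilon>) / \<rho>)"
    using ev1 ev2 ev3 eventually_N_ge[of "max (c / \<delta>) (c / \<theta>)"]
  proof eventually_elim
    case (elim N)
    hence N: "N > 0" and Nc: "c / real N \<le> \<delta>" "c / real N \<le> \<theta>" using \<delta> \<theta> by (auto simp: field_simps)
    note h = hN_simps[OF N]
    have cN: "c / real N > 0" using c_pos N by simp
    show ?case
    proof (intro allI impI)
      fix a b :: nat
      define yb where "yb = (real a - 1 / 2) * c / real N"
      define yt where "yt = (real b - 1 / 2) * c / real N"
      assume ab: "1 \<le> a" "a < b" and "yl \<le> (real a - 1 / 2) * c / real N" "(real a - 1 / 2) * c / real N
          < c - 2 * pi + \<theta>"
        "c - \<delta>' \<le> (real b - 1 / 2) * c / real N" "(real b - 1 / 2) * c / real N \<le> c - \<delta>"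
      hence yb: "yl \<le> yb" "yb < c - 2 * pi + \<theta>" and yt: "c - \<delta>' \<le> yt" "yt \<le> c - \<delta>" by (simp_all add: yb_def yt_def)
      have ybt: "yb < yt" unfolding yb_def yt_def using ab c_pos N
          by (intro divide_strict_right_mono mult_strict_right_mono) auto
      have yb0: "yb > 0" using yb yl by linarith
      define e where "e = exp (real N * (M - \<epsilon>) / \<rho>)"
      define ff where "ff = (\<lambda>Z. E R N Z * lattice_kernel (hN N) Z)"
      define W where "W = {Z. c - 2 * pi < Im Z \<and> Im Z < c - Im (hN N) / 2}"
      have holW: "E R N holomorphic_on W" unfolding W_def by (rule E_holomorphic[OF N R])
      have inW: "Complex s y \<in> W" if "yb \<le> y" "y \<le> yt" for s y
        using that yb yl yt Nc(1) cN by (auto simp: W_def h)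
      \<comment> \<open>Widened by a quarter of a step on either side, so that the lattice points in
        \<open>S\<close> are still those with a \<le> k < b.\<close>
      define S where "S = {Z. (real a - 3 / 4) * (c / real N) < Im Z \<and> Im Z < (real b - 1 / 4) * (c / real N)}"
      have S_eq: "S = {Z. (real a - 3 / 4) * (c / real N) < Im Z} \<inter> {Z. Im Z < (real b - 1 / 4) * (c / real N)}"
          by (auto simp: S_def)
      have SW: "S \<subseteq> W"
      proof
        fix Z assume Z: "Z \<in> S"
        have "(real a - 3 / 4) * (c / real N) = yb - c / real N / 4" "(real b - 1 / 4) * (c / real N)
            = yt + c / real N / 4"
          by (simp_all add: yb_def yt_def algebra_simps diff_divide_distrib)
        hence "yb - c / real N / 4 < Im Z" "Im Z < yt + c / real N / 4" using Z by (simp_all add: S_def)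
        moreover have "c / real N / 4 \<le> \<theta> / 2" using Nc cN by simp
        ultimately show "Z \<in> W" using yb yt Nc cN by (simp add: W_def h yl_def)
      qed
      define K where "K = int ` {a..<b}"
      have "contour_integral (rectpath (Complex 0 yb) (Complex (3 * u) yt)) (\<lambda>Z. E R N Z / (exp (2 * of_real pi * \<i>
          * Z / hN N) - 1))
          = hN N * (\<Sum>k\<in>K. E R N (of_int k * hN N))"
      proof (rule contour_integral_rectpath_lattice[of _ S])
        show "hN N \<noteq> 0" by (rule h)
        show "open S" unfolding S_eq by (intro open_Int open_halfspace_Im_gt open_halfspace_Im_lt)
        show "convex S" unfolding S_eq by (intro convex_Int convex_halfspace_Im_gt convex_halfspace_Im_lt)
        show "E R N holomorphic_on S" by (rule holomorphic_on_subset[OF holW SW])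
        have "(real a - 3 / 4) * (c / real N) < yb" "yt < (real b - 1 / 4) * (c / real N)"
          using mult_strict_right_mono[OF _ cN, of "real a - 3 / 4" "real a - 1 / 2"]
            mult_strict_right_mono[OF _ cN, of "real b - 1 / 2" "real b - 1 / 4"] by (simp_all add: yb_def yt_def)
        thus "cbox (Complex 0 yb) (Complex (3 * u) yt) \<subseteq> S" by (auto simp: in_cbox_complex_iff S_def)
        show "finite K" by (simp add: K_def)
        show "Re (Complex 0 yb) < Re (Complex (3 * u) yt)" "Im (Complex 0 yb) < Im (Complex (3 * u) yt)"
            using u_pos ybt by auto
        fix k :: int
        { assume "k \<in> K"
          then obtain n where n: "k = int n" "a \<le> n" "n < b" by (auto simp: K_def)
          have "(real a - 1 / 2) * (c / real N) < real n * (c / real N)" "real n * (c / real N)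
              < (real b - 1 / 2) * (c / real N)"
            using n by (intro mult_strict_right_mono[OF _ cN]; linarith)+
          hence n1: "yb < real n * c / real N" "real n * c / real N < yt" by (simp_all add: yb_def yt_def)
          hence "real n * c / real N < c" using yt \<delta> by linarith
          hence "real n < real N" using c_pos N by (simp add: field_simps)
          hence "real n * u < real N * u" using u_pos by simp
          hence "real n * u / real N < 3 * u" using N u_pos by (simp add: field_simps)
          moreover have "0 < real n * u / real N" using n ab u_pos N by simp
          ultimately show "of_int k * hN N \<in> box (Complex 0 yb) (Complex (3 * u) yt)"
            using n1 by (simp add: in_box_complex_iff n(1) h)
        }
        { assume "of_int k * hN N \<in> S"
          hence "(real a - 3 / 4) * (c / real N) < of_int k * (c / real N)" "of_int k * (c / real N)
              < (real b - 1 / 4) * (c / real N)"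
            by (simp_all add: S_def h)
          hence "real a - 3 / 4 < of_int k" "of_int k < real b - 1 / 4" using cN
              by (simp_all only: mult_less_cancel_right_pos)
          hence "int a \<le> k" "k < int b" by linarith+
          thus "k \<in> K" unfolding K_def by (intro image_eqI[of _ _ "nat k"]) auto
        }
      qed
      moreover have "(\<Sum>k\<in>K. E R N (of_int k * hN N)) = (\<Sum>k\<in>{a..<b}. E R N (of_nat k * hN N))"
        unfolding K_def by (subst sum.reindex) auto
      ultimately have rect: "contour_integral (rectpath (Complex 0 yb) (Complex (3 * u) yt)) ff
          = hN N * (\<Sum>k\<in>{a..<b}. E R N (of_nat k * hN N))"
        by (simp add: ff_def lattice_kernel_def)
      define A1 A2 A3 A4 where "A1 = Complex 0 yb" and "A2 = Complex (3 * u) yb" and "A3 = Complex (3 * u) yt" and "A4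
          = Complex 0 yt"
      have nz_hor: "exp (2 * of_real pi * \<i> * Complex s y / hN N) - 1 \<noteq> 0" if "y = (real m - 1 / 2) * c / real N"
          for s y m
      proof (rule lattice_denominator_nonzero)
        show "0 < Im (hN N)" using cN by (simp add: h)
        fix k :: int
        show "Im (Complex s y) \<noteq> of_int k * Im (hN N)"
        proof
          assume "Im (Complex s y) = of_int k * Im (hN N)"
          hence "real m - 1 / 2 = of_int k" using that c_pos N by (simp add: h)
          hence "real_of_int (2 * int m - 1) = of_int (2 * k)" by simp
          hence "2 * int m - 1 = 2 * k" by (simp only: of_int_eq_iff)
          thus False by presburger
        qed
      qed
      \<comment> \<open>On the lattice line s * c = y * u, and 0 < y < c then gives 0 < s < u. This
        excludes both vertical sides.\<close>
      have nz_ver: "exp (2 * of_real pi * \<i> * Complex s y / hN N) - 1 \<noteq> 0" if "s = 0 \<or> s = 3 * u" "yb \<le> y" "y \<le> yt"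
          for s y
      proof
        assume "exp (2 * of_real pi * \<i> * Complex s y / hN N) - 1 = 0"
        then obtain k :: int where "Complex s y = of_int k * hN N"
            using exp_lattice_eq_1_iff[OF h(4), of "Complex s y"] by auto
        hence "s = of_int k * (u / real N)" "y = of_int k * (c / real N)" by (simp_all add: complex_eq_iff h)
        hence "s * c = y * u" by simp
        moreover have "0 < y * u" "y * u < c * u" using that yb0 yt \<delta> u_pos by auto
        moreover have "3 * u * c > c * u" using u_pos c_pos by simp
        ultimately show False using that(1) by auto
      qed
      have hor_pts: "\<exists>s. 0 \<le> s \<and> s \<le> 3 * u \<and> Z = Complex s y"
          if "Z \<in> closed_segment (Complex 0 y) (Complex (3 * u) y) \<or> Z \<in> closed_segment (Complex (3
          * u) y) (Complex 0 y)" for Z y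
      proof -
        have "Z \<in> closed_segment (Complex 0 y) (Complex (3 * u) y)" using that by (auto simp: closed_segment_commute)
        then obtain v where v: "0 \<le> v" "v \<le> 1" "Z = (1 - v) *\<^sub>R Complex 0 y + v *\<^sub>R Complex (3 * u) y"
            by (auto simp: in_segment)
        hence "Z = Complex (v * (3 * u)) y" by (simp add: complex_eq_iff algebra_simps)
        moreover have "v * (3 * u) \<le> 1 * (3 * u)" using v u_pos by (intro mult_right_mono) auto
        ultimately show ?thesis using v u_pos by (intro exI[of _ "v * (3 * u)"]) auto
      qed
      have ver_pts: "\<exists>y. yb \<le> y \<and> y \<le> yt \<and> Z = Complex s y" if Zs: "Z \<in> closed_segment (Complex s yb) (Complex s yt)"
          for Z s
      proof -
        obtain v where v: "0 \<le> v" "v \<le> 1" "Z = (1 - v) *\<^sub>R Complex s yb + v *\<^sub>R Complex s yt"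
          using Zs unfolding in_segment by blast
        hence Zv: "Z = Complex s (yb + v * (yt - yb))" by (simp add: complex_eq_iff algebra_simps)
        have "v * (yt - yb) \<le> yt - yb" using v ybt by (intro mult_left_le_one_le) auto
        hence "yb + v * (yt - yb) \<le> yt" unfolding le_diff_eq by (simp only: add.commute)
        moreover have "yb \<le> yb + v * (yt - yb)" using v ybt by simp
        ultimately show ?thesis using Zv by blast
      qed
      have Ec: "continuous_on U (E R N)" if "U \<subseteq> W" for U
        by (rule continuous_on_subset[OF holomorphic_on_imp_continuous_on[OF holW] that])
      have kc: "continuous_on U (lattice_kernel (hN N))" if "\<And>Z. Z \<in> U \<Longrightarrow> exp (2 * of_real pi * \<i> * Z / hN N) - 1 \<noteq> 0"
          for U
        unfolding lattice_kernel_def by (intro continuous_intros) (use that h(4) in auto)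
      have c_hor: "continuous_on (closed_segment X Y) ff"
          if "X = Complex 0 y \<and> Y = Complex (3 * u) y \<or> X = Complex (3 * u) y \<and> Y = Complex 0 y"
        "y = (real m - 1 / 2) * c / real N" "yb \<le> y" "y \<le> yt" for X Y y m
      proof -
        have pts: "\<exists>s. Z = Complex s y" if "Z \<in> closed_segment X Y" for Z using hor_pts[of Z y] that \<open>X = _ \<and> _ \<or> _\<close>
            by blast
        show ?thesis unfolding ff_def
        proof (intro continuous_on_mult Ec kc)
          show "closed_segment X Y \<subseteq> W" using pts inW that by blast
          show "exp (2 * of_real pi * \<i> * Z / hN N) - 1 \<noteq> 0" if "Z \<in> closed_segment X Y" for Z
            using pts[OF that] nz_hor[OF \<open>y = _\<close>] by blast
        qed
      qed
      have c_ver: "continuous_on (closed_segment (Complex s yb) (Complex s yt)) (lattice_kernel (hN N))"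
        "closed_segment (Complex s yb) (Complex s yt) \<subseteq> W" if "s = 0 \<or> s = 3 * u" for s
      proof -
        show "closed_segment (Complex s yb) (Complex s yt) \<subseteq> W" using ver_pts inW by blast
        show "continuous_on (closed_segment (Complex s yb) (Complex s yt)) (lattice_kernel (hN N))"
        proof (rule kc)
          fix Z assume "Z \<in> closed_segment (Complex s yb) (Complex s yt)"
          then obtain y where "yb \<le> y" "y \<le> yt" "Z = Complex s y" using ver_pts by blast
          thus "exp (2 * of_real pi * \<i> * Z / hN N) - 1 \<noteq> 0" using nz_ver[OF that] by blast
        qed
      qed
      have ci: "ff contour_integrable_on linepath A1 A2" "ff contour_integrable_on linepath A2 A3"
        "ff contour_integrable_on linepath A3 A4" "ff contour_integrable_on linepath A4 A1"
      proof -
        show "ff contour_integrable_on linepath A1 A2" unfolding A1_def A2_def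
          by (rule contour_integrable_continuous_linepath, rule c_hor[where y = yb and m
              = a]) (use ybt in \<open>auto simp: yb_def\<close>)
        show "ff contour_integrable_on linepath A3 A4" unfolding A3_def A4_def
          by (rule contour_integrable_continuous_linepath, rule c_hor[where y = yt and m
              = b]) (use ybt in \<open>auto simp: yt_def\<close>)
        show "ff contour_integrable_on linepath A2 A3" unfolding A2_def A3_def ff_def
          by (rule contour_integrable_continuous_linepath, intro continuous_on_mult c_ver Ec) auto
        show "ff contour_integrable_on linepath A4 A1" unfolding A4_def A1_def ff_def
          by (rule contour_integrable_continuous_linepath, subst closed_segment_commute, intro continuous_on_mult
              c_ver Ec) auto
      qed
      define I where "I = (\<lambda>X Y. contour_integral (linepath X Y) ff)"
      have "rectpath (Complex 0 yb) (Complex (3 * u) yt)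
          = linepath A1 A2 +++ linepath A2 A3 +++ linepath A3 A4 +++ linepath A4 A1"
        by (simp add: rectpath_def Let_def A1_def A2_def A3_def A4_def)
      moreover have "contour_integral (linepath A1 A2 +++ linepath A2 A3 +++ linepath A3 A4 +++ linepath A4 A1) ff
          = I A1 A2 + (I A2 A3 + (I A3 A4 + I A4 A1))"
        unfolding I_def by (subst contour_integral_join; (use ci in \<open>auto intro!: contour_integrable_joinI
            valid_path_join\<close>)?)+
      ultimately have sum4: "hN N * (\<Sum>k\<in>{a..<b}. E R N (of_nat k * hN N)) = I A1 A2 + I A2 A3 + I A3 A4 + I A4 A1"
        using rect by (simp add: add.assoc)
      have e_ge: "x * exp (real N * (M - \<epsilon>') / \<rho>) \<le> x * e" if "\<epsilon> \<le> \<epsilon>'" "x > 0" for x \<epsilon>'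
        unfolding e_def using exp_rate_mono[OF that(1), of N] that(2) by (intro mult_left_mono) auto
      have B1: "norm (I A1 A2) \<le> C1 * e * norm (A2 - A1)"
      proof (rule has_contour_integral_bound_linepath)
        show "(ff has_contour_integral I A1 A2) (linepath A1 A2)" unfolding I_def
            by (rule has_contour_integral_integral[OF ci(1)])
        fix Z assume "Z \<in> closed_segment A1 A2"
        then obtain s where s: "0 \<le> s" "s \<le> 3 * u" "Z = Complex s yb" using hor_pts[of Z yb] unfolding A1_def A2_def
            by blast
        have "norm (ff Z) \<le> C1 * exp (real N * (M - \<epsilon>0) / \<rho>)"
          unfolding ff_def s(3)
          by (rule elim(1)[rule_format, of a]) (use ab s yb yb0 ybt yt H_low yb_def in auto)
        also have "\<dots> \<le> C1 * e" by (rule e_ge) (use \<epsilon> C1 in auto)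
        finally show "norm (ff Z) \<le> C1 * e" .
      qed (use C1 in \<open>auto simp: e_def\<close>)
      have B3: "norm (I A3 A4) \<le> C1 * e * norm (A4 - A3)"
      proof (rule has_contour_integral_bound_linepath)
        show "(ff has_contour_integral I A3 A4) (linepath A3 A4)" unfolding I_def
            by (rule has_contour_integral_integral[OF ci(3)])
        fix Z assume "Z \<in> closed_segment A3 A4"
        then obtain s where s: "0 \<le> s" "s \<le> 3 * u" "Z = Complex s yt" using hor_pts[of Z yt] unfolding A3_def A4_def
            by blast
        have "norm (ff Z) \<le> C1 * exp (real N * (M - \<epsilon>1) / \<rho>)"
          unfolding ff_def s(3)
          by (rule elim(1)[rule_format, of b]) (use ab s yb ybt yt \<delta> top yt_def in auto)
        also have "\<dots> \<le> C1 * e" by (rule e_ge) (use \<epsilon> C1 in auto)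
        finally show "norm (ff Z) \<le> C1 * e" .
      qed (use C1 in \<open>auto simp: e_def\<close>)
      have B2: "norm (I A2 A3) \<le> C2 * e * norm (A3 - A2)"
      proof (rule has_contour_integral_bound_linepath)
        show "(ff has_contour_integral I A2 A3) (linepath A2 A3)" unfolding I_def
            by (rule has_contour_integral_integral[OF ci(2)])
        fix Z assume "Z \<in> closed_segment A2 A3"
        then obtain y where y: "yb \<le> y" "y \<le> yt" "Z = Complex (3 * u) y" using ver_pts[of Z "3 * u"]
            unfolding A2_def A3_def by blast
        have "norm (ff Z) \<le> C2 * exp (real N * (M - \<epsilon>2) / \<rho>)"
          unfolding ff_def y(3) by (rule elim(2)[rule_format]) (use y yb yt in auto)
        also have "\<dots> \<le> C2 * e" by (rule e_ge) (use \<epsilon> C2 in auto)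
        finally show "norm (ff Z) \<le> C2 * e" .
      qed (use C2 in \<open>auto simp: e_def\<close>)
      have c14: "continuous_on (closed_segment A1 A4) (E R N)"
          "continuous_on (closed_segment A1 A4) (lattice_kernel (hN N))"
        unfolding A1_def A4_def by (intro Ec c_ver, simp)+
      have cE: "E R N contour_integrable_on linepath A1 A4"
        and cE1: "(\<lambda>Z. E R N Z * (lattice_kernel (hN N) Z + 1)) contour_integrable_on linepath A1 A4"
        by (intro contour_integrable_continuous_linepath continuous_intros c14)+
      have "I A4 A1 = - contour_integral (linepath A1 A4) ff"
        unfolding I_def ff_def
        by (rule contour_integral_reverse_linepath) (subst closed_segment_commute, intro continuous_on_mult c14)
      also have "contour_integral (linepath A1 A4) ff = contour_integral (linepath A1 A4) (\<lambda>Z. E R N Z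
          * (lattice_kernel (hN N) Z + 1) - E R N Z)"
        unfolding ff_def by (simp add: algebra_simps)
      also have "\<dots> = contour_integral (linepath A1 A4) (\<lambda>Z. E R N Z * (lattice_kernel (hN N) Z + 1))
          - contour_integral (linepath A1 A4) (E R N)"
        by (rule contour_integral_diff[OF cE1 cE])
      also have "contour_integral (linepath A1 A4) (E R N) = \<i> * integral {yb..yt} (\<lambda>y. E R N (Complex 0 y))"
        by (rule contour_integral_linepath_same_Re) (use ybt in \<open>auto simp: A1_def A4_def\<close>)
      finally have I41: "I A4 A1 = \<i> * integral {yb..yt} (\<lambda>y. E R N (Complex 0 y))
          - contour_integral (linepath A1 A4) (\<lambda>Z. E R N Z * (lattice_kernel (hN N) Z + 1))"
        by simp
      have B4: "norm (contour_integral (linepath A1 A4) (\<lambda>Z. E R N Z * (lattice_kernel (hN N) Z + 1)))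
          \<le> C3 * e * norm (A4 - A1)"
      proof (rule has_contour_integral_bound_linepath[OF has_contour_integral_integral[OF cE1]])
        fix Z assume "Z \<in> closed_segment A1 A4"
        then obtain y where y: "yb \<le> y" "y \<le> yt" "Z = Complex 0 y" using ver_pts[of Z 0] unfolding A1_def A4_def
            by blast
        have "norm (E R N Z * (lattice_kernel (hN N) Z + 1)) \<le> C3 * exp (real N * (M - \<epsilon>3) / \<rho>)"
          unfolding y(3) by (rule elim(3)[rule_format]) (use y yb yt in auto)
        also have "\<dots> \<le> C3 * e" by (rule e_ge) (use \<epsilon> C3 in auto)
        finally show "norm (E R N Z * (lattice_kernel (hN N) Z + 1)) \<le> C3 * e" .
      qed (use C3 in \<open>auto simp: e_def\<close>)
      have "A2 - A1 = of_real (3 * u)" "A4 - A3 = of_real (- (3 * u))" "A3 - A2 = \<i> * of_real (yt - yb)" "A4 - A1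
          = \<i> * of_real (yt - yb)"
        by (simp_all add: complex_eq_iff A1_def A2_def A3_def A4_def)
      hence len: "norm (A2 - A1) = 3 * u" "norm (A4 - A3) = 3 * u" "norm (A3 - A2) = yt - yb" "norm (A4 - A1) = yt - yb"
        using u_pos ybt by (simp_all add: norm_mult del: of_real_diff of_real_mult)
      have ytb: "yt - yb \<le> c" using yb0 yt \<delta> by linarith
      have e0: "e > 0" by (simp add: e_def)
      have "norm (hN N * (\<Sum>k\<in>{a..<b}. E R N (of_nat k * hN N)) - \<i> * integral {yb..yt} (\<lambda>y. E R N (Complex 0 y)))
         = norm (I A1 A2 + I A2 A3 + I A3 A4 - contour_integral (linepath A1 A4) (\<lambda>Z. E R N Z
             * (lattice_kernel (hN N) Z + 1)))"
        unfolding sum4 I41 by (simp add: algebra_simps)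
      also have "\<dots> \<le> C1 * e * (3 * u) + C2 * e * (yt - yb) + C1 * e * (3 * u) + C3 * e * (yt - yb)"
        by (rule order_trans[OF norm_triangle_ineq4] order_trans[OF norm_triangle_ineq] add_mono B1[unfolded len]
            B2[unfolded len] B3[unfolded len] B4[unfolded len])+
      also have "\<dots> \<le> C1 * e * (3 * u) + C2 * e * c + C1 * e * (3 * u) + C3 * e * c"
        using ytb C1 C2 C3 e0 by (intro add_mono mult_left_mono) auto
      also have "\<dots> = C * e" by (simp add: C_def algebra_simps)
      finally show "norm (hN N * (\<Sum>k\<in>{a..<b}. E R N (of_nat k * hN N))
        - \<i> * integral {(real a - 1 / 2) * c / real N..(real b - 1 / 2) * c / real N} (\<lambda>y. E R N (Complex 0 y)))
       \<le> C * exp (real N * (M - \<epsilon>) / \<rho>)" by (simp only: yb_def yt_def e_def)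
    qed
  qed
  thus ?thesis using C \<epsilon> by blast
qed

end

section \<open>The contribution of the saddle point\<close>

lemma bounded_on_cball_holomorphic:
  assumes "f holomorphic_on S" "open S" "cball z r \<subseteq> S"
  shows "\<exists>D\<ge>0. \<forall>w\<in>cball z r. norm (f w) \<le> D"
proof -
  have "continuous_on (cball z r) f" using assms holomorphic_on_imp_continuous_on continuous_on_subset by blast
  hence "bounded (f ` cball z r)" by (intro compact_imp_bounded compact_continuous_image) auto
  then obtain D where "\<And>w. w \<in> cball z r \<Longrightarrow> norm (f w) \<le> D" unfolding bounded_iff by blast
  thus ?thesis by (intro exI[of _ "max 0 D"]) (auto simp: le_max_iff_disj)
qed

context fig8 begin

definition "amp y = exp (ln (2 * cosh u - 2 * cos y) / 2)" for y :: real
text \<open>On the axis F / h = N \<mu> Fr, so this is the complex parameter of Laplace's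
  method.\<close>

definition "\<mu> = \<i> / \<xi>"

lemma Re_\<mu>: "Re \<mu> = c / \<rho>" by (simp add: \<mu>_def \<rho> Re_divide power2_eq_square)
lemma Re_\<mu>_pos: "Re \<mu> > 0" using c_pos \<rho> by (simp add: Re_\<mu>)

lemma amp: "exp (g (\<i> * of_real y) / 2) = of_real (amp y)"
  by (simp add: g_axis amp_def flip: exp_of_real)

lemma amp_le: "0 \<le> amp y" "amp y \<le> exp 2"
proof -
  have "norm (exp (g (\<i> * of_real y) / 2)) \<le> exp 2"
    by (rule norm_exp_half_g) (use axis_strip u_pos in \<open>auto simp: dmn_def\<close>)
  thus "amp y \<le> exp 2" unfolding amp by (simp add: amp_def)
qed (simp add: amp_def)

lemma amp_cont: "continuous_on S amp"
proof -
  have "2 * cosh u - 2 * cos y \<noteq> 0" for y using G_axis_pos[of y] by simp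
  thus ?thesis unfolding amp_def by (intro continuous_intros) auto
qed

lemma sc_y0: "cos y0 = cosh u - 1 / 2" "sin y0 = - sin \<theta>"
  using sin_cos_c \<theta>(1) by (simp_all add: y0_def cos_diff sin_diff)

lemma z0_eq: "z0 = \<i> * of_real y0" by (simp add: z0_def complex_eq_iff)

lemma G_z0: "G z0 = 1" unfolding z0_eq G_axis sc_y0 by simp
lemma g_z0: "g z0 = 0" by (simp add: g_def G_z0)

text \<open>The second derivative of y \<mapsto> F (i y) is -g' (i y), so the phase has second
  derivative -2 sin \<theta> at y0. Laplace's method is used with the constant 2 sin
  \<theta>.\<close>

lemma g_deriv_z0: "deriv g z0 = 2 * \<i> * of_real (sin \<theta>)"
proof -
  have "(G has_field_derivative (- exp z0 + exp (- z0))) (at z0)"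
    unfolding G_def[abs_def] by (auto intro!: derivative_eq_intros)
  hence "(g has_field_derivative (inverse (G z0) * (- exp z0 + exp (- z0)))) (at z0)"
    unfolding g_def[abs_def] by (rule DERIV_chain2[where f = Ln and g
        = G, OF has_field_derivative_Ln[OF G_not_nonpos[OF z0_mem(3)]]])
  hence "deriv g z0 = - exp z0 + exp (- z0)" by (simp add: G_z0 DERIV_imp_deriv)
  also have "\<dots> = 2 * \<i> * of_real (sin \<theta>)"
    by (simp add: complex_eq_iff z0_def Re_exp Im_exp sc_y0)
  finally show ?thesis .
qed

lemma cball_strip: "cball z0 (u / 2) \<subseteq> strip"
proof
  fix w assume "w \<in> cball z0 (u / 2)"
  hence "\<bar>Re (w - z0)\<bar> \<le> u / 2" using abs_Re_le_cmod[of "w - z0"] by (simp add: dist_norm norm_minus_commute)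
  hence "\<bar>Re w\<bar> < u" using u_pos by (simp add: z0_def)
  thus "w \<in> strip" by (auto simp: strip_def)
qed

lemma gs_holo: "g holomorphic_on strip" by (rule holomorphic_on_subset[OF g_holo]) (auto simp: dmn_def)

lemma axis_point: "Complex 0 (y0 + t) = z0 + \<i> * of_real t" "\<i> * of_real (y0 + t) = z0 + \<i> * of_real t"
  by (simp_all add: complex_eq_iff z0_def)

text \<open>Taylor's formula for \<open>F\<close> on a disc inside the strip, read off along the
  axis: as i^2 = -1 and i^3 = -i, the imaginary part gives the expansion of the phase. The linear
  term is absent because g z0 = 0.\<close>

lemma Fr_Taylor: "\<exists>D d. D \<ge> 0 \<and> (\<forall>t. \<bar>t\<bar> \<le> u / 2 \<longrightarrow> \<bar>(Fr (y0 + t) - Fr y0) + (2 * sin \<theta>) / 2 * t\<^sup>2 - d * t ^ 3\<bar>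
    \<le> D * t ^ 4)"
proof -
  define T where "T = (\<lambda>i::nat. if i = 0 then F else (deriv ^^ (i - 1)) g)"
  have dh: "(deriv ^^ i) g holomorphic_on strip" for i
    using gs_holo open_strip by (rule holomorphic_higher_deriv)
  obtain D where D: "D \<ge> 0" "\<And>w. w \<in> cball z0 (u / 2) \<Longrightarrow> norm ((deriv ^^ 3) g w) \<le> D"
    using bounded_on_cball_holomorphic[OF dh open_strip cball_strip] by blast
  define d where "d = - Re (deriv (deriv g) z0) / 6"
  have "\<bar>(Fr (y0 + t) - Fr y0) + (2 * sin \<theta>) / 2 * t\<^sup>2 - d * t ^ 3\<bar> \<le> D * t ^ 4" if t: "\<bar>t\<bar> \<le> u / 2" for t
  proof -
    define z where "z = z0 + \<i> * of_real t"
    have zz: "z - z0 = \<i> * of_real t" by (simp add: z_def)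
    have zb: "z \<in> cball z0 (u / 2)" using t by (simp add: z_def dist_norm norm_mult)
    have "norm (T 0 z - (\<Sum>i\<le>3. T i z0 * (z - z0) ^ i / fact i)) \<le> D * norm (z - z0) ^ Suc 3 / fact 3"
    proof (rule complex_Taylor[of "cball z0 (u / 2)"])
      fix i :: nat and x assume x: "x \<in> cball z0 (u / 2)"
      hence xs: "x \<in> strip" using cball_strip by blast
      show "norm (T (Suc 3) x) \<le> D" using D(2)[OF x] by (simp add: T_def)
      assume "i \<le> 3"
      show "(T i has_field_derivative T (Suc i) x) (at x within cball z0 (u / 2))"
      proof (cases i)
        case 0
        thus ?thesis using has_field_derivative_at_within[OF F_deriv[OF strip_dmn[OF xs]]] by (simp add: T_def)
      next
        case (Suc j)
        have "((deriv ^^ j) g has_field_derivative deriv ((deriv ^^ j) g) x) (at x)"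
          by (rule holomorphic_derivI[OF dh open_strip xs])
        thus ?thesis using Suc by (simp add: T_def has_field_derivative_at_within)
      qed
    qed (use zb u_pos in auto)
    also have "D * norm (z - z0) ^ Suc 3 / fact 3 = D * t ^ 4 / 6"
      unfolding zz by (simp add: norm_mult fact_numeral)
    also have "\<dots> \<le> D * t ^ 4" using D by simp
    also have "(\<Sum>i\<le>3. T i z0 * (z - z0) ^ i / fact i) = F z0 + g z0 * (z - z0) + deriv g z0 * (z - z0)\<^sup>2 / 2
        + deriv (deriv g) z0 * (z - z0) ^ 3 / 6"
      by (simp add: T_def numeral_eq_Suc fact_numeral)
    also have "\<dots> = F z0 - \<i> * of_real (sin \<theta> * t\<^sup>2) - \<i> * deriv (deriv g) z0 * of_real (t ^ 3 / 6)"
    proof -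
      have "\<i> ^ 3 = - \<i>" by (simp add: power3_eq_cube)
      hence "(\<i> * of_real t)\<^sup>2 = - of_real (t\<^sup>2)" "(\<i> * of_real t) ^ 3 = - \<i> * of_real (t ^ 3)"
        by (simp_all add: power_mult_distrib)
      thus ?thesis unfolding zz g_z0 g_deriv_z0 by simp
    qed
    finally have 1: "norm (F z - (F z0 - \<i> * of_real (sin \<theta> * t\<^sup>2) - \<i> * deriv (deriv g) z0 * of_real (t ^ 3 / 6)))
        \<le> D * t ^ 4"
      by (simp add: T_def)
    have Fz: "Im (F z) = Fr (y0 + t)" "Im (F z0) = Fr y0"
      unfolding Fr_def axis_point z_def z0_eq[symmetric] by simp_all
    have eq: "Im (F z - (F z0 - \<i> * of_real (sin \<theta> * t\<^sup>2) - \<i> * deriv (deriv g) z0 * of_real (t ^ 3 / 6)))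
        = (Fr (y0 + t) - Fr y0) + (2 * sin \<theta>) / 2 * t\<^sup>2 - d * t ^ 3"
      by (simp add: Fz d_def)
    show ?thesis using order_trans[OF abs_Im_le_cmod 1] unfolding eq .
  qed
  thus ?thesis using D by blast
qed

lemma amp_Taylor: "\<exists>D A1. D \<ge> 0 \<and> (\<forall>t. \<bar>t\<bar> \<le> u / 2 \<longrightarrow> \<bar>amp (y0 + t) - 1 - A1 * t\<bar> \<le> D * t\<^sup>2)"
proof -
  define Q where "Q = (\<lambda>z. exp (g z / 2))"
  have Qh: "Q holomorphic_on strip" unfolding Q_def by (intro holomorphic_intros gs_holo) auto
  have dQ: "deriv Q holomorphic_on strip" by (rule holomorphic_deriv[OF Qh open_strip])
  have ddQ: "deriv (deriv Q) holomorphic_on strip" by (rule holomorphic_deriv[OF dQ open_strip])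
  obtain D where D: "D \<ge> 0" "\<And>w. w \<in> cball z0 (u / 2) \<Longrightarrow> norm (deriv (deriv Q) w) \<le> D"
    using bounded_on_cball_holomorphic[OF ddQ open_strip cball_strip] by blast
  define T where "T = (\<lambda>i::nat. if i = 0 then Q else if i = 1 then deriv Q else deriv (deriv Q))"
  have "\<bar>amp (y0 + t) - 1 - (- Im (deriv Q z0)) * t\<bar> \<le> D * t\<^sup>2" if t: "\<bar>t\<bar> \<le> u / 2" for t
  proof -
    define z where "z = z0 + \<i> * of_real t"
    have zz: "z - z0 = \<i> * of_real t" by (simp add: z_def)
    have zb: "z \<in> cball z0 (u / 2)" using t by (simp add: z_def dist_norm norm_mult)
    have "norm (T 0 z - (\<Sum>i\<le>1. T i z0 * (z - z0) ^ i / fact i)) \<le> D * norm (z - z0) ^ Suc 1 / fact 1"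
    proof (rule complex_Taylor[of "cball z0 (u / 2)"])
      fix i :: nat and x assume x: "x \<in> cball z0 (u / 2)"
      hence xs: "x \<in> strip" using cball_strip by blast
      show "norm (T (Suc 1) x) \<le> D" using D(2)[OF x] by (simp add: T_def)
      assume "i \<le> 1"
      hence i: "i = 0 \<or> i = 1" by linarith
      note d = has_field_derivative_at_within[OF holomorphic_derivI[OF Qh open_strip xs]]
        has_field_derivative_at_within[OF holomorphic_derivI[OF dQ open_strip xs]]
      from i show "(T i has_field_derivative T (Suc i) x) (at x within cball z0 (u / 2))"
        by (elim disjE) (use d in \<open>simp_all add: T_def\<close>)
    qed (use zb u_pos in auto)
    hence 1: "norm (Q z - (Q z0 + deriv Q z0 * (\<i> * of_real t))) \<le> D * t\<^sup>2"
      by (simp add: T_def zz norm_mult power2_eq_square)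
    have "Q z = of_real (amp (y0 + t))" unfolding Q_def z_def axis_point(2)[symmetric] by (rule amp)
    moreover have "Q z0 = 1" by (simp add: Q_def g_z0)
    ultimately have eq: "Re (Q z - (Q z0 + deriv Q z0 * (\<i> * of_real t)))
        = amp (y0 + t) - 1 - (- Im (deriv Q z0)) * t" by simp
    show ?thesis using order_trans[OF abs_Re_le_cmod 1] unfolding eq .
  qed
  thus ?thesis using D by blast
qed

lemma integral_translate:
  fixes f :: "real \<Rightarrow> 'a :: euclidean_space"
  shows "integral {a - s..b - s} (\<lambda>t. f (s + t)) = integral {a..b} f"
  using integral_shift_Icc_real[of "a - s" "b - s" f s] by (simp add: o_def)

lemma laplace_Fr:
  assumes \<delta>: "0 < \<delta>" "\<delta> \<le> \<theta> / 2"
  shows "\<exists>C>0. \<forall>N. real N \<ge> 1 \<longrightarrow> (\<forall>yb yt. yl \<le> yb \<longrightarrow> yb \<le> c - 2 * pi + \<theta> \<longrightarrow> c - \<delta> \<le> yt \<longrightarrow> yt \<le> c \<longrightarrow>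
     norm (integral {yb..yt} (\<lambda>y. of_real (amp y) * exp (of_real (real N) * \<mu> * of_real (Fr y - Fr y0)))
         - csqrt (of_real pi / (of_real (real N) * (\<mu> * of_real (sin \<theta>))))) \<le> C / (real N * sqrt (real N))
     \<and> integral {yb..yt} (\<lambda>y. exp (real N * Re \<mu> * (Fr y - Fr y0))) \<le> C / sqrt (real N))"
proof -
  obtain D1 d where D1: "D1 \<ge> 0" "\<And>t. \<bar>t\<bar> \<le> u / 2 \<Longrightarrow> \<bar>(Fr (y0 + t) - Fr y0) + (2 * sin \<theta>) / 2 * t\<^sup>2 - d * t ^ 3\<bar>
      \<le> D1 * t ^ 4"
    using Fr_Taylor by blast
  obtain D2 A1 where D2: "D2 \<ge> 0" "\<And>t. \<bar>t\<bar> \<le> u / 2 \<Longrightarrow> \<bar>amp (y0 + t) - 1 - A1 * t\<bar> \<le> D2 * t\<^sup>2"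
    using amp_Taylor by blast
  define D where "D = max D1 D2"
  have D: "D \<ge> 0" "D1 \<le> D" "D2 \<le> D" using D1 D2 by (auto simp: D_def)
  define E' where "E' = (\<lambda>t. Fr (y0 + t) - Fr y0)"
  define A' where "A' = (\<lambda>t. amp (y0 + t))"
  have cE: "continuous_on S E'" for S
  proof -
    have "continuous_on S (Fr \<circ> (\<lambda>t. y0 + t))" by (intro continuous_on_compose Fr_cont continuous_intros)
    thus ?thesis unfolding E'_def by (auto simp: o_def intro!: continuous_intros)
  qed
  have cA: "continuous_on S A'" for S
  proof -
    have "continuous_on S (amp \<circ> (\<lambda>t. y0 + t))" by (intro continuous_on_compose amp_cont continuous_intros)
    thus ?thesis unfolding A'_def by (auto simp: o_def)
  qed
  have tE: "\<bar>E' t + (2 * sin \<theta>) / 2 * t\<^sup>2 - d * t ^ 3\<bar> \<le> D * t ^ 4" if "\<bar>t\<bar> \<le> u / 2" for t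
    using D1(2)[OF that] mult_right_mono[OF D(2), of "t ^ 4"] by (simp add: E'_def)
  have tA: "\<bar>A' t - 1 - A1 * t\<bar> \<le> D * t\<^sup>2" if "\<bar>t\<bar> \<le> u / 2" for t
    using D2(2)[OF that] mult_right_mono[OF D(3), of "t\<^sup>2"] by (simp add: A'_def)
  \<comment> \<open>The ranges of the two end points after the saddle point has been moved to 0;
    they lie on opposite sides of it by ab.\<close>
  define a0 a1 b1 b0 where "a0 = yl - y0" and "a1 = (c - 2 * pi + \<theta>) - y0" and "b1 = (c - \<delta>) - y0" and "b0 = c - y0"
  have ab: "a0 \<le> a1" "a1 < 0" "0 < b1" "b1 \<le> b0"
    using yl \<theta> \<delta> pi_gt3 by (auto simp: a0_def a1_def b1_def b0_def y0_def)
  have far: "\<exists>\<kappa>>0. \<forall>t\<in>{a0..b0}. \<bar>t\<bar> \<ge> e \<longrightarrow> E' t \<le> - \<kappa>" if e: "e > 0" for e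
  proof -
    obtain \<kappa> where \<kappa>: "\<kappa> > 0" "\<And>y. y \<in> {0..c} \<Longrightarrow> \<bar>y - y0\<bar> \<ge> e \<Longrightarrow> Fr y \<le> Fr y0 - \<kappa>"
      using Fr_y0_strict[OF e] by blast
    have "E' t \<le> - \<kappa>" if "t \<in> {a0..b0}" "\<bar>t\<bar> \<ge> e" for t
      using \<kappa>(2)[of "y0 + t"] that yl by (simp add: E'_def a0_def b0_def)
    thus ?thesis using \<kappa>(1) by blast
  qed
  have s2: "2 * sin \<theta> > 0" "u / 2 > 0" using \<theta> u_pos by auto
  obtain C1 where C1: "\<And>N a b. N \<ge> 1 \<Longrightarrow> a \<in> {a0..a1} \<Longrightarrow> b \<in> {b1..b0} \<Longrightarrow>
     norm (integral {a..b} (\<lambda>t. of_real (A' t) * exp (of_real N * \<mu> * of_real (E' t)))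
         - of_real 1 * csqrt (of_real pi / (of_real N * (\<mu> * of_real (2 * sin \<theta> / 2))))) \<le> C1 / (N * sqrt N)"
    using laplace_asymptotic[OF Re_\<mu>_pos s2 D(1) ab cE cA tE tA far] by blast
  obtain C2 where C2: "\<And>N a b. N \<ge> 1 \<Longrightarrow> a \<in> {a0..a1} \<Longrightarrow> b \<in> {b1..b0} \<Longrightarrow>
      integral {a..b} (\<lambda>t. exp (N * Re \<mu> * E' t)) \<le> C2 / sqrt N"
    using laplace_upper_bound[OF Re_\<mu>_pos s2 D(1) ab cE tE far] by blast
  define C where "C = max 1 (max C1 C2)"
  have C: "C > 0" "C1 \<le> C" "C2 \<le> C" by (auto simp: C_def)
  show ?thesis
  proof (intro exI[of _ C] conjI allI impI C(1))
    fix N :: nat and yb yt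
    assume N: "real N \<ge> 1" and y: "yl \<le> yb" "yb \<le> c - 2 * pi + \<theta>" "c - \<delta> \<le> yt" "yt \<le> c"
    have mem: "yb - y0 \<in> {a0..a1}" "yt - y0 \<in> {b1..b0}" using y by (auto simp: a0_def a1_def b1_def b0_def)
    have t1: "integral {yb - y0..yt - y0} (\<lambda>t. of_real (A' t) * exp (of_real (real N) * \<mu> * of_real (E' t)))
       = integral {yb..yt} (\<lambda>y. of_real (amp y) * exp (of_real (real N) * \<mu> * of_real (Fr y - Fr y0)))"
      unfolding A'_def E'_def
      by (rule integral_translate[of yb y0 yt "\<lambda>y. of_real (amp y) * exp (of_real (real N) * \<mu> * of_real (Fr y
          - Fr y0))"])
    have t2: "integral {yb - y0..yt - y0} (\<lambda>t. exp (real N * Re \<mu> * E' t))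
        = integral {yb..yt} (\<lambda>y. exp (real N * Re \<mu> * (Fr y - Fr y0)))"
      unfolding E'_def
      by (rule integral_translate[of yb y0 yt "\<lambda>y. exp (real N * Re \<mu> * (Fr y - Fr y0))"])
    have "C1 / (real N * sqrt (real N)) \<le> C / (real N * sqrt (real N))" using C by (intro divide_right_mono) auto
    thus "norm (integral {yb..yt} (\<lambda>y. of_real (amp y) * exp (of_real (real N) * \<mu> * of_real (Fr y - Fr y0)))
         - csqrt (of_real pi / (of_real (real N) * (\<mu> * of_real (sin \<theta>))))) \<le> C / (real N * sqrt (real N))"
      using C1[OF N mem] unfolding t1 by simp
    have "C2 / sqrt (real N) \<le> C / sqrt (real N)" using C by (intro divide_right_mono) auto
    thus "integral {yb..yt} (\<lambda>y. exp (real N * Re \<mu> * (Fr y - Fr y0))) \<le> C / sqrt (real N)"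
      using C2[OF N mem] unfolding t2 by simp
  qed
qed

text \<open>The interpolant differs from exp (F / h + g / 2) by a factor exp e with e = O(1/N) that
  varies with y. The integral of the modulus has order N^(-1/2) relative to the saddle value, so
  this variation costs N^(-3/2), the same order as the error of Laplace's method.\<close>

lemma integral_E:
  assumes \<delta>: "0 < \<delta>" "0 < \<delta>'" "\<delta>' \<le> \<theta> / 2" and R: "R > 2"
  shows "\<exists>C>0. \<forall>\<^sub>F N in sequentially. \<forall>yb yt. yl \<le> yb \<longrightarrow> yb \<le> c - 2 * pi + \<theta> \<longrightarrow> c - \<delta>' \<le> yt \<longrightarrow> yt \<le> c - \<delta> \<longrightarrow>
     norm (integral {yb..yt} (\<lambda>y. E R N (Complex 0 y))
         - exp (of_real (real N) * \<mu> * of_real (Fr y0)) * csqrt (of_real pi / (of_real (real N) * (\<mu>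
             * of_real (sin \<theta>)))))
       \<le> C / (real N * sqrt (real N)) * exp (real N * M / \<rho>)"
proof -
  obtain C1 where C1: "C1 > 0" "\<And>N yb yt. real N \<ge> 1 \<Longrightarrow> yl \<le> yb \<Longrightarrow> yb \<le> c - 2 * pi + \<theta> \<Longrightarrow> c - \<delta>' \<le> yt \<Longrightarrow> yt \<le> c \<Longrightarrow>
     norm (integral {yb..yt} (\<lambda>y. of_real (amp y) * exp (of_real (real N) * \<mu> * of_real (Fr y - Fr y0)))
         - csqrt (of_real pi / (of_real (real N) * (\<mu> * of_real (sin \<theta>))))) \<le> C1 / (real N * sqrt (real N))
     \<and> integral {yb..yt} (\<lambda>y. exp (real N * Re \<mu> * (Fr y - Fr y0))) \<le> C1 / sqrt (real N)"
    using laplace_Fr[OF \<delta>(2,3)] by blast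
  obtain C2 where C2: "C2 > 0" and ev: "\<forall>\<^sub>F N in sequentially. \<forall>Z. 0 \<le> Re Z \<longrightarrow> Re Z \<le> 3 * u \<longrightarrow> yl \<le> Im Z \<longrightarrow> Im Z \<le> c - \<delta> \<longrightarrow>
     (\<exists>e. norm e \<le> C2 / real N \<and> E R N Z = exp (F Z / hN N + g Z / 2 + e))"
    using E_asymptotic[OF \<delta>(1) R] by blast
  define C where "C = C1 + exp 2 * (C2 * exp C2) * C1"
  have C: "C > 0" using C1 C2 by (simp add: C_def add_pos_pos)
  have "\<forall>\<^sub>F N in sequentially. \<forall>yb yt. yl \<le> yb \<longrightarrow> yb \<le> c - 2 * pi + \<theta> \<longrightarrow> c - \<delta>' \<le> yt \<longrightarrow> yt \<le> c - \<delta> \<longrightarrow>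
     norm (integral {yb..yt} (\<lambda>y. E R N (Complex 0 y))
         - exp (of_real (real N) * \<mu> * of_real (Fr y0)) * csqrt (of_real pi / (of_real (real N) * (\<mu>
             * of_real (sin \<theta>)))))
       \<le> C / (real N * sqrt (real N)) * exp (real N * M / \<rho>)"
    using ev eventually_N_ge[of "max 1 (c / \<delta>)"]
  proof eventually_elim
    case (elim N)
    hence N: "N > 0" "real N \<ge> 1" and Nc: "c / real N \<le> \<delta>" using \<delta> by (auto simp: field_simps)
    note h = hN_simps[OF N(1)]
    show ?case
    proof (intro allI impI)
      fix yb yt assume y: "yl \<le> yb" "yb \<le> c - 2 * pi + \<theta>" "c - \<delta>' \<le> yt" "yt \<le> c - \<delta>"
      have ytc: "yt \<le> c" using y \<delta> by linarith
      define G0 where "G0 = csqrt (of_real pi / (of_real (real N) * (\<mu> * of_real (sin \<theta>))))"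
      define X0 where "X0 = exp (of_real (real N) * \<mu> * of_real (Fr y0))"
      define \<phi> where "\<phi> = (\<lambda>y. of_real (amp y) * exp (of_real (real N) * \<mu> * of_real (Fr y - Fr y0)))"
      have nX0: "norm X0 = exp (real N * M / \<rho>)" by (simp add: X0_def M_def Re_\<mu>)
      have Lap: "norm (integral {yb..yt} \<phi> - G0) \<le> C1 / (real N * sqrt (real N))"
        and ub: "integral {yb..yt} (\<lambda>y. exp (real N * Re \<mu> * (Fr y - Fr y0))) \<le> C1 / sqrt (real N)"
        using C1(2)[OF N(2) y(1-3) ytc] by (simp_all add: G0_def \<phi>_def)
      have Eeq: "\<exists>e. norm e \<le> C2 / real N \<and> E R N (Complex 0 y) = X0 * (\<phi> y * exp e)" if yy: "y \<in> {yb..yt}" for y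
      proof -
        have "\<exists>e. norm e \<le> C2 / real N \<and> E R N (Complex 0 y) = exp (F (Complex 0 y) / hN N + g (Complex 0 y) / 2 + e)"
          using elim(1)[rule_format, of "Complex 0 y"] yy y u_pos by simp
        then obtain e where e: "norm e \<le> C2 / real N" "E R N (Complex 0 y)
            = exp (F (Complex 0 y) / hN N + g (Complex 0 y) / 2 + e)" by blast
        have iy: "Complex 0 y = \<i> * of_real y" by (simp add: complex_eq_iff)
        have "F (\<i> * of_real y) / hN N = of_real (real N) * \<mu> * of_real (Fr y)"
          unfolding F_axis by (simp add: hN_def \<mu>_def)
        hence "E R N (Complex 0 y) = exp (of_real (real N) * \<mu> * of_real (Fr y)) * of_real (amp y) * exp e"
          unfolding e(2) unfolding iy exp_add amp by simp
        also have "exp (of_real (real N) * \<mu> * of_real (Fr y))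
            = X0 * exp (of_real (real N) * \<mu> * of_real (Fr y - Fr y0))"
          unfolding X0_def by (simp flip: exp_add add: algebra_simps)
        finally show ?thesis using e(1) by (auto simp: \<phi>_def mult_ac)
      qed
      have cont\<phi>: "continuous_on {yb..yt} \<phi>" unfolding \<phi>_def by (intro continuous_intros amp_cont Fr_cont)
      have contE: "continuous_on {yb..yt} (\<lambda>y. E R N (Complex 0 y))"
      proof -
        have "continuous_on {yb..yt} (E R N \<circ> (\<lambda>y. Complex 0 y))"
        proof (rule continuous_on_compose)
          show "continuous_on {yb..yt} (\<lambda>y. Complex 0 y)" unfolding Complex_split by (intro continuous_intros)
          have "c / real N > 0" using c_pos N by simp
          moreover have "x < c - q / 2" if "0 < q" "q \<le> \<delta>" "x \<le> yt" for q x using that y by linarith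
          ultimately have top: "x < c - Im (hN N) / 2" if "x \<le> yt" for x using that Nc unfolding h(2) by blast
          show "continuous_on ((\<lambda>y. Complex 0 y) ` {yb..yt}) (E R N)"
            by (rule continuous_on_subset[OF holomorphic_on_imp_continuous_on[OF E_holomorphic[OF N(1) R]]])
              (use y yl top in auto)
        qed
        thus ?thesis by (simp add: o_def)
      qed
      have i1: "(\<lambda>y. E R N (Complex 0 y)) integrable_on {yb..yt}" by (rule integrable_continuous_interval[OF contE])
      have i2: "(\<lambda>y. X0 * \<phi> y) integrable_on {yb..yt}" by (intro integrable_continuous_interval continuous_intros cont\<phi>)
      define K where "K = exp (real N * M / \<rho>) * (exp 2 * (C2 * exp C2 / real N))"
      have "norm (integral {yb..yt} (\<lambda>y. E R N (Complex 0 y) - X0 * \<phi> y))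
          \<le> integral {yb..yt} (\<lambda>y. K * exp (real N * Re \<mu> * (Fr y - Fr y0)))"
      proof (rule integral_norm_bound_integral[OF integrable_diff[OF i1 i2]])
        show "(\<lambda>y. K * exp (real N * Re \<mu> * (Fr y - Fr y0))) integrable_on {yb..yt}"
          by (intro integrable_continuous_interval continuous_intros Fr_cont)
        fix y assume yy: "y \<in> {yb..yt}"
        then obtain e where e: "norm e \<le> C2 / real N" "E R N (Complex 0 y) = X0 * (\<phi> y * exp e)" using Eeq by blast
        have n\<phi>: "norm (\<phi> y) \<le> exp 2 * exp (real N * Re \<mu> * (Fr y - Fr y0))"
          unfolding \<phi>_def norm_mult using amp_le[of y] by (intro mult_mono) auto
        have "C2 / real N \<le> C2 / 1" using C2 N by (intro divide_left_mono) auto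
        hence e1: "norm e \<le> C2" using e by simp
        have "norm (exp e - 1) \<le> norm e * exp (norm e)" by (rule norm_exp_minus_one_le)
        also have "\<dots> \<le> C2 / real N * exp C2" using e(1) e1 C2 N by (intro mult_mono) auto
        finally have ne: "norm (exp e - 1) \<le> C2 * exp C2 / real N" by simp
        have "E R N (Complex 0 y) - X0 * \<phi> y = X0 * (\<phi> y * (exp e - 1))" unfolding e(2) by (simp add: algebra_simps)
        hence "norm (E R N (Complex 0 y) - X0 * \<phi> y) = exp (real N * M / \<rho>) * (norm (\<phi> y) * norm (exp e - 1))"
          by (simp only: norm_mult nX0)
        also have "\<dots> \<le> exp (real N * M / \<rho>) * ((exp 2 * exp (real N * Re \<mu> * (Fr y - Fr y0))) * (C2 * exp C2 / real N))"
          using n\<phi> ne by (intro mult_left_mono mult_mono) auto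
        finally show "norm (E R N (Complex 0 y) - X0 * \<phi> y) \<le> K * exp (real N * Re \<mu> * (Fr y - Fr y0))"
          by (simp add: K_def mult_ac)
      qed
      also have "\<dots> = K * integral {yb..yt} (\<lambda>y. exp (real N * Re \<mu> * (Fr y - Fr y0)))" by (rule integral_mult_right)
      also have "\<dots> \<le> K * (C1 / sqrt (real N))" using ub C2 by (intro mult_left_mono) (auto simp: K_def)
      finally have b1: "norm (integral {yb..yt} (\<lambda>y. E R N (Complex 0 y)) - X0 * integral {yb..yt} \<phi>)
          \<le> K * (C1 / sqrt (real N))"
        unfolding integral_diff[OF i1 i2] by simp
      have X: "X0 * integral {yb..yt} \<phi> - X0 * G0 = X0 * (integral {yb..yt} \<phi> - G0)" by (simp add: algebra_simps)
      have b2: "norm (X0 * integral {yb..yt} \<phi> - X0 * G0) \<le> exp (real N * M / \<rho>) * (C1 / (real N * sqrt (real N)))"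
        unfolding X norm_mult nX0 by (intro mult_left_mono Lap) simp
      have "integral {yb..yt} (\<lambda>y. E R N (Complex 0 y)) - X0 * G0
         = (integral {yb..yt} (\<lambda>y. E R N (Complex 0 y)) - X0 * integral {yb..yt} \<phi>) + (X0 * integral {yb..yt} \<phi> - X0
             * G0)" by simp
      also have "norm \<dots> \<le> K * (C1 / sqrt (real N)) + exp (real N * M / \<rho>) * (C1 / (real N * sqrt (real N)))"
        by (rule norm_triangle_mono[OF b1 b2])
      also have "\<dots> = C / (real N * sqrt (real N)) * exp (real N * M / \<rho>)"
        using N by (simp add: K_def C_def field_simps)
      finally show "norm (integral {yb..yt} (\<lambda>y. E R N (Complex 0 y))
         - exp (of_real (real N) * \<mu> * of_real (Fr y0)) * csqrt (of_real pi / (of_real (real N) * (\<mu>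
             * of_real (sin \<theta>)))))
       \<le> C / (real N * sqrt (real N)) * exp (real N * M / \<rho>)" by (simp only: X0_def G0_def)
    qed
  qed
  thus ?thesis using C by blast
qed

end

section \<open>The asymptotic expansion\<close>

lemma square_exp_decay:
  fixes \<epsilon> :: real assumes "\<epsilon> > 0"
  shows "\<exists>C>0. \<forall>N::nat. N > 0 \<longrightarrow> (real N)\<^sup>2 * exp (- (\<epsilon> * real N)) \<le> C / sqrt (real N)"
proof -
  obtain K where K: "K > 0" "\<And>\<tau>. \<tau> \<ge> 0 \<Longrightarrow> (1 + \<tau>) ^ 4 \<le> K * exp (\<epsilon> * \<tau>)"
    using power4_le_exp[OF assms] by blast
  have "(real N)\<^sup>2 * exp (- (\<epsilon> * real N)) \<le> K / sqrt (real N)" if N: "N > 0" for N :: nat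
  proof -
    have N1: "real N \<ge> 1" using N by linarith
    have "(real N) ^ 4 \<le> (1 + real N) ^ 4" by (intro power_mono) auto
    also have "\<dots> \<le> K * exp (\<epsilon> * real N)" by (rule K) simp
    finally have "(real N) ^ 4 * exp (- (\<epsilon> * real N)) \<le> K * exp (\<epsilon> * real N) * exp (- (\<epsilon> * real N))"
        by (intro mult_right_mono) auto
    hence "(real N) ^ 4 * exp (- (\<epsilon> * real N)) \<le> K" by (simp add: mult.assoc flip: exp_add)
    hence "(real N)\<^sup>2 * ((real N)\<^sup>2 * exp (- (\<epsilon> * real N))) \<le> K" by (simp add: power4_eq_xxxx power2_eq_square mult_ac)
    hence "(real N)\<^sup>2 * exp (- (\<epsilon> * real N)) \<le> K / (real N)\<^sup>2" using N1 by (simp add: field_simps)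
    also have "\<dots> \<le> K / sqrt (real N)"
    proof (intro divide_left_mono)
      have "sqrt (real N) \<le> sqrt ((real N)\<^sup>2)" using N1 self_le_power[of "real N" 2] by (intro real_sqrt_le_mono) auto
      also have "\<dots> = real N * 1" by simp
      also have "\<dots> \<le> real N * real N" using N1 by (intro mult_left_mono) auto
      finally show "sqrt (real N) \<le> (real N)\<^sup>2" by (simp add: power2_eq_square)
    qed (use K N in auto)
    finally show ?thesis .
  qed
  thus ?thesis using K(1) by blast
qed

context fig8 begin

text \<open>Since i / h = N \<mu>, this is the factor that turns the integral along the axis into
  the sum. The first factor is exp (- g 0 / 2), the last one the Gaussian integral at the saddle
  point.\<close>

definition "V N = of_real (1 / (2 * sinh (u / 2))) * (of_nat N * \<mu>) * exp (of_real (real N) * \<mu> * of_real (Fr y0))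
    * csqrt (of_real pi / (of_real (real N) * (\<mu> * of_real (sin \<theta>))))" for N :: nat

lemma mult_h: "of_nat k * hN N = Complex (real k * u / real N) (real k * c / real N)" if "N > 0"
  using that by (simp add: complex_eq_iff hN_simps)

lemma head_sum:
  assumes Cf: "\<And>k. k < a \<Longrightarrow> norm (f N k) \<le> Cf * exp (real N * H (of_nat k * hN N) / \<rho>)" "Cf > 0"
    and N: "N > 0" and a: "a \<le> N" "\<And>k. k < a \<Longrightarrow> real k * c / real N < c - 2 * pi + \<theta>"
  shows "norm (\<Sum>k<a. f N k) \<le> real N * Cf * exp (real N * (M - \<epsilon>0) / \<rho>)"
proof -
  have "norm (f N k) \<le> Cf * exp (real N * (M - \<epsilon>0) / \<rho>)" if k: "k < a" for k
  proof -
    have "real k * u < real N * u" using k a u_pos by simp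
    hence "real k * u / real N < u" using N by (simp add: field_simps)
    hence "H (of_nat k * hN N) \<le> M - \<epsilon>0"
      unfolding mult_h[OF N] using u_pos c_pos a(2)[OF k] by (intro H_low) auto
    hence "exp (real N * H (of_nat k * hN N) / \<rho>) \<le> exp (real N * (M - \<epsilon>0) / \<rho>)"
      using \<rho> by (simp add: divide_right_mono mult_left_mono)
    hence "Cf * exp (real N * H (of_nat k * hN N) / \<rho>) \<le> Cf * exp (real N * (M - \<epsilon>0) / \<rho>)"
      using Cf(2) by (intro mult_left_mono) auto
    thus ?thesis using Cf(1)[OF k] by linarith
  qed
  hence "norm (\<Sum>k<a. f N k) \<le> (\<Sum>k<a. Cf * exp (real N * (M - \<epsilon>0) / \<rho>))" by (intro sum_norm_le) auto
  also have "\<dots> = real a * (Cf * exp (real N * (M - \<epsilon>0) / \<rho>))" by simp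
  also have "\<dots> \<le> real N * (Cf * exp (real N * (M - \<epsilon>0) / \<rho>))" using a Cf by (intro mult_right_mono) auto
  finally show ?thesis by (simp add: mult.assoc)
qed

text \<open>Past b every further factor has modulus at most 1, so the term at b dominates all later
  ones and no asymptotic formula is needed near k = N.\<close>

lemma tail_sum:
  assumes N: "N > 0" and b: "norm (f N b) \<le> D" and G1: "\<And>l. b < l \<Longrightarrow> l < N \<Longrightarrow> norm (G (of_nat l * hN N)) \<le> 1"
  shows "norm (\<Sum>k\<in>{b..<N}. f N k) \<le> real N * D"
proof -
  have "norm (f N k) \<le> D" if "b \<le> k" "k < N" for k
    using that
  proof (induction k rule: dec_induct)
    case base
    show ?case by (rule b)
  next
    case (step k)
    have "norm (f N (Suc k)) = norm (f N k) * norm (G (of_nat (Suc k) * hN N))" unfolding f_Suc norm_mult ..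
    also have "\<dots> \<le> norm (f N k) * 1" using G1[of "Suc k"] step by (intro mult_left_mono) auto
    finally show ?case using step by simp
  qed
  hence "norm (\<Sum>k\<in>{b..<N}. f N k) \<le> (\<Sum>k\<in>{b..<N}. D)" by (intro sum_norm_le) auto
  also have "\<dots> = real (N - b) * D" by simp
  also have "\<dots> \<le> real N * D" using order_trans[OF norm_ge_zero b] by (intro mult_right_mono) auto
  finally show ?thesis .
qed

text \<open>On the lattice ray \<open>H\<close> may exceed its saddle value \<open>M\<close>, but
  not by more than B u. This excess is what the exponentially small interpolation error has to
  absorb.\<close>

lemma H_upper: assumes "N > 0" "k < N" shows "H (of_nat k * hN N) \<le> M + B * u"
proof -
  have "real k * u < real N * u" using assms u_pos by simp
  hence s: "0 \<le> real k * u / real N" "real k * u / real N < u" using assms u_pos by (auto simp: field_simps)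
  have "real k * c \<le> real N * c" using assms c_pos by simp
  hence y: "0 \<le> real k * c / real N" "real k * c / real N \<le> c" using assms c_pos by (auto simp: field_simps)
  have "H (Complex (real k * u / real N) (real k * c / real N))
      \<le> H (Complex 0 (real k * c / real N)) + B * (real k * u / real N - 0)"
    by (rule H_horizontal) (use s u_pos in \<open>auto intro!: strip_dmn Complex_strip\<close>)
  also have "H (Complex 0 (real k * c / real N)) \<le> M" unfolding H_axis M_def using Fr_y0_max[OF y] c_pos
      by (intro mult_left_mono) auto
  also have "B * (real k * u / real N - 0) \<le> B * u" using s u_pos c_pos by (intro mult_left_mono) (auto simp: B_def)
  finally show ?thesis unfolding mult_h[OF assms(1)] by simp
qed

text \<open>The terms are bounded through M + B u; a relative error with exponent B u + 1 brings
  their total error down to M - 1, safely below the saddle value.\<close>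

lemma middle_sum:
  fixes \<tau> :: real
  assumes N: "N > 0" and ab: "b \<le> N"
    and Cf: "\<And>k. a \<le> k \<Longrightarrow> k < b \<Longrightarrow> norm (f N k) \<le> Cf * exp (real N * H (of_nat k * hN N) / \<rho>)" "Cf > 0"
    and int: "\<And>k. a \<le> k \<Longrightarrow> k < b \<Longrightarrow> \<exists>e. norm e \<le> \<tau> \<and> f N k = s * E R N (of_nat k * hN N) * exp e"
    and \<tau>: "0 \<le> \<tau>" "\<tau> \<le> K1" "\<tau> \<le> K2 * real N * exp (- (real N * (B * u + 1) / \<rho>))" "K2 > 0"
  shows "norm ((\<Sum>k\<in>{a..<b}. f N k) - s * (\<Sum>k\<in>{a..<b}. E R N (of_nat k * hN N)))
      \<le> (Cf * K2 * exp K1) * (real N)\<^sup>2 * exp (real N * (M - 1) / \<rho>)"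
proof -
  have t: "norm (f N k - s * E R N (of_nat k * hN N)) \<le> (Cf * K2 * exp K1) * real N * exp (real N * (M
      - 1) / \<rho>)" if k: "a \<le> k" "k < b" for k
  proof -
    obtain e where e: "norm e \<le> \<tau>" "f N k = s * E R N (of_nat k * hN N) * exp e" using int[OF k] by blast
    have "s * E R N (of_nat k * hN N) = f N k * exp (- e)" unfolding e(2) by (simp add: exp_minus)
    hence "f N k - s * E R N (of_nat k * hN N) = - (f N k * (exp (- e) - 1))" by (simp add: algebra_simps)
    hence "norm (f N k - s * E R N (of_nat k * hN N)) = norm (f N k) * norm (exp (- e) - 1)" by (simp add: norm_mult)
    also have "norm (exp (- e) - 1) \<le> norm (- e) * exp (norm (- e))" by (rule norm_exp_minus_one_le)
    also have "\<dots> \<le> \<tau> * exp K1" using e \<tau> by (intro mult_mono) auto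
    also have "\<dots> \<le> K2 * real N * exp (- (real N * (B * u + 1) / \<rho>)) * exp K1" using \<tau> by (intro mult_right_mono) auto
    finally have 1: "norm (f N k - s * E R N (of_nat k * hN N))
        \<le> norm (f N k) * (K2 * real N * exp (- (real N * (B * u + 1) / \<rho>)) * exp K1)"
      by (simp add: mult_left_mono)
    have "H (of_nat k * hN N) \<le> M + B * u" using k ab N by (intro H_upper) auto
    hence "exp (real N * H (of_nat k * hN N) / \<rho>) \<le> exp (real N * (M + B * u) / \<rho>)"
      using \<rho> by (simp add: divide_right_mono mult_left_mono)
    hence "Cf * exp (real N * H (of_nat k * hN N) / \<rho>) \<le> Cf * exp (real N * (M + B * u) / \<rho>)" using Cf(2)
        by (intro mult_left_mono) auto
    hence "norm (f N k) \<le> Cf * exp (real N * (M + B * u) / \<rho>)" using Cf(1)[OF k] by linarith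
    hence "norm (f N k) * (K2 * real N * exp (- (real N * (B * u + 1) / \<rho>)) * exp K1)
       \<le> (Cf * exp (real N * (M + B * u) / \<rho>)) * (K2 * real N * exp (- (real N * (B * u + 1) / \<rho>)) * exp K1)"
      using \<tau>(4) by (intro mult_right_mono) auto
    also have "\<dots> = (Cf * K2 * exp K1) * real N * (exp (real N * (M + B * u) / \<rho>) * exp (- (real N * (B * u + 1) / \<rho>)))"
      by (simp only: mult_ac)
    also have "exp (real N * (M + B * u) / \<rho>) * exp (- (real N * (B * u + 1) / \<rho>)) = exp (real N * (M - 1) / \<rho>)"
    proof -
      have "real N * (M + B * u) / \<rho> + - (real N * (B * u + 1) / \<rho>) = real N * (M - 1) / \<rho>"
        by (simp add: algebra_simps flip: add_divide_distrib diff_divide_distrib)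
      thus ?thesis by (simp flip: exp_add)
    qed
    finally show ?thesis using 1 by linarith
  qed
  have "(\<Sum>k\<in>{a..<b}. f N k) - s * (\<Sum>k\<in>{a..<b}. E R N (of_nat k * hN N))
      = (\<Sum>k\<in>{a..<b}. f N k - s * E R N (of_nat k * hN N))"
    by (simp add: sum_subtractf sum_distrib_left)
  also have "norm \<dots> \<le> (\<Sum>k\<in>{a..<b}. (Cf * K2 * exp K1) * real N * exp (real N * (M - 1) / \<rho>))"
    using t by (intro sum_norm_le) auto
  also have "\<dots> = real (b - a) * ((Cf * K2 * exp K1) * real N * exp (real N * (M - 1) / \<rho>))" by simp
  also have "\<dots> \<le> real N * ((Cf * K2 * exp K1) * real N * exp (real N * (M - 1) / \<rho>))"
    using ab Cf(2) \<tau>(4) by (intro mult_right_mono) auto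
  finally show ?thesis by (simp add: power2_eq_square mult_ac)
qed

lemma main_sum: "\<exists>C>0. \<forall>\<^sub>F N in sequentially. norm ((\<Sum>k<N. f N k) - V N) \<le> C / sqrt (real N) * exp (real N * M / \<rho>)"
proof -
  obtain \<delta>1 \<epsilon>1 where \<delta>1: "\<delta>1 > 0" "\<epsilon>1 > 0" "\<delta>1 \<le> \<theta> / 2"
    and top: "\<And>y s. c - \<delta>1 \<le> y \<Longrightarrow> y \<le> c \<Longrightarrow> 0 \<le> s \<Longrightarrow> s < u \<Longrightarrow> H (Complex s y) \<le> M - \<epsilon>1"
    using H_top by blast
  obtain \<eta> where \<eta>: "\<eta> > 0" "\<And>x. \<bar>x - 1\<bar> < \<eta> \<Longrightarrow> norm (G (of_real x * \<xi>)) \<le> 1" using G_tail by blast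
  \<comment> \<open>2 \<delta> \<le> \<delta>1 keeps the upper side of the rectangle where
    \<open>H_top\<close> applies. The last cut will be at height at least c - 3 \<delta> / 2, and
    \<delta> \<le> \<eta> c / 2 puts all later indices within \<eta> of the end, where
    \<open>G_tail\<close> applies.\<close>
  define \<delta> where "\<delta> = min (\<delta>1 / 2) (\<eta> * c / 2)"
  have \<delta>: "\<delta> > 0" "2 * \<delta> \<le> \<delta>1" "\<delta> \<le> \<eta> * c / 2" "\<delta> < c" "2 * \<delta> \<le> \<theta> / 2"
  proof -
    have d: "\<delta> \<le> \<delta>1 / 2" by (simp add: \<delta>_def)
    show "\<delta> > 0" using \<delta>1 \<eta> c_pos by (simp add: \<delta>_def)
    show "\<delta> \<le> \<eta> * c / 2" by (simp add: \<delta>_def)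
    show "2 * \<delta> \<le> \<delta>1" "\<delta> < c" "2 * \<delta> \<le> \<theta> / 2" using d \<delta>1 \<theta> c_ge pi_gt3 by linarith+
  qed
  \<comment> \<open>The interpolation error has exponent \<open>rate N * (R / 2)\<close>, that is N
    pi c R / \<rho>, and this must be at least N (B u + 1) / \<rho>. The summand 4 provides R >
    3.\<close>
  define R where "R = 4 + (B * u + 1) / (pi * c)"
  have B0: "B > 0" using u_pos c_pos by (simp add: B_def add_pos_pos)
  have "(B * u + 1) / (pi * c) \<ge> 0" using B0 u_pos c_pos by simp
  hence R: "R > 3" "R > 2" by (simp_all add: R_def)
  have "x * (4 + y / x) = 4 * x + y" if "x \<noteq> 0" for x y :: real using that by (simp add: field_simps)
  hence "pi * c * R = 4 * (pi * c) + (B * u + 1)" unfolding R_def using c_pos by simp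
  moreover have "pi * c > 0" using c_pos by simp
  ultimately have Rc: "pi * c * R \<ge> B * u + 1" by linarith
  define \<beta> where "\<beta> = 1 - \<delta> / c"
  have \<beta>: "0 < \<beta>" "\<beta> < 1" using \<delta> c_pos by (auto simp: \<beta>_def)
  obtain Cf where Cf: "Cf > 0" "\<And>N k. N > 0 \<Longrightarrow> real k \<le> \<beta> * real N \<Longrightarrow>
      norm (f N k) \<le> Cf * exp (real N * H (of_nat k * hN N) / \<rho>)"
    using f_bound[OF \<beta>] by blast
  obtain Ci where Ci: "Ci > 0" and ev_i: "\<forall>\<^sub>F N in sequentially. \<forall>a. yl \<le> real a * c / real N \<longrightarrow>
      real a * c / real N \<le> c - \<delta> \<longrightarrow>
     (\<exists>e'. norm e' \<le> Ci / real N \<and> (\<forall>k\<ge>a. real k * c / real N \<le> c - \<delta> \<longrightarrow>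
        (\<exists>e. norm e \<le> Ci * real N * exp (- (rate N * (R / 2))) \<and>
            f N k = exp (- (g 0 / 2)) * exp e' * E R N (of_nat k * hN N) * exp e)))"
    using interpolation[OF \<delta>(1) \<delta>(4) R(1)] by blast
  have top': "\<And>y s. c - 2 * \<delta> \<le> y \<Longrightarrow> y \<le> c \<Longrightarrow> 0 \<le> s \<Longrightarrow> s < u \<Longrightarrow> H (Complex s y) \<le> M - \<epsilon>1"
    using top \<delta>(2) by auto
  obtain Cs \<epsilon>s where Cs: "Cs > 0" "\<epsilon>s > 0" and ev_s: "\<forall>\<^sub>F N in sequentially. \<forall>a b. 1 \<le> a \<longrightarrow> a < b \<longrightarrow>
     yl \<le> (real a - 1 / 2) * c / real N \<longrightarrow> (real a - 1 / 2) * c / real N < c - 2 * pi + \<theta> \<longrightarrow>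
     c - 2 * \<delta> \<le> (real b - 1 / 2) * c / real N \<longrightarrow> (real b - 1 / 2) * c / real N \<le> c - \<delta> \<longrightarrow>
     norm (hN N * (\<Sum>k\<in>{a..<b}. E R N (of_nat k * hN N))
        - \<i> * integral {(real a - 1 / 2) * c / real N..(real b - 1 / 2) * c / real N} (\<lambda>y. E R N (Complex 0 y)))
       \<le> Cs * exp (real N * (M - \<epsilon>s) / \<rho>)"
    using sum_E[OF \<delta>(1) R(2) \<delta>1(2) top'] by blast
  have d2: "0 < 2 * \<delta>" using \<delta> by simp
  obtain CE where CE: "CE > 0" and ev_E: "\<forall>\<^sub>F N in sequentially. \<forall>yb yt. yl \<le> yb \<longrightarrow> yb \<le> c - 2 * pi + \<theta> \<longrightarrow>
      c - 2 * \<delta> \<le> yt \<longrightarrow> yt \<le> c - \<delta> \<longrightarrow>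
     norm (integral {yb..yt} (\<lambda>y. E R N (Complex 0 y))
         - exp (of_real (real N) * \<mu> * of_real (Fr y0)) * csqrt (of_real pi / (of_real (real N) * (\<mu>
             * of_real (sin \<theta>)))))
       \<le> CE / (real N * sqrt (real N)) * exp (real N * M / \<rho>)"
    using integral_E[OF \<delta>(1) d2 \<delta>(5) R(2)] by blast
  define \<epsilon> where "\<epsilon> = min (min \<epsilon>0 \<epsilon>1) (min 1 \<epsilon>s)"
  have \<epsilon>: "\<epsilon> > 0" "\<epsilon> \<le> \<epsilon>0" "\<epsilon> \<le> \<epsilon>1" "\<epsilon> \<le> 1" "\<epsilon> \<le> \<epsilon>s" using \<epsilon>0_pos \<delta>1 Cs by (auto simp: \<epsilon>_def)
  have "\<epsilon> / \<rho> > 0" using \<epsilon> \<rho> by simp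
  from square_exp_decay[OF this] obtain Cd where Cd: "Cd > 0" "\<And>N::nat. N > 0 \<Longrightarrow>
      (real N)\<^sup>2 * exp (- (\<epsilon> / \<rho> * real N)) \<le> Cd / sqrt (real N)"
    by blast
  define K1 where "K1 = Ci * \<rho>"
  define \<sigma> where "\<sigma> = 1 / (2 * sinh (u / 2))"
  have \<sigma>: "\<sigma> > 0" using u_pos by (simp add: \<sigma>_def)
  define CG where "CG = sqrt (pi / (norm \<mu> * sin \<theta>))"
  have n\<xi>: "norm \<xi> > 0" using \<xi>_nonzero by simp
  define C where "C = Cf * Cd + Cf * Cd + Cf * Ci * exp K1 * Cd + (\<sigma> * (Ci * exp Ci * norm \<mu> * CG) + \<sigma> * exp Ci
      * (norm \<mu> * CE + Cs / norm \<xi> * Cd)) + 1"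
  have CG0: "CG \<ge> 0" using \<theta> by (simp add: CG_def)
  have C: "C > 0" unfolding C_def using Cf Cd Ci Cs CE \<sigma> CG0 n\<xi>
      by (intro add_nonneg_pos add_nonneg_nonneg mult_nonneg_nonneg) auto
  have "\<forall>\<^sub>F N in sequentially. norm ((\<Sum>k<N. f N k) - V N) \<le> C / sqrt (real N) * exp (real N * M / \<rho>)"
    using ev_i ev_s ev_E eventually_N_ge[of "max 1 (max (8 * c / \<theta>) (8 * c / \<delta>))"]
  proof eventually_elim
    case (elim N)
    have N: "N > 0" "real N \<ge> 1" and Nt: "c / real N \<le> \<theta> / 8" and Nd: "c / real N \<le> \<delta> / 8"
    proof -
      have e: "1 \<le> real N" "8 * c / \<theta> \<le> real N" "8 * c / \<delta> \<le> real N" using elim(4) by auto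
      have "\<theta> > 0" using \<delta> by linarith
      thus "c / real N \<le> \<theta> / 8" "c / real N \<le> \<delta> / 8" using e \<delta>(1) by (simp_all add: field_simps)
      show "N > 0" "real N \<ge> 1" using e(1) by auto
    qed
    note h = hN_simps[OF N(1)]
    have cN: "c / real N > 0" using c_pos N by simp
    \<comment> \<open>The targets 3 \<theta> / 4 and 3 \<delta> / 2 lie midway in the admissible
      ranges from \<theta> / 2 to \<theta> and from \<delta> to 2 \<delta>. Rounding up moves a
      height by less than c / N, and the half-integral heights are another half step lower; c / N is
      at most an eighth of \<theta> and of \<delta>.\<close>
    define a where "a = nat \<lceil>(c - 2 * pi + 3 * \<theta> / 4) / (c / real N)\<rceil>"
    define b where "b = nat \<lceil>(c - 3 * \<delta> / 2) / (c / real N)\<rceil>"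
    have pos: "c - 2 * pi + 3 * \<theta> / 4 > 0" "c - 3 * \<delta> / 2 > 0" using c_ge \<theta> \<delta> pi_gt3 by linarith+
    have ceil: "x \<le> real (nat \<lceil>x / (c / real N)\<rceil>) * (c / real N)" "real (nat \<lceil>x / (c / real N)\<rceil>) * (c / real N)
        < x + c / real N" if "x > 0" for x
    proof -
      have "x / (c / real N) > 0" by (intro divide_pos_pos that cN)
      hence "real (nat \<lceil>x / (c / real N)\<rceil>) = of_int \<lceil>x / (c / real N)\<rceil>" by simp
      hence "x / (c / real N) \<le> real (nat \<lceil>x / (c / real N)\<rceil>)" "real (nat \<lceil>x / (c / real N)\<rceil>) < x / (c / real N) + 1"
          by linarith+
      hence "x / (c / real N) * (c / real N) \<le> real (nat \<lceil>x / (c / real N)\<rceil>) * (c / real N)"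
        "real (nat \<lceil>x / (c / real N)\<rceil>) * (c / real N) < (x / (c / real N) + 1) * (c / real N)"
        using cN by (simp_all only: mult_right_mono mult_strict_right_mono less_imp_le)
      moreover have "x / (c / real N) * (c / real N) = x" using c_pos N by simp
      ultimately show "x \<le> real (nat \<lceil>x / (c / real N)\<rceil>) * (c / real N)" "real (nat \<lceil>x / (c / real N)\<rceil>) * (c / real N)
          < x + c / real N"
        by (simp_all only: distrib_right mult_1)
    qed
    have a: "c - 2 * pi + 3 * \<theta> / 4 \<le> real a * c / real N" "real a * c / real N < c - 2 * pi + 3 * \<theta> / 4 + c / real N"
      using ceil[OF pos(1)] by (simp_all add: a_def)
    have b: "c - 3 * \<delta> / 2 \<le> real b * c / real N" "real b * c / real N < c - 3 * \<delta> / 2 + c / real N"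
      using ceil[OF pos(2)] by (simp_all add: b_def)
    have half: "(real m - 1 / 2) * c / real N = real m * c / real N - c / real N / 2" for m :: nat
        by (simp add: algebra_simps diff_divide_distrib)
    have ha: "yl \<le> (real a - 1 / 2) * c / real N" "(real a - 1 / 2) * c / real N < c - 2 * pi + \<theta>" "yl
        \<le> real a * c / real N"
    proof -
      define q ra where "q = c / real N" and "ra = real a * c / real N"
      show "yl \<le> (real a - 1 / 2) * c / real N" "(real a - 1 / 2) * c / real N < c - 2 * pi + \<theta>" "yl
          \<le> real a * c / real N"
        using a Nt cN \<theta>(2) unfolding half yl_def q_def[symmetric] ra_def[symmetric] by linarith+
    qed
    have hb: "c - 2 * \<delta> \<le> (real b - 1 / 2) * c / real N" "(real b - 1 / 2) * c / real N \<le> c - \<delta>" "real b * c / real N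
        \<le> c - \<delta>"
    proof -
      define q rb where "q = c / real N" and "rb = real b * c / real N"
      show "c - 2 * \<delta> \<le> (real b - 1 / 2) * c / real N" "(real b - 1 / 2) * c / real N \<le> c - \<delta>" "real b * c / real N
          \<le> c - \<delta>"
        using b Nd cN \<delta>(1) unfolding half q_def[symmetric] rb_def[symmetric] by linarith+
    qed
    have "real a * c / real N < real b * c / real N" using a b Nt cN \<delta> \<theta> pi_gt3 by linarith
    hence "real a * c < real b * c" using N by (simp add: divide_less_cancel)
    hence ab: "a < b" using c_pos by simp
    have a1: "1 \<le> a"
    proof (rule ccontr)
      assume "\<not> 1 \<le> a"
      hence "a = 0" by simp
      thus False using a(1) pos(1) by simp
    qed
    have kb: "real k * c / real N \<le> c - \<delta>" "real k \<le> \<beta> * real N" if "k \<le> b" for k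
    proof -
      have "real k * c / real N \<le> real b * c / real N" using that c_pos
          by (intro divide_right_mono mult_right_mono) auto
      thus k: "real k * c / real N \<le> c - \<delta>" using hb by linarith
      have "real k * c \<le> (c - \<delta>) * real N" using k N by (simp add: pos_divide_le_eq)
      also have "\<dots> = \<beta> * real N * c" using c_pos by (simp add: \<beta>_def field_simps)
      finally show "real k \<le> \<beta> * real N" using c_pos by simp
    qed
    have "real b \<le> \<beta> * real N" using kb by simp
    also have "\<dots> < 1 * real N" using \<beta> N by (intro mult_strict_right_mono) auto
    finally have bN: "b < N" by simp
    have ha4: "real a * c / real N \<le> c - \<delta>" using kb(1)[of a] ab by simp
    define X where "X = exp (real N * M / \<rho>)"
    have X0: "X > 0" by (simp add: X_def)
    \<comment> \<open>Everything exponentially smaller than the saddle value, even after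
      multiplication by N^2, is absorbed into the target error X / sqrt N.\<close>
    have small: "(real N)\<^sup>2 * exp (real N * (M - \<epsilon>') / \<rho>) \<le> Cd / sqrt (real N) * X" if "\<epsilon> \<le> \<epsilon>'" for \<epsilon>'
    proof -
      have "exp (real N * (M - \<epsilon>') / \<rho>) \<le> exp (real N * (M - \<epsilon>) / \<rho>)" by (rule exp_rate_mono[OF that])
      also have "real N * (M - \<epsilon>) / \<rho> = - (\<epsilon> / \<rho> * real N) + real N * M / \<rho>"
          by (simp add: algebra_simps diff_divide_distrib)
      also have "exp (- (\<epsilon> / \<rho> * real N) + real N * M / \<rho>) = exp (- (\<epsilon> / \<rho> * real N)) * X" unfolding X_def
          by (rule exp_add)
      finally have "(real N)\<^sup>2 * exp (real N * (M - \<epsilon>') / \<rho>) \<le> (real N)\<^sup>2 * (exp (- (\<epsilon> / \<rho> * real N)) * X)"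
          by (intro mult_left_mono) auto
      also have "\<dots> \<le> Cd / sqrt (real N) * X" using mult_right_mono[OF Cd(2)[OF N(1)], of X] X0 by (simp add: mult.assoc)
      finally show ?thesis .
    qed
    have small1: "real N * exp (real N * (M - \<epsilon>') / \<rho>) \<le> Cd / sqrt (real N) * X" if "\<epsilon> \<le> \<epsilon>'" for \<epsilon>'
    proof -
      have "real N \<le> (real N)\<^sup>2" using N(2) self_le_power[of "real N" 2] by simp
      hence "real N * exp (real N * (M - \<epsilon>') / \<rho>) \<le> (real N)\<^sup>2 * exp (real N * (M - \<epsilon>') / \<rho>)"
          by (intro mult_right_mono) auto
      thus ?thesis using small[OF that] by linarith
    qed
    have head: "norm (\<Sum>k<a. f N k) \<le> Cf * (Cd / sqrt (real N) * X)"
    proof -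
      have "norm (\<Sum>k<a. f N k) \<le> real N * Cf * exp (real N * (M - \<epsilon>0) / \<rho>)"
      proof (rule head_sum)
        fix k assume k: "k < a"
        show "norm (f N k) \<le> Cf * exp (real N * H (of_nat k * hN N) / \<rho>)" using k ab kb(2)[of k] by (intro Cf(2) N) auto
        have "real k * c / real N \<le> (real a - 1) * c / real N" using k c_pos
            by (intro divide_right_mono mult_right_mono) auto
        also have "\<dots> < (real a - 1 / 2) * c / real N" using c_pos N
            by (intro divide_strict_right_mono mult_strict_right_mono) auto
        finally show "real k * c / real N < c - 2 * pi + \<theta>" using ha by linarith
      qed (use Cf N ab bN in auto)
      also have "\<dots> = Cf * (real N * exp (real N * (M - \<epsilon>0) / \<rho>))" by simp
      also have "\<dots> \<le> Cf * (Cd / sqrt (real N) * X)" using small1[OF \<epsilon>(2)] Cf by (intro mult_left_mono) auto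
      finally show ?thesis .
    qed
    have tail: "norm (\<Sum>k\<in>{b..<N}. f N k) \<le> Cf * (Cd / sqrt (real N) * X)"
    proof -
      have "norm (\<Sum>k\<in>{b..<N}. f N k) \<le> real N * (Cf * exp (real N * (M - \<epsilon>1) / \<rho>))"
      proof (rule tail_sum[OF N(1)])
        have "norm (f N b) \<le> Cf * exp (real N * H (of_nat b * hN N) / \<rho>)" using kb(2)[of b] by (intro Cf(2) N) auto
        also have "H (of_nat b * hN N) \<le> M - \<epsilon>1"
          unfolding mult_h[OF N(1)]
        proof (rule top')
          show "c - 2 * \<delta> \<le> real b * c / real N" using b \<delta> by linarith
          show "real b * c / real N \<le> c" using hb \<delta> by linarith
          show "0 \<le> real b * u / real N" using u_pos by simp
          have "real b * u < real N * u" using bN u_pos by simp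
          thus "real b * u / real N < u" using N by (simp add: field_simps)
        qed
        hence "Cf * exp (real N * H (of_nat b * hN N) / \<rho>) \<le> Cf * exp (real N * (M - \<epsilon>1) / \<rho>)"
          using Cf(1) \<rho> by (simp add: divide_right_mono mult_left_mono)
        finally show "norm (f N b) \<le> Cf * exp (real N * (M - \<epsilon>1) / \<rho>)" .
        fix l assume l: "b < l" "l < N"
        have e: "of_nat l * hN N = of_real (real l / real N) * \<xi>" by (simp add: hN_def)
        have "real b * c / real N \<le> real l * c / real N" using l c_pos by (intro divide_right_mono mult_right_mono) auto
        hence "c - 3 * \<delta> / 2 \<le> real l / real N * c" using b by simp
        hence "c - 3 / 4 * \<eta> * c \<le> real l / real N * c" using \<delta>(3) by linarith
        hence "(1 - 3 / 4 * \<eta>) * c \<le> real l / real N * c" by (simp add: left_diff_distrib)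
        hence "1 - 3 / 4 * \<eta> \<le> real l / real N" by (simp only: mult_le_cancel_right_pos[OF c_pos])
        moreover have "real l / real N < 1" using l by simp
        ultimately show "norm (G (of_nat l * hN N)) \<le> 1" unfolding e using \<eta>(1) by (intro \<eta>(2)) auto
      qed
      also have "\<dots> = Cf * (real N * exp (real N * (M - \<epsilon>1) / \<rho>))" by simp
      also have "\<dots> \<le> Cf * (Cd / sqrt (real N) * X)" using small1[OF \<epsilon>(3)] Cf by (intro mult_left_mono) auto
      finally show ?thesis .
    qed
    obtain e' where e': "norm e' \<le> Ci / real N" and ie: "\<And>k. k \<ge> a \<Longrightarrow> real k * c / real N \<le> c - \<delta> \<Longrightarrow>
        \<exists>e. norm e \<le> Ci * real N * exp (- (rate N * (R / 2))) \<and>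
            f N k = exp (- (g 0 / 2)) * exp e' * E R N (of_nat k * hN N) * exp e"
      using elim(1) ha(3) ha4 by blast
    define \<tau> where "\<tau> = Ci * real N * exp (- (rate N * (R / 2)))"
    have rR: "rate N * (R / 2) \<ge> real N * (B * u + 1) / \<rho>"
    proof -
      have "rate N * (R / 2) = real N * (pi * c * R) / \<rho>" by (simp add: rate_def)
      thus ?thesis using Rc \<rho>(2) by (simp only:) (intro divide_right_mono mult_left_mono; simp)
    qed
    have \<tau>1: "\<tau> \<le> Ci * real N * exp (- (real N * (B * u + 1) / \<rho>))"
      unfolding \<tau>_def using rR Ci by (intro mult_left_mono) auto
    have \<tau>2: "\<tau> \<le> K1"
    proof -
      have "real N / \<rho> \<le> real N * (B * u + 1) / \<rho>" using B0 u_pos \<rho>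
          by (intro divide_right_mono) (auto simp: mult_le_cancel_left1)
      hence "exp (- (real N * (B * u + 1) / \<rho>)) \<le> exp (- (real N / \<rho>))" by simp
      hence "Ci * real N * exp (- (real N * (B * u + 1) / \<rho>)) \<le> Ci * real N * exp (- (real N / \<rho>))" using Ci
          by (intro mult_left_mono) auto
      also have "\<dots> = Ci * \<rho> * (real N / \<rho> * exp (- (real N / \<rho>)))" using \<rho>(2) by simp
      also have "\<dots> \<le> Ci * \<rho> * 1"
      proof (intro mult_left_mono)
        have "real N / \<rho> \<le> exp (real N / \<rho>)" using exp_ge_add_one_self[of "real N / \<rho>"] by linarith
        moreover have "x * exp (- x) \<le> 1" if "x \<le> exp x" for x :: real using that by (simp add: exp_minus field_simps)
        ultimately show "real N / \<rho> * exp (- (real N / \<rho>)) \<le> 1" by blast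
      qed (use Ci \<rho> in auto)
      finally show ?thesis using \<tau>1 by (simp add: K1_def)
    qed
    define s where "s = exp (- (g 0 / 2)) * exp e'"
    define SE where "SE = (\<Sum>k\<in>{a..<b}. E R N (of_nat k * hN N))"
    have mid: "norm ((\<Sum>k\<in>{a..<b}. f N k) - s * SE) \<le> (Cf * Ci * exp K1) * (Cd / sqrt (real N) * X)"
    proof -
      have "norm ((\<Sum>k\<in>{a..<b}. f N k) - s * SE) \<le> (Cf * Ci * exp K1) * (real N)\<^sup>2 * exp (real N * (M - 1) / \<rho>)"
        unfolding SE_def
      proof (rule middle_sum[where \<tau> = \<tau>])
        fix k assume k: "a \<le> k" "k < b"
        show "norm (f N k) \<le> Cf * exp (real N * H (of_nat k * hN N) / \<rho>)" using k kb(2)[of k] by (intro Cf(2) N) auto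
        show "\<exists>e. norm e \<le> \<tau> \<and> f N k = s * E R N (of_nat k * hN N) * exp e"
          using ie[OF k(1)] kb(1)[of k] k unfolding \<tau>_def s_def by auto
      qed (use N bN Cf Ci \<tau>1 \<tau>2 in \<open>auto simp: \<tau>_def\<close>)
      also have "\<dots> = (Cf * Ci * exp K1) * ((real N)\<^sup>2 * exp (real N * (M - 1) / \<rho>))" by simp
      also have "\<dots> \<le> (Cf * Ci * exp K1) * (Cd / sqrt (real N) * X)" using small[OF \<epsilon>(4)] Cf Ci
          by (intro mult_left_mono) auto
      finally show ?thesis .
    qed
    define Q where "Q = exp (of_real (real N) * \<mu> * of_real (Fr y0)) * csqrt (of_real pi / (of_real (real N) * (\<mu>
        * of_real (sin \<theta>))))"
    define I where "I = integral {(real a - 1 / 2) * c / real N..(real b - 1 / 2)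
        * c / real N} (\<lambda>y. E R N (Complex 0 y))"
    have r1: "norm (hN N * SE - \<i> * I) \<le> Cs * exp (real N * (M - \<epsilon>s) / \<rho>)"
      using elim(2) a1 ab ha hb unfolding SE_def I_def by blast
    have r2: "norm (I - Q) \<le> CE / (real N * sqrt (real N)) * X"
      using elim(3)[rule_format, of "(real a - 1 / 2) * c / real N" "(real b - 1 / 2) * c / real N"] ha hb
          unfolding I_def Q_def X_def by simp
    have ih: "\<i> / hN N = of_nat N * \<mu>" by (simp add: hN_def \<mu>_def)
    have hSE: "SE = of_nat N * \<mu> * Q + (of_nat N * \<mu> * (I - Q) + (hN N * SE - \<i> * I) / hN N)"
      using h(4) unfolding ih[symmetric] by (simp add: field_simps)
    define r where "r = of_nat N * \<mu> * (I - Q) + (hN N * SE - \<i> * I) / hN N"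
    have nr: "norm r \<le> (norm \<mu> * CE + Cs / norm \<xi> * Cd) * (1 / sqrt (real N) * X)"
    proof -
      have "norm (of_nat N * \<mu> * (I - Q)) \<le> real N * norm \<mu> * (CE / (real N * sqrt (real N)) * X)"
        unfolding norm_mult norm_of_nat using r2 by (intro mult_left_mono) auto
      also have "\<dots> = norm \<mu> * CE * (1 / sqrt (real N) * X)" using N by simp
      finally have n1: "norm (of_nat N * \<mu> * (I - Q)) \<le> norm \<mu> * CE * (1 / sqrt (real N) * X)" .
      have "norm ((hN N * SE - \<i> * I) / hN N) \<le> Cs * exp (real N * (M - \<epsilon>s) / \<rho>) / (norm \<xi> / real N)"
        unfolding norm_divide h(3) using r1 by (intro divide_right_mono) auto
      also have "\<dots> = Cs / norm \<xi> * (real N * exp (real N * (M - \<epsilon>s) / \<rho>))" by simp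
      also have "\<dots> \<le> Cs / norm \<xi> * (Cd / sqrt (real N) * X)" using small1[OF \<epsilon>(5)] Cs n\<xi> by (intro mult_left_mono) auto
      finally have n2: "norm ((hN N * SE - \<i> * I) / hN N) \<le> Cs / norm \<xi> * Cd * (1 / sqrt (real N) * X)" by simp
      have "norm r \<le> norm \<mu> * CE * (1 / sqrt (real N) * X) + Cs / norm \<xi> * Cd * (1 / sqrt (real N) * X)"
        unfolding r_def by (rule norm_triangle_mono[OF n1 n2])
      thus ?thesis by (simp only: distrib_right)
    qed
    have Ci1: "norm e' \<le> Ci"
    proof -
      have "Ci / real N \<le> Ci / 1" using Ci N by (intro divide_left_mono) auto
      thus ?thesis using e' by simp
    qed
    have ee: "norm (exp e' - 1) \<le> Ci * exp Ci / real N"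
    proof -
      have "norm (exp e' - 1) \<le> norm e' * exp (norm e')" by (rule norm_exp_minus_one_le)
      also have "\<dots> \<le> Ci / real N * exp Ci" using e' Ci1 Ci by (intro mult_mono) auto
      finally show ?thesis by simp
    qed
    have ee2: "norm (exp e') \<le> exp Ci" using Ci1 abs_Re_le_cmod[of e'] by simp
    have nQ: "norm Q = X * (CG / sqrt (real N))"
    proof -
      have "norm (csqrt (of_real pi / (of_real (real N) * (\<mu> * of_real (sin \<theta>)))))
          = sqrt (pi / (real N * (norm \<mu> * sin \<theta>)))"
        using \<theta> by (simp add: norm_divide norm_mult norm_csqrt)
      also have "\<dots> = CG / sqrt (real N)" by (simp add: CG_def real_sqrt_divide real_sqrt_mult)
      finally show ?thesis by (simp add: Q_def norm_mult X_def M_def Re_\<mu>)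
    qed
    have sV: "s * SE - V N = of_real \<sigma> * ((exp e' - 1) * (of_nat N * \<mu> * Q)) + of_real \<sigma> * (exp e' * r)"
    proof -
      have "V N = of_real \<sigma> * (of_nat N * \<mu> * Q)" by (simp add: V_def \<sigma>_def Q_def mult.assoc)
      moreover have "SE = of_nat N * \<mu> * Q + r" using hSE unfolding r_def .
      moreover have "s = of_real \<sigma> * exp e'" unfolding s_def exp_half_g0 \<sigma>_def ..
      ultimately show ?thesis by (simp add: algebra_simps)
    qed
    have m1: "norm (of_real \<sigma> * ((exp e' - 1) * (of_nat N * \<mu> * Q)))
        \<le> \<sigma> * (Ci * exp Ci * norm \<mu> * CG) * (1 / sqrt (real N) * X)"
    proof -
      have "norm (of_real \<sigma> * ((exp e' - 1) * (of_nat N * \<mu> * Q)))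
          = \<sigma> * (norm (exp e' - 1) * (real N * norm \<mu> * (X * (CG / sqrt (real N)))))"
        using \<sigma> by (simp add: norm_mult nQ)
      also have "\<dots> \<le> \<sigma> * ((Ci * exp Ci / real N) * (real N * norm \<mu> * (X * (CG / sqrt (real N)))))"
        using ee \<sigma> X0 CG0 by (intro mult_left_mono mult_right_mono) auto
      also have "\<dots> = \<sigma> * (Ci * exp Ci * norm \<mu> * CG) * (1 / sqrt (real N) * X)" using N by simp
      finally show ?thesis .
    qed
    have m2: "norm (of_real \<sigma> * (exp e' * r)) \<le> \<sigma> * exp Ci * (norm \<mu> * CE + Cs / norm \<xi> * Cd) * (1 / sqrt (real N) * X)"
    proof -
      have "norm (of_real \<sigma> * (exp e' * r)) = \<sigma> * (norm (exp e') * norm r)" using \<sigma> by (simp add: norm_mult)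
      also have "\<dots> \<le> \<sigma> * (exp Ci * ((norm \<mu> * CE + Cs / norm \<xi> * Cd) * (1 / sqrt (real N) * X)))"
        using ee2 nr \<sigma> by (intro mult_left_mono mult_mono) auto
      finally show ?thesis by (simp only: mult.assoc)
    qed
    have sumsplit: "(\<Sum>k<N. f N k) = (\<Sum>k<a. f N k) + (\<Sum>k\<in>{a..<b}. f N k) + (\<Sum>k\<in>{b..<N}. f N k)"
      using ab bN sum.atLeastLessThan_concat[of 0 a b "f N"] sum.atLeastLessThan_concat[of 0 b N "f N"]
      by (simp add: lessThan_atLeast0)
    have "(\<Sum>k<N. f N k) - V N = (\<Sum>k<a. f N k) + (\<Sum>k\<in>{b..<N}. f N k) + ((\<Sum>k\<in>{a..<b}. f N k) - s * SE)
        + (of_real \<sigma> * ((exp e' - 1) * (of_nat N * \<mu> * Q)) + of_real \<sigma> * (exp e' * r))"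
      unfolding sumsplit sV[symmetric] by simp
    also have "norm \<dots> \<le> Cf * (Cd / sqrt (real N) * X) + Cf * (Cd / sqrt (real N) * X) + (Cf * Ci * exp K1)
        * (Cd / sqrt (real N) * X)
        + (\<sigma> * (Ci * exp Ci * norm \<mu> * CG) * (1 / sqrt (real N) * X) + \<sigma> * exp Ci * (norm \<mu> * CE + Cs / norm \<xi> * Cd)
            * (1 / sqrt (real N) * X))"
      by (rule norm_triangle_mono head tail mid m1 m2)+
    also have "\<dots> = (C - 1) * (1 / sqrt (real N) * X)" unfolding C_def by (simp add: algebra_simps)
    also have "\<dots> \<le> C * (1 / sqrt (real N) * X)" using X0 by (intro mult_right_mono) auto
    finally show "norm ((\<Sum>k<N. f N k) - V N) \<le> C / sqrt (real N) * exp (real N * M / \<rho>)" by (simp add: X_def)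
  qed
  thus ?thesis using C by blast
qed

end

text \<open>The factor i * csqrt (-i) is exp (i pi / 4). For Im z < 0 the argument of csqrt z lies
  between -pi / 2 and 0, so the product stays in the right half-plane and is the principal root. The
  two factors appear separately in the final formula: i from the root of -pi, csqrt (-i) from the
  root of the torsion factor.\<close>

lemma csqrt_rotate:
  fixes z :: complex
  assumes z: "Im z < 0"
  shows "csqrt (\<i> * z) = \<i> * csqrt (- \<i>) * csqrt z"
proof -
  define v where "v = csqrt z"
  define r where "r = csqrt (- \<i>)"
  have v2: "v\<^sup>2 = z" and r2: "r\<^sup>2 = - \<i>" by (simp_all add: v_def r_def)
  have pos: "Re w > 0 \<and> Im w < 0" if w: "w = csqrt z'" "Im z' < 0" for w z'
  proof -
    have w2: "w\<^sup>2 = z'" by (simp add: w)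
    have im: "2 * (Re w * Im w) < 0" using w(2) unfolding w2[symmetric] by (simp add: power2_eq_square)
    have "Re w \<ge> 0" unfolding w(1) by (rule Re_csqrt)
    moreover have "Re w \<noteq> 0" using im by auto
    ultimately have "Re w > 0" by simp
    thus ?thesis using im by (simp add: mult_less_0_iff)
  qed
  have v: "Re v > 0" "Im v < 0" using pos[of v z] z by (auto simp: v_def)
  have r: "Re r > 0" "Im r < 0" using pos[of r "- \<i>"] by (auto simp: r_def)
  have "Re (r\<^sup>2) = 0" unfolding r2 by simp
  hence "(Re r)\<^sup>2 = (Im r)\<^sup>2" by (simp add: power2_eq_square)
  hence ri: "Im r = - Re r" using r by (auto simp: power2_eq_iff)
  have "csqrt (\<i> * z) = \<i> * r * v"
  proof (rule csqrt_unique)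
    show "(\<i> * r * v)\<^sup>2 = \<i> * z" by (simp add: power_mult_distrib v2 r2)
    have "Re (\<i> * r * v) = Re r * (Re v - Im v)" by (simp add: ri algebra_simps)
    also have "\<dots> > 0" using v r by (intro mult_pos_pos) auto
    finally show "0 < Re (\<i> * r * v) \<or> Re (\<i> * r * v) = 0 \<and> 0 \<le> Im (\<i> * r * v)" by simp
  qed
  thus ?thesis by (simp add: v_def r_def)
qed

section \<open>Closed form of the main term\<close>

context fig8 begin

lemma fig8_root_eq: "fig8_root u = 2 * \<i> * of_real (sin \<theta>)"
proof -
  have "(2 * cosh u + 1) * (2 * cosh u - 3) = - (2 * sin \<theta>)\<^sup>2"
  proof -
    have "(sin \<theta>)\<^sup>2 = 1 - (cosh u - 1 / 2)\<^sup>2" using sin_cos_squared_add[of \<theta>] \<theta>(1) by simp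
    thus ?thesis by (simp add: power_mult_distrib) (simp add: power2_eq_square algebra_simps)
  qed
  hence "fig8_root u = csqrt (of_real (- (2 * sin \<theta>)\<^sup>2))" by (simp only: fig8_root_def)
  also have "\<dots> = 2 * \<i> * of_real (sin \<theta>)"
    by (rule csqrt_unique) (use \<theta> in \<open>auto simp: power_mult_distrib\<close>)
  finally show ?thesis .
qed

text \<open>With cosh u - 1/2 = cos \<theta> and the root equal to 2 i sin \<theta>, the logarithm
  is taken at exp (-i \<theta>), and 0 < \<theta> < pi / 2 makes it principal.\<close>

lemma fig8_phi_eq: "fig8_phi u = - \<i> * of_real \<theta>"
proof -
  have "of_real (cosh u) - 1 / 2 - 1 / 2 * fig8_root u = exp (- \<i> * of_real \<theta>)"
    using \<theta>(1) by (simp add: fig8_root_eq complex_eq_iff Re_exp Im_exp)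
  thus ?thesis unfolding fig8_phi_def using \<theta> by (simp only:) (rule Ln_exp, auto)
qed

text \<open>z0 = i (2 pi p - \<theta>) and -i \<theta> have the same exponential, so the
  dilogarithms are those of \<open>fig8_S\<close>. The linear term yields u (2 pi p i - i \<theta>),
  of which \<open>fig8_S\<close> contains the part with a single 2 pi i.\<close>

lemma F_z0: "F z0 = fig8_S u + 2 * of_real pi * \<i> * of_real (real p - 1) * of_real u"
proof -
  have e: "exp z0 = exp (- \<i> * of_real \<theta>)" "exp (- z0) = exp (\<i> * of_real \<theta>)"
    by (simp_all add: complex_eq_iff z0_def Re_exp Im_exp sc_y0 \<theta>(1))
  have "F z0 = of_real u * z0 + dilog (exp (- of_real u - z0)) - dilog (exp (- of_real u + z0))"
    by (simp add: F_strip z0_mem F0_def)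
  also have "exp (- of_real u - z0) = exp (- of_real u + \<i> * of_real \<theta>)"
    by (simp only: exp_add e diff_conv_add_uminus)
  also have "exp (- of_real u + z0) = exp (- of_real u + (- \<i> * of_real \<theta>))"
    by (simp only: exp_add e)
  finally have 1: "F z0 = of_real u * z0 + dilog (exp (- of_real u + \<i> * of_real \<theta>)) - dilog (exp (- of_real u + (- \<i>
      * of_real \<theta>)))" .
  have 2: "of_real u * z0 = of_real u * (- \<i> * of_real \<theta> + 2 * of_real pi * \<i>) + 2 * of_real pi * \<i> * of_real (real p
      - 1) * of_real u"
    unfolding z0_eq y0_def c_def by (simp add: algebra_simps)
  show ?thesis unfolding 1 2 fig8_S_def fig8_phi_eq by simp
qed

lemma \<xi>_eq: "\<xi> = of_real u + \<i> * of_real c" by (simp add: complex_eq_iff)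

lemma V_eq:
  assumes N: "N > 0"
  defines "w \<equiv> 4 * of_nat N * (of_real pi)\<^sup>2 / \<xi>"
  shows "V N = csqrt (- of_real pi) / (2 * of_real (sinh (u / 2))) * csqrt (fig8_T u) * csqrt (of_nat N / \<xi>)
      * exp (of_nat N / \<xi> * fig8_S u)
     * exp (of_nat (p * (p - 1)) * w)"
proof -
  define s where "s = sin \<theta>"
  have s: "s > 0" using \<theta> by (simp add: s_def)
  define x where "x = of_nat N / \<xi>"
  \<comment> \<open>Im \<xi> > 0 puts N / \<xi> into the lower half-plane, which is what
    \<open>csqrt_rotate\<close> needs and what makes Re (i x) positive.\<close>
  have imx: "Im x < 0" using N c_pos \<rho> by (simp add: x_def Im_divide)
  have x\<mu>: "of_nat N * \<mu> = \<i> * x" by (simp add: x_def \<mu>_def)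
  have T: "csqrt (fig8_T u) = of_real (sqrt (1 / s)) * csqrt (- \<i>)"
  proof -
    have "fig8_T u = of_real (1 / s) * (- \<i>)" unfolding fig8_T_def fig8_root_eq s_def[symmetric] using s
        by (simp add: field_simps)
    moreover have "csqrt (of_real (1 / s) * (- \<i>)) = of_real (sqrt (1 / s)) * csqrt (- \<i>)"
    proof (rule csqrt_unique)
      show "(of_real (sqrt (1 / s)) * csqrt (- \<i>))\<^sup>2 = of_real (1 / s) * (- \<i>)"
        using s by (simp add: power_mult_distrib flip: of_real_power del: real_sqrt_divide)
      have "Re (csqrt (- \<i>)) > 0" by simp
      hence "Re (of_real (sqrt (1 / s)) * csqrt (- \<i>)) > 0" using s by simp
      thus "0 < Re (of_real (sqrt (1 / s)) * csqrt (- \<i>)) \<or> Re (of_real (sqrt (1 / s)) * csqrt (- \<i>)) = 0 \<and>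
          0 \<le> Im (of_real (sqrt (1 / s)) * csqrt (- \<i>))" by blast
    qed
    ultimately show ?thesis by simp
  qed
  define y where "y = csqrt (\<i> * x)"
  have y2: "y\<^sup>2 = \<i> * x" by (simp add: y_def)
  have Rey: "Re y > 0"
  proof -
    have "Re y \<ge> 0" unfolding y_def by (rule Re_csqrt)
    moreover have "Re y \<noteq> 0"
    proof
      assume "Re y = 0"
      hence "Re (y\<^sup>2) \<le> 0" by (simp add: power2_eq_square)
      thus False using imx by (simp add: y2)
    qed
    ultimately show ?thesis by simp
  qed
  hence y0: "y \<noteq> 0" by auto
  have yx: "y = \<i> * csqrt (- \<i>) * csqrt x" unfolding y_def by (rule csqrt_rotate[OF imx])
  have G: "csqrt (of_real pi / (of_real (real N) * (\<mu> * of_real s))) = of_real (sqrt (pi / s)) / y"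
  proof (rule csqrt_unique)
    show "(of_real (sqrt (pi / s)) / y)\<^sup>2 = of_real pi / (of_real (real N) * (\<mu> * of_real s))"
      using s x\<mu> by (simp add: power_divide y2 flip: of_real_power mult.assoc del: real_sqrt_divide)
    have "Re (of_real (sqrt (pi / s)) / y) = sqrt (pi / s) * Re y / ((Re y)\<^sup>2 + (Im y)\<^sup>2)" by (simp add: Re_divide)
    also have "\<dots> > 0" using s Rey by (intro divide_pos_pos mult_pos_pos add_pos_nonneg) auto
    finally show "0 < Re (of_real (sqrt (pi / s)) / y) \<or> Re (of_real (sqrt (pi / s)) / y) = 0 \<and>
        0 \<le> Im (of_real (sqrt (pi / s)) / y)" by simp
  qed
  \<comment> \<open>The factor N \<mu> = y^2 combines with 1 / y from the Gaussian to y, the square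
    root of i N / \<xi>. This changes the order N^(-1/2) of the integral into the N^(1/2) of the
    theorem.\<close>
  have "of_nat N * \<mu> * csqrt (of_real pi / (of_real (real N) * (\<mu> * of_real s))) = of_real (sqrt (pi / s)) * y"
    unfolding G x\<mu> y2[symmetric] using y0 by (simp add: power2_eq_square)
  also have "\<dots> = csqrt (- of_real pi) * csqrt (fig8_T u) * csqrt x"
  proof -
    have "csqrt (- of_real pi) = \<i> * of_real (sqrt pi)"
      by (rule csqrt_unique) (auto simp: power_mult_distrib simp flip: of_real_power)
    thus ?thesis unfolding T yx by (simp add: real_sqrt_divide mult_ac)
  qed
  finally have pre: "of_nat N * \<mu> * csqrt (of_real pi / (of_real (real N) * (\<mu> * of_real s)))
      = csqrt (- of_real pi) * csqrt (fig8_T u) * csqrt x" .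
  have ex: "exp (of_real (real N) * \<mu> * of_real (Fr y0)) = exp (x * fig8_S u) * exp (of_nat (p * (p - 1)) * w)"
  proof -
    have "of_real (real N) * \<mu> * of_real (Fr y0) = x * F z0"
      unfolding z0_eq F_axis by (simp add: x_def \<mu>_def)
    also have "\<dots> = x * fig8_S u + x * (2 * of_real pi * \<i> * of_real (real p - 1) * of_real u)"
      unfolding F_z0 by (simp add: distrib_left)
    also have "x * (2 * of_real pi * \<i> * of_real (real p - 1) * of_real u)
       = of_int (2 * (int N * (int p - 1))) * (of_real pi * \<i>) + of_nat (p * (p - 1)) * w"
    proof -
      \<comment> \<open>Writing u as \<xi> - i c splits the term: the part with \<xi> cancels the
        denominator and leaves 2 pi i N (p - 1), while i c = 2 pi i p produces the exponent with p
        (p - 1).\<close>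
      have u: "of_real u = \<xi> - \<i> * of_real c" by (simp add: \<xi>_eq)
      have "x * (2 * of_real pi * \<i> * of_real (real p - 1) * of_real u)
         = x * \<xi> * (2 * of_real pi * \<i> * of_real (real p - 1)) + x * of_real c * (2 * of_real pi * of_real (real p
             - 1))"
        unfolding u by (simp add: algebra_simps)
      moreover have "x * \<xi> = of_nat N" using \<xi>_nonzero by (simp add: x_def)
      moreover have "x * of_real c * (2 * of_real pi * of_real (real p - 1)) = of_nat (p * (p - 1)) * w"
        using p_pos by (simp add: x_def w_def c_def power2_eq_square of_nat_diff)
      ultimately show ?thesis by simp
    qed
    finally have "exp (of_real (real N) * \<mu> * of_real (Fr y0))
        = exp (x * fig8_S u) * (exp (of_int (2 * (int N * (int p - 1))) * (of_real pi * \<i>)) * exp (of_nat (p * (p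
        - 1)) * w))"
      by (simp only: exp_add)
    moreover have "exp (of_int (2 * (int N * (int p - 1))) * (of_real pi * \<i>)) = 1"
      using exp_integer_2pi[of "of_int (int N * (int p - 1))"] by (simp add: mult_ac)
    ultimately show ?thesis by simp
  qed
  show ?thesis
    unfolding V_def s_def[symmetric] ex x_def[symmetric] using pre[unfolded x_def[symmetric]]
    by (simp add: divide_simps) (simp add: mult_ac)
qed

text \<open>The modulus is known exactly and has order sqrt N times the saddle value, so the error
  N^(-1/2) in \<open>main_sum\<close> is a relative error of order 1/N.\<close>

lemma norm_V: "\<exists>K>0. \<forall>N>0. norm (V N) = K * sqrt (real N) * exp (real N * M / \<rho>)"
proof -
  define K where "K = 1 / (2 * sinh (u / 2)) * norm \<mu> * sqrt (pi / (norm \<mu> * sin \<theta>))"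
  have "norm \<mu> > 0" using Re_\<mu>_pos by auto
  hence "K > 0" using u_pos \<theta> by (simp add: K_def)
  moreover have "norm (V N) = K * sqrt (real N) * exp (real N * M / \<rho>)" if N: "N > 0" for N
  proof -
    have "norm (csqrt (of_real pi / (of_real (real N) * (\<mu> * of_real (sin \<theta>)))))
        = sqrt (pi / (norm \<mu> * sin \<theta>)) / sqrt (real N)"
      using \<theta> by (simp add: norm_divide norm_mult norm_csqrt real_sqrt_divide real_sqrt_mult)
    moreover have "norm (exp (of_real (real N) * \<mu> * of_real (Fr y0))) = exp (real N * M / \<rho>)" by (simp add: M_def Re_\<mu>)
    moreover have "norm (of_real (1 / (2 * sinh (u / 2))) :: complex) = 1 / (2 * sinh (u / 2))" using u_pos
        by (simp only: norm_of_real) simp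
    ultimately have "norm (V N) = 1 / (2 * sinh (u / 2)) * (real N * norm \<mu>) * exp (real N * M / \<rho>)
        * (sqrt (pi / (norm \<mu> * sin \<theta>)) / sqrt (real N))"
      unfolding V_def norm_mult norm_of_nat by simp
    also have "\<dots> = K * (real N / sqrt (real N)) * exp (real N * M / \<rho>)" by (simp add: K_def)
    also have "real N / sqrt (real N) = sqrt (real N)" by (simp add: real_div_sqrt)
    finally show ?thesis .
  qed
  ultimately show ?thesis by blast
qed

text \<open>\<open>V_eq\<close> contains only the leading exponential of the p-dimensional
  invariant. Passing to the invariant itself introduces a factor 1 + y, and y is exponentially small
  since Re w is a positive multiple of N, owing to u > 0. N \<ge> 2 C3 ensures |y| \<le> 1/2, so the
  quotient (1 + x) / (1 + y) is 1 + O(1/N).\<close>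

lemma asymptotic_expansion:
  "\<exists>C. \<forall>\<^sub>F N in sequentially. \<exists>r. norm r \<le> C / real N \<and>
     colored_Jones_fig8 N (exp (\<xi> / of_nat N)) =
        csqrt (- of_real pi) / (2 * of_real (sinh (u / 2))) * csqrt (fig8_T u)
        * colored_Jones_fig8 p (exp (4 * of_nat N * (of_real pi)\<^sup>2 / \<xi>))
        * csqrt (of_nat N / \<xi>) * exp (of_nat N / \<xi> * fig8_S u) * (1 + r)"
proof -
  obtain C1 where C1: "C1 > 0" and ev: "\<forall>\<^sub>F N in sequentially. norm ((\<Sum>k<N. f N k) - V N)
      \<le> C1 / sqrt (real N) * exp (real N * M / \<rho>)"
    using main_sum by blast
  obtain K where K: "K > 0" "\<And>N. N > 0 \<Longrightarrow> norm (V N) = K * sqrt (real N) * exp (real N * M / \<rho>)" using norm_V by blast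
  obtain C2 where C2: "\<And>w. 0 \<le> Re w \<Longrightarrow> norm (colored_Jones_fig8 p (exp w) * exp (- (of_nat (p * (p - 1)) * w)) - 1)
      \<le> C2 * exp (- Re w)"
    using colored_Jones_fig8_leading[OF p_pos] by blast
  define q where "q = 4 * pi\<^sup>2 * u / \<rho>"
  have q: "q > 0" using u_pos \<rho> by (simp add: q_def)
  define C3 where "C3 = \<bar>C2\<bar> / q"
  have C3: "C3 \<ge> 0" using q by (simp add: C3_def)
  define C where "C = 2 * (C1 / K + C3)"
  have "\<forall>\<^sub>F N in sequentially. \<exists>r. norm r \<le> C / real N \<and>
     colored_Jones_fig8 N (exp (\<xi> / of_nat N)) =
        csqrt (- of_real pi) / (2 * of_real (sinh (u / 2))) * csqrt (fig8_T u)
        * colored_Jones_fig8 p (exp (4 * of_nat N * (of_real pi)\<^sup>2 / \<xi>))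
        * csqrt (of_nat N / \<xi>) * exp (of_nat N / \<xi> * fig8_S u) * (1 + r)"
    using ev eventually_N_ge[of "max 1 (2 * C3)"]
  proof eventually_elim
    case (elim N)
    hence N: "N > 0" "real N \<ge> 1" "real N \<ge> 2 * C3" by auto
    define w where "w = 4 * of_nat N * (of_real pi)\<^sup>2 / \<xi>"
    define A where "A = csqrt (- of_real pi) / (2 * of_real (sinh (u / 2))) * csqrt (fig8_T u) * csqrt (of_nat N / \<xi>)
        * exp (of_nat N / \<xi> * fig8_S u)"
    define L where "L = exp (of_nat (p * (p - 1)) * w)"
    have VA: "V N = A * L" unfolding A_def L_def w_def by (rule V_eq[OF N(1)])
    have nV: "norm (V N) = K * sqrt (real N) * exp (real N * M / \<rho>)" by (rule K(2)[OF N(1)])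
    hence "norm (V N) > 0" using K N by simp
    hence V0: "V N \<noteq> 0" by auto
    define J where "J = colored_Jones_fig8 p (exp w)"
    define y where "y = J * exp (- (of_nat (p * (p - 1)) * w)) - 1"
    have JL: "J = L * (1 + y)" by (simp add: y_def L_def exp_minus)
    have Rew: "Re w = q * real N"
    proof -
      have "w = of_real (4 * real N * pi\<^sup>2) / \<xi>" by (simp add: w_def)
      thus ?thesis by (simp add: q_def \<rho> Re_divide power2_eq_square)
    qed
    have ny: "norm y \<le> C3 / real N"
    proof -
      have "norm y \<le> C2 * exp (- Re w)" unfolding y_def J_def by (rule C2) (use q in \<open>simp add: Rew\<close>)
      also have "\<dots> \<le> \<bar>C2\<bar> * exp (- Re w)" by (intro mult_right_mono) auto
      also have "exp (- Re w) \<le> 1 / (q * real N)"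
      proof -
        have "q * real N \<le> exp (q * real N)" using exp_ge_add_one_self[of "q * real N"] by linarith
        hence "1 / exp (q * real N) \<le> 1 / (q * real N)" using q N by (intro divide_left_mono) auto
        thus ?thesis by (simp add: Rew exp_minus inverse_eq_divide)
      qed
      hence "\<bar>C2\<bar> * exp (- Re w) \<le> \<bar>C2\<bar> * (1 / (q * real N))" by (intro mult_left_mono) auto
      finally show ?thesis by (simp add: C3_def)
    qed
    have "C3 / real N \<le> 1 / 2" using N by (simp add: field_simps)
    hence y2: "norm y \<le> 1 / 2" using ny by linarith
    have "1 \<le> norm (1 + y) + norm y" using norm_triangle_ineq4[of "1 + y" y] by simp
    hence y1: "norm (1 + y) \<ge> 1 / 2" using y2 by linarith
    hence y0: "1 + y \<noteq> 0" by auto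
    define S where "S = (\<Sum>k<N. f N k)"
    define x where "x = (S - V N) / V N"
    have Sx: "S = V N * (1 + x)" using V0 by (simp add: x_def field_simps)
    have nx: "norm x \<le> C1 / K / real N"
    proof -
      have "norm x \<le> (C1 / sqrt (real N) * exp (real N * M / \<rho>)) / (K * sqrt (real N) * exp (real N * M / \<rho>))"
        unfolding x_def norm_divide nV using elim K by (intro divide_right_mono) (auto simp: S_def)
      also have "\<dots> = C1 / K / (sqrt (real N) * sqrt (real N))" by simp
      finally show ?thesis by simp
    qed
    define r where "r = (x - y) / (1 + y)"
    have "norm r \<le> (C1 / K / real N + C3 / real N) / (1 / 2)"
      unfolding r_def norm_divide
      using y1 C1 C3 K by (intro frac_le order_trans[OF norm_triangle_ineq4 add_mono[OF nx ny]]) auto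
    also have "\<dots> = C / real N" by (simp add: C_def add_divide_distrib mult_ac)
    finally have nr: "norm r \<le> C / real N" .
    have "(1 + y) * (1 + r) = 1 + x" using y0 by (simp add: r_def field_simps)
    hence "S = A * J * (1 + r)" unfolding Sx VA JL by (simp add: mult.assoc)
    moreover have "S = colored_Jones_fig8 N (exp (\<xi> / of_nat N))" unfolding S_def
        by (rule colored_Jones_eq[OF N(1), symmetric])
    ultimately have "colored_Jones_fig8 N (exp (\<xi> / of_nat N)) =
        csqrt (- of_real pi) / (2 * of_real (sinh (u / 2))) * csqrt (fig8_T u)
        * colored_Jones_fig8 p (exp (4 * of_nat N * (of_real pi)\<^sup>2 / \<xi>))
        * csqrt (of_nat N / \<xi>) * exp (of_nat N / \<xi> * fig8_S u) * (1 + r)"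
      by (simp only: A_def J_def w_def mult_ac)
    thus ?case using nr by blast
  qed
  thus ?thesis by blast
qed

end

theorem theorem1p4:
  fixes u :: real and p :: nat and \<xi> :: complex
  assumes "0 < u" and "u < arcosh (3/2)" and "p > 0"
    and "\<xi> = of_real u + 2 * of_nat p * of_real pi * \<i>"
  shows "\<exists>r :: nat \<Rightarrow> complex. r \<in> O[sequentially](\<lambda>N. 1 / of_nat N) \<and>
    (\<forall>\<^sub>F N in sequentially.
      colored_Jones_fig8 N (exp (\<xi> / of_nat N)) =
        csqrt (- of_real pi) / (2 * of_real (sinh (u / 2))) * csqrt (fig8_T u)
        * colored_Jones_fig8 p (exp (4 * of_nat N * (of_real pi)\<^sup>2 / \<xi>))
        * csqrt (of_nat N / \<xi>)
        * exp (of_nat N / \<xi> * fig8_S u)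
        * (1 + r N))"
proof -
  interpret fig8 u p using assms(1-3) by unfold_locales
  have \<xi>: "\<xi> = fig8.\<xi> u p"
    by (simp add: assms(4) complex_eq_iff c_def)
  let ?P = "\<lambda>N r. colored_Jones_fig8 N (exp (\<xi> / of_nat N)) =
        csqrt (- of_real pi) / (2 * of_real (sinh (u / 2))) * csqrt (fig8_T u)
        * colored_Jones_fig8 p (exp (4 * of_nat N * (of_real pi)\<^sup>2 / \<xi>))
        * csqrt (of_nat N / \<xi>)
        * exp (of_nat N / \<xi> * fig8_S u)
        * (1 + r)"
  obtain C where ev: "\<forall>\<^sub>F N in sequentially. \<exists>r. norm r \<le> C / real N \<and> ?P N r"
    using asymptotic_expansion unfolding \<xi> by blast
  \<comment> \<open>The error is chosen for each N separately; at the finitely many N for which none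
    exists its value is arbitrary.\<close>
  define r where "r = (\<lambda>N. SOME r. norm r \<le> C / real N \<and> ?P N r)"
  have r: "\<forall>\<^sub>F N in sequentially. norm (r N) \<le> C / real N \<and> ?P N (r N)"
    using ev unfolding r_def by eventually_elim (rule someI_ex)
  have "r \<in> O[sequentially](\<lambda>N. 1 / of_nat N)"
  proof (rule bigoI)
    show "\<forall>\<^sub>F N in sequentially. norm (r N) \<le> C * norm (1 / of_nat N :: complex)"
      using r by eventually_elim (simp add: norm_divide)
  qed
  moreover have "\<forall>\<^sub>F N in sequentially. ?P N (r N)" using r by eventually_elim simp
  ultimately show ?thesis by blast
qed

end
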